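(* Let $V$ and $W$ be arbitrary vector superspaces over $\Bbbk$, where $\Bbbk=\mathbb{R}$ or $\mathbb{C}$ (in particular, $V$ and $W$ may be ordinary vector spaces). Then the weighted projective (super)space $P_{+1,-1}(V\oplus W)$ with weights $+1$ and $-1$ has natural fiber bundle structures over $P(V)$ and over $P(W)$, $$\pi_V\colon P_{+1,-1}(V\oplus W)\to P(V),\quad [v\|w]\mapsto [v],\qquad\qquad \pi_W\colon P_{+1,-1}(V\oplus W)\to P(W),\quad [v\|w]\mapsto [w].$$ The bundle $\pi_V\colon P_{+1,-1}(V\oplus W)\to P(V)$ is isomorphic to the bundle $(E_V\otimes W)_0\to P(V)$, and the bundle $\pi_W\colon P_{+1,-1}(V\oplus W)\to P(W)$ is isomorphic to the bundle $(E_W\otimes V)_0\to P(W)$.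
   Context: Vector superspaces are finite-dimensional and regarded as supermanifolds; in the purely even case they are ordinary vector spaces regarded as manifolds (smooth for $\Bbbk=\mathbb{R}$, complex-analytic for $\Bbbk=\mathbb{C}$). For a vector (super)space $V$ or a (super) vector bundle $E$, $V_0$ or $E_0$ denotes the open subspace of all non-zero vectors (for a bundle: the complement of the zero section in the total space). Here the points of a vector superspace considered as a supermanifold are its even vectors. Let $G=\Bbbk^*=\Bbbk\setminus\{0\}$ act on $V_0\times W_0$ by $\lambda\cdot(v,w):=(\lambda v,\lambda^{-1}w)$ for $\lambda\in G$, $v\in V_0$, $w\in W_0$. The weighted projective (super)space with weights $+1$ and $-1$ is the quotient $P_{+1,-1}(V\oplus W):=(V_0\times W_0)/G$. Its points are denoted $[v\|w]$, where $v\in V_0$, $w\in W_0$ and $[v\|w]=[\lambda v\|\lambda^{-1}w]$ for all $\lambda\in\Bbbk^*$. $P(V)=V_0/\Bbbk^*$ is the usual projectivization of $V$ (quotient by $v\sim\lambda v$), with $[v]$ the class of $v$, and $E_V\to P(V)$ is the tautological line bundle, whose fiber over $[v]$ is the line $\Bbbk v\subset V$; similarly for $W$. In $E_V\otimes W$, the symbol $W$ stands for the trivial bundle with fiber $W$ over $P(V)$; similarly in $E_W\otimes V$, $V$ stands for the trivial bundle over $P(W)$. *)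

theory Defs
  imports "HOL-Analysis.Analysis"
begin

text \<open>
  Supermanifolds are treated through their points with values in Grassmann algebras
  (Molotkov, Sachse): a supermanifold is a functor from the finitely generated Grassmann algebras
  \<open>\<Lambda>\<^sub>n\<close> over the ground field to sets, with an atlas of charts onto superdomains and supersmooth
  transition maps.  This category is equivalent to that of Berezin--Leites supermanifolds.

  The ground field is a type \<open>'k\<close> of sort \<open>{real_normed_field, euclidean_space}\<close>.  The types
  \<open>real\<close> and \<open>complex\<close> have this sort, and up to isomorphism nothing else does, since
  \<open>\<real>\<close> and \<open>\<complex>\<close> are the only finite-dimensional commutative real division algebras.
\<close>

section \<open>Grassmann algebras\<close>

text \<open>
  \<open>(\<lambda>I. x I)\<close> stands for \<open>\<Sum>\<^sub>I \<theta>\<^sub>I x\<^sub>I\<close>, where \<open>\<theta>\<^sub>I\<close> is the product of the odd generators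
  \<open>\<theta>\<^sub>i\<close>, \<open>i \<in> I\<close>, in increasing order.  The coefficients \<open>x\<^sub>I\<close> are taken from the field, for
  elements of a Grassmann algebra, or from a vector superspace.
\<close>

type_synonym 'a gr = "nat set \<Rightarrow> 'a"

definition Grass :: "nat \<Rightarrow> 'k::real_normed_field gr set" where
  "Grass n = {a. \<forall>I. \<not> I \<subseteq> {..<n} \<longrightarrow> a I = 0}"

definition Grass_even :: "nat \<Rightarrow> 'k::real_normed_field gr set" where
  "Grass_even n = {a \<in> Grass n. \<forall>I. odd (card I) \<longrightarrow> a I = 0}"

definition Grass_odd :: "nat \<Rightarrow> 'k::real_normed_field gr set" where
  "Grass_odd n = {a \<in> Grass n. \<forall>I. even (card I) \<longrightarrow> a I = 0}"

text \<open>For disjoint \<open>I\<close> and \<open>J\<close>: \<open>\<theta>\<^sub>I \<theta>\<^sub>J = gsgn I J * \<theta>\<^bsub>I \<union> J\<^esub>\<close>.\<close>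

definition gsgn :: "nat set \<Rightarrow> nat set \<Rightarrow> 'k::real_normed_field" where
  "gsgn I J = (- 1) ^ card {(i, j). i \<in> I \<and> j \<in> J \<and> j < i}"

definition gsmult :: "('k \<Rightarrow> 'v \<Rightarrow> 'v) \<Rightarrow> 'k::real_normed_field gr \<Rightarrow> 'v::comm_monoid_add gr \<Rightarrow> 'v gr" where
  "gsmult sc a x = (\<lambda>K. \<Sum>I\<in>Pow K. sc (gsgn I (K - I) * a I) (x (K - I)))"

abbreviation gmult :: "'k::real_normed_field gr \<Rightarrow> 'k gr \<Rightarrow> 'k gr" where
  "gmult \<equiv> gsmult (*)"

definition gconst :: "'a::zero \<Rightarrow> 'a gr" where
  "gconst v = (\<lambda>I. if I = {} then v else 0)"

definition gtheta :: "nat set \<Rightarrow> 'k::real_normed_field gr" where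
  "gtheta I = (\<lambda>J. if J = I then 1 else 0)"

definition Grass_units :: "nat \<Rightarrow> 'k::real_normed_field gr set" where
  "Grass_units n = {a \<in> Grass_even n. \<exists>b\<in>Grass_even n. gmult a b = gconst 1}"

definition ginv :: "nat \<Rightarrow> 'k::real_normed_field gr \<Rightarrow> 'k gr" where
  "ginv n a = (THE b. b \<in> Grass_even n \<and> gmult a b = gconst 1)"

definition Grass_hom :: "nat \<Rightarrow> nat \<Rightarrow> ('k::real_normed_field gr \<Rightarrow> 'k gr) \<Rightarrow> bool" where
  "Grass_hom m n \<rho> \<longleftrightarrow>
     \<rho> ` Grass_even m \<subseteq> Grass_even n \<and> \<rho> ` Grass_odd m \<subseteq> Grass_odd n \<and>
     (\<forall>a\<in>Grass m. \<forall>b\<in>Grass m.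
        \<rho> (\<lambda>I. a I + b I) = (\<lambda>I. \<rho> a I + \<rho> b I) \<and> \<rho> (gmult a b) = gmult (\<rho> a) (\<rho> b)) \<and>
     (\<forall>c. \<rho> (gconst c) = gconst c)"

text \<open>The augmentation \<open>\<Lambda>\<^sub>n \<rightarrow> \<Lambda>\<^sub>0\<close>; it maps a \<open>\<Lambda>\<^sub>n\<close>-point to the underlying ordinary point.\<close>

definition gaug :: "'k::real_normed_field gr \<Rightarrow> 'k gr" where
  "gaug a = gconst (a {})"

text \<open>The map \<open>\<rho> \<otimes> id\<close> on superspace-valued elements, for a homomorphism \<open>\<rho>\<close> defined on \<open>\<Lambda>\<^sub>m\<close>.\<close>

definition gpush ::
  "('k \<Rightarrow> 'v \<Rightarrow> 'v) \<Rightarrow> nat \<Rightarrow> ('k::real_normed_field gr \<Rightarrow> 'k gr) \<Rightarrow> 'v::comm_monoid_add gr \<Rightarrow> 'v gr" where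
  "gpush sc m \<rho> x = (\<lambda>J. \<Sum>I\<in>Pow {..<m}. sc (\<rho> (gtheta I) J) (x I))"

definition gpair :: "'v gr \<Rightarrow> 'w gr \<Rightarrow> ('v \<times> 'w) gr" where
  "gpair x y = (\<lambda>I. (x I, y I))"


section \<open>Vector superspaces and superdomains\<close>

text \<open>
  The superspace is \<open>ev V \<oplus> od V\<close>, two subspaces of the ambient type, either of which may be zero.
  Of the Euclidean structure on the ambient type only the topology is used.
\<close>

record ('k, 'v) sspace =
  scl :: "'k \<Rightarrow> 'v \<Rightarrow> 'v"
  ev :: "'v set"
  od :: "'v set"

definition vector_superspace ::
  "('k::{real_normed_field, euclidean_space}, 'v::euclidean_space) sspace \<Rightarrow> bool" where
  "vector_superspace V \<longleftrightarrow>
     vector_space (scl V) \<and> (\<forall>r v. scl V (of_real r) v = r *\<^sub>R v) \<and>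
     module.subspace (scl V) (ev V) \<and> module.subspace (scl V) (od V) \<and> ev V \<inter> od V = {0}"

definition ssum :: "('k, 'v) sspace \<Rightarrow> ('k, 'w) sspace \<Rightarrow> ('k, 'v \<times> 'w) sspace" where
  "ssum V W = \<lparr>scl = (\<lambda>a (v, w). (scl V a v, scl W a w)), ev = ev V \<times> ev W, od = od V \<times> od W\<rparr>"

text \<open>The \<open>\<Lambda>\<^sub>n\<close>-points of \<open>V\<close> are the even elements of \<open>\<Lambda>\<^sub>n \<otimes> V\<close>.\<close>

definition spts :: "('k, 'v::zero) sspace \<Rightarrow> nat \<Rightarrow> 'v gr set" where
  "spts V n = {x. \<forall>I. (I \<subseteq> {..<n} \<longrightarrow> x I \<in> (if even (card I) then ev V else od V)) \<and>
                      (\<not> I \<subseteq> {..<n} \<longrightarrow> x I = 0)}"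

text \<open>The superdomain over an open subset \<open>D\<close> of \<open>ev V\<close>.\<close>

definition dpts :: "('k, 'v::zero) sspace \<Rightarrow> 'v set \<Rightarrow> nat \<Rightarrow> 'v gr set" where
  "dpts V D n = {x \<in> spts V n. x {} \<in> D}"

definition nonzero :: "('k, 'v::zero) sspace \<Rightarrow> 'v set" where
  "nonzero V = ev V - {0}"


section \<open>Supersmooth maps of superdomains\<close>

definition has_dir_deriv ::
  "('v::real_normed_vector gr \<Rightarrow> 'w::real_normed_vector gr) \<Rightarrow> 'v gr \<Rightarrow> 'v gr \<Rightarrow> 'w gr \<Rightarrow> bool" where
  "has_dir_deriv f x h d \<longleftrightarrow>
     (\<forall>I. ((\<lambda>t::real. f (\<lambda>J. x J + t *\<^sub>R h J) I) has_vector_derivative d I) (at 0))"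

text \<open>
  \<open>C\<^sup>k\<close> on an open subset \<open>U\<close> of a finite-dimensional space \<open>E\<close>: all iterated directional derivatives
  up to order \<open>k\<close> exist and are continuous.
\<close>

primrec Ck_on ::
  "nat \<Rightarrow> 'v::real_normed_vector gr set \<Rightarrow> 'v gr set \<Rightarrow> ('v gr \<Rightarrow> 'w::real_normed_vector gr) \<Rightarrow> bool" where
  "Ck_on 0 E U f \<longleftrightarrow> continuous_on U f"
| "Ck_on (Suc k) E U f \<longleftrightarrow> continuous_on U f \<and>
     (\<forall>h\<in>E. \<exists>g. (\<forall>x\<in>U. has_dir_deriv f x h (g x)) \<and> Ck_on k E U g)"

text \<open>
  The differential is required to be linear over the even part of \<open>\<Lambda>\<^sub>n\<close>, which contains the
  ground field.  Over \<open>\<complex>\<close> it is therefore complex linear, and supersmooth maps are holomorphic.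
\<close>

definition supersmooth ::
  "('k::{real_normed_field, euclidean_space}, 'v::euclidean_space) sspace \<Rightarrow> 'v set \<Rightarrow>
   ('k, 'w::euclidean_space) sspace \<Rightarrow> 'w set \<Rightarrow> (nat \<Rightarrow> 'v gr \<Rightarrow> 'w gr) \<Rightarrow> bool" where
  "supersmooth V D W D' f \<longleftrightarrow>
     openin (top_of_set (ev V)) D \<and> openin (top_of_set (ev W)) D' \<and>
     (\<forall>n. f n ` dpts V D n \<subseteq> dpts W D' n) \<and>
     (\<forall>m n \<rho>. Grass_hom m n \<rho> \<longrightarrow>
        (\<forall>x\<in>dpts V D m. f n (gpush (scl V) m \<rho> x) = gpush (scl W) m \<rho> (f m x))) \<and>
     (\<forall>n k. Ck_on k (spts V n) (dpts V D n) (f n)) \<and>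
     (\<forall>n. \<forall>x\<in>dpts V D n. \<exists>L.
        (\<forall>h\<in>spts V n. has_dir_deriv (f n) x h (L h)) \<and>
        (\<forall>h\<in>spts V n. \<forall>h'\<in>spts V n. L (\<lambda>I. h I + h' I) = (\<lambda>I. L h I + L h' I)) \<and>
        (\<forall>a\<in>Grass_even n. \<forall>h\<in>spts V n. L (gsmult (scl V) a h) = gsmult (scl W) a (L h)))"


section \<open>Supermanifolds\<close>

text \<open>
  \<open>pts M n\<close> are the \<open>\<Lambda>\<^sub>n\<close>-points, and \<open>pts M 0\<close> is the underlying set of ordinary points.
  \<open>act M m n \<rho>\<close> is the map of points induced by a homomorphism \<open>\<rho>\<close> from \<open>\<Lambda>\<^sub>m\<close> to \<open>\<Lambda>\<^sub>n\<close>.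
\<close>

record ('k, 'x, 'm) chart =
  cdom :: "'x set"
  cmodel :: "('k, 'm) sspace"
  cimg :: "'m set"
  cmap :: "nat \<Rightarrow> 'x \<Rightarrow> 'm gr"

record ('k, 'x) gfunctor =
  pts :: "nat \<Rightarrow> 'x set"
  act :: "nat \<Rightarrow> nat \<Rightarrow> ('k gr \<Rightarrow> 'k gr) \<Rightarrow> 'x \<Rightarrow> 'x"

record ('k, 'x, 'm) smfd = "('k, 'x) gfunctor" +
  charts :: "('k, 'x, 'm) chart set"

definition is_gfunctor :: "('k::real_normed_field, 'x, 'z) gfunctor_scheme \<Rightarrow> bool" where
  "is_gfunctor F \<longleftrightarrow>
     (\<forall>m n \<rho>. Grass_hom m n \<rho> \<longrightarrow> act F m n \<rho> ` pts F m \<subseteq> pts F n) \<and>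
     (\<forall>n \<rho>. Grass_hom n n \<rho> \<and> (\<forall>a\<in>Grass n. \<rho> a = a) \<longrightarrow> (\<forall>x\<in>pts F n. act F n n \<rho> x = x)) \<and>
     (\<forall>l m n \<rho> \<sigma> \<tau>. Grass_hom l m \<rho> \<and> Grass_hom m n \<sigma> \<and> Grass_hom l n \<tau> \<and>
        (\<forall>a\<in>Grass l. \<tau> a = \<sigma> (\<rho> a)) \<longrightarrow>
        (\<forall>x\<in>pts F l. act F l n \<tau> x = act F m n \<sigma> (act F l m \<rho> x)))"

text \<open>The open subfunctor over a set \<open>U\<close> of ordinary points.\<close>

definition rpts :: "('k::real_normed_field, 'x, 'z) gfunctor_scheme \<Rightarrow> 'x set \<Rightarrow> nat \<Rightarrow> 'x set" where
  "rpts F U n = {x \<in> pts F n. act F n 0 gaug x \<in> U}"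

definition is_chart ::
  "('k::{real_normed_field, euclidean_space}, 'x, 'z) gfunctor_scheme \<Rightarrow>
   ('k, 'x, 'm::euclidean_space) chart \<Rightarrow> bool" where
  "is_chart F c \<longleftrightarrow>
     cdom c \<subseteq> pts F 0 \<and> vector_superspace (cmodel c) \<and>
     openin (top_of_set (ev (cmodel c))) (cimg c) \<and>
     (\<forall>n. bij_betw (cmap c n) (rpts F (cdom c) n) (dpts (cmodel c) (cimg c) n)) \<and>
     (\<forall>m n \<rho>. Grass_hom m n \<rho> \<longrightarrow>
        (\<forall>x\<in>rpts F (cdom c) m.
           cmap c n (act F m n \<rho> x) = gpush (scl (cmodel c)) m \<rho> (cmap c m x)))"

definition cinv ::
  "('k::real_normed_field, 'x, 'z) gfunctor_scheme \<Rightarrow> ('k, 'x, 'm) chart \<Rightarrow> nat \<Rightarrow> 'm gr \<Rightarrow> 'x" where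
  "cinv F c n = inv_into (rpts F (cdom c) n) (cmap c n)"

definition cbody :: "('k, 'x, 'm) chart \<Rightarrow> 'x set \<Rightarrow> 'm set" where
  "cbody c S = (\<lambda>x. cmap c 0 x {}) ` S"

definition mtop :: "('k::real_normed_field, 'x, 'm::euclidean_space) smfd \<Rightarrow> 'x topology" where
  "mtop M = topology_generated_by
     {{x \<in> cdom c. cmap c 0 x {} \<in> D} | c D.
        c \<in> charts M \<and> openin (top_of_set (ev (cmodel c))) D \<and> D \<subseteq> cimg c}"

definition supermanifold ::
  "('k::{real_normed_field, euclidean_space}, 'x, 'm::euclidean_space) smfd \<Rightarrow> bool" where
  "supermanifold M \<longleftrightarrow>
     is_gfunctor M \<and> (\<forall>c\<in>charts M. is_chart M c) \<and> \<Union> (cdom ` charts M) = pts M 0 \<and>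
     (\<forall>c\<in>charts M. \<forall>d\<in>charts M.
        supersmooth (cmodel c) (cbody c (cdom c \<inter> cdom d)) (cmodel d) (cimg d)
          (\<lambda>n y. cmap d n (cinv M c n y))) \<and>
     Hausdorff_space (mtop M) \<and> second_countable (mtop M)"

text \<open>Maps \<open>f\<close> into \<open>N\<close> that are defined on the open part of \<open>M\<close> over \<open>U\<close>.\<close>

definition smooth_map ::
  "('k::{real_normed_field, euclidean_space}, 'x, 'm::euclidean_space) smfd \<Rightarrow> 'x set \<Rightarrow>
   ('k, 'y, 'l::euclidean_space) smfd \<Rightarrow> (nat \<Rightarrow> 'x \<Rightarrow> 'y) \<Rightarrow> bool" where
  "smooth_map M U N f \<longleftrightarrow>
     openin (mtop M) U \<and>
     (\<forall>n. f n ` rpts M U n \<subseteq> pts N n) \<and>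
     (\<forall>m n \<rho>. Grass_hom m n \<rho> \<longrightarrow>
        (\<forall>x\<in>rpts M U m. f n (act M m n \<rho> x) = act N m n \<rho> (f m x))) \<and>
     (\<forall>c\<in>charts M. \<forall>d\<in>charts N.
        supersmooth (cmodel c) (cbody c {x \<in> cdom c \<inter> U. f 0 x \<in> cdom d}) (cmodel d) (cimg d)
          (\<lambda>n y. cmap d n (f n (cinv M c n y))))"

definition domain_mfd ::
  "('k::{real_normed_field, euclidean_space}, 'v::euclidean_space) sspace \<Rightarrow> 'v set \<Rightarrow>
   ('k, 'v gr, 'v) smfd" where
  "domain_mfd V D =
     \<lparr>pts = dpts V D, act = (\<lambda>m n. gpush (scl V) m),
      charts = {\<lparr>cdom = dpts V D 0, cmodel = V, cimg = D, cmap = (\<lambda>n x. x)\<rparr>}\<rparr>"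

definition open_sub ::
  "('k::{real_normed_field, euclidean_space}, 'x, 'm::euclidean_space) smfd \<Rightarrow> 'x set \<Rightarrow>
   ('k, 'x, 'm) smfd" where
  "open_sub M S =
     \<lparr>pts = rpts M S, act = act M,
      charts = (\<lambda>c. c\<lparr>cdom := cdom c \<inter> S, cimg := cbody c (cdom c \<inter> S)\<rparr>) ` charts M\<rparr>"

definition prod_mfd ::
  "('k, 'x, 'm) smfd \<Rightarrow> ('k, 'y, 'l) smfd \<Rightarrow> ('k, 'x \<times> 'y, 'm \<times> 'l) smfd" where
  "prod_mfd M N =
     \<lparr>pts = (\<lambda>n. pts M n \<times> pts N n),
      act = (\<lambda>m n \<rho> (x, y). (act M m n \<rho> x, act N m n \<rho> y)),
      charts = {\<lparr>cdom = cdom c \<times> cdom d, cmodel = ssum (cmodel c) (cmodel d),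
                 cimg = cimg c \<times> cimg d,
                 cmap = (\<lambda>n (x, y). gpair (cmap c n x) (cmap d n y))\<rparr> | c d.
                c \<in> charts M \<and> d \<in> charts N}\<rparr>"


section \<open>Fiber bundles\<close>

definition fiber_bundle ::
  "('k::{real_normed_field, euclidean_space}, 'x, 'm::euclidean_space) smfd \<Rightarrow>
   ('k, 'b, 'l::euclidean_space) smfd \<Rightarrow> ('k, 'f, 'j::euclidean_space) smfd \<Rightarrow>
   (nat \<Rightarrow> 'x \<Rightarrow> 'b) \<Rightarrow> bool" where
  "fiber_bundle E B F p \<longleftrightarrow>
     supermanifold E \<and> supermanifold B \<and> supermanifold F \<and> smooth_map E (pts E 0) B p \<and>
     (\<forall>b\<in>pts B 0. \<exists>U \<tau> \<sigma>. b \<in> U \<and> openin (mtop B) U \<and>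
        smooth_map E {x \<in> pts E 0. p 0 x \<in> U} (prod_mfd B F) \<tau> \<and>
        smooth_map (prod_mfd B F) (U \<times> pts F 0) E \<sigma> \<and>
        (\<forall>n. \<forall>x\<in>rpts E {x \<in> pts E 0. p 0 x \<in> U} n. fst (\<tau> n x) = p n x \<and> \<sigma> n (\<tau> n x) = x) \<and>
        (\<forall>n. \<forall>y\<in>rpts (prod_mfd B F) (U \<times> pts F 0) n. p n (\<sigma> n y) = fst y \<and> \<tau> n (\<sigma> n y) = y))"

definition bundle_isomorphic ::
  "('k::{real_normed_field, euclidean_space}, 'x, 'm::euclidean_space) smfd \<Rightarrow> (nat \<Rightarrow> 'x \<Rightarrow> 'b) \<Rightarrow>
   ('k, 'y, 'l::euclidean_space) smfd \<Rightarrow> (nat \<Rightarrow> 'y \<Rightarrow> 'b) \<Rightarrow> bool" where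
  "bundle_isomorphic E p E' p' \<longleftrightarrow>
     (\<exists>\<tau> \<sigma>. smooth_map E (pts E 0) E' \<tau> \<and> smooth_map E' (pts E' 0) E \<sigma> \<and>
        (\<forall>n. \<forall>x\<in>pts E n. \<sigma> n (\<tau> n x) = x \<and> p' n (\<tau> n x) = p n x) \<and>
        (\<forall>n. \<forall>y\<in>pts E' n. \<tau> n (\<sigma> n y) = y \<and> p n (\<sigma> n y) = p' n y))"


section \<open>Quotients by the multiplicative group\<close>

text \<open>
  The \<open>\<Lambda>\<^sub>n\<close>-points of the group \<open>'k - {0}\<close> are the even units of \<open>\<Lambda>\<^sub>n\<close>.  The parameter
  \<open>g n\<close> below is the action of these units on the \<open>\<Lambda>\<^sub>n\<close>-points of a superdomain.
\<close>

definition orbit :: "(nat \<Rightarrow> 'k::real_normed_field gr \<Rightarrow> 'v gr \<Rightarrow> 'v gr) \<Rightarrow> nat \<Rightarrow> 'v gr \<Rightarrow> 'v gr set" where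
  "orbit g n x = (\<lambda>a. g n a x) ` Grass_units n"

definition quot_functor ::
  "('k::real_normed_field, 'v::euclidean_space) sspace \<Rightarrow> 'v set \<Rightarrow>
   (nat \<Rightarrow> 'k gr \<Rightarrow> 'v gr \<Rightarrow> 'v gr) \<Rightarrow> ('k, 'v gr set) gfunctor" where
  "quot_functor V D g =
     \<lparr>pts = (\<lambda>n. orbit g n ` dpts V D n),
      act = (\<lambda>m n \<rho> C. \<Union>x\<in>C. orbit g n (gpush (scl V) m \<rho> x))\<rparr>"

text \<open>
  The supermanifold structure on the quotient for which the projection is a submersion: a chart
  has to be supersmooth as a function on the superdomain, and its inverse has to lift locally to
  supersmooth maps into the superdomain.
\<close>

definition quot_preimage ::
  "'v::euclidean_space set \<Rightarrow> (nat \<Rightarrow> 'k::real_normed_field gr \<Rightarrow> 'v gr \<Rightarrow> 'v gr) \<Rightarrow>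
   'v gr set set \<Rightarrow> 'v set" where
  "quot_preimage D g U = {v \<in> D. orbit g 0 (gconst v) \<in> U}"

definition quot_chart ::
  "('k::{real_normed_field, euclidean_space}, 'v::euclidean_space) sspace \<Rightarrow> 'v set \<Rightarrow>
   (nat \<Rightarrow> 'k gr \<Rightarrow> 'v gr \<Rightarrow> 'v gr) \<Rightarrow> ('k, 'v gr set, 'v) chart \<Rightarrow> bool" where
  "quot_chart V D g c \<longleftrightarrow>
     is_chart (quot_functor V D g) c \<and>
     supersmooth V (quot_preimage D g (cdom c)) (cmodel c) (cimg c)
       (\<lambda>n x. cmap c n (orbit g n x)) \<and>
     (\<forall>y\<in>cimg c. \<exists>D' s. y \<in> D' \<and> D' \<subseteq> cimg c \<and>
        supersmooth (cmodel c) D' V (quot_preimage D g (cdom c)) s \<and>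
        (\<forall>n. \<forall>x\<in>dpts (cmodel c) D' n. cmap c n (orbit g n (s n x)) = x))"

definition quot_mfd ::
  "('k::{real_normed_field, euclidean_space}, 'v::euclidean_space) sspace \<Rightarrow> 'v set \<Rightarrow>
   (nat \<Rightarrow> 'k gr \<Rightarrow> 'v gr \<Rightarrow> 'v gr) \<Rightarrow> ('k, 'v gr set, 'v) smfd" where
  "quot_mfd V D g =
     \<lparr>pts = pts (quot_functor V D g), act = act (quot_functor V D g),
      charts = Collect (quot_chart V D g)\<rparr>"


section \<open>Projective superspaces\<close>

definition proj_action ::
  "('k::real_normed_field, 'v::euclidean_space) sspace \<Rightarrow> nat \<Rightarrow> 'k gr \<Rightarrow> 'v gr \<Rightarrow> 'v gr" where
  "proj_action V n a v = gsmult (scl V) a v"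

definition proj_class ::
  "('k::real_normed_field, 'v::euclidean_space) sspace \<Rightarrow> nat \<Rightarrow> 'v gr \<Rightarrow> 'v gr set" where
  "proj_class V n v = orbit (proj_action V) n v"

definition proj_space ::
  "('k::{real_normed_field, euclidean_space}, 'v::euclidean_space) sspace \<Rightarrow> ('k, 'v gr set, 'v) smfd" where
  "proj_space V = quot_mfd V (nonzero V) (proj_action V)"

definition wproj_action ::
  "('k::real_normed_field, 'v::euclidean_space) sspace \<Rightarrow> ('k, 'w::euclidean_space) sspace \<Rightarrow>
   nat \<Rightarrow> 'k gr \<Rightarrow> ('v \<times> 'w) gr \<Rightarrow> ('v \<times> 'w) gr" where
  "wproj_action V W n a x =
     gpair (gsmult (scl V) a (fst \<circ> x)) (gsmult (scl W) (ginv n a) (snd \<circ> x))"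

definition wproj_class ::
  "('k::real_normed_field, 'v::euclidean_space) sspace \<Rightarrow> ('k, 'w::euclidean_space) sspace \<Rightarrow>
   nat \<Rightarrow> 'v gr \<Rightarrow> 'w gr \<Rightarrow> ('v \<times> 'w) gr set" where
  "wproj_class V W n v w = orbit (wproj_action V W) n (gpair v w)"

definition wproj_space ::
  "('k::{real_normed_field, euclidean_space}, 'v::euclidean_space) sspace \<Rightarrow>
   ('k, 'w::euclidean_space) sspace \<Rightarrow> ('k, ('v \<times> 'w) gr set, 'v \<times> 'w) smfd" where
  "wproj_space V W = quot_mfd (ssum V W) (nonzero V \<times> nonzero W) (wproj_action V W)"


section \<open>The tautological line bundle and its tensor products with trivial bundles\<close>

text \<open>The fiber of \<open>E_V\<close>: the even multiples of any generator of the line.\<close>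

definition taut_fiber ::
  "('k::real_normed_field, 'v::euclidean_space) sspace \<Rightarrow> nat \<Rightarrow> 'v gr set \<Rightarrow> 'v gr set" where
  "taut_fiber V n L = {gsmult (scl V) a v | a v. a \<in> Grass_even n \<and> v \<in> L}"

text \<open>A nowhere vanishing supersmooth section of \<open>E_V\<close> over the domain of a chart \<open>c\<close>.\<close>

definition taut_frame ::
  "('k::{real_normed_field, euclidean_space}, 'v::euclidean_space) sspace \<Rightarrow>
   ('k, 'v gr set, 'v) chart \<Rightarrow> (nat \<Rightarrow> 'v gr set \<Rightarrow> 'v gr) \<Rightarrow> bool" where
  "taut_frame V c s \<longleftrightarrow>
     (\<forall>n. \<forall>L\<in>rpts (proj_space V) (cdom c) n. s n L \<in> taut_fiber V n L) \<and>
     supersmooth (cmodel c) (cimg c) V (nonzero V) (\<lambda>n y. s n (cinv (proj_space V) c n y))"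

text \<open>
  The tensor product of finite-dimensional spaces is realized as the space of bilinear forms on the
  product of the duals, \<open>v \<otimes> w\<close> being \<open>\<lambda>\<alpha> \<beta>. \<alpha> v * \<beta> w\<close>.  On \<open>\<Lambda>\<^sub>n\<close>-points the rule of signs is
  \<open>\<theta>\<^sub>I v \<otimes> \<theta>\<^sub>J w = (-1)\<^bsup>|v||J|\<^esup> \<theta>\<^sub>I \<theta>\<^sub>J (v \<otimes> w)\<close>, with \<open>v\<close> of the parity of \<open>card I\<close>.
\<close>

type_synonym ('k, 'v, 'w) tensor = "('v \<Rightarrow> 'k) \<Rightarrow> ('w \<Rightarrow> 'k) \<Rightarrow> 'k"

definition gtensor ::
  "('k::real_normed_field, 'v::euclidean_space) sspace \<Rightarrow> ('k, 'w::euclidean_space) sspace \<Rightarrow>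
   'v gr \<Rightarrow> 'w gr \<Rightarrow> ('k, 'v, 'w) tensor gr" where
  "gtensor V W x y = (\<lambda>K \<alpha> \<beta>.
     if Vector_Spaces.linear (scl V) (*) \<alpha> \<and> Vector_Spaces.linear (scl W) (*) \<beta>
     then \<Sum>I\<in>Pow K. (- 1) ^ (card I * card (K - I)) * gsgn I (K - I) * \<alpha> (x I) * \<beta> (y (K - I))
     else 0)"

definition tensor_push ::
  "nat \<Rightarrow> ('k::real_normed_field gr \<Rightarrow> 'k gr) \<Rightarrow> ('k, 'v, 'w) tensor gr \<Rightarrow> ('k, 'v, 'w) tensor gr" where
  "tensor_push m \<rho> z = (\<lambda>J \<alpha> \<beta>. gpush (*) m \<rho> (\<lambda>I. z I \<alpha> \<beta>) J)"

text \<open>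
  The total space of \<open>E_V \<otimes> W\<close>, a subbundle of the trivial bundle with fiber \<open>V \<otimes> W\<close>.  As \<open>E_V\<close> is
  a line bundle of rank \<open>1|0\<close>, pure tensors exhaust the fibers.  A frame \<open>s\<close> of \<open>E_V\<close> over the domain
  of a chart \<open>c\<close> of \<open>P(V)\<close> gives the chart with inverse
  \<open>(c(L), w) \<mapsto> (L, s(L) \<otimes> w)\<close>.
\<close>

definition taut_tensor_functor ::
  "('k::{real_normed_field, euclidean_space}, 'v::euclidean_space) sspace \<Rightarrow>
   ('k, 'w::euclidean_space) sspace \<Rightarrow> ('k, 'v gr set \<times> ('k, 'v, 'w) tensor gr) gfunctor" where
  "taut_tensor_functor V W =
     \<lparr>pts = (\<lambda>n. {(L, gtensor V W x w) | L x w.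
                   L \<in> pts (proj_space V) n \<and> x \<in> taut_fiber V n L \<and> w \<in> spts W n}),
      act = (\<lambda>m n \<rho> (L, z). (act (proj_space V) m n \<rho> L, tensor_push m \<rho> z))\<rparr>"

definition taut_tensor ::
  "('k::{real_normed_field, euclidean_space}, 'v::euclidean_space) sspace \<Rightarrow>
   ('k, 'w::euclidean_space) sspace \<Rightarrow>
   ('k, 'v gr set \<times> ('k, 'v, 'w) tensor gr, 'v \<times> 'w) smfd" where
  "taut_tensor V W =
     \<lparr>pts = pts (taut_tensor_functor V W), act = act (taut_tensor_functor V W),
      charts = {\<lparr>cdom = {(L, z) \<in> pts (taut_tensor_functor V W) 0. L \<in> cdom c},
                 cmodel = ssum (cmodel c) W, cimg = cimg c \<times> ev W, cmap = \<kappa>\<rparr> | c s \<kappa>.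
                c \<in> charts (proj_space V) \<and> taut_frame V c s \<and>
                (\<forall>n. \<forall>L\<in>rpts (proj_space V) (cdom c) n. \<forall>w\<in>spts W n.
                   \<kappa> n (L, gtensor V W (s n L) w) = gpair (cmap c n L) w)}\<rparr>"

text \<open>The complement \<open>(E_V \<otimes> W)\<^sub>0\<close> of the zero section.\<close>

definition taut_tensor_nonzero ::
  "('k::{real_normed_field, euclidean_space}, 'v::euclidean_space) sspace \<Rightarrow>
   ('k, 'w::euclidean_space) sspace \<Rightarrow>
   ('k, 'v gr set \<times> ('k, 'v, 'w) tensor gr, 'v \<times> 'w) smfd" where
  "taut_tensor_nonzero V W =
     open_sub (taut_tensor V W) {(L, z) \<in> pts (taut_tensor V W) 0. z {} \<noteq> (\<lambda>\<alpha> \<beta>. 0)}"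

end

theory Submission
  imports Defs
begin

text \<open>
  Let \<open>\<alpha>\<close> be an even linear form on \<open>V\<close> and \<open>\<alpha>(e) = 1\<close>.  Where \<open>\<alpha>(v)\<close> is invertible, \<open>[v]\<close> has the coordinate
  \<open>v / \<alpha>(v) - e\<close> in the kernel of \<open>\<alpha>\<close>, and \<open>[v\<parallel>w]\<close> has the coordinates \<open>(v / \<alpha>(v) - e, \<alpha>(v) w)\<close>; so the
  projection to \<open>P(V)\<close> is trivial there, with fiber \<open>W\<^sub>0\<close>.  Since \<open>\<lambda>v \<otimes> w = v \<otimes> \<lambda>w\<close>, the map
  \<open>[v\<parallel>w] \<mapsto> ([v], v \<otimes> w)\<close> into \<open>(E_V \<otimes> W)\<^sub>0\<close> is well defined, and it is bijective because \<open>v\<close> with an invertible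
  \<open>\<alpha>(v)\<close> can be cancelled from \<open>v \<otimes> w\<close>.  In the coordinates of \<open>E_V \<otimes> W\<close> that belong to the frame
  \<open>[v] \<mapsto> v / \<alpha>(v)\<close> of \<open>E_V\<close> this map is the identity.  Any two points lie in one such coordinate domain and countably
  many of these domains cover, which gives the separation axioms.  Exchanging \<open>V\<close> and \<open>W\<close> identifies the two
  weighted projective spaces and yields the statements over \<open>P(W)\<close>.
\<close>

section \<open>Signs\<close>

text \<open>The charts of a quotient and those of (E_V \<otimes> W)_0 form large families: all
  coordinate systems with local supersmooth lifts, and one or more for every frame of E_V over every
  chart of P(V). The coordinates built from \<alpha> are mere samples, so compatibility has to be
  shown for all charts at once. For quotients it rests on the lifts, which turn a question about
  classes into one about functions on the superdomain; for frames it rests on the fact that two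
  frames of a line bundle differ by a supersmooth unit. The form \<alpha> has to kill the odd part:
  then \<alpha>(v) is an even element of the Grassmann algebra, hence central, and it is invertible
  exactly when its constant term is non-zero. The coordinates are algebraic in v, w and
  1/\<alpha>(v), so supersmoothness reduces to sums, products and inversion of units. Composing
  supersmooth maps is the analytic obstacle: the definition speaks of directional derivatives of
  functions on families of coefficients, and the chain rule has to be won from the continuity of
  partial derivatives.\<close>

lemma gsgn_empty [simp]: "gsgn {} J = 1" "gsgn I {} = 1"
  by (simp_all add: gsgn_def)

lemma finite_inversions: "finite I \<Longrightarrow> finite J \<Longrightarrow> finite {(i, j). i \<in> I \<and> j \<in> J \<and> j < (i::nat)}"
  by (rule finite_subset[of _ "I \<times> J"]) auto

lemma gsgn_Un_left:
  assumes "finite I" "finite J" "finite K" "I \<inter> J = {}"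
  shows "gsgn (I \<union> J) K = gsgn I K * gsgn J K"
proof -
  let ?S = "\<lambda>I. {(i, j). i \<in> I \<and> j \<in> K \<and> j < i}"
  have "?S (I \<union> J) = ?S I \<union> ?S J" by auto
  moreover have "?S I \<inter> ?S J = {}" using assms(4) by auto
  ultimately have "card (?S (I \<union> J)) = card (?S I) + card (?S J)"
    using assms by (simp add: card_Un_disjoint finite_inversions)
  then show ?thesis by (simp add: gsgn_def power_add)
qed

lemma gsgn_Un_right:
  assumes "finite I" "finite J" "finite K" "J \<inter> K = {}"
  shows "gsgn I (J \<union> K) = gsgn I J * gsgn I K"
proof -
  let ?S = "\<lambda>J. {(i, j). i \<in> I \<and> j \<in> J \<and> j < i}"
  have "?S (J \<union> K) = ?S J \<union> ?S K" by auto
  moreover have "?S J \<inter> ?S K = {}" using assms(4) by auto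
  ultimately have "card (?S (J \<union> K)) = card (?S J) + card (?S K)"
    using assms by (simp add: card_Un_disjoint finite_inversions)
  then show ?thesis by (simp add: gsgn_def power_add)
qed

text \<open>Every pair in \<open>I \<times> J\<close> is an inversion of exactly one of the two
  arrangements, so the two inversion counts add up to \<open>card I * card J\<close>. The sign is
  the one for commuting \<theta>_I past \<theta>_J.\<close>

lemma gsgn_swap:
  assumes "finite I" "finite J" "I \<inter> J = {}"
  shows "(- 1) ^ (card I * card J) * gsgn I J = (gsgn J I :: 'k::real_normed_field)"
proof -
  let ?A = "{(i, j). i \<in> I \<and> j \<in> J \<and> j < i}" and ?B = "{(j, i). j \<in> J \<and> i \<in> I \<and> i < j}"
  have "I \<times> J = ?A \<union> prod.swap ` ?B"
    using assms(3) by (auto simp: image_iff)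
  moreover have "?A \<inter> prod.swap ` ?B = {}" by auto
  moreover have "card (prod.swap ` ?B) = card ?B" by (rule card_image) simp
  ultimately have "card I * card J = card ?A + card ?B"
    using assms finite_inversions[of I J] finite_inversions[of J I]
      card_Un_disjoint[of ?A "prod.swap ` ?B"] by (simp flip: card_cartesian_product)
  then have "(- 1) ^ (card I * card J) * gsgn I J = ((- 1) ^ card ?A * (- 1) ^ card ?A) * gsgn J I"
    by (simp add: gsgn_def power_add mult_ac)
  also have "(- 1) ^ card ?A * (- 1) ^ card ?A = (1::'k)"
    by (simp flip: power_mult_distrib)
  finally show ?thesis by simp
qed

section \<open>Grassmann algebras\<close>

text \<open>The support condition of \<open>Grass\<close>, freed from the coefficient type, so that
  it applies to superspace-valued elements as well. Outside of it unit laws fail: products vanish at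
  infinite index sets by the convention for infinite sums.\<close>

definition gsupported :: "nat \<Rightarrow> 'v::zero gr set" where
  "gsupported n = {x. \<forall>I. \<not> I \<subseteq> {..<n} \<longrightarrow> x I = 0}"

lemma gsupportedD: "x \<in> gsupported n \<Longrightarrow> \<not> I \<subseteq> {..<n} \<Longrightarrow> x I = 0"
  by (simp add: gsupported_def)

lemma Grass_eq: "Grass n = gsupported n"
  by (simp add: Grass_def gsupported_def)

lemma gsupported_infinite: "x \<in> gsupported n \<Longrightarrow> infinite I \<Longrightarrow> x I = 0"
  using finite_subset by (auto simp: gsupported_def)

lemma gsmult_infinite [simp]: "infinite K \<Longrightarrow> gsmult sc a x K = 0"
  by (simp add: gsmult_def)

lemma gconst_gsupported [simp]: "gconst v \<in> gsupported n"
  by (auto simp: gsupported_def gconst_def)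

lemma gconst_empty [simp]: "gconst v {} = v"
  by (simp add: gconst_def)

lemma vector_space_module: "vector_space sc \<Longrightarrow> module sc"
  by (simp add: module_iff_vector_space)

lemma vector_space_mult: "vector_space ((*) :: 'k::field \<Rightarrow> 'k \<Rightarrow> 'k)"
  by (rule vector_space_over_itself.vector_space_axioms)

section \<open>Module laws for Grassmann scalars acting on superspace-valued elements\<close>

context
  fixes sc :: "'k::real_normed_field \<Rightarrow> 'v::ab_group_add \<Rightarrow> 'v"
  assumes sc: "vector_space sc"
begin

interpretation vector_space sc by (rule sc)

lemma gsmult_empty [simp]: "gsmult sc a x {} = sc (a {}) (x {})"
  by (simp add: gsmult_def)

lemma gsmult_gsupported:
  assumes "a \<in> gsupported n" "x \<in> gsupported n"
  shows "gsmult sc a x \<in> gsupported n"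
proof -
  have "gsmult sc a x K = 0" if "\<not> K \<subseteq> {..<n}" for K
    unfolding gsmult_def
  proof (intro sum.neutral ballI)
    fix I assume "I \<in> Pow K"
    then consider "\<not> I \<subseteq> {..<n}" | "\<not> K - I \<subseteq> {..<n}" using \<open>\<not> K \<subseteq> {..<n}\<close> by blast
    then show "sc (gsgn I (K - I) * a I) (x (K - I)) = 0"
      by cases (simp_all add: gsupportedD[OF assms(1)] gsupportedD[OF assms(2)])
  qed
  then show ?thesis by (simp add: gsupported_def)
qed

lemma gsmult_add_left: "gsmult sc (\<lambda>I. a I + b I) x = (\<lambda>K. gsmult sc a x K + gsmult sc b x K)"
  by (simp add: gsmult_def algebra_simps scale_left_distrib sum.distrib)

lemma gsmult_add_right: "gsmult sc a (\<lambda>I. x I + y I) = (\<lambda>K. gsmult sc a x K + gsmult sc a y K)"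
  by (simp add: gsmult_def scale_right_distrib sum.distrib)

lemma gsmult_diff_left: "gsmult sc (\<lambda>I. a I - b I) x = (\<lambda>K. gsmult sc a x K - gsmult sc b x K)"
  by (simp add: gsmult_def algebra_simps scale_left_diff_distrib sum_subtractf)

lemma gsmult_diff_right: "gsmult sc a (\<lambda>I. x I - y I) = (\<lambda>K. gsmult sc a x K - gsmult sc a y K)"
  by (simp add: gsmult_def scale_right_diff_distrib sum_subtractf)

lemma gsmult_scale_left: "gsmult sc (\<lambda>I. c * a I) x = (\<lambda>K. sc c (gsmult sc a x K))"
  by (simp add: gsmult_def scale_sum_right mult.left_commute)

lemma gsmult_scale_right: "gsmult sc a (\<lambda>I. sc c (x I)) = (\<lambda>K. sc c (gsmult sc a x K))"
  by (simp add: gsmult_def scale_sum_right mult_ac)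

lemma gsmult_gconst:
  assumes "x \<in> gsupported n"
  shows "gsmult sc (gconst c) x = (\<lambda>K. sc c (x K))"
proof
  fix K
  show "gsmult sc (gconst c) x K = sc c (x K)"
  proof (cases "finite K")
    case True
    have "gsmult sc (gconst c) x K = (\<Sum>I\<in>Pow K. if I = {} then sc c (x K) else 0)"
      unfolding gsmult_def gconst_def by (intro sum.cong) auto
    also have "\<dots> = sc c (x K)" using True by simp
    finally show ?thesis .
  qed (simp add: gsupported_infinite[OF assms])
qed

lemma gsmult_one: "x \<in> gsupported n \<Longrightarrow> gsmult sc (gconst 1) x = x"
  by (simp add: gsmult_gconst)

text \<open>Both sides run over the ordered splittings of \<open>K\<close> into three disjoint
  pieces. The signs agree because \<open>gsgn\<close> is multiplicative in each argument under
  disjoint unions: each side carries the product of the three pairwise signs.\<close>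

lemma gsmult_assoc: "gsmult sc (gmult a b) x = gsmult sc a (gsmult sc b x)"
proof
  fix K
  show "gsmult sc (gmult a b) x K = gsmult sc a (gsmult sc b x) K"
  proof (cases "finite K")
    case fin: True
    have "gsmult sc (gmult a b) x K = (\<Sum>I\<in>Pow K. \<Sum>A\<in>Pow I.
        sc (gsgn I (K - I) * (gsgn A (I - A) * a A * b (I - A))) (x (K - I)))"
      by (simp add: gsmult_def sum_distrib_left scale_sum_left)
    also have "\<dots> = (\<Sum>(I, A)\<in>Sigma (Pow K) Pow.
        sc (gsgn I (K - I) * (gsgn A (I - A) * a A * b (I - A))) (x (K - I)))"
      using fin by (subst sum.Sigma) (auto intro: finite_subset)
    also have "\<dots> = (\<Sum>(A, B)\<in>Sigma (Pow K) (\<lambda>A. Pow (K - A)).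
        sc (gsgn A (K - A) * a A) (sc (gsgn B (K - A - B) * b B) (x (K - A - B))))"
    \<comment> \<open>A splitting is recorded on the left as (union of the first two pieces, first
      piece) and on the right as (first piece, second piece).\<close>
    proof (rule sum.reindex_bij_witness[where i = "\<lambda>(A, B). (A \<union> B, A)" and j = "\<lambda>(I, A). (A, I - A)"])
      fix p assume "p \<in> Sigma (Pow K) Pow"
      then obtain I A where p: "p = (I, A)" and IA: "I \<subseteq> K" "A \<subseteq> I" by auto
      have f: "finite I" "finite A" "finite (K - I)" "finite (I - A)"
        using fin IA by (auto intro: finite_subset)
      have e: "K - A = (I - A) \<union> (K - I)" "(I - A) \<union> (K - I) - (I - A) = K - I" using IA by auto
      have "gsgn A ((I - A) \<union> (K - I)) = gsgn A (I - A) * (gsgn A (K - I) :: 'k)"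
        using f by (intro gsgn_Un_right) auto
      moreover have "gsgn (A \<union> (I - A)) (K - I) = gsgn A (K - I) * (gsgn (I - A) (K - I) :: 'k)"
        using f by (intro gsgn_Un_left) auto
      moreover have "A \<union> (I - A) = I" using IA by auto
      ultimately show "(case (case p of (I, A) \<Rightarrow> (A, I - A)) of (A, B) \<Rightarrow>
          sc (gsgn A (K - A) * a A) (sc (gsgn B (K - A - B) * b B) (x (K - A - B)))) =
        (case p of (I, A) \<Rightarrow> sc (gsgn I (K - I) * (gsgn A (I - A) * a A * b (I - A))) (x (K - I)))"
        by (simp only: p e prod.case) (simp add: mult_ac)
    qed auto
    also have "\<dots> = gsmult sc a (gsmult sc b x) K"
      unfolding gsmult_def using fin by (subst sum.Sigma[symmetric]) (auto simp: scale_sum_right)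
    finally show ?thesis .
  qed simp
qed

end

lemma gmult_empty [simp]: "gmult a b {} = a {} * b {}"
  by (simp add: gsmult_def)

text \<open>Interchanging the roles of \<open>I\<close> and \<open>K - I\<close> costs the sign with
  exponent \<open>card I * card (K - I)\<close>, which is 1 when \<open>card I\<close> is even; for
  odd \<open>card I\<close> the coefficient of a vanishes. The other factor is arbitrary, so even
  elements are central.\<close>

lemma gmult_commute:
  assumes "\<And>I. odd (card I) \<Longrightarrow> a I = 0"
  shows "gmult a b = gmult b a"
proof
  fix K
  show "gmult a b K = gmult b a K"
  proof (cases "finite K")
    case fin: True
    show ?thesis unfolding gsmult_def
    proof (rule sum.reindex_bij_witness[where i = "\<lambda>I. K - I" and j = "\<lambda>I. K - I"])
      fix I assume I: "I \<in> Pow K"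
      then have f: "finite I" "finite (K - I)" "K - (K - I) = I" using fin by (auto intro: finite_subset)
      show "gsgn (K - I) (K - (K - I)) * b (K - I) * a (K - (K - I)) = gsgn I (K - I) * a I * b (K - I)"
      proof (cases "odd (card I)")
        case False
        then show ?thesis using gsgn_swap[of I "K - I", where ?'k = 'a] f by simp
      qed (simp add: assms f)
    qed auto
  qed simp
qed

lemma gmult_assoc: "gmult (gmult a b) c = gmult a (gmult b c)"
  by (rule gsmult_assoc[OF vector_space_mult])

lemma Grass_evenD: "a \<in> Grass_even n \<Longrightarrow> odd (card I) \<Longrightarrow> a I = 0"
  and Grass_even_gsupported: "a \<in> Grass_even n \<Longrightarrow> a \<in> gsupported n"
  by (auto simp: Grass_even_def Grass_eq)

lemma Grass_even_commute: "a \<in> Grass_even n \<Longrightarrow> gmult a b = gmult b a"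
  by (rule gmult_commute) (rule Grass_evenD)

lemma gconst_even [simp]: "gconst c \<in> Grass_even n"
  by (auto simp: Grass_even_def Grass_eq gconst_def gsupported_def)

lemma gmult_gconst: "a \<in> gsupported n \<Longrightarrow> gmult (gconst c) a = (\<lambda>K. c * a K)"
  by (rule gsmult_gconst[OF vector_space_mult])

lemma gmult_one [simp]: "a \<in> gsupported n \<Longrightarrow> gmult (gconst 1) a = a"
  by (simp add: gmult_gconst)

lemma gmult_one_right [simp]: "a \<in> gsupported n \<Longrightarrow> gmult a (gconst 1) = a"
  using Grass_even_commute[of "gconst 1" n a] by simp

subsection \<open>Superspaces\<close>

lemma vector_superspaceD:
  assumes "vector_superspace V"
  shows "vector_space (scl V)" "\<And>r v. scl V (of_real r) v = r *\<^sub>R v"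
    "module.subspace (scl V) (ev V)" "module.subspace (scl V) (od V)" "ev V \<inter> od V = {0}"
  using assms by (auto simp: vector_superspace_def)

lemma spts_gsupported: "x \<in> spts V n \<Longrightarrow> x \<in> gsupported n"
  by (auto simp: spts_def gsupported_def)

lemma spts_even: "x \<in> spts V n \<Longrightarrow> I \<subseteq> {..<n} \<Longrightarrow> even (card I) \<Longrightarrow> x I \<in> ev V"
  and spts_odd: "x \<in> spts V n \<Longrightarrow> I \<subseteq> {..<n} \<Longrightarrow> odd (card I) \<Longrightarrow> x I \<in> od V"
  by (auto simp: spts_def split: if_splits)

lemma spts_empty: "x \<in> spts V n \<Longrightarrow> x {} \<in> ev V"
  by (rule spts_even) auto

lemma dpts_spts: "x \<in> dpts V D n \<Longrightarrow> x \<in> spts V n"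
  by (simp add: dpts_def)

text \<open>The summand of V from which the coefficient at \<open>I\<close> has to come in order
  that \<theta>_I x_I be even. As one family of subspaces it allows both parities to be treated
  together.\<close>

definition spart :: "('k, 'v) sspace \<Rightarrow> nat set \<Rightarrow> 'v set" where
  "spart V I = (if even (card I) then ev V else od V)"

lemma spts_iff: "x \<in> spts V n \<longleftrightarrow> x \<in> gsupported n \<and> (\<forall>I\<subseteq>{..<n}. x I \<in> spart V I)"
  by (auto simp: spts_def gsupported_def spart_def)

lemma spart_empty [simp]: "spart V {} = ev V"
  by (simp add: spart_def)

lemma spart_cong: "even (card I) = even (card J) \<Longrightarrow> spart V I = spart V J"
  by (simp add: spart_def)

lemma subspace_spart: "vector_superspace V \<Longrightarrow> module.subspace (scl V) (spart V I)"
  by (simp add: vector_superspace_def spart_def)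

lemma vector_superspace_module: "vector_superspace V \<Longrightarrow> module (scl V)"
  by (simp add: vector_superspace_def vector_space_def module_def)

lemma spart_zero [simp]: "vector_superspace V \<Longrightarrow> 0 \<in> spart V I"
  by (rule module.subspace_0[OF vector_superspace_module subspace_spart])

lemma spart_add: "vector_superspace V \<Longrightarrow> v \<in> spart V I \<Longrightarrow> w \<in> spart V I \<Longrightarrow> v + w \<in> spart V I"
  by (rule module.subspace_add[OF vector_superspace_module subspace_spart])

lemma spart_diff: "vector_superspace V \<Longrightarrow> v \<in> spart V I \<Longrightarrow> w \<in> spart V I \<Longrightarrow> v - w \<in> spart V I"
  by (rule module.subspace_diff[OF vector_superspace_module subspace_spart])

lemma spart_scale: "vector_superspace V \<Longrightarrow> v \<in> spart V I \<Longrightarrow> scl V c v \<in> spart V I"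
  by (rule module.subspace_scale[OF vector_superspace_module subspace_spart])

lemma spart_sum: "vector_superspace V \<Longrightarrow> (\<And>i. i \<in> S \<Longrightarrow> f i \<in> spart V I) \<Longrightarrow> sum f S \<in> spart V I"
  by (rule module.subspace_sum[OF vector_superspace_module subspace_spart])

lemma spart_scaleR: "vector_superspace V \<Longrightarrow> v \<in> spart V I \<Longrightarrow> r *\<^sub>R v \<in> spart V I"
  using spart_scale[of V v I "of_real r"] by (simp add: vector_superspaceD)

lemma spts_add: "vector_superspace V \<Longrightarrow> x \<in> spts V n \<Longrightarrow> y \<in> spts V n \<Longrightarrow> (\<lambda>I. x I + y I) \<in> spts V n"
  by (auto simp: spts_iff gsupported_def spart_add)

lemma spts_scaleR: "vector_superspace V \<Longrightarrow> x \<in> spts V n \<Longrightarrow> (\<lambda>I. r *\<^sub>R x I) \<in> spts V n"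
  by (auto simp: spts_iff gsupported_def spart_scaleR)

lemma gconst_spts: "vector_superspace V \<Longrightarrow> v \<in> ev V \<Longrightarrow> gconst v \<in> spts V n"
  by (auto simp: spts_iff gconst_def gsupported_def)

lemma gconst_dpts: "vector_superspace V \<Longrightarrow> v \<in> D \<Longrightarrow> D \<subseteq> ev V \<Longrightarrow> gconst v \<in> dpts V D n"
  by (auto simp: dpts_def intro: gconst_spts)

text \<open>An even scalar has coefficients at sets of even size only, and removing such a set from
  \<open>K\<close> preserves the parity of the size.\<close>

lemma gsmult_spts:
  assumes V: "vector_superspace V" and "a \<in> Grass_even n" "x \<in> spts V n"
  shows "gsmult (scl V) a x \<in> spts V n"
  unfolding spts_iff
proof (intro conjI allI impI)
  show "gsmult (scl V) a x \<in> gsupported n"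
    using assms by (intro gsmult_gsupported vector_superspaceD Grass_even_gsupported) (auto intro: spts_gsupported)
  fix K assume K: "K \<subseteq> {..<n}"
  show "gsmult (scl V) a x K \<in> spart V K" unfolding gsmult_def
  proof (intro spart_sum V)
    fix I assume I: "I \<in> Pow K"
    show "scl V (gsgn I (K - I) * a I) (x (K - I)) \<in> spart V K"
    proof (cases "odd (card I)")
      case True
      then show ?thesis
        by (simp add: Grass_evenD[OF assms(2)] module.scale_zero_left[OF vector_space_module[OF vector_superspaceD(1)]] V)
    next
      case False
      have "card K = card I + card (K - I)" using I K
        using card_mono[of K I] finite_subset[OF K] by (simp add: card_Diff_subset finite_subset)
      then have "spart V (K - I) = spart V K" using False by (intro spart_cong) simp
      moreover have "x (K - I) \<in> spart V (K - I)" using assms(3) I K by (simp add: spts_iff subset_iff)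
      ultimately show ?thesis by (auto intro: spart_scale V)
    qed
  qed
qed

text \<open>The ground field as a superspace of dimension 1|0. Its \<Lambda>_n-points are the even
  elements of \<Lambda>_n, so that scalar functions, and inversion of units, become supersmooth maps
  between superspaces.\<close>

definition sfield :: "('k::real_normed_field, 'k) sspace" where
  "sfield = \<lparr>scl = (*), ev = UNIV, od = {0}\<rparr>"

lemma sfield_simps [simp]: "scl sfield = (*)" "ev sfield = UNIV" "od sfield = {0}"
  by (simp_all add: sfield_def)

lemma vector_superspace_sfield: "vector_superspace sfield"
  unfolding vector_superspace_def sfield_simps
  by (intro conjI vector_space_mult module.subspace_UNIV module.subspace_single_0 module_axioms)
    (simp_all add: scaleR_conv_of_real vector_space_over_itself.module_axioms)

lemma spts_sfield: "spts sfield n = Grass_even n"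
proof -
  have "(\<forall>I\<subseteq>{..<n}. x I \<in> spart sfield I) \<longleftrightarrow> (\<forall>I. odd (card I) \<longrightarrow> x I = 0)"
    if "x \<in> gsupported n" for x :: "'a gr"
    using gsupportedD[OF that] by (auto simp: spart_def)
  then show ?thesis by (auto simp: spts_iff Grass_even_def Grass_eq)
qed

lemma gmult_even:
  assumes "a \<in> Grass_even n" "b \<in> Grass_even n"
  shows "gmult a b \<in> Grass_even n"
proof -
  have "a I * b (K - I) = 0" if "odd (card K)" "I \<subseteq> K" for K I
  proof (cases "odd (card I)")
    case False
    have "finite K" using that(1) card.infinite by fastforce
    then have "odd (card (K - I))" using that False
      using card_mono[of K I] by (simp add: card_Diff_subset finite_subset)
    then show ?thesis by (simp add: Grass_evenD[OF assms(2)])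
  qed (simp add: Grass_evenD[OF assms(1)])
  then have "gmult a b K = 0" if "odd (card K)" for K
    using that by (auto simp: gsmult_def mult.assoc intro!: sum.neutral)
  moreover have "gmult a b \<in> gsupported n"
    by (intro gsmult_gsupported vector_space_mult Grass_even_gsupported assms)
  ultimately show ?thesis by (simp add: Grass_even_def Grass_eq)
qed

lemma Grass_even_add: "a \<in> Grass_even n \<Longrightarrow> b \<in> Grass_even n \<Longrightarrow> (\<lambda>I. a I + b I) \<in> Grass_even n"
  by (auto simp: Grass_even_def Grass_eq gsupported_def)

lemma Grass_even_scale: "a \<in> Grass_even n \<Longrightarrow> (\<lambda>I. c * a I) \<in> Grass_even n"
  by (auto simp: Grass_even_def Grass_eq gsupported_def)

subsection \<open>Units\<close>

primrec gpow :: "'k::real_normed_field gr \<Rightarrow> nat \<Rightarrow> 'k gr" where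
  "gpow u 0 = gconst 1"
| "gpow u (Suc j) = gmult u (gpow u j)"

text \<open>Every factor without constant term uses up at least one generator, so a product of j
  factors has coefficients only at sets of at least j elements.\<close>

lemma gpow_nilpotent:
  assumes "u {} = 0" "finite K" "card K < j"
  shows "gpow u j K = 0"
  using assms(2,3)
proof (induction j arbitrary: K)
  case (Suc j)
  have "u I * gpow u j (K - I) = 0" if "I \<subseteq> K" for I
  proof (cases "I = {}")
    case False
    then have "card (K - I) < card K" using that Suc.prems by (intro psubset_card_mono) auto
    then show ?thesis using Suc by simp
  qed (simp add: assms)
  then show ?case by (auto simp: gsmult_def mult.assoc intro!: sum.neutral)
qed simp

lemma gpow_even: "u \<in> Grass_even n \<Longrightarrow> gpow u j \<in> Grass_even n"
  by (induction j) (auto intro: gmult_even)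

text \<open>The geometric series terminates, since an element without constant term is nilpotent.\<close>

lemma Grass_even_inverse_exists:
  fixes a :: "'k::real_normed_field gr"
  assumes a: "a \<in> Grass_even n" and a0: "a {} \<noteq> 0"
  shows "\<exists>b\<in>Grass_even n. gmult a b = gconst 1"
proof -
  \<comment> \<open>Chosen such that a = a_0 (1 - u), where a_0 is the constant term of a; u is even
    and has no constant term.\<close>
  define u where "u = (\<lambda>I. if I = {} then 0 else - a I / a {})"
  have u: "u \<in> Grass_even n" "u {} = 0"
    using a by (auto simp: u_def Grass_even_def Grass_eq gsupported_def)
  define S where "S j = (\<lambda>I. \<Sum>i\<le>j. gpow u i I)" for j
  have S: "S j \<in> Grass_even n" for j
    using gpow_even[OF u(1)] by (auto simp: S_def Grass_even_def Grass_eq gsupported_def)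
  \<comment> \<open>Telescoping: (1 - u)(1 + u + ... + u^j) = 1 - u^(j+1).\<close>
  have uS: "gmult (\<lambda>I. gconst 1 I - u I) (S j) = (\<lambda>I. gconst 1 I - gpow u (Suc j) I)" for j
  proof (induction j)
    case 0
    have "S 0 = gconst 1" by (simp add: S_def)
    then show ?case
      using u(1) by (simp add: gsmult_diff_left[OF vector_space_mult] Grass_even_gsupported gmult_one_right)
  next
    case (Suc j)
    have "S (Suc j) = (\<lambda>I. S j I + gpow u (Suc j) I)" by (simp add: S_def)
    moreover have "gmult (gconst 1) (gpow u (Suc j)) = gpow u (Suc j)"
      using Grass_even_gsupported[OF gpow_even[OF u(1)]] by (rule gmult_one)
    moreover have "gmult (\<lambda>I. gconst 1 I - u I) (gpow u (Suc j)) =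
        (\<lambda>K. gpow u (Suc j) K - gpow u (Suc (Suc j)) K)"
      by (simp add: gsmult_diff_left[OF vector_space_mult] calculation(2)[simplified])
    ultimately show ?case
      by (simp only: gsmult_add_right[OF vector_space_mult] Suc) (simp del: gpow.simps)
  qed
  \<comment> \<open>Only n generators are available, so n + 1 factors give 0.\<close>
  have "gpow u (Suc n) = (\<lambda>_. 0)"
  proof
    fix K
    show "gpow u (Suc n) K = 0"
    proof (cases "K \<subseteq> {..<n}")
      case True
      then have "finite K" "card K \<le> n" using finite_subset card_mono[OF finite_lessThan] by fastforce+
      then show ?thesis by (intro gpow_nilpotent u) auto
    next
      case False
      then show ?thesis using Grass_even_gsupported[OF gpow_even[OF u(1)]] by (rule gsupportedD[rotated])
    qed
  qed
  then have 1: "gmult (\<lambda>I. gconst 1 I - u I) (S n) = gconst 1" using uS[of n] by simp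
  have a_eq: "a = (\<lambda>I. a {} * (gconst 1 I - u I))" using a0 by (auto simp: u_def gconst_def)
  have "gmult a (\<lambda>I. inverse (a {}) * S n I) = gconst 1"
    unfolding gsmult_scale_right[OF vector_space_mult]
    by (subst a_eq, unfold gsmult_scale_left[OF vector_space_mult] 1) (use a0 in \<open>auto simp: fun_eq_iff\<close>)
  then show ?thesis using Grass_even_scale[OF S] by blast
qed

text \<open>Taking the constant term is multiplicative, so that of a unit is non-zero; the converse
  is the geometric series.\<close>

lemma Grass_units_iff: "a \<in> Grass_units n \<longleftrightarrow> a \<in> Grass_even n \<and> a {} \<noteq> 0"
proof -
  have "a {} \<noteq> 0" if "gmult a b = gconst 1" for b
    using fun_cong[OF that, of "{}"] by auto
  then show ?thesis using Grass_even_inverse_exists by (auto simp: Grass_units_def)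
qed

lemma Grass_units_eq: "Grass_units n = dpts sfield (- {0}) n"
  by (auto simp: Grass_units_iff dpts_def spts_sfield)

text \<open>If c is another inverse, then c = (a b) c = b (a c) = b, where b moves past a because it
  is even. This is how the definite description in \<open>ginv\<close> gets evaluated.\<close>

lemma ginv_unique:
  assumes "b \<in> Grass_even n" "gmult a b = gconst 1"
  shows "ginv n a = b"
  unfolding ginv_def
proof (rule the_equality)
  fix c assume c: "c \<in> Grass_even n \<and> gmult a c = gconst 1"
  have "c = gmult (gmult a b) c"
    using c assms(2) gmult_one[OF Grass_even_gsupported, of c n] by simp
  also have "\<dots> = gmult b (gmult a c)"
    using Grass_even_commute[OF assms(1), of a] by (simp add: gmult_assoc flip: gmult_assoc[of b])
  also have "\<dots> = b" using c gmult_one_right[OF Grass_even_gsupported[OF assms(1)]] by simp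
  finally show "c = b" .
qed (use assms in simp)

lemma
  assumes "a \<in> Grass_units n"
  shows ginv_even: "ginv n a \<in> Grass_even n" and gmult_ginv: "gmult a (ginv n a) = gconst 1"
    and ginv_gmult: "gmult (ginv n a) a = gconst 1" and ginv_units: "ginv n a \<in> Grass_units n"
proof -
  obtain b where b: "b \<in> Grass_even n" "gmult a b = gconst 1" using assms by (auto simp: Grass_units_def)
  then show 1: "ginv n a \<in> Grass_even n" "gmult a (ginv n a) = gconst 1"
    using ginv_unique by auto
  then show 2: "gmult (ginv n a) a = gconst 1" by (simp add: Grass_even_commute)
  then show "ginv n a \<in> Grass_units n"
    using 1 assms by (auto simp: Grass_units_def)
qed

lemma Grass_units_even: "a \<in> Grass_units n \<Longrightarrow> a \<in> Grass_even n"
  by (simp add: Grass_units_def)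

lemma Grass_units_gmult: "a \<in> Grass_units n \<Longrightarrow> b \<in> Grass_units n \<Longrightarrow> gmult a b \<in> Grass_units n"
  by (simp add: Grass_units_iff gmult_even)

lemma one_units [simp]: "gconst 1 \<in> Grass_units n"
  by (simp add: Grass_units_iff)

lemma ginv_ginv: "a \<in> Grass_units n \<Longrightarrow> ginv n (ginv n a) = a"
  by (intro ginv_unique Grass_units_even ginv_gmult)

lemma ginv_gmult_distrib:
  assumes "a \<in> Grass_units n" "b \<in> Grass_units n"
  shows "ginv n (gmult a b) = gmult (ginv n a) (ginv n b)"
proof (rule ginv_unique)
  have "gmult (gmult a b) (gmult (ginv n a) (ginv n b)) = gmult (gmult a (ginv n a)) (gmult b (ginv n b))"
    using Grass_even_commute[OF ginv_even[OF assms(1)], of b]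
    by (simp add: gmult_assoc) (simp add: gmult_assoc[symmetric])
  then show "gmult (gmult a b) (gmult (ginv n a) (ginv n b)) = gconst 1"
    by (simp add: gmult_ginv assms)
qed (intro gmult_even ginv_even assms)

lemma ginv_one [simp]: "ginv n (gconst 1) = gconst 1"
  by (rule ginv_unique) simp_all

section \<open>Homomorphisms of Grassmann algebras\<close>

lemma gtheta_gsupported: "I \<subseteq> {..<m} \<Longrightarrow> gtheta I \<in> gsupported m"
  by (auto simp: gtheta_def gsupported_def)

lemma gtheta_expansion: "a \<in> gsupported m \<Longrightarrow> a = (\<lambda>J. \<Sum>I\<in>Pow {..<m}. a I * gtheta I J)"
  by (rule ext) (auto simp: gtheta_def gsupported_def if_distrib cong: if_cong)

context
  fixes m n :: nat and \<rho> :: "'k::{real_normed_field, euclidean_space} gr \<Rightarrow> 'k gr"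
  assumes \<rho>: "Grass_hom m n \<rho>"
begin

lemma Grass_hom_even: "a \<in> Grass_even m \<Longrightarrow> \<rho> a \<in> Grass_even n"
  and Grass_hom_odd: "a \<in> Grass_odd m \<Longrightarrow> \<rho> a \<in> Grass_odd n"
  and Grass_hom_add: "a \<in> gsupported m \<Longrightarrow> b \<in> gsupported m \<Longrightarrow> \<rho> (\<lambda>I. a I + b I) = (\<lambda>I. \<rho> a I + \<rho> b I)"
  and Grass_hom_mult: "a \<in> gsupported m \<Longrightarrow> b \<in> gsupported m \<Longrightarrow> \<rho> (gmult a b) = gmult (\<rho> a) (\<rho> b)"
  and Grass_hom_gconst: "\<rho> (gconst c) = gconst c"
  using \<rho> by (auto simp: Grass_hom_def Grass_eq image_subset_iff)

text \<open>\<open>Grass_hom\<close> controls \<rho> on even and on odd elements separately; a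
  general element is the sum of its even and its odd part, and \<rho> is additive.\<close>

lemma Grass_hom_gsupported:
  assumes "a \<in> gsupported m"
  shows "\<rho> a \<in> gsupported n"
proof -
  let ?e = "\<lambda>I. if even (card I) then a I else 0" and ?o = "\<lambda>I. if odd (card I) then a I else 0"
  have eo: "?e \<in> Grass_even m" "?o \<in> Grass_odd m"
    using assms by (auto simp: Grass_even_def Grass_odd_def Grass_eq gsupported_def)
  have "a = (\<lambda>I. ?e I + ?o I)" by auto
  then have "\<rho> a = (\<lambda>I. \<rho> ?e I + \<rho> ?o I)"
    using Grass_hom_add[of ?e ?o] eo by (simp add: Grass_even_def Grass_odd_def Grass_eq)
  then show ?thesis using Grass_hom_even[OF eo(1)] Grass_hom_odd[OF eo(2)]
    by (auto simp: Grass_even_def Grass_odd_def Grass_eq gsupported_def)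
qed

text \<open>Homogeneity comes from multiplicativity, since \<rho> fixes the constants.\<close>

lemma Grass_hom_scale:
  assumes "a \<in> gsupported m"
  shows "\<rho> (\<lambda>I. c * a I) = (\<lambda>I. c * \<rho> a I)"
  using Grass_hom_mult[of "gconst c" a] assms
  by (simp add: gmult_gconst[OF assms] gmult_gconst[OF Grass_hom_gsupported[OF assms]] Grass_hom_gconst)

lemma Grass_hom_sum:
  assumes "finite S" "\<And>i. i \<in> S \<Longrightarrow> a i \<in> gsupported m"
  shows "\<rho> (\<lambda>I. \<Sum>i\<in>S. a i I) = (\<lambda>I. \<Sum>i\<in>S. \<rho> (a i) I)"
  using assms
proof (induction S rule: finite_induct)
  case empty
  show ?case using Grass_hom_gconst[of 0] by (simp add: gconst_def)
next
  case (insert i S)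
  have "(\<lambda>I. \<Sum>i\<in>S. a i I) \<in> gsupported m" using insert.prems by (auto simp: gsupported_def)
  then show ?case using insert Grass_hom_add[of "a i" "\<lambda>I. \<Sum>i\<in>S. a i I"] by simp
qed

text \<open>Being linear over the ground field, \<rho> is determined by its values on the basis
  \<theta>_I. The lemma reconciles two ways of moving scalars along \<rho>: directly, and as
  coefficients in a superspace.\<close>

lemma Grass_hom_gpush:
  assumes "a \<in> gsupported m"
  shows "gpush (*) m \<rho> a = \<rho> a"
proof -
  have "\<rho> a = \<rho> (\<lambda>J. \<Sum>I\<in>Pow {..<m}. a I * gtheta I J)"
    using gtheta_expansion[OF assms] by simp
  also have "\<dots> = (\<lambda>J. \<Sum>I\<in>Pow {..<m}. \<rho> (\<lambda>J. a I * gtheta I J) J)"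
    by (rule Grass_hom_sum) (auto simp: gsupported_def gtheta_def)
  also have "\<dots> = gpush (*) m \<rho> a"
    by (auto simp: gpush_def Grass_hom_scale gtheta_gsupported mult.commute)
  finally show ?thesis ..
qed

lemma Grass_hom_units: "a \<in> Grass_units m \<Longrightarrow> \<rho> a \<in> Grass_units n"
  and Grass_hom_ginv: "a \<in> Grass_units m \<Longrightarrow> \<rho> (ginv m a) = ginv n (\<rho> a)"
proof -
  assume a: "a \<in> Grass_units m"
  have 1: "gmult (\<rho> a) (\<rho> (ginv m a)) = gconst 1"
    using Grass_hom_mult[of a "ginv m a"] a gmult_ginv[OF a] Grass_hom_gconst[of 1]
    by (simp add: Grass_even_gsupported Grass_units_even ginv_even)
  then show "\<rho> a \<in> Grass_units n"
    unfolding Grass_units_def[of n]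
    using Grass_hom_even[OF ginv_even[OF a]] Grass_hom_even[OF Grass_units_even[OF a]] by blast
  show "\<rho> (ginv m a) = ginv n (\<rho> a)"
    by (rule ginv_unique[OF Grass_hom_even[OF ginv_even[OF a]] 1, symmetric])
qed

text \<open>If the constant term of \<open>\<rho> a\<close> were different from that of \<open>a\<close>, subtracting it would turn a
  unit into a non-unit.\<close>

lemma Grass_hom_body_even:
  assumes "a \<in> Grass_even m"
  shows "\<rho> a {} = a {}"
proof (rule ccontr)
  assume ne: "\<rho> a {} \<noteq> a {}"
  let ?c = "\<rho> a {}" and ?b = "\<lambda>I. a I + gconst (- \<rho> a {}) I"
  have "?b \<in> Grass_units m" using ne assms by (simp add: Grass_units_iff Grass_even_add)
  then have "\<rho> ?b \<in> Grass_units n" by (rule Grass_hom_units)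
  moreover have "\<rho> ?b {} = 0"
    by (simp add: Grass_hom_add Grass_even_gsupported assms Grass_hom_gconst)
  ultimately show False by (simp add: Grass_units_iff)
qed

text \<open>Odd elements have odd images, which lack a constant term, and even elements keep their
  constant term.\<close>

lemma Grass_hom_gtheta_body:
  assumes "I \<subseteq> {..<m}"
  shows "\<rho> (gtheta I) {} = (if I = {} then 1 else 0)"
proof (cases "even (card I)")
  case True
  then have "gtheta I \<in> Grass_even m"
    using assms by (auto simp: Grass_even_def Grass_eq gtheta_gsupported) (auto simp: gtheta_def)
  then show ?thesis by (subst Grass_hom_body_even) (auto simp: gtheta_def)
next
  case False
  then have "gtheta I \<in> Grass_odd m"
    using assms by (auto simp: Grass_odd_def Grass_eq gtheta_gsupported) (auto simp: gtheta_def)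
  then have "\<rho> (gtheta I) \<in> Grass_odd n" by (rule Grass_hom_odd)
  then have "\<rho> (gtheta I) {} = 0" by (simp add: Grass_odd_def)
  then show ?thesis using False by auto
qed

lemma gpush_gsupported:
  assumes "vector_space sc"
  shows "gpush sc m \<rho> x \<in> gsupported n"
proof -
  have "\<rho> (gtheta I) \<in> gsupported n" if "I \<subseteq> {..<m}" for I
    using that by (intro Grass_hom_gsupported gtheta_gsupported)
  then show ?thesis
    by (auto simp: gsupported_def gpush_def module.scale_zero_left[OF vector_space_module[OF assms]])
qed

lemma gpush_body:
  assumes "vector_space sc"
  shows "gpush sc m \<rho> x {} = x {}"
proof -
  have "gpush sc m \<rho> x {} = (\<Sum>I\<in>Pow {..<m}. if I = {} then x {} else 0)"
    unfolding gpush_def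
    by (intro sum.cong refl) (auto simp: Grass_hom_gtheta_body module.scale_one[OF vector_space_module[OF assms]] module.scale_zero_left[OF vector_space_module[OF assms]])
  then show ?thesis by simp
qed

text \<open>\<rho> preserves parity, so the coefficient of \<theta>_J in \<rho>(\<theta>_I) vanishes
  unless \<open>card I\<close> and \<open>card J\<close> have the same parity.\<close>

lemma gpush_spts:
  assumes "vector_superspace V" "x \<in> spts V m"
  shows "gpush (scl V) m \<rho> x \<in> spts V n"
  unfolding spts_iff
proof (intro conjI allI impI gpush_gsupported vector_superspaceD assms)
  fix J assume "J \<subseteq> {..<n}"
  show "gpush (scl V) m \<rho> x J \<in> spart V J" unfolding gpush_def
  proof (intro spart_sum assms)
    fix I assume I: "I \<in> Pow {..<m}"
    show "scl V (\<rho> (gtheta I) J) (x I) \<in> spart V J"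
    proof (cases "even (card I) = even (card J)")
      case True
      then show ?thesis using spart_cong[of I J V] assms(2) I
        by (auto simp: spts_iff intro!: spart_scale assms)
    next
      case False
      have "\<rho> (gtheta I) J = 0"
      proof (cases "even (card I)")
        case True
        then have "gtheta I \<in> Grass_even m"
          using I by (auto simp: Grass_even_def Grass_eq gtheta_gsupported) (auto simp: gtheta_def)
        then show ?thesis using Grass_hom_even[of "gtheta I"] False True by (auto simp: Grass_even_def)
      next
        case odd: False
        then have "gtheta I \<in> Grass_odd m"
          using I by (auto simp: Grass_odd_def Grass_eq gtheta_gsupported) (auto simp: gtheta_def)
        then show ?thesis using Grass_hom_odd[of "gtheta I"] False odd by (auto simp: Grass_odd_def)
      qed
      then show ?thesis by (simp add: module.scale_zero_left[OF vector_space_module[OF vector_superspaceD(1)]] assms)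
    qed
  qed
qed

lemma gpush_dpts: "vector_superspace V \<Longrightarrow> x \<in> dpts V D m \<Longrightarrow> gpush (scl V) m \<rho> x \<in> dpts V D n"
  by (auto simp: dpts_def gpush_body vector_superspaceD intro: gpush_spts)

text \<open>Expanding x in the basis \<theta>_L reduces the claim to \<rho>(a \<theta>_L) =
  \<rho>(a) \<rho>(\<theta>_L). Generators always stand to the left of the vectors, so the parity of
  the vectors causes no sign.\<close>

lemma gpush_gsmult:
  assumes sc: "vector_space sc" and a: "a \<in> gsupported m" and x: "x \<in> gsupported m"
  shows "gpush sc m \<rho> (gsmult sc a x) = gsmult sc (\<rho> a) (gpush sc m \<rho> x)"
proof
  fix J
  interpret vector_space sc by (rule sc)
  let ?P = "Pow {..<m}"
  show "gpush sc m \<rho> (gsmult sc a x) J = gsmult sc (\<rho> a) (gpush sc m \<rho> x) J"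
  proof (cases "finite J")
    case True
    \<comment> \<open>Multiplication by a single \<theta>_L from the right shifts coefficients: at
      \<open>K\<close> the only term that survives is the one with \<open>I = K - L\<close>.\<close>
    have th: "gmult a (gtheta L) K = (if L \<subseteq> K then gsgn (K - L) L * a (K - L) else 0)"
      if "finite K" for K L
    proof -
      have "gmult a (gtheta L) K = (\<Sum>I\<in>Pow K. if I = K - L \<and> L \<subseteq> K then gsgn (K - L) L * a (K - L) else 0)"
        unfolding gsmult_def gtheta_def
      proof (intro sum.cong refl)
        fix I assume "I \<in> Pow K"
        then have *: "K - I = L \<longleftrightarrow> I = K - L \<and> L \<subseteq> K" by blast
        have "L \<subseteq> K \<Longrightarrow> K - (K - L) = L" by blast
        then show "gsgn I (K - I) * a I * (if K - I = L then 1 else 0) =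
            (if I = K - L \<and> L \<subseteq> K then gsgn (K - L) L * a (K - L) else 0)"
          unfolding * by (cases "I = K - L \<and> L \<subseteq> K") auto
      qed
      also have "\<dots> = (if L \<subseteq> K then gsgn (K - L) L * a (K - L) else 0)"
        using that by (cases "L \<subseteq> K") simp_all
      finally show ?thesis .
    qed
    have "gsmult sc (\<rho> a) (gpush sc m \<rho> x) J =
        (\<Sum>A\<in>Pow J. \<Sum>L\<in>?P. sc (gsgn A (J - A) * \<rho> a A * \<rho> (gtheta L) (J - A)) (x L))"
      by (simp add: gsmult_def gpush_def scale_sum_right)
    also have "\<dots> = (\<Sum>L\<in>?P. sc (gmult (\<rho> a) (\<rho> (gtheta L)) J) (x L))"
      by (subst sum.swap) (simp add: gsmult_def scale_sum_left)
    also have "\<dots> = (\<Sum>L\<in>?P. sc (\<rho> (gmult a (gtheta L)) J) (x L))"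
      by (intro sum.cong refl) (simp add: Grass_hom_mult a gtheta_gsupported)
    also have "\<dots> = (\<Sum>L\<in>?P. sc (\<Sum>K\<in>?P. \<rho> (gtheta K) J * gmult a (gtheta L) K) (x L))"
    proof (intro sum.cong refl)
      fix L assume "L \<in> ?P"
      then have "gmult a (gtheta L) \<in> gsupported m"
        by (intro gsmult_gsupported vector_space_mult a gtheta_gsupported) auto
      then have "\<rho> (gmult a (gtheta L)) J = gpush (*) m \<rho> (gmult a (gtheta L)) J"
        by (simp add: Grass_hom_gpush)
      then show "sc (\<rho> (gmult a (gtheta L)) J) (x L) =
          sc (\<Sum>K\<in>?P. \<rho> (gtheta K) J * gmult a (gtheta L) K) (x L)"
        by (simp add: gpush_def)
    qed
    also have "\<dots> = (\<Sum>K\<in>?P. \<Sum>L\<in>?P. sc (\<rho> (gtheta K) J) (sc (gmult a (gtheta L) K) (x L)))"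
      by (subst sum.swap) (simp add: scale_sum_left)
    also have "\<dots> = (\<Sum>K\<in>?P. sc (\<rho> (gtheta K) J) (gsmult sc a x K))"
    proof (intro sum.cong refl)
      fix K assume K: "K \<in> ?P"
      then have fK: "finite K" using finite_subset[of K "{..<m}"] by simp
      have "(\<Sum>L\<in>?P. sc (gmult a (gtheta L) K) (x L)) = (\<Sum>L\<in>Pow K. sc (gsgn (K - L) L * a (K - L)) (x L))"
        using K by (intro sum.mono_neutral_cong_right) (simp_all add: th[OF fK] Pow_mono)
      also have "\<dots> = gsmult sc a x K" unfolding gsmult_def
      proof (rule sum.reindex_bij_witness[where i = "\<lambda>I. K - I" and j = "\<lambda>I. K - I"])
        fix L assume "L \<in> Pow K"
        then have "K - (K - L) = L" by blast
        then show "sc (gsgn (K - L) (K - (K - L)) * a (K - L)) (x (K - (K - L))) =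
            sc (gsgn (K - L) L * a (K - L)) (x L)" by simp
      qed blast+
      finally show "(\<Sum>L\<in>?P. sc (\<rho> (gtheta K) J) (sc (gmult a (gtheta L) K) (x L))) =
          sc (\<rho> (gtheta K) J) (gsmult sc a x K)"
        by (simp only: scale_sum_right[symmetric])
    qed
    finally show ?thesis by (simp add: gpush_def)
  next
    case False
    then show ?thesis using gsupported_infinite[OF gpush_gsupported[OF sc]] by simp
  qed
qed

end

lemma gpush_linear:
  assumes "Vector_Spaces.linear sc sc' f"
  shows "gpush sc' m \<rho> (\<lambda>I. f (x I)) = (\<lambda>J. f (gpush sc m \<rho> x J))"
proof -
  interpret Vector_Spaces.linear sc sc' f by (rule assms)
  show ?thesis unfolding gpush_def by (simp only: sum scale)
qed

lemma gpush_add: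
  assumes "vector_space sc"
  shows "gpush sc m \<rho> (\<lambda>I. x I + y I) = (\<lambda>J. gpush sc m \<rho> x J + gpush sc m \<rho> y J)"
  by (simp add: gpush_def module.scale_right_distrib[OF vector_space_module[OF assms]] sum.distrib)

lemma gpush_gconst:
  fixes \<rho> :: "'k::{real_normed_field, euclidean_space} gr \<Rightarrow> 'k gr"
  assumes "Grass_hom m n \<rho>" "vector_space sc"
  shows "gpush sc m \<rho> (gconst v) = gconst v"
proof
  fix J
  have 1: "gtheta {} = gconst (1::'k)" by (auto simp: gtheta_def gconst_def)
  have "gpush sc m \<rho> (gconst v) J = (\<Sum>I\<in>Pow {..<m}. if I = {} then sc (\<rho> (gtheta {}) J) v else 0)"
    unfolding gpush_def
    by (intro sum.cong refl) (auto simp: gconst_def module.scale_zero_right[OF vector_space_module[OF assms(2)]])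
  then show "gpush sc m \<rho> (gconst v) J = gconst v J"
    by (simp add: 1 Grass_hom_gconst[OF assms(1)])
      (simp add: gconst_def module.scale_one[OF vector_space_module[OF assms(2)]] module.scale_zero_left[OF vector_space_module[OF assms(2)]])
qed

lemma gpush_id:
  assumes "\<And>a. a \<in> Grass m \<Longrightarrow> \<rho> a = a" "vector_space sc" "x \<in> gsupported m"
  shows "gpush sc m \<rho> x = x"
proof
  fix J
  have "\<rho> (gtheta I) = gtheta I" if "I \<subseteq> {..<m}" for I
    using that by (simp add: assms(1) Grass_eq gtheta_gsupported)
  then have "gpush sc m \<rho> x J = (\<Sum>I\<in>Pow {..<m}. if I = J then x J else 0)"
    unfolding gpush_def
    by (intro sum.cong refl)
      (auto simp: gtheta_def
        module.scale_one[OF vector_space_module[OF assms(2)]] module.scale_zero_left[OF vector_space_module[OF assms(2)]])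
  then show "gpush sc m \<rho> x J = x J"
    using gsupportedD[OF assms(3)] by auto
qed

text \<open>Coefficients in the superspace are carried along unchanged; what has to be compared are
  the coefficients of \<tau>(\<theta>_I), and these come from expanding \<rho>(\<theta>_I) in the
  basis of \<Lambda>_m.\<close>

lemma gpush_comp:
  fixes \<sigma> :: "'k::{real_normed_field, euclidean_space} gr \<Rightarrow> 'k gr"
  assumes "Grass_hom l m \<rho>" "Grass_hom m n \<sigma>" "Grass_hom l n \<tau>"
    "\<And>a. a \<in> Grass l \<Longrightarrow> \<tau> a = \<sigma> (\<rho> a)" "vector_space sc"
  shows "gpush sc l \<tau> x = gpush sc m \<sigma> (gpush sc l \<rho> x)"
proof
  fix J
  interpret vector_space sc by (rule assms)
  have *: "\<tau> (gtheta I) J = (\<Sum>K\<in>Pow {..<m}. \<sigma> (gtheta K) J * \<rho> (gtheta I) K)" if "I \<subseteq> {..<l}" for I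
  proof -
    have "\<tau> (gtheta I) = gpush (*) m \<sigma> (\<rho> (gtheta I))"
      using that by (simp add: assms(4) Grass_eq gtheta_gsupported Grass_hom_gpush[OF assms(2)] Grass_hom_gsupported[OF assms(1)])
    then show ?thesis by (simp add: gpush_def)
  qed
  show "gpush sc l \<tau> x J = gpush sc m \<sigma> (gpush sc l \<rho> x) J"
    unfolding gpush_def
    by (simp add: * scale_sum_left scale_sum_right) (rule sum.swap)
qed

text \<open>Constants belong to every Grassmann algebra, so the augmentation is a homomorphism into
  any of them; with target \<Lambda>_0 it yields underlying ordinary points.\<close>

lemma gaug_hom: "Grass_hom m n gaug"
  unfolding Grass_hom_def
proof (intro conjI ballI allI)
  show "gaug ` Grass_even m \<subseteq> Grass_even n" by (auto simp: gaug_def)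
  show "gaug ` Grass_odd m \<subseteq> Grass_odd n"
    by (auto simp: gaug_def Grass_odd_def Grass_eq gconst_def gsupported_def)
  fix a b :: "'k::real_normed_field gr"
  show "gaug (\<lambda>I. a I + b I) = (\<lambda>I. gaug a I + gaug b I)" by (auto simp: gaug_def gconst_def)
  have "gmult (gconst (a {})) (gconst (b {})) = gconst (a {} * b {})"
    by (subst gmult_gconst[OF gconst_gsupported[of _ 0]]) (auto simp: gconst_def)
  then show "gaug (gmult a b) = gmult (gaug a) (gaug b)" by (simp add: gaug_def)
qed (auto simp: gaug_def)

lemma gpush_gaug:
  assumes "vector_space sc"
  shows "gpush sc m gaug x = gconst (x {})"
proof
  fix J
  have "gpush sc m gaug x J = (\<Sum>I\<in>Pow {..<m}. if I = {} then gconst (x {}) J else 0)"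
    unfolding gpush_def
    by (intro sum.cong refl)
      (auto simp: gaug_def gconst_def gtheta_def module.scale_one[OF vector_space_module[OF assms]] module.scale_zero_left[OF vector_space_module[OF assms]])
  then show "gpush sc m gaug x J = gconst (x {}) J" by simp
qed

text \<open>\<Lambda>_0 has no generators, so only the empty index set remains.\<close>

lemma spts_0:
  assumes "x \<in> gsupported 0"
  shows "x = gconst (x {})"
  using gsupportedD[OF assms] by (auto simp: gconst_def)

section \<open>Differentiation along curves\<close>

text \<open>The velocity at time 0 of a curve of coefficient families. In contrast to
  \<open>has_dir_deriv\<close> the curve need not be the image of a straight line, which is the form
  in which derivatives can be composed.\<close>

definition gderiv :: "(real \<Rightarrow> 'v::real_normed_vector gr) \<Rightarrow> 'v gr \<Rightarrow> bool" where
  "gderiv \<gamma> d \<longleftrightarrow> (\<forall>I. ((\<lambda>t. \<gamma> t I) has_vector_derivative d I) (at 0))"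

lemma has_dir_deriv_gderiv: "has_dir_deriv f x h d \<longleftrightarrow> gderiv (\<lambda>t. f (\<lambda>J. x J + t *\<^sub>R h J)) d"
  by (simp add: has_dir_deriv_def gderiv_def)

lemma gderivD: "gderiv \<gamma> d \<Longrightarrow> ((\<lambda>t. \<gamma> t I) has_vector_derivative d I) (at 0)"
  by (simp add: gderiv_def)

lemma gderiv_unique: "gderiv \<gamma> d \<Longrightarrow> gderiv \<gamma> d' \<Longrightarrow> d = d'"
  by (rule ext) (metis gderivD vector_derivative_unique_at)

lemma gderiv_cong:
  assumes "eventually (\<lambda>t. \<gamma> t = \<delta> t) (nhds 0)" "gderiv \<gamma> d"
  shows "gderiv \<delta> d"
  unfolding gderiv_def
proof
  fix I
  have "eventually (\<lambda>t. t \<in> UNIV \<longrightarrow> \<gamma> t I = \<delta> t I) (nhds 0)"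
    using assms(1) by (rule eventually_mono) simp
  moreover have "\<gamma> 0 I = \<delta> 0 I" using eventually_nhds_x_imp_x[OF assms(1)] by simp
  ultimately show "((\<lambda>t. \<delta> t I) has_vector_derivative d I) (at 0)"
    using has_vector_derivative_cong_ev[of UNIV "\<lambda>t. \<gamma> t I" "\<lambda>t. \<delta> t I" 0 "d I"] gderivD[OF assms(2), of I]
    by simp
qed

lemma gderiv_const: "gderiv (\<lambda>t. x) (\<lambda>I. 0)"
  by (simp add: gderiv_def)

lemma gderiv_line: "gderiv (\<lambda>t J. x J + t *\<^sub>R h J) h"
  unfolding gderiv_def
proof
  fix I
  have "((\<lambda>t. t *\<^sub>R h I) has_vector_derivative 1 *\<^sub>R h I) (at 0)"
    by (rule bounded_linear.has_vector_derivative[OF bounded_linear_scaleR_left]) (rule has_vector_derivative_id)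
  from has_vector_derivative_add[OF has_vector_derivative_const[of "x I"] this]
  show "((\<lambda>t. x I + t *\<^sub>R h I) has_vector_derivative h I) (at 0)" by simp
qed

lemma gderiv_tendsto: "gderiv \<gamma> d \<Longrightarrow> ((\<lambda>t. \<gamma> t I) \<longlongrightarrow> \<gamma> 0 I) (nhds 0)"
  using has_vector_derivative_continuous[OF gderivD] by (metis isCont_def tendsto_at_iff_tendsto_nhds)

text \<open>A basic open set of the product topology constrains finitely many coefficients, so
  convergence of each single coefficient is enough.\<close>

lemma eventually_open_gr:
  fixes A :: "'v::topological_space gr set"
  assumes "open A" "x \<in> A" "\<And>I. ((\<lambda>t. p t I) \<longlongrightarrow> x I) F"
  shows "eventually (\<lambda>t. p t \<in> A) F"
proof -
  obtain X where X: "x \<in> Pi\<^sub>E UNIV X" "\<And>i. open (X i)" "finite {i. X i \<noteq> UNIV}" "Pi\<^sub>E UNIV X \<subseteq> A"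
    using product_topology_open_contains_basis[of "\<lambda>_. euclidean" UNIV A x] assms(1,2)
    by (auto simp: open_fun_def)
  have "eventually (\<lambda>t. \<forall>i\<in>{i. X i \<noteq> UNIV}. p t i \<in> X i) F"
    using X by (intro eventually_ball_finite ballI topological_tendstoD[OF assms(3)]) auto
  then show ?thesis
  proof (rule eventually_mono)
    fix t assume "\<forall>i\<in>{i. X i \<noteq> UNIV}. p t i \<in> X i"
    then have "p t \<in> Pi\<^sub>E UNIV X" by (auto simp: PiE_def extensional_def)
    then show "p t \<in> A" using X(4) by blast
  qed
qed

definition gsubspace :: "'v::real_vector gr set \<Rightarrow> bool" where
  "gsubspace E \<longleftrightarrow> (\<forall>x\<in>E. \<forall>y\<in>E. (\<lambda>I. x I + y I) \<in> E) \<and> (\<forall>x\<in>E. \<forall>r. (\<lambda>I. r *\<^sub>R x I) \<in> E)"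

lemma gsubspace_line: "gsubspace E \<Longrightarrow> x \<in> E \<Longrightarrow> h \<in> E \<Longrightarrow> (\<lambda>I. x I + r *\<^sub>R h I) \<in> E"
  by (simp add: gsubspace_def)

lemma gsubspace_spts: "vector_superspace V \<Longrightarrow> gsubspace (spts V n)"
  by (simp add: gsubspace_def spts_add spts_scaleR)

lemma eventually_line:
  fixes E :: "'v::real_normed_vector gr set"
  assumes "gsubspace E" "openin (top_of_set E) U" "x \<in> U" "h \<in> E"
  shows "eventually (\<lambda>t. (\<lambda>J. x J + t *\<^sub>R h J) \<in> U) (nhds 0)"
proof -
  obtain T where T: "open T" "U = E \<inter> T" using assms(2) by (auto simp: openin_open)
  have "eventually (\<lambda>t. (\<lambda>J. x J + t *\<^sub>R h J) \<in> T) (nhds 0)"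
    using T assms(3) gderiv_tendsto[OF gderiv_line[of x h]] by (intro eventually_open_gr[of T x]) auto
  then show ?thesis
    by (rule eventually_mono) (use T assms in \<open>auto intro: gsubspace_line\<close>)
qed

section \<open>The chain rule\<close>

text \<open>Moving the argument by \<open>c t\<close> in the direction \<open>e\<close> contributes \<open>c'\<close> times the derivative in the
  direction \<open>e\<close>: by continuity of the latter the mean value estimate is uniform in the base point.\<close>

lemma gderiv_line_step:
  fixes g :: "'v::real_normed_vector gr \<Rightarrow> 'w::real_normed_vector gr"
  assumes E: "gsubspace E" and U: "openin (top_of_set E) U" and e: "e \<in> E"
    and D: "\<And>x. x \<in> U \<Longrightarrow> has_dir_deriv g x e (D x)" and contD: "continuous_on U D"
    and p: "\<And>t. p t \<in> E" "p 0 \<in> U" "\<And>I. ((\<lambda>t. p t I) \<longlongrightarrow> p 0 I) (nhds 0)"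
    and c: "(c has_real_derivative c') (at 0)" "c 0 = 0"
    and g: "gderiv (\<lambda>t. g (p t)) d"
  shows "gderiv (\<lambda>t. g (\<lambda>J. p t J + c t *\<^sub>R e J)) (\<lambda>I. d I + c' *\<^sub>R D (p 0) I)"
  unfolding gderiv_def
proof
  fix I
  define q where "q t s = (\<lambda>J. p t J + s *\<^sub>R e J)" for t s
  have q0: "q t 0 = p t" for t by (simp add: q_def)
  have qE: "q t s \<in> E" for t s unfolding q_def by (rule gsubspace_line[OF E p(1) e])
  obtain T where T: "open T" "U = E \<inter> T" using U by (auto simp: openin_open)
  \<comment> \<open>Continuity of \<open>D\<close> gives closeness to \<open>D (p 0)\<close> jointly
    in the time t and the shift s. This uniformity is what the mean value estimate needs.\<close>
  have key: "\<exists>\<delta>>0. \<forall>t s. \<bar>t\<bar> < \<delta> \<and> \<bar>s\<bar> < \<delta> \<longrightarrow> q t s \<in> U \<and> norm (D (q t s) I - D (p 0) I) < \<epsilon>"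
    if "\<epsilon> > 0" for \<epsilon>
  proof -
    have "continuous_on U (\<lambda>x. D x I)"
      using contD by (rule continuous_on_product_then_coordinatewise)
    from continuous_on_topological[THEN iffD1, rule_format, OF this p(2) open_ball[of "D (p 0) I" \<epsilon>]]
    obtain A where A: "open A" "p 0 \<in> A" "\<And>x. x \<in> U \<Longrightarrow> x \<in> A \<Longrightarrow> D x I \<in> ball (D (p 0) I) \<epsilon>"
      using \<open>\<epsilon> > 0\<close> by auto
    have A3: "norm (D x I - D (p 0) I) < \<epsilon>" if "x \<in> U" "x \<in> A" for x
      using A(3)[OF that] by (simp add: dist_norm norm_minus_commute)
    have "((\<lambda>z. q (fst z) (snd z) J) \<longlongrightarrow> p 0 J + 0 *\<^sub>R e J) (nhds 0 \<times>\<^sub>F nhds 0)" for J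
      unfolding q_def
      by (intro tendsto_intros filterlim_compose[OF p(3)] filterlim_fst filterlim_snd)
    then have "eventually (\<lambda>z. q (fst z) (snd z) \<in> T \<inter> A) (nhds 0 \<times>\<^sub>F nhds 0)"
      using A T p(2) by (intro eventually_open_gr[of _ "p 0"]) auto
    then obtain P Q where PQ: "eventually P (nhds (0::real))" "eventually Q (nhds (0::real))"
        "\<And>t s. P t \<Longrightarrow> Q s \<Longrightarrow> q t s \<in> T \<inter> A"
      by (auto simp: eventually_prod_filter)
    then obtain \<delta>1 \<delta>2 where "\<delta>1 > 0" "\<And>t. \<bar>t\<bar> < \<delta>1 \<Longrightarrow> P t" "\<delta>2 > 0" "\<And>t. \<bar>t\<bar> < \<delta>2 \<Longrightarrow> Q t"
      by (auto simp: eventually_nhds_metric)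
    then show ?thesis using PQ(3) A3 T(2) qE
      by (intro exI[of _ "min \<delta>1 \<delta>2"]) auto
  qed
  \<comment> \<open>The error of the first-order expansion in the direction \<open>e\<close>, with
    the derivative frozen at the base point \<open>p 0\<close>.\<close>
  define R where "R t = g (q t (c t)) I - g (p t) I - c t *\<^sub>R D (p 0) I" for t
  have R0: "R 0 = 0" by (simp add: R_def c(2) q0)
  \<comment> \<open>Two \<epsilon> come from the mean value theorem, as \<open>D (q t s)\<close> and
    \<open>D (q t 0)\<close> are both \<epsilon>-close to \<open>D (p 0)\<close>; the third comes
    from replacing \<open>D (q t 0)\<close> by \<open>D (p 0)\<close>.\<close>
  have Rbound: "norm (R t) \<le> \<bar>c t\<bar> * (3 * \<epsilon>)"
    if \<delta>: "\<And>s. \<bar>s\<bar> \<le> \<bar>c t\<bar> \<Longrightarrow> q t s \<in> U \<and> norm (D (q t s) I - D (p 0) I) < \<epsilon>" for t \<epsilon>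
  proof -
    let ?S = "closed_segment 0 (c t)"
    have S: "\<bar>s\<bar> \<le> \<bar>c t\<bar>" if "s \<in> ?S" for s
      using that by (auto simp: closed_segment_eq_real_ivl split: if_splits)
    have "norm (g (q t (c t)) I - g (q t 0) I - (c t - 0) *\<^sub>R D (q t 0) I) \<le> norm (c t - 0) * (2 * \<epsilon>)"
    proof (rule vector_differentiable_bound_linearization[where S = ?S and f' = "\<lambda>s. D (q t s) I"])
      fix s assume s: "s \<in> ?S"
      have "has_dir_deriv g (q t s) e (D (q t s))" using \<delta>[OF S[OF s]] by (intro D) simp
      then have "((\<lambda>\<tau>. g (q t (s + \<tau>)) I) has_vector_derivative D (q t s) I) (at (s - s))"
        by (simp add: has_dir_deriv_def q_def scaleR_add_left add.assoc)
      from vector_diff_chain_at[OF has_vector_derivative_diff[OF has_vector_derivative_id has_vector_derivative_const] this]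
      have "((\<lambda>\<tau>. g (q t \<tau>) I) has_vector_derivative D (q t s) I) (at s)" by (simp add: o_def)
      then show "((\<lambda>s. g (q t s) I) has_vector_derivative D (q t s) I) (at s within ?S)"
        by (rule has_vector_derivative_at_within)
      show "norm (D (q t s) I - D (q t 0) I) \<le> 2 * \<epsilon>"
        using \<delta>[OF S[OF s]] \<delta>[of 0] norm_triangle_ineq4[of "D (q t s) I - D (p 0) I" "D (q t 0) I - D (p 0) I"]
        by simp
    qed auto
    moreover have "norm (c t *\<^sub>R (D (q t 0) I - D (p 0) I)) \<le> \<bar>c t\<bar> * \<epsilon>"
      using \<delta>[of 0] by (simp add: mult_left_mono)
    ultimately have "norm ((g (q t (c t)) I - g (q t 0) I - (c t - 0) *\<^sub>R D (q t 0) I) +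
        c t *\<^sub>R (D (q t 0) I - D (p 0) I)) \<le> \<bar>c t\<bar> * (2 * \<epsilon>) + \<bar>c t\<bar> * \<epsilon>"
      by (intro norm_triangle_mono) simp_all
    then show ?thesis by (simp add: R_def q0 algebra_simps)
  qed
  have "(R has_vector_derivative 0) (at 0)"
    unfolding has_vector_derivative_def has_derivative_at_alt
  proof (intro conjI allI impI)
    fix \<epsilon> :: real assume "\<epsilon> > 0"
    \<comment> \<open>Near 0 the bound |c t| \<le> C |t| holds, by differentiability of c with
      relative error 1. The tolerance \<open>\<epsilon> / (3 * C)\<close> is chosen so that 3 C
      cancels.\<close>
    define C where "C = \<bar>c'\<bar> + 1"
    have C: "C > 0" by (simp add: C_def)
    obtain \<delta> where \<delta>: "\<delta> > 0" "\<And>t s. \<bar>t\<bar> < \<delta> \<Longrightarrow> \<bar>s\<bar> < \<delta> \<Longrightarrow> q t s \<in> U \<and> norm (D (q t s) I - D (p 0) I) < \<epsilon> / (3 * C)"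
      using key[of "\<epsilon> / (3 * C)"] \<open>\<epsilon> > 0\<close> C by auto
    obtain \<delta>' where \<delta>': "\<delta>' > 0" "\<And>t. \<bar>t\<bar> < \<delta>' \<Longrightarrow> \<bar>c t - c' * t\<bar> \<le> \<bar>t\<bar>"
    proof -
      have "\<forall>e>0. \<exists>d>0. \<forall>y. norm (y - 0) < d \<longrightarrow> norm (c y - c 0 - c' * (y - 0)) \<le> e * norm (y - 0)"
        using c(1) unfolding has_field_derivative_def has_derivative_at_alt by simp
      from this[rule_format, of 1] show ?thesis using c(2) that by auto
    qed
    have ct: "\<bar>c t\<bar> \<le> C * \<bar>t\<bar>" if "\<bar>t\<bar> < \<delta>'" for t
    proof -
      have "\<bar>c t\<bar> \<le> \<bar>c t - c' * t\<bar> + \<bar>c'\<bar> * \<bar>t\<bar>"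
        using abs_triangle_ineq[of "c t - c' * t" "c' * t"] by (simp add: abs_mult)
      then show ?thesis using \<delta>'(2)[OF that] by (simp add: C_def algebra_simps)
    qed
    show "\<exists>d>0. \<forall>y. norm (y - 0) < d \<longrightarrow> norm (R y - R 0 - (y - 0) *\<^sub>R 0) \<le> \<epsilon> * norm (y - 0)"
    proof (intro exI[of _ "min (min \<delta> \<delta>') (\<delta> / C)"] conjI allI impI)
      fix t :: real assume "norm (t - 0) < min (min \<delta> \<delta>') (\<delta> / C)"
      then have t: "\<bar>t\<bar> < \<delta>" "\<bar>t\<bar> < \<delta>'" "C * \<bar>t\<bar> < \<delta>" using C by (auto simp: field_simps)
      have "\<bar>c t\<bar> < \<delta>" using ct[OF t(2)] t(3) by simp
      then have "norm (R t) \<le> \<bar>c t\<bar> * (3 * (\<epsilon> / (3 * C)))" using \<delta>(2)[OF t(1)] by (intro Rbound) auto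
      also have "\<dots> \<le> (C * \<bar>t\<bar>) * (3 * (\<epsilon> / (3 * C)))"
        using ct[OF t(2)] C \<open>\<epsilon> > 0\<close> by (intro mult_right_mono) auto
      also have "\<dots> = \<epsilon> * \<bar>t\<bar>" using C by simp
      finally show "norm (R t - R 0 - (t - 0) *\<^sub>R 0) \<le> \<epsilon> * norm (t - 0)" by (simp add: R0)
    qed (use \<delta> \<delta>' C in auto)
  qed simp
  moreover have "((\<lambda>t. c t *\<^sub>R D (p 0) I) has_vector_derivative c' *\<^sub>R D (p 0) I) (at 0)"
    using c(1) by (intro bounded_linear.has_vector_derivative[OF bounded_linear_scaleR_left])
      (simp add: has_real_derivative_iff_has_vector_derivative)
  ultimately have "((\<lambda>t. R t + (g (p t) I + c t *\<^sub>R D (p 0) I)) has_vector_derivative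
      0 + (d I + c' *\<^sub>R D (p 0) I)) (at 0)"
    by (intro has_vector_derivative_add gderivD[OF g])
  then show "((\<lambda>t. g (\<lambda>J. p t J + c t *\<^sub>R e J) I) has_vector_derivative d I + c' *\<^sub>R D (p 0) I) (at 0)"
    by (simp add: R_def q_def)
qed

definition gsingle :: "nat set \<Rightarrow> 'v::zero \<Rightarrow> 'v gr" where
  "gsingle I b = (\<lambda>J. if J = I then b else 0)"

text \<open>The type \<open>'v gr\<close> is infinite-dimensional.  A frame of a finite-dimensional subspace consists of
  coordinates each of which depends on a single coefficient.\<close>

definition gframe :: "'v::real_inner gr set \<Rightarrow> (nat set \<times> 'v) set \<Rightarrow> bool" where
  "gframe E B \<longleftrightarrow> gsubspace E \<and> finite B \<and> (\<forall>k\<in>B. gsingle (fst k) (snd k) \<in> E) \<and>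
     (\<forall>x\<in>E. \<forall>J. x J = (\<Sum>k\<in>B. (x (fst k) \<bullet> snd k) *\<^sub>R gsingle (fst k) (snd k) J))"

text \<open>The increment of the curve is split into its finitely many frame coordinates, which are
  switched on one after another; each switch contributes a partial derivative by
  \<open>gderiv_line_step\<close>. Continuity of the partial derivatives thus stands in for total
  differentiability.\<close>

lemma gderiv_chain:
  fixes g :: "'v::real_inner gr \<Rightarrow> 'w::real_normed_vector gr"
  assumes B: "gframe E B" and U: "openin (top_of_set E) U"
    and D: "\<And>k x. k \<in> B \<Longrightarrow> x \<in> U \<Longrightarrow> has_dir_deriv g x (gsingle (fst k) (snd k)) (D k x)"
    and contD: "\<And>k. k \<in> B \<Longrightarrow> continuous_on U (D k)"
    and \<gamma>: "eventually (\<lambda>t. \<gamma> t \<in> E) (nhds 0)" "\<gamma> 0 \<in> U" "gderiv \<gamma> \<gamma>'"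
  shows "gderiv (\<lambda>t. g (\<gamma> t)) (\<lambda>J. \<Sum>k\<in>B. (\<gamma>' (fst k) \<bullet> snd k) *\<^sub>R D k (\<gamma> 0) J)"
proof -
  have E: "gsubspace E" and fin: "finite B" and BE: "\<And>k. k \<in> B \<Longrightarrow> gsingle (fst k) (snd k) \<in> E"
    using B by (auto simp: gframe_def)
  have \<gamma>0: "\<gamma> 0 \<in> E" using \<gamma>(2) U by (auto simp: openin_open)
  define c where "c k t = (\<gamma> t (fst k) - \<gamma> 0 (fst k)) \<bullet> snd k" for k t
  \<comment> \<open>The curve on which only the coordinates in \<open>S\<close> move while the
    others rest at their value at time 0. It may leave \<open>U\<close>, but it stays in the
    subspace \<open>E\<close>.\<close>
  define p where "p S t = (\<lambda>J. \<gamma> 0 J + (\<Sum>k\<in>S. c k t *\<^sub>R gsingle (fst k) (snd k) J))" for S t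
  have c: "(c k has_real_derivative (\<gamma>' (fst k) \<bullet> snd k)) (at 0)" for k
  proof -
    have "((\<lambda>t. \<gamma> t (fst k) - \<gamma> 0 (fst k)) has_vector_derivative \<gamma>' (fst k) - 0) (at 0)"
      by (intro has_vector_derivative_diff gderivD[OF \<gamma>(3)] has_vector_derivative_const)
    from bounded_linear.has_vector_derivative[OF bounded_linear_inner_left this, of "snd k"] show ?thesis
      by (simp add: c_def[abs_def] has_real_derivative_iff_has_vector_derivative)
  qed
  have "gderiv (\<lambda>t. g (p S t)) (\<lambda>J. \<Sum>k\<in>S. (\<gamma>' (fst k) \<bullet> snd k) *\<^sub>R D k (\<gamma> 0) J) \<and> (\<forall>t. p S t \<in> E)"
    if "S \<subseteq> B" for S
    using finite_subset[OF that fin] that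
  proof (induction S rule: finite_induct)
    case empty
    then show ?case using gderiv_const \<gamma>0 by (simp add: p_def)
  next
    case (insert k S)
    have pS: "p (insert k S) t = (\<lambda>J. p S t J + c k t *\<^sub>R gsingle (fst k) (snd k) J)" for t
      using insert.hyps by (auto simp: p_def)
    have p0: "p S 0 = \<gamma> 0" by (simp add: p_def c_def)
    have "((\<lambda>t. c k t) \<longlongrightarrow> c k 0) (nhds 0)" for k
      using DERIV_isCont[OF c] by (metis isCont_def tendsto_at_iff_tendsto_nhds)
    then have "((\<lambda>t. p S t I) \<longlongrightarrow> p S 0 I) (nhds 0)" for I
      unfolding p_def by (intro tendsto_intros)
    then have "gderiv (\<lambda>t. g (\<lambda>J. p S t J + c k t *\<^sub>R gsingle (fst k) (snd k) J))
        (\<lambda>J. (\<Sum>k\<in>S. (\<gamma>' (fst k) \<bullet> snd k) *\<^sub>R D k (\<gamma> 0) J) + (\<gamma>' (fst k) \<bullet> snd k) *\<^sub>R D k (p S 0) J)"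
      using insert \<gamma>(2)
      by (intro gderiv_line_step[OF E U BE D contD] c) (auto simp: p0 c_def)
    moreover have "p (insert k S) t \<in> E" for t
      unfolding pS using insert by (intro gsubspace_line E BE) auto
    ultimately show ?case
      using insert.hyps by (simp add: pS p0 add.commute)
  qed
  from this[of B] have "gderiv (\<lambda>t. g (p B t)) (\<lambda>J. \<Sum>k\<in>B. (\<gamma>' (fst k) \<bullet> snd k) *\<^sub>R D k (\<gamma> 0) J)"
    by simp
  \<comment> \<open>With all coordinates switched on, the original curve is recovered at those times
    at which it lies in \<open>E\<close>, where the frame expansion is valid.\<close>
  moreover have "eventually (\<lambda>t. g (p B t) = g (\<gamma> t)) (nhds 0)"
    using \<gamma>(1)
  proof (rule eventually_mono)
    fix t assume t: "\<gamma> t \<in> E"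
    have exp: "x J = (\<Sum>k\<in>B. (x (fst k) \<bullet> snd k) *\<^sub>R gsingle (fst k) (snd k) J)" if "x \<in> E" for x J
      using B that by (auto simp: gframe_def)
    have "p B t J = \<gamma> t J" for J
    proof -
      have "p B t J = \<gamma> 0 J + ((\<Sum>k\<in>B. (\<gamma> t (fst k) \<bullet> snd k) *\<^sub>R gsingle (fst k) (snd k) J) -
          (\<Sum>k\<in>B. (\<gamma> 0 (fst k) \<bullet> snd k) *\<^sub>R gsingle (fst k) (snd k) J))"
        by (simp add: p_def c_def inner_diff_left scaleR_left_diff_distrib sum_subtractf)
      then show ?thesis by (simp flip: exp[OF t] exp[OF \<gamma>0])
    qed
    then show "g (p B t) = g (\<gamma> t)" by (metis ext)
  qed
  ultimately show ?thesis by (rule gderiv_cong[rotated])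
qed

lemma subspace_spart_real: "vector_superspace V \<Longrightarrow> subspace (spart V I)"
  by (simp add: subspace_def spart_add spart_scaleR)

text \<open>Orthonormal bases of the homogeneous parts, one for each of the finitely many index sets
  below n, make up a frame; orthonormality turns the coordinates into inner products.\<close>

lemma gframe_spts:
  assumes V: "vector_superspace V"
  shows "\<exists>B. gframe (spts V n) B"
proof -
  have "\<exists>B. finite B \<and> B \<subseteq> spart V I \<and> (\<forall>x\<in>spart V I. x = (\<Sum>b\<in>B. (x \<bullet> b) *\<^sub>R b))" for I
  proof -
    obtain B where B: "B \<subseteq> spart V I" "pairwise orthogonal B" "\<And>x. x \<in> B \<Longrightarrow> norm x = 1"
        "independent B" "span B = spart V I"
      using orthonormal_basis_subspace[OF subspace_spart_real[OF V]] by metis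
    then show ?thesis using orthonormal_basis_expand[OF B(2,3)] independent_imp_finite[OF B(4)]
      by (intro exI[of _ B]) auto
  qed
  then obtain B where B: "\<And>I. finite (B I)" "\<And>I. B I \<subseteq> spart V I"
      "\<And>I x. x \<in> spart V I \<Longrightarrow> x = (\<Sum>b\<in>B I. (x \<bullet> b) *\<^sub>R b)" by metis
  have "gframe (spts V n) (Sigma (Pow {..<n}) B)"
    unfolding gframe_def
  proof (intro conjI ballI allI)
    show "gsubspace (spts V n)" by (rule gsubspace_spts[OF V])
    show "finite (Sigma (Pow {..<n}) B)" using B(1) by auto
    show "gsingle (fst k) (snd k) \<in> spts V n" if "k \<in> Sigma (Pow {..<n}) B" for k
      using that subsetD[OF B(2)] V by (auto simp: spts_iff gsupported_def gsingle_def)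
    fix x J assume x: "x \<in> spts V n"
    have "(\<Sum>k\<in>Sigma (Pow {..<n}) B. (x (fst k) \<bullet> snd k) *\<^sub>R gsingle (fst k) (snd k) J) =
        (\<Sum>I\<in>Pow {..<n}. \<Sum>b\<in>B I. (x I \<bullet> b) *\<^sub>R gsingle I b J)"
      using B(1) by (simp add: sum.Sigma case_prod_beta)
    also have "\<dots> = (\<Sum>I\<in>Pow {..<n}. if I = J then x J else 0)"
    proof (intro sum.cong refl)
      fix I assume "I \<in> Pow {..<n}"
      then have "x I = (\<Sum>b\<in>B I. (x I \<bullet> b) *\<^sub>R b)" using x by (intro B(3)) (auto simp: spts_iff)
      then show "(\<Sum>b\<in>B I. (x I \<bullet> b) *\<^sub>R gsingle I b J) = (if I = J then x J else 0)"
        by (auto simp: gsingle_def)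
    qed
    also have "\<dots> = x J" using gsupportedD[OF spts_gsupported[OF x]] by auto
    finally show "x J = (\<Sum>k\<in>Sigma (Pow {..<n}) B. (x (fst k) \<bullet> snd k) *\<^sub>R gsingle (fst k) (snd k) J)" ..
  qed
  then show ?thesis ..
qed

text \<open>Membership in \<open>D\<close> is tested on the coefficient at the empty set, which is a
  continuous coordinate.\<close>

lemma openin_dpts:
  fixes V :: "('k, 'v::euclidean_space) sspace"
  assumes "openin (top_of_set (ev V)) D"
  shows "openin (top_of_set (spts V n)) (dpts V D n)"
proof -
  obtain T where T: "open T" "D = ev V \<inter> T" using assms by (auto simp: openin_open)
  have "open ((\<lambda>x :: 'v gr. x {}) -` T)"
    using T(1) by (intro open_vimage) simp_all
  moreover have "dpts V D n = spts V n \<inter> (\<lambda>x. x {}) -` T"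
    using T(2) by (auto simp: dpts_def spts_empty)
  ultimately show ?thesis by (auto simp: openin_open)
qed

section \<open>Functions with continuous iterated derivatives\<close>

lemma Ck_on_continuous:
  assumes "Ck_on k E U f"
  shows "continuous_on U f"
proof (cases k)
  case 0
  then show ?thesis using assms by simp
next
  case (Suc j)
  show ?thesis using assms unfolding Suc Ck_on.simps(2) by (rule conjunct1)
qed

lemma Ck_on_Suc_dir:
  assumes "Ck_on (Suc k) E U f" "h \<in> E"
  shows "\<exists>g. (\<forall>x\<in>U. has_dir_deriv f x h (g x)) \<and> Ck_on k E U g"
  using assms(1)[unfolded Ck_on.simps(2), THEN conjunct2] assms(2) by (rule bspec)

lemma Ck_on_Suc_D: "Ck_on (Suc k) E U f \<Longrightarrow> Ck_on k E U f"
proof (induction k arbitrary: f)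
  case 0
  show ?case unfolding Ck_on.simps(1) by (rule Ck_on_continuous[OF 0])
next
  case (Suc k)
  show ?case unfolding Ck_on.simps(2)[of k]
  proof (intro conjI ballI)
    fix h assume "h \<in> E"
    from Ck_on_Suc_dir[OF Suc.prems this]
    obtain g where "\<forall>x\<in>U. has_dir_deriv f x h (g x)" "Ck_on (Suc k) E U g" by blast
    then show "\<exists>g. (\<forall>x\<in>U. has_dir_deriv f x h (g x)) \<and> Ck_on k E U g" using Suc.IH by blast
  qed (rule Ck_on_continuous[OF Suc.prems])
qed

lemma Ck_on_subset: "Ck_on k E U f \<Longrightarrow> U' \<subseteq> U \<Longrightarrow> Ck_on k E U' f"
proof (induction k arbitrary: f)
  case (Suc k)
  show ?case unfolding Ck_on.simps(2)
  proof (intro conjI ballI)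
    show "continuous_on U' f" using Ck_on_continuous[OF Suc.prems(1)] Suc.prems(2) by (rule continuous_on_subset)
    fix h assume "h \<in> E"
    from Ck_on_Suc_dir[OF Suc.prems(1) this] obtain g where "\<forall>x\<in>U. has_dir_deriv f x h (g x)" "Ck_on k E U g"
      by blast
    then show "\<exists>g. (\<forall>x\<in>U'. has_dir_deriv f x h (g x)) \<and> Ck_on k E U' g"
      using Suc.IH[of g] Suc.prems(2) by (intro exI[of _ g]) auto
  qed
qed (simp add: continuous_on_subset)

lemma has_dir_deriv_cong:
  assumes "gsubspace E" "openin (top_of_set E) U" "x \<in> U" "h \<in> E" "\<And>y. y \<in> U \<Longrightarrow> f y = g y"
    "has_dir_deriv g x h d"
  shows "has_dir_deriv f x h d"
  unfolding has_dir_deriv_gderiv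
  by (rule gderiv_cong[OF _ assms(6)[unfolded has_dir_deriv_gderiv]])
    (rule eventually_mono[OF eventually_line[OF assms(1-4)]], simp add: assms(5))

lemma continuous_on_local:
  assumes U: "U \<subseteq> E"
    and *: "\<And>x. x \<in> U \<Longrightarrow> \<exists>U' f'. x \<in> U' \<and> openin (top_of_set E) U' \<and> continuous_on U' f' \<and> (\<forall>y\<in>U'. f y = f' y)"
  shows "continuous_on U f"
  unfolding continuous_on_def
proof
  fix x assume x: "x \<in> U"
  obtain U' f' where U': "x \<in> U'" "openin (top_of_set E) U'" "continuous_on U' f'" "\<forall>y\<in>U'. f y = f' y"
    using *[OF x] by blast
  then obtain T where T: "open T" "U' = E \<inter> T" by (auto simp: openin_open)
  have "continuous_on U' f" using U'(3,4) by (simp cong: continuous_on_cong)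
  then have "continuous_on (U \<inter> T) f" using U T(2) by (auto intro: continuous_on_subset)
  then have "\<forall>x\<in>U \<inter> T. (f \<longlongrightarrow> f x) (at x within U \<inter> T)"
    by (simp only: continuous_on_def)
  moreover have "x \<in> U \<inter> T" using x U'(1) T(2) by blast
  ultimately have "(f \<longlongrightarrow> f x) (at x within U \<inter> T)" by (rule bspec)
  moreover have "at x within U \<inter> T = at x within U"
    by (rule at_within_nhd[of x T]) (use U'(1) T in auto)
  ultimately show "(f \<longlongrightarrow> f x) (at x within U)" by simp
qed

text \<open>Directional derivatives are unique. Hence the derivatives of the local representatives
  agree with one globally chosen derivative and inherit their regularity to it.\<close>

lemma Ck_on_local:
  assumes E: "gsubspace E" and U: "U \<subseteq> E"
    and "\<And>x. x \<in> U \<Longrightarrow> \<exists>U' f'. x \<in> U' \<and> openin (top_of_set E) U' \<and> Ck_on k E U' f' \<and> (\<forall>y\<in>U'. f y = f' y)"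
  shows "Ck_on k E U f"
  using assms(3)
proof (induction k arbitrary: f)
  case 0
  then show ?case unfolding Ck_on.simps(1) by (rule continuous_on_local[OF U])
next
  case (Suc k)
  show ?case unfolding Ck_on.simps(2)
  proof (intro conjI ballI)
    show "continuous_on U f"
    proof (rule continuous_on_local[OF U])
      fix x assume "x \<in> U"
      then obtain U' f' where "x \<in> U'" "openin (top_of_set E) U'" "Ck_on (Suc k) E U' f'" "\<forall>y\<in>U'. f y = f' y"
        using Suc.prems by blast
      then show "\<exists>U' f'. x \<in> U' \<and> openin (top_of_set E) U' \<and> continuous_on U' f' \<and> (\<forall>y\<in>U'. f y = f' y)"
        using Ck_on_continuous[of "Suc k" E U' f'] by blast
    qed
    fix h assume h: "h \<in> E"
    define G where "G x = (SOME d. has_dir_deriv f x h d)" for x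
    have G: "\<exists>U' g'. x \<in> U' \<and> openin (top_of_set E) U' \<and> Ck_on k E U' g' \<and> (\<forall>y\<in>U'. G y = g' y \<and> has_dir_deriv f y h (g' y))"
      if x: "x \<in> U" for x
    proof -
      obtain U' f' where U': "x \<in> U'" "openin (top_of_set E) U'" "Ck_on (Suc k) E U' f'" "\<forall>y\<in>U'. f y = f' y"
        using Suc.prems[OF x] by blast
      then obtain g' where g': "\<forall>x\<in>U'. has_dir_deriv f' x h (g' x)" "Ck_on k E U' g'"
        using Ck_on_Suc_dir[OF U'(3) h] by blast
      have "has_dir_deriv f y h (g' y)" if "y \<in> U'" for y
        using g'(1) U'(4) that by (intro has_dir_deriv_cong[OF E U'(2) that h, of f f']) auto
      moreover from this have "G y = g' y" if "y \<in> U'" for y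
        unfolding G_def using that
        by (intro some_equality) (auto simp: has_dir_deriv_gderiv intro: gderiv_unique)
      ultimately show ?thesis using U' g' by blast
    qed
    have "has_dir_deriv f x h (G x)" if x: "x \<in> U" for x
    proof -
      obtain U' g' where "x \<in> U'" "\<forall>y\<in>U'. G y = g' y \<and> has_dir_deriv f y h (g' y)"
        using G[OF x] by blast
      then show ?thesis by simp
    qed
    moreover have "Ck_on k E U G"
    proof (rule Suc.IH)
      fix x assume "x \<in> U"
      from G[OF this] show "\<exists>U' f'. x \<in> U' \<and> openin (top_of_set E) U' \<and> Ck_on k E U' f' \<and> (\<forall>y\<in>U'. G y = f' y)"
        by blast
    qed
    ultimately show "\<exists>g. (\<forall>x\<in>U. has_dir_deriv f x h (g x)) \<and> Ck_on k E U g" by blast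
  qed
qed

lemma Ck_on_const: "Ck_on k E U (\<lambda>x. c)"
proof (induction k arbitrary: c)
  case (Suc k)
  show ?case unfolding Ck_on.simps(2)
    by (intro conjI ballI exI[of _ "\<lambda>_ _. 0"] Suc)
      (auto simp: has_dir_deriv_gderiv gderiv_const)
qed simp

section \<open>Finitary linear and bilinear operations on coefficient families\<close>

definition glinear :: "('v::real_normed_vector gr \<Rightarrow> 'w::real_normed_vector gr) \<Rightarrow> bool" where
  "glinear l \<longleftrightarrow> (\<forall>J. \<exists>(S :: nat set set) p \<beta>. finite S \<and> (\<forall>i\<in>S. bounded_linear (\<beta> i)) \<and>
     (\<forall>x. l x J = (\<Sum>i\<in>S. \<beta> i (x (p i)))))"

text \<open>Finiteness of the sum at each coefficient lets continuity and the product rule pass to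
  the result term by term; the elements of \<open>S\<close> serve as labels of the terms. The
  product of Grassmann elements is the main instance.\<close>

definition gbilinear ::
  "('u::real_normed_vector gr \<Rightarrow> 'v::real_normed_vector gr \<Rightarrow> 'w::real_normed_vector gr) \<Rightarrow> bool" where
  "gbilinear m \<longleftrightarrow> (\<forall>J. \<exists>(S :: nat set set) p q \<beta>. finite S \<and> (\<forall>i\<in>S. bounded_bilinear (\<beta> i)) \<and>
     (\<forall>x y. m x y J = (\<Sum>i\<in>S. \<beta> i (x (p i)) (y (q i)))))"

lemma gderiv_add:
  "gderiv \<gamma> d \<Longrightarrow> gderiv \<delta> e \<Longrightarrow> gderiv (\<lambda>t I. \<gamma> t I + \<delta> t I) (\<lambda>I. d I + e I)"
  by (simp add: gderiv_def has_vector_derivative_add)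

lemma gderiv_glinear:
  assumes "glinear l" "gderiv \<gamma> d"
  shows "gderiv (\<lambda>t. l (\<gamma> t)) (l d)"
  unfolding gderiv_def
proof
  fix J
  obtain S :: "nat set set" and p \<beta> where "finite S" "\<forall>i\<in>S. bounded_linear (\<beta> i)"
      and l: "\<And>x. l x J = (\<Sum>i\<in>S. \<beta> i (x (p i)))"
    using assms(1)[unfolded glinear_def, rule_format, of J] by blast
  then show "((\<lambda>t. l (\<gamma> t) J) has_vector_derivative l d J) (at 0)"
    unfolding l
    by (intro has_vector_derivative_sum) (rule bounded_linear.has_vector_derivative[OF _ gderivD[OF assms(2)]], blast)
qed

lemma continuous_on_glinear:
  assumes "glinear l" "continuous_on U f"
  shows "continuous_on U (\<lambda>x. l (f x))"
proof (rule continuous_on_coordinatewise_then_product)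
  fix J
  obtain S :: "nat set set" and p \<beta> where "finite S" "\<forall>i\<in>S. bounded_linear (\<beta> i)"
      and l: "\<And>x. l x J = (\<Sum>i\<in>S. \<beta> i (x (p i)))"
    using assms(1)[unfolded glinear_def, rule_format, of J] by blast
  then show "continuous_on U (\<lambda>x. l (f x) J)"
    unfolding l
    using bounded_linear.continuous_on[of "\<beta> i" U "\<lambda>x. f x (p i)" for i]
      continuous_on_product_then_coordinatewise[OF assms(2)]
    by (intro continuous_on_sum) blast
qed

lemma gderiv_gbilinear:
  assumes "gbilinear m" "gderiv \<gamma> d" "gderiv \<delta> e"
  shows "gderiv (\<lambda>t. m (\<gamma> t) (\<delta> t)) (\<lambda>J. m (\<gamma> 0) e J + m d (\<delta> 0) J)"
  unfolding gderiv_def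
proof
  fix J
  obtain S :: "nat set set" and p q \<beta> where "finite S" and \<beta>: "\<forall>i\<in>S. bounded_bilinear (\<beta> i)"
      and m: "\<And>x y. m x y J = (\<Sum>i\<in>S. \<beta> i (x (p i)) (y (q i)))"
    using assms(1)[unfolded gbilinear_def, rule_format, of J] by blast
  have "((\<lambda>t. \<Sum>i\<in>S. \<beta> i (\<gamma> t (p i)) (\<delta> t (q i))) has_vector_derivative
      (\<Sum>i\<in>S. \<beta> i (\<gamma> 0 (p i)) (e (q i)) + \<beta> i (d (p i)) (\<delta> 0 (q i)))) (at 0)"
    using \<beta> bounded_bilinear.has_vector_derivative[OF _ gderivD[OF assms(2)] gderivD[OF assms(3)], of "\<beta> i" "p i" "q i" for i]
    by (intro has_vector_derivative_sum) blast
  then show "((\<lambda>t. m (\<gamma> t) (\<delta> t) J) has_vector_derivative m (\<gamma> 0) e J + m d (\<delta> 0) J) (at 0)"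
    by (simp add: m sum.distrib)
qed

lemma continuous_on_gbilinear:
  assumes "gbilinear m" "continuous_on U f" "continuous_on U g"
  shows "continuous_on U (\<lambda>x. m (f x) (g x))"
proof (rule continuous_on_coordinatewise_then_product)
  fix J
  obtain S :: "nat set set" and p q \<beta> where "finite S" "\<forall>i\<in>S. bounded_bilinear (\<beta> i)"
      and m: "\<And>x y. m x y J = (\<Sum>i\<in>S. \<beta> i (x (p i)) (y (q i)))"
    using assms(1)[unfolded gbilinear_def, rule_format, of J] by blast
  then show "continuous_on U (\<lambda>x. m (f x) (g x) J)"
    unfolding m
    using bounded_bilinear.continuous_on[of "\<beta> i" U "\<lambda>x. f x (p i)" "\<lambda>x. g x (q i)" for i]
      continuous_on_product_then_coordinatewise[OF assms(2)] continuous_on_product_then_coordinatewise[OF assms(3)]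
    by (intro continuous_on_sum) blast
qed

lemma continuous_on_gr_add:
  fixes f g :: "'a::topological_space \<Rightarrow> 'v::real_normed_vector gr"
  assumes "continuous_on U f" "continuous_on U g"
  shows "continuous_on U (\<lambda>x I. f x I + g x I)"
  by (intro continuous_on_coordinatewise_then_product continuous_on_add
      continuous_on_product_then_coordinatewise[OF assms(1)] continuous_on_product_then_coordinatewise[OF assms(2)])

lemma Ck_on_add: "Ck_on k E U f \<Longrightarrow> Ck_on k E U g \<Longrightarrow> Ck_on k E U (\<lambda>x I. f x I + g x I)"
proof (induction k arbitrary: f g)
  case (Suc k)
  show ?case unfolding Ck_on.simps(2)
  proof (intro conjI ballI)
    fix h assume "h \<in> E"
    obtain f' where "\<forall>x\<in>U. has_dir_deriv f x h (f' x)" "Ck_on k E U f'"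
      using Ck_on_Suc_dir[OF Suc.prems(1) \<open>h \<in> E\<close>] by blast
    moreover obtain g' where "\<forall>x\<in>U. has_dir_deriv g x h (g' x)" "Ck_on k E U g'"
      using Ck_on_Suc_dir[OF Suc.prems(2) \<open>h \<in> E\<close>] by blast
    ultimately show "\<exists>d. (\<forall>x\<in>U. has_dir_deriv (\<lambda>x I. f x I + g x I) x h (d x)) \<and> Ck_on k E U d"
      using Suc.IH[of f' g']
      by (intro exI[of _ "\<lambda>x I. f' x I + g' x I"]) (simp add: has_dir_deriv_gderiv gderiv_add)
  qed (rule continuous_on_gr_add[OF Suc.prems[THEN Ck_on_continuous]])
qed (simp add: continuous_on_gr_add)

lemma Ck_on_sum:
  "finite S \<Longrightarrow> (\<And>i. i \<in> S \<Longrightarrow> Ck_on k E U (f i)) \<Longrightarrow> Ck_on k E U (\<lambda>x I. \<Sum>i\<in>S. f i x I)"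
  by (induction S rule: finite_induct) (simp_all add: Ck_on_const Ck_on_add)

lemma Ck_on_glinear:
  assumes "glinear l"
  shows "Ck_on k E U f \<Longrightarrow> Ck_on k E U (\<lambda>x. l (f x))"
proof (induction k arbitrary: f)
  case (Suc k)
  show ?case unfolding Ck_on.simps(2)
  proof (intro conjI ballI)
    fix h assume "h \<in> E"
    obtain f' where "\<forall>x\<in>U. has_dir_deriv f x h (f' x)" "Ck_on k E U f'"
      using Ck_on_Suc_dir[OF Suc.prems \<open>h \<in> E\<close>] by blast
    then show "\<exists>d. (\<forall>x\<in>U. has_dir_deriv (\<lambda>x. l (f x)) x h (d x)) \<and> Ck_on k E U d"
      using Suc.IH[of f'] gderiv_glinear[OF assms]
      by (intro exI[of _ "\<lambda>x. l (f' x)"]) (simp add: has_dir_deriv_gderiv)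
  qed (rule continuous_on_glinear[OF assms Suc.prems[THEN Ck_on_continuous]])
qed (simp add: continuous_on_glinear[OF assms])

text \<open>By the product rule the derivative is a sum of two expressions of the same form, each
  with one factor differentiated and the other taken with one order of regularity less.\<close>

lemma Ck_on_gbilinear:
  assumes "gbilinear m"
  shows "Ck_on k E U f \<Longrightarrow> Ck_on k E U g \<Longrightarrow> Ck_on k E U (\<lambda>x. m (f x) (g x))"
proof (induction k arbitrary: f g)
  case (Suc k)
  show ?case unfolding Ck_on.simps(2)
  proof (intro conjI ballI)
    fix h assume "h \<in> E"
    obtain f' where d1: "\<forall>x\<in>U. has_dir_deriv f x h (f' x)" "Ck_on k E U f'"
      using Ck_on_Suc_dir[OF Suc.prems(1) \<open>h \<in> E\<close>] by blast
    obtain g' where d2: "\<forall>x\<in>U. has_dir_deriv g x h (g' x)" "Ck_on k E U g'"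
      using Ck_on_Suc_dir[OF Suc.prems(2) \<open>h \<in> E\<close>] by blast
    note d = d1 d2
    have "has_dir_deriv (\<lambda>x. m (f x) (g x)) x h (\<lambda>J. m (f x) (g' x) J + m (f' x) (g x) J)" if "x \<in> U" for x
      using gderiv_gbilinear[OF assms, of "\<lambda>t. f (\<lambda>J. x J + t *\<^sub>R h J)" "f' x" "\<lambda>t. g (\<lambda>J. x J + t *\<^sub>R h J)" "g' x"]
        d that by (simp add: has_dir_deriv_gderiv)
    moreover have "Ck_on k E U (\<lambda>x J. m (f x) (g' x) J + m (f' x) (g x) J)"
      by (intro Ck_on_add Suc.IH Ck_on_Suc_D[OF Suc.prems(1)] Ck_on_Suc_D[OF Suc.prems(2)] d)
    ultimately show "\<exists>d. (\<forall>x\<in>U. has_dir_deriv (\<lambda>x. m (f x) (g x)) x h (d x)) \<and> Ck_on k E U d"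
      by (intro exI[of _ "\<lambda>x J. m (f x) (g' x) J + m (f' x) (g x) J"]) simp
  qed (rule continuous_on_gbilinear[OF assms Suc.prems[THEN Ck_on_continuous]])
qed (simp add: continuous_on_gbilinear[OF assms])

text \<open>The terms of the chain rule have this shape: a coordinate of the inner derivative times
  a partial derivative of the outer function.\<close>

lemma gbilinear_component: "gbilinear (\<lambda>x y J. (x I \<bullet> b) *\<^sub>R y J)"
  unfolding gbilinear_def
proof
  fix J
  have *: "bounded_bilinear (\<lambda>v w. (v \<bullet> b) *\<^sub>R w)"
    using bounded_bilinear.comp1[OF bounded_bilinear_scaleR bounded_linear_inner_left[of b]] by simp
  show "\<exists>(S :: nat set set) p q \<beta>. finite S \<and> (\<forall>i\<in>S. bounded_bilinear (\<beta> i)) \<and>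
      (\<forall>x y. (x I \<bullet> b) *\<^sub>R y J = (\<Sum>i\<in>S. \<beta> i (x (p i)) (y (q i))))"
    by (intro exI[of _ "{{}}"] exI[of _ "\<lambda>_. I"] exI[of _ "\<lambda>_. J"] exI[of _ "\<lambda>_ v w. (v \<bullet> b) *\<^sub>R w"]) (simp add: *)
qed

text \<open>By the chain rule the derivative of the composite is a finite sum of coordinates of the
  inner derivative times partial derivatives of g along f. The latter are again composites with f,
  of lower order, so the induction is over all outer functions at once.\<close>

lemma Ck_on_compose:
  fixes f :: "'u::real_normed_vector gr \<Rightarrow> 'v::real_inner gr" and g :: "'v gr \<Rightarrow> 'w::real_normed_vector gr"
  assumes E: "gsubspace E" "openin (top_of_set E) U" and F: "gframe F B" "openin (top_of_set F) U'"
    and fU: "f ` U \<subseteq> U'"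
  shows "Ck_on k E U f \<Longrightarrow> Ck_on k F U' g \<Longrightarrow> Ck_on k E U (\<lambda>x. g (f x))"
proof (induction k arbitrary: g)
  case 0
  then show ?case using fU by (simp add: continuous_on_compose2[of U' g U f])
next
  case (Suc k)
  show ?case unfolding Ck_on.simps(2)
  proof (intro conjI ballI)
    show "continuous_on U (\<lambda>x. g (f x))"
      using Ck_on_continuous[OF Suc.prems(1)] Ck_on_continuous[OF Suc.prems(2)] fU
      by (simp add: continuous_on_compose2[of U' g U f])
    fix h assume h: "h \<in> E"
    obtain f' where f': "\<forall>x\<in>U. has_dir_deriv f x h (f' x)" "Ck_on k E U f'"
      using Ck_on_Suc_dir[OF Suc.prems(1) h] by blast
    have "\<exists>d. (\<forall>x\<in>U'. has_dir_deriv g x (gsingle (fst k') (snd k')) (d x)) \<and> Ck_on k F U' d" if "k' \<in> B" for k'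
      using F(1) that by (intro Ck_on_Suc_dir[OF Suc.prems(2)]) (simp add: gframe_def)
    then have "\<exists>D. \<forall>k'\<in>B. (\<forall>x\<in>U'. has_dir_deriv g x (gsingle (fst k') (snd k')) (D k' x)) \<and> Ck_on k F U' (D k')"
      by (intro bchoice) blast
    then obtain D where D: "\<And>k' x. k' \<in> B \<Longrightarrow> x \<in> U' \<Longrightarrow> has_dir_deriv g x (gsingle (fst k') (snd k')) (D k' x)"
        "\<And>k'. k' \<in> B \<Longrightarrow> Ck_on k F U' (D k')"
      by blast
    have "has_dir_deriv (\<lambda>x. g (f x)) x h (\<lambda>J. \<Sum>k'\<in>B. (f' x (fst k') \<bullet> snd k') *\<^sub>R D k' (f x) J)"
      if x: "x \<in> U" for x
    proof -
      have "eventually (\<lambda>t. f (\<lambda>J. x J + t *\<^sub>R h J) \<in> F) (nhds 0)"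
        using eventually_line[OF E x h]
        by (rule eventually_mono) (use fU openin_imp_subset[OF F(2)] in auto)
      then show ?thesis
        using gderiv_chain[OF F D(1) Ck_on_continuous[OF D(2)], of "\<lambda>t. f (\<lambda>J. x J + t *\<^sub>R h J)" "f' x"]
          f'(1) x fU by (auto simp: has_dir_deriv_gderiv)
    qed
    moreover have "Ck_on k E U (\<lambda>x J. \<Sum>k'\<in>B. (f' x (fst k') \<bullet> snd k') *\<^sub>R D k' (f x) J)"
      using F(1) by (intro Ck_on_sum Ck_on_gbilinear[OF gbilinear_component, of k E U f'] f' Suc.IH
          Ck_on_Suc_D[OF Suc.prems(1)] D) (auto simp: gframe_def)
    ultimately show "\<exists>d. (\<forall>x\<in>U. has_dir_deriv (\<lambda>x. g (f x)) x h (d x)) \<and> Ck_on k E U d"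
      by (intro exI[of _ "\<lambda>x J. \<Sum>k'\<in>B. (f' x (fst k') \<bullet> snd k') *\<^sub>R D k' (f x) J"]) simp
  qed
qed

section \<open>Supersmooth maps\<close>

text \<open>The linearity of differentials demanded by \<open>supersmooth\<close>, singled out
  because it is what has to be carried through composition, pairing and products.\<close>

definition even_linear ::
  "('k::{real_normed_field, euclidean_space}, 'v::euclidean_space) sspace \<Rightarrow> ('k, 'w::euclidean_space) sspace \<Rightarrow>
   nat \<Rightarrow> ('v gr \<Rightarrow> 'w gr) \<Rightarrow> bool" where
  "even_linear V W n L \<longleftrightarrow>
     (\<forall>h\<in>spts V n. \<forall>h'\<in>spts V n. L (\<lambda>I. h I + h' I) = (\<lambda>I. L h I + L h' I)) \<and>
     (\<forall>a\<in>Grass_even n. \<forall>h\<in>spts V n. L (gsmult (scl V) a h) = gsmult (scl W) a (L h))"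

lemma even_linearD:
  assumes "even_linear V W n L"
  shows "h \<in> spts V n \<Longrightarrow> h' \<in> spts V n \<Longrightarrow> L (\<lambda>I. h I + h' I) = (\<lambda>I. L h I + L h' I)"
    and "a \<in> Grass_even n \<Longrightarrow> h \<in> spts V n \<Longrightarrow> L (gsmult (scl V) a h) = gsmult (scl W) a (L h)"
  using assms by (auto simp: even_linear_def)

lemma supersmoothI:
  assumes "openin (top_of_set (ev V)) D" "openin (top_of_set (ev W)) D'"
    and "\<And>n x. x \<in> dpts V D n \<Longrightarrow> f n x \<in> dpts W D' n"
    and "\<And>m n \<rho> x. Grass_hom m n \<rho> \<Longrightarrow> x \<in> dpts V D m \<Longrightarrow>
       f n (gpush (scl V) m \<rho> x) = gpush (scl W) m \<rho> (f m x)"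
    and "\<And>n k. Ck_on k (spts V n) (dpts V D n) (f n)"
    and "\<And>n x. x \<in> dpts V D n \<Longrightarrow>
       \<exists>L. (\<forall>h\<in>spts V n. has_dir_deriv (f n) x h (L h)) \<and> even_linear V W n L"
  shows "supersmooth V D W D' f"
  unfolding supersmooth_def even_linear_def[symmetric] using assms by (simp add: image_subset_iff)

lemma supersmoothD:
  assumes "supersmooth V D W D' f"
  shows "openin (top_of_set (ev V)) D" "openin (top_of_set (ev W)) D'"
    and "\<And>n x. x \<in> dpts V D n \<Longrightarrow> f n x \<in> dpts W D' n"
    and "\<And>m n \<rho> x. Grass_hom m n \<rho> \<Longrightarrow> x \<in> dpts V D m \<Longrightarrow>
       f n (gpush (scl V) m \<rho> x) = gpush (scl W) m \<rho> (f m x)"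
    and "\<And>n k. Ck_on k (spts V n) (dpts V D n) (f n)"
    and "\<And>n x. x \<in> dpts V D n \<Longrightarrow>
       \<exists>L. (\<forall>h\<in>spts V n. has_dir_deriv (f n) x h (L h)) \<and> even_linear V W n L"
  using assms unfolding supersmooth_def even_linear_def[symmetric] by (simp_all add: image_subset_iff)

text \<open>The subspace consists of the fixed points of a coefficientwise linear projection
  \<open>P\<close>. A curve in it is fixed by \<open>P\<close>, hence so is its velocity.\<close>

lemma gderiv_in_frame:
  assumes B: "gframe E B" and \<gamma>: "eventually (\<lambda>t. \<gamma> t \<in> E) (nhds 0)" "gderiv \<gamma> d"
  shows "d \<in> E"
proof -
  have E: "gsubspace E" and fin: "finite B" and BE: "\<And>k. k \<in> B \<Longrightarrow> gsingle (fst k) (snd k) \<in> E"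
    and exp: "\<And>x J. x \<in> E \<Longrightarrow> x J = (\<Sum>k\<in>B. (x (fst k) \<bullet> snd k) *\<^sub>R gsingle (fst k) (snd k) J)"
    using B by (auto simp: gframe_def)
  define P where "P x = (\<lambda>J. \<Sum>k\<in>B. (x (fst k) \<bullet> snd k) *\<^sub>R gsingle (fst k) (snd k) J)" for x
  have \<gamma>0: "\<gamma> 0 \<in> E" using eventually_nhds_x_imp_x[OF \<gamma>(1)] .
  have PE: "P x \<in> E" for x
  proof -
    have "(\<lambda>J. \<Sum>k\<in>S. (x (fst k) \<bullet> snd k) *\<^sub>R gsingle (fst k) (snd k) J) \<in> E" if "S \<subseteq> B" for S
      using finite_subset[OF that fin] that
    proof (induction S rule: finite_induct)
      case empty
      have "(\<lambda>I. 0 *\<^sub>R \<gamma> 0 I) \<in> E" using E \<gamma>0 unfolding gsubspace_def by blast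
      then show ?case by simp
    next
      case (insert k S)
      have "(\<lambda>J. (\<Sum>k\<in>S. (x (fst k) \<bullet> snd k) *\<^sub>R gsingle (fst k) (snd k) J) +
          (x (fst k) \<bullet> snd k) *\<^sub>R gsingle (fst k) (snd k) J) \<in> E"
        using insert by (intro gsubspace_line[OF E _ BE]) auto
      then show ?case using insert.hyps by (simp add: add.commute)
    qed
    from this[of B] show ?thesis by (simp add: P_def)
  qed
  have "gderiv (\<lambda>t. P (\<gamma> t)) (P d)"
    unfolding gderiv_def P_def
  proof (intro allI has_vector_derivative_sum)
    fix J k
    show "((\<lambda>t. (\<gamma> t (fst k) \<bullet> snd k) *\<^sub>R gsingle (fst k) (snd k) J) has_vector_derivative
        (d (fst k) \<bullet> snd k) *\<^sub>R gsingle (fst k) (snd k) J) (at 0)"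
      by (rule bounded_linear.has_vector_derivative[OF bounded_linear_scaleR_left
          bounded_linear.has_vector_derivative[OF bounded_linear_inner_left gderivD[OF \<gamma>(2)]]])
  qed
  moreover have "eventually (\<lambda>t. P (\<gamma> t) = \<gamma> t) (nhds 0)"
    using \<gamma>(1) by (rule eventually_mono) (use exp in \<open>auto simp: P_def\<close>)
  ultimately have "gderiv \<gamma> (P d)" by (rule gderiv_cong[rotated])
  then have "P d = d" using \<gamma>(2) by (rule gderiv_unique)
  then show ?thesis using PE[of d] by simp
qed

lemma supersmooth_line:
  assumes "vector_superspace V" "supersmooth V D W D' f" "x \<in> dpts V D n" "h \<in> spts V n"
  shows "eventually (\<lambda>t. f n (\<lambda>J. x J + t *\<^sub>R h J) \<in> dpts W D' n) (nhds 0)"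
  by (rule eventually_mono[OF eventually_line[OF gsubspace_spts[OF assms(1)]
          openin_dpts[OF supersmoothD(1)[OF assms(2)]] assms(3,4)] supersmoothD(3)[OF assms(2)]])

lemma supersmooth_deriv_spts:
  assumes "vector_superspace V" "vector_superspace W" "supersmooth V D W D' f" "x \<in> dpts V D n" "h \<in> spts V n"
    "has_dir_deriv (f n) x h d"
  shows "d \<in> spts W n"
proof -
  obtain B where "gframe (spts W n) B" using gframe_spts[OF assms(2)] by blast
  then show ?thesis
    using eventually_mono[OF supersmooth_line[OF assms(1,3-5)] dpts_spts] assms(6)
    unfolding has_dir_deriv_gderiv by (rule gderiv_in_frame)
qed

text \<open>The differential of the composite is \<open>M\<close> after \<open>L\<close>, where
  \<open>L\<close> and \<open>M\<close> are the differentials of f and g. The chain rule expresses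
  the velocity of the composite by partial derivatives of g; applied to the straight line with
  velocity \<open>L h\<close> it gives the same sum, which is therefore \<open>M (L h)\<close>.
  Linearity over even scalars is then inherited from the two factors.\<close>

lemma supersmooth_compose:
  assumes V: "vector_superspace V" and W: "vector_superspace W"
    and f: "supersmooth V D W D' f" and g: "supersmooth W D' X D'' g"
  shows "supersmooth V D X D'' (\<lambda>n x. g n (f n x))"
proof (rule supersmoothI)
  show "openin (top_of_set (ev V)) D" "openin (top_of_set (ev X)) D''"
    by (rule supersmoothD(1)[OF f], rule supersmoothD(2)[OF g])
  show "g n (f n x) \<in> dpts X D'' n" if "x \<in> dpts V D n" for n x
    by (intro supersmoothD(3)[OF g] supersmoothD(3)[OF f] that)
  show "g n (f n (gpush (scl V) m \<rho> x)) = gpush (scl X) m \<rho> (g m (f m x))"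
    if "Grass_hom m n \<rho>" "x \<in> dpts V D m" for m n \<rho> x
    using supersmoothD(4)[OF f that] supersmoothD(4)[OF g that(1) supersmoothD(3)[OF f that(2)]] by simp
  fix n
  obtain B where B: "gframe (spts W n) B" using gframe_spts[OF W] by blast
  note opV = openin_dpts[OF supersmoothD(1)[OF f], of n] and opW = openin_dpts[OF supersmoothD(1)[OF g], of n]
  have im: "f n ` dpts V D n \<subseteq> dpts W D' n" using supersmoothD(3)[OF f] by blast
  show "Ck_on k (spts V n) (dpts V D n) (\<lambda>x. g n (f n x))" for k
    by (rule Ck_on_compose[OF gsubspace_spts[OF V] opV B opW im supersmoothD(5)[OF f] supersmoothD(5)[OF g]])
  fix x assume x: "x \<in> dpts V D n"
  obtain L where L: "\<And>h. h \<in> spts V n \<Longrightarrow> has_dir_deriv (f n) x h (L h)" "even_linear V W n L"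
    using supersmoothD(6)[OF f x] by blast
  obtain M where M: "\<And>h. h \<in> spts W n \<Longrightarrow> has_dir_deriv (g n) (f n x) h (M h)" "even_linear W X n M"
    using supersmoothD(6)[OF g supersmoothD(3)[OF f x]] by blast
  have Lh: "L h \<in> spts W n" if "h \<in> spts V n" for h
    by (rule supersmooth_deriv_spts[OF V W f x that L(1)[OF that]])
  have "\<exists>D. \<forall>k\<in>B. (\<forall>y\<in>dpts W D' n. has_dir_deriv (g n) y (gsingle (fst k) (snd k)) (D k y)) \<and>
      continuous_on (dpts W D' n) (D k)"
  proof (rule bchoice, rule ballI)
    fix k assume "k \<in> B"
    then have "gsingle (fst k) (snd k) \<in> spts W n" using B by (simp add: gframe_def)
    from Ck_on_Suc_dir[OF supersmoothD(5)[OF g, of "Suc 0" n] this]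
    show "\<exists>d. (\<forall>y\<in>dpts W D' n. has_dir_deriv (g n) y (gsingle (fst k) (snd k)) (d y)) \<and>
      continuous_on (dpts W D' n) d" by simp
  qed
  then obtain D where D: "\<And>k y. k \<in> B \<Longrightarrow> y \<in> dpts W D' n \<Longrightarrow> has_dir_deriv (g n) y (gsingle (fst k) (snd k)) (D k y)"
      "\<And>k. k \<in> B \<Longrightarrow> continuous_on (dpts W D' n) (D k)" by blast
  note chain = gderiv_chain[OF B opW D(1) D(2)]
  have "has_dir_deriv (\<lambda>x. g n (f n x)) x h (M (L h))" if h: "h \<in> spts V n" for h
  proof -
    let ?\<gamma> = "\<lambda>t. f n (\<lambda>J. x J + t *\<^sub>R h J)" and ?\<delta> = "\<lambda>t J. f n x J + t *\<^sub>R L h J"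
    have fx: "f n x \<in> dpts W D' n" by (rule supersmoothD(3)[OF f x])
    have ev: "eventually (\<lambda>t. ?\<gamma> t \<in> spts W n) (nhds 0)"
      by (rule eventually_mono[OF supersmooth_line[OF V f x h]]) (rule dpts_spts)
    have 1: "gderiv (\<lambda>t. g n (?\<gamma> t)) (\<lambda>J. \<Sum>k\<in>B. (L h (fst k) \<bullet> snd k) *\<^sub>R D k (f n x) J)"
      using chain[of ?\<gamma> "L h"] ev L(1)[OF h] fx by (simp add: has_dir_deriv_gderiv)
    have "eventually (\<lambda>t. ?\<delta> t \<in> spts W n) (nhds 0)"
      by (rule always_eventually) (intro allI gsubspace_line[OF gsubspace_spts[OF W] dpts_spts[OF fx] Lh[OF h]])
    then have 2: "gderiv (\<lambda>t. g n (?\<delta> t)) (\<lambda>J. \<Sum>k\<in>B. (L h (fst k) \<bullet> snd k) *\<^sub>R D k (f n x) J)"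
      using chain[of ?\<delta> "L h"] gderiv_line[of "f n x" "L h"] fx by simp
    have "M (L h) = (\<lambda>J. \<Sum>k\<in>B. (L h (fst k) \<bullet> snd k) *\<^sub>R D k (f n x) J)"
      using M(1)[OF Lh[OF h]] 2 unfolding has_dir_deriv_gderiv by (rule gderiv_unique)
    then show ?thesis using 1 by (simp add: has_dir_deriv_gderiv)
  qed
  moreover have "even_linear V X n (\<lambda>h. M (L h))"
    unfolding even_linear_def by (simp add: even_linearD[OF L(2)] even_linearD[OF M(2)] Lh)
  ultimately show "\<exists>L. (\<forall>h\<in>spts V n. has_dir_deriv (\<lambda>x. g n (f n x)) x h (L h)) \<and> even_linear V X n L"
    by (intro exI[of _ "\<lambda>h. M (L h)"]) simp
qed

lemma dpts_mono: "D \<subseteq> D' \<Longrightarrow> x \<in> dpts V D n \<Longrightarrow> x \<in> dpts V D' n"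
  by (auto simp: dpts_def)

text \<open>A point of a superdomain lies over a subset as soon as its body does, so a cover of
  \<open>D\<close> by ordinary open sets covers the points over every Grassmann algebra.\<close>

lemma supersmooth_local:
  assumes V: "vector_superspace V" and D': "openin (top_of_set (ev W)) D'"
    and loc: "\<And>y. y \<in> D \<Longrightarrow> \<exists>D1 g. y \<in> D1 \<and> D1 \<subseteq> D \<and> supersmooth V D1 W D' g \<and>
      (\<forall>n. \<forall>x\<in>dpts V D1 n. f n x = g n x)"
  shows "supersmooth V D W D' f"
proof (rule supersmoothI[OF _ D'])
  show op: "openin (top_of_set (ev V)) D"
  proof (subst openin_subopen, intro ballI)
    fix y assume "y \<in> D"
    from loc[OF this] obtain D1 g where "y \<in> D1" "D1 \<subseteq> D" "supersmooth V D1 W D' g" by blast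
    then show "\<exists>T. openin (top_of_set (ev V)) T \<and> y \<in> T \<and> T \<subseteq> D"
      using supersmoothD(1)[of V D1 W D' g] by blast
  qed
  have loc': "\<exists>D1 g. x \<in> dpts V D1 n \<and> D1 \<subseteq> D \<and> supersmooth V D1 W D' g \<and> (\<forall>n. \<forall>x\<in>dpts V D1 n. f n x = g n x)"
    if x: "x \<in> dpts V D n" for x n
  proof -
    have "x {} \<in> D" using x by (simp add: dpts_def)
    from loc[OF this] obtain D1 g where D1: "x {} \<in> D1" "D1 \<subseteq> D" "supersmooth V D1 W D' g"
      "\<forall>n. \<forall>x\<in>dpts V D1 n. f n x = g n x" by blast
    have "x \<in> dpts V D1 n" using D1(1) x by (simp add: dpts_def)
    with D1(2-) show ?thesis by blast
  qed
  show "f n x \<in> dpts W D' n" if x: "x \<in> dpts V D n" for n x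
  proof -
    obtain D1 g where D1: "x \<in> dpts V D1 n" "supersmooth V D1 W D' g" "\<forall>n. \<forall>x\<in>dpts V D1 n. f n x = g n x"
      using loc'[OF x] by blast
    then show ?thesis using supersmoothD(3)[OF D1(2,1)] by simp
  qed
  show "f n (gpush (scl V) m \<rho> x) = gpush (scl W) m \<rho> (f m x)"
    if \<rho>: "Grass_hom m n \<rho>" and x: "x \<in> dpts V D m" for m n \<rho> x
  proof -
    obtain D1 g where D1: "x \<in> dpts V D1 m" "supersmooth V D1 W D' g" "\<forall>n. \<forall>x\<in>dpts V D1 n. f n x = g n x"
      using loc'[OF x] by blast
    then show ?thesis using supersmoothD(4)[OF D1(2) \<rho> D1(1)] gpush_dpts[OF \<rho> V D1(1)] by simp
  qed
  fix n
  show "Ck_on k (spts V n) (dpts V D n) (f n)" for k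
  proof (rule Ck_on_local[OF gsubspace_spts[OF V]])
    show "dpts V D n \<subseteq> spts V n" by (auto simp: dpts_def)
    fix x assume x: "x \<in> dpts V D n"
    obtain D1 g where D1: "x \<in> dpts V D1 n" "supersmooth V D1 W D' g" "\<forall>n. \<forall>x\<in>dpts V D1 n. f n x = g n x"
      using loc'[OF x] by blast
    then show "\<exists>U' f'. x \<in> U' \<and> openin (top_of_set (spts V n)) U' \<and> Ck_on k (spts V n) U' f' \<and> (\<forall>y\<in>U'. f n y = f' y)"
      using openin_dpts[OF supersmoothD(1)[OF D1(2)]] supersmoothD(5)[OF D1(2)]
      by (intro exI[of _ "dpts V D1 n"] exI[of _ "g n"]) simp
  qed
  fix x assume x: "x \<in> dpts V D n"
  obtain D1 g where D1: "x \<in> dpts V D1 n" "supersmooth V D1 W D' g" "\<forall>n. \<forall>x\<in>dpts V D1 n. f n x = g n x"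
    using loc'[OF x] by blast
  obtain L where L: "\<And>h. h \<in> spts V n \<Longrightarrow> has_dir_deriv (g n) x h (L h)" "even_linear V W n L"
    using supersmoothD(6)[OF D1(2,1)] by blast
  have "has_dir_deriv (f n) x h (L h)" if "h \<in> spts V n" for h
    using D1(3) by (intro has_dir_deriv_cong[OF gsubspace_spts[OF V] openin_dpts[OF supersmoothD(1)[OF D1(2)]]
          D1(1) that _ L(1)[OF that]]) simp
  then show "\<exists>L. (\<forall>h\<in>spts V n. has_dir_deriv (f n) x h (L h)) \<and> even_linear V W n L"
    using L(2) by blast
qed

lemma supersmooth_cong:
  assumes "vector_superspace V" "supersmooth V D W D' g" "\<And>n x. x \<in> dpts V D n \<Longrightarrow> f n x = g n x"
  shows "supersmooth V D W D' f"
  using assms by (intro supersmooth_local[OF assms(1) supersmoothD(2)[OF assms(2)]]) blast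

text \<open>Derivatives and their linearity refer to the target through its scalar multiplication
  alone. So the target can be exchanged, for instance for the kernel of a functional, once the
  values are known to lie there.\<close>

lemma supersmooth_into:
  assumes "supersmooth V D W D' f" "scl W' = scl W" "openin (top_of_set (ev W')) D''"
    "\<And>n x. x \<in> dpts V D n \<Longrightarrow> f n x \<in> dpts W' D'' n"
  shows "supersmooth V D W' D'' f"
  by (rule supersmoothI) (use supersmoothD[OF assms(1)] assms(2-) in \<open>simp_all add: even_linear_def\<close>)

definition fbody :: "(nat \<Rightarrow> 'v::zero gr \<Rightarrow> 'w gr) \<Rightarrow> 'v \<Rightarrow> 'w" where
  "fbody f y = f 0 (gconst y) {}"

text \<open>Naturality with respect to the augmentation: the body of the value depends on the body
  of the argument. Domains of composites can therefore be cut out by conditions on ordinary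
  points.\<close>

lemma supersmooth_body:
  assumes V: "vector_superspace V" "vector_superspace W" and f: "supersmooth V D W D' f" and x: "x \<in> dpts V D n"
  shows "f n x {} = fbody f (x {})"
proof -
  have "f 0 (gpush (scl V) n gaug x) = gpush (scl W) n gaug (f n x)"
    by (rule supersmoothD(4)[OF f gaug_hom x])
  then show ?thesis by (simp add: fbody_def gpush_gaug vector_superspaceD V)
qed

lemma supersmooth_fbody:
  assumes V: "vector_superspace V" and f: "supersmooth V D W D' f" and y: "y \<in> D"
  shows "fbody f y \<in> D'"
proof -
  have "gconst y \<in> dpts V D 0"
    using y openin_imp_subset[OF supersmoothD(1)[OF f]] by (auto intro: gconst_dpts[OF V])
  from supersmoothD(3)[OF f this] show ?thesis by (simp add: fbody_def dpts_def)
qed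

lemma supersmooth_restrict:
  assumes V: "vector_superspace V" "vector_superspace W" and f: "supersmooth V D W D' f"
    and D1: "openin (top_of_set (ev V)) D1" "D1 \<subseteq> D"
    and D2: "openin (top_of_set (ev W)) D2" "\<And>y. y \<in> D1 \<Longrightarrow> fbody f y \<in> D2"
  shows "supersmooth V D1 W D2 f"
proof (rule supersmoothI[OF D1(1) D2(1)])
  fix n x assume x: "x \<in> dpts V D1 n"
  then have x': "x \<in> dpts V D n" by (rule dpts_mono[OF D1(2)])
  show "f n x \<in> dpts W D2 n"
    using supersmoothD(3)[OF f x'] supersmooth_body[OF V f x'] x D2(2) by (simp add: dpts_def)
  show "\<exists>L. (\<forall>h\<in>spts V n. has_dir_deriv (f n) x h (L h)) \<and> even_linear V W n L"
    by (rule supersmoothD(6)[OF f x'])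
next
  show "f n (gpush (scl V) m \<rho> x) = gpush (scl W) m \<rho> (f m x)"
    if "Grass_hom m n \<rho>" "x \<in> dpts V D1 m" for m n \<rho> x
    by (rule supersmoothD(4)[OF f that(1) dpts_mono[OF D1(2) that(2)]])
next
  fix n k
  show "Ck_on k (spts V n) (dpts V D1 n) (f n)"
    by (rule Ck_on_subset[OF supersmoothD(5)[OF f]]) (use D1(2) in \<open>auto simp: dpts_def\<close>)
qed

lemma continuous_on_gconst: "continuous_on U (\<lambda>y :: 'v::real_normed_vector. gconst y)"
proof (rule continuous_on_coordinatewise_then_product)
  show "continuous_on U (\<lambda>y. gconst y I)" for I
    by (cases "I = {}") (simp_all add: gconst_def)
qed

text \<open>Ordinary vectors embed continuously as constants, and over \<Lambda>_0 a supersmooth map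
  is continuous, so the underlying map is continuous.\<close>

lemma openin_fbody_vimage:
  assumes V: "vector_superspace V" and f: "supersmooth V D W D' f" and D2: "openin (top_of_set (ev W)) D2"
  shows "openin (top_of_set (ev V)) {y \<in> D. fbody f y \<in> D2}"
proof -
  note D = supersmoothD(1)[OF f]
  have "continuous_on (dpts V D 0) (f 0)" using supersmoothD(5)[OF f, of 0 0] by simp
  then have "continuous_on D (\<lambda>y. f 0 (gconst y))"
    using openin_imp_subset[OF D] by (intro continuous_on_compose2[OF _ continuous_on_gconst]) (auto intro: gconst_dpts[OF V])
  then have "continuous_on D (fbody f)"
    unfolding fbody_def by (rule continuous_on_product_then_coordinatewise)
  moreover have "fbody f \<in> D \<rightarrow> ev W"
    using supersmooth_fbody[OF V f] openin_imp_subset[OF supersmoothD(2)[OF f]] by blast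
  ultimately have "openin (top_of_set D) (D \<inter> fbody f -` D2)"
    using D2 by (rule continuous_openin_preimage)
  then have "openin (top_of_set (ev V)) (D \<inter> fbody f -` D2)" using D by (rule openin_trans)
  moreover have "D \<inter> fbody f -` D2 = {y \<in> D. fbody f y \<in> D2}" by blast
  ultimately show ?thesis by simp
qed

lemma supersmooth_vimage:
  assumes V: "vector_superspace V" "vector_superspace W" and f: "supersmooth V D W D' f"
    and D2: "openin (top_of_set (ev W)) D2"
  shows "supersmooth V {y \<in> D. fbody f y \<in> D2} W D2 f"
  by (rule supersmooth_restrict[OF V f openin_fbody_vimage[OF V(1) f D2] _ D2]) auto

subsection \<open>Constructions\<close>

lemma linear_real:
  assumes "vector_superspace V" "vector_superspace W" "Vector_Spaces.linear (scl V) (scl W) l"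
  shows "bounded_linear l"
proof -
  interpret l: Vector_Spaces.linear "scl V" "scl W" l by (rule assms(3))
  have "linear l"
    by (rule linearI) (auto simp: l.add l.scale vector_superspaceD(2)[OF assms(1), symmetric] vector_superspaceD(2)[OF assms(2), symmetric])
  then show ?thesis by (rule linear_linear[THEN iffD1] linear_conv_bounded_linear[THEN iffD1])
qed

lemma Ck_on_id: "Ck_on k E U (\<lambda>x. x)"
proof (cases k)
  case (Suc j)
  show ?thesis unfolding Suc Ck_on.simps(2)
  proof (intro conjI ballI continuous_on_id)
    fix h assume "h \<in> E"
    show "\<exists>g. (\<forall>x\<in>U. has_dir_deriv (\<lambda>x. x) x h (g x)) \<and> Ck_on j E U g"
      by (intro exI[of _ "\<lambda>_. h"]) (simp add: has_dir_deriv_gderiv gderiv_line Ck_on_const)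
  qed
qed simp

lemma glinear_map: "bounded_linear l \<Longrightarrow> glinear (\<lambda>x I. l (x I))"
  unfolding glinear_def
proof
  fix J :: "nat set"
  assume "bounded_linear l"
  then show "\<exists>(S :: nat set set) p \<beta>. finite S \<and> (\<forall>i\<in>S. bounded_linear (\<beta> i)) \<and> (\<forall>x. l (x J) = (\<Sum>i\<in>S. \<beta> i (x (p i))))"
    by (intro exI[of _ "{{}}"] exI[of _ "\<lambda>_. J"] exI[of _ "\<lambda>_. l"]) simp
qed

lemma gsmult_linear:
  assumes "Vector_Spaces.linear sc sc' l"
  shows "(\<lambda>I. l (gsmult sc a x I)) = gsmult sc' a (\<lambda>I. l (x I))"
proof -
  interpret l: Vector_Spaces.linear sc sc' l by (rule assms)
  show ?thesis unfolding gsmult_def by (simp only: l.sum l.scale)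
qed

lemma spts_linear:
  assumes "l 0 = 0" "l ` ev V \<subseteq> ev W" "l ` od V \<subseteq> od W" "x \<in> spts V n"
  shows "(\<lambda>I. l (x I)) \<in> spts W n"
proof -
  have "l (x I) \<in> spart W I" if "I \<subseteq> {..<n}" for I
  proof -
    have "x I \<in> spart V I" using assms(4) that by (simp add: spts_iff)
    then show ?thesis using assms(2,3) by (cases "even (card I)") (simp_all add: spart_def image_subset_iff)
  qed
  moreover have "(\<lambda>I. l (x I)) \<in> gsupported n"
    using gsupportedD[OF spts_gsupported[OF assms(4)]] assms(1) by (simp add: gsupported_def)
  ultimately show ?thesis by (simp add: spts_iff)
qed

lemma supersmooth_linear:
  assumes V: "vector_superspace V" "vector_superspace W"
    and l: "Vector_Spaces.linear (scl V) (scl W) l" "l ` ev V \<subseteq> ev W" "l ` od V \<subseteq> od W"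
    and D: "openin (top_of_set (ev V)) D" "openin (top_of_set (ev W)) D'" "l ` D \<subseteq> D'"
  shows "supersmooth V D W D' (\<lambda>n x I. l (x I))"
proof (rule supersmoothI[OF D(1,2)])
  interpret l: Vector_Spaces.linear "scl V" "scl W" l by (rule l(1))
  note gl = glinear_map[OF linear_real[OF V l(1)]]
  show "(\<lambda>I. l (x I)) \<in> dpts W D' n" if "x \<in> dpts V D n" for n x
    using that spts_linear[OF l.zero l(2,3)] D(3) by (auto simp: dpts_def)
  show "(\<lambda>I. l (gpush (scl V) m \<rho> x I)) = gpush (scl W) m \<rho> (\<lambda>I. l (x I))" for m \<rho> x
    by (simp add: gpush_linear[OF l(1)])
  show "Ck_on k (spts V n) (dpts V D n) (\<lambda>x I. l (x I))" for k n
    by (rule Ck_on_glinear[OF gl Ck_on_id])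
  have "has_dir_deriv (\<lambda>x I. l (x I)) x h (\<lambda>I. l (h I))" for x h
    using gderiv_glinear[OF gl gderiv_line] by (simp only: has_dir_deriv_gderiv)
  then show "\<exists>L. (\<forall>h\<in>spts V n. has_dir_deriv (\<lambda>x I. l (x I)) x h (L h)) \<and> even_linear V W n L" for n x
    by (intro exI[of _ "\<lambda>h I. l (h I)"]) (simp add: even_linear_def l.add gsmult_linear[OF l(1)])
qed

lemma supersmooth_inclusion:
  assumes V: "vector_superspace V" "vector_superspace W"
    and "scl V = scl W" "ev V \<subseteq> ev W" "od V \<subseteq> od W"
    and D: "openin (top_of_set (ev V)) D" "openin (top_of_set (ev W)) D'" "D \<subseteq> D'"
  shows "supersmooth V D W D' (\<lambda>n x. x)"
  using supersmooth_linear[OF V _ _ _ D(1,2), of "\<lambda>x. x"] assms(3-) module.module_hom_ident[OF vector_superspace_module[OF V(2)]]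
    vector_superspaceD(1)[OF V(2)] by (auto simp: linear_iff_module_hom image_subset_iff)

lemma supersmooth_const:
  assumes V: "vector_superspace V" "vector_superspace W"
    and D: "openin (top_of_set (ev V)) D" "openin (top_of_set (ev W)) D'" "v \<in> D'"
  shows "supersmooth V D W D' (\<lambda>n x. gconst v)"
proof (rule supersmoothI[OF D(1,2)])
  show "gconst v \<in> dpts W D' n" for n
    using D(2,3) by (intro gconst_dpts V) (auto simp: openin_imp_subset)
  show "gconst v = gpush (scl W) m \<rho> (gconst v)" if "Grass_hom m n \<rho>" for m n \<rho>
    by (simp add: gpush_gconst[OF that] vector_superspaceD V)
  show "\<exists>L. (\<forall>h\<in>spts V n. has_dir_deriv (\<lambda>x. gconst v) x h (L h)) \<and> even_linear V W n L" for n x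
    by (intro exI[of _ "\<lambda>h I. 0"])
      (simp add: has_dir_deriv_gderiv gderiv_const even_linear_def gsmult_def
        module.scale_zero_right[OF vector_superspace_module[OF V(2)]])
qed (rule Ck_on_const)

lemma ssum_simps [simp]:
  "scl (ssum V W) = (\<lambda>a (v, w). (scl V a v, scl W a w))" "ev (ssum V W) = ev V \<times> ev W" "od (ssum V W) = od V \<times> od W"
  by (simp_all add: ssum_def)

lemma vector_superspace_ssum:
  assumes V: "vector_superspace V" and W: "vector_superspace W"
  shows "vector_superspace (ssum V W)"
proof -
  interpret V: module "scl V" by (rule vector_superspace_module[OF V])
  interpret W: module "scl W" by (rule vector_superspace_module[OF W])
  have mod: "module (scl (ssum V W))"
    by unfold_locales (auto simp: V.scale_right_distrib W.scale_right_distrib V.scale_left_distrib W.scale_left_distrib)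
  then interpret S: module "scl (ssum V W)" .
  have "vector_space (scl (ssum V W))" using mod by (simp add: module_iff_vector_space)
  moreover have "scl (ssum V W) (of_real r) p = r *\<^sub>R p" for r p
    by (cases p) (simp add: vector_superspaceD V W)
  moreover have "S.subspace (A \<times> B)" if "V.subspace A" "W.subspace B" for A B
    using that unfolding S.subspace_def V.subspace_def W.subspace_def by (auto simp: zero_prod_def)
  ultimately show ?thesis
    using vector_superspaceD[OF V] vector_superspaceD[OF W] unfolding vector_superspace_def
    by (simp add: Times_Int_Times zero_prod_def)
qed

lemma linear_fst: "vector_superspace V \<Longrightarrow> vector_superspace W \<Longrightarrow> Vector_Spaces.linear (scl (ssum V W)) (scl V) fst"
  and linear_snd: "vector_superspace V \<Longrightarrow> vector_superspace W \<Longrightarrow> Vector_Spaces.linear (scl (ssum V W)) (scl W) snd"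
  using vector_superspaceD(1)[OF vector_superspace_ssum[of V W]] vector_superspaceD(1)[of V] vector_superspaceD(1)[of W]
  by (auto simp: linear_iff_module_hom module_hom_def module_hom_axioms_def vector_space_module simp del: ssum_simps)
    (simp_all add: ssum_def case_prod_beta)

lemma gpair_sel [simp]: "fst (gpair x y I) = x I" "snd (gpair x y I) = y I"
  by (simp_all add: gpair_def)

lemma gpair_spts_iff: "gpair x y \<in> spts (ssum V W) n \<longleftrightarrow> x \<in> spts V n \<and> y \<in> spts W n"
  by (auto simp: spts_def gpair_def zero_prod_def split: if_splits)

lemma gpair_dpts_iff: "gpair x y \<in> dpts (ssum V W) (D \<times> D') n \<longleftrightarrow> x \<in> dpts V D n \<and> y \<in> dpts W D' n"
  by (auto simp: dpts_def gpair_spts_iff) (simp_all add: gpair_def)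

lemma gpair_surj: "z = gpair (\<lambda>I. fst (z I)) (\<lambda>I. snd (z I))"
  by (simp add: gpair_def)

lemma gpair_eq_iff: "gpair x y = gpair x' y' \<longleftrightarrow> x = x' \<and> y = y'"
  by (auto simp: gpair_def fun_eq_iff)

lemma gpair_comp [simp]: "fst \<circ> gpair x y = x" "snd \<circ> gpair x y = y"
  by (auto simp: gpair_def)

lemma gpush_gpair:
  assumes V: "vector_superspace V" and W: "vector_superspace W"
  shows "gpush (scl (ssum V W)) m \<rho> (gpair x y) = gpair (gpush (scl V) m \<rho> x) (gpush (scl W) m \<rho> y)"
  using gpush_linear[OF linear_fst[OF V W], of m \<rho> "gpair x y"] gpush_linear[OF linear_snd[OF V W], of m \<rho> "gpair x y"]
  by (subst gpair_surj) (simp add: gpair_sel[abs_def] del: ssum_simps)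

lemma gsmult_gpair:
  assumes V: "vector_superspace V" and W: "vector_superspace W"
  shows "gsmult (scl (ssum V W)) a (gpair x y) = gpair (gsmult (scl V) a x) (gsmult (scl W) a y)"
  using gsmult_linear[OF linear_fst[OF V W], of a "gpair x y"] gsmult_linear[OF linear_snd[OF V W], of a "gpair x y"]
  by (subst gpair_surj) (simp del: ssum_simps)

lemma supersmooth_pair:
  assumes V: "vector_superspace V" and W: "vector_superspace W" and X: "vector_superspace X"
    and f: "supersmooth V D W D1 f" and g: "supersmooth V D X D2 g"
  shows "supersmooth V D (ssum W X) (D1 \<times> D2) (\<lambda>n x. gpair (f n x) (g n x))"
proof (rule supersmoothI)
  show "openin (top_of_set (ev V)) D" by (rule supersmoothD(1)[OF f])
  show "openin (top_of_set (ev (ssum W X))) (D1 \<times> D2)"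
    using openin_Times[OF supersmoothD(2)[OF f] supersmoothD(2)[OF g]] by simp
  show "gpair (f n x) (g n x) \<in> dpts (ssum W X) (D1 \<times> D2) n" if "x \<in> dpts V D n" for n x
    using supersmoothD(3)[OF f that] supersmoothD(3)[OF g that] by (simp add: gpair_dpts_iff)
  show "gpair (f n (gpush (scl V) m \<rho> x)) (g n (gpush (scl V) m \<rho> x)) =
      gpush (scl (ssum W X)) m \<rho> (gpair (f m x) (g m x))" if "Grass_hom m n \<rho>" "x \<in> dpts V D m" for m n \<rho> x
    unfolding gpush_gpair[OF W X] supersmoothD(4)[OF f that] supersmoothD(4)[OF g that] by (rule refl)
  have gl: "glinear (\<lambda>x :: 'c gr. \<lambda>I. (x I, 0 :: 'd))" "glinear (\<lambda>x :: 'd gr. \<lambda>I. (0 :: 'c, x I))"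
    by (intro glinear_map bounded_linear_Pair bounded_linear_ident bounded_linear_zero)+
  have split: "gpair x y = (\<lambda>I. (x I, 0) + (0, y I))" for x :: "'c gr" and y :: "'d gr"
    by (simp add: gpair_def)
  show "Ck_on k (spts V n) (dpts V D n) (\<lambda>x. gpair (f n x) (g n x))" for k n
    unfolding split
    by (rule Ck_on_add[OF Ck_on_glinear[OF gl(1) supersmoothD(5)[OF f]] Ck_on_glinear[OF gl(2) supersmoothD(5)[OF g]]])
  fix n x assume x: "x \<in> dpts V D n"
  obtain L where L: "\<And>h. h \<in> spts V n \<Longrightarrow> has_dir_deriv (f n) x h (L h)" "even_linear V W n L"
    using supersmoothD(6)[OF f x] by blast
  obtain M where M: "\<And>h. h \<in> spts V n \<Longrightarrow> has_dir_deriv (g n) x h (M h)" "even_linear V X n M"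
    using supersmoothD(6)[OF g x] by blast
  have "has_dir_deriv (\<lambda>x. gpair (f n x) (g n x)) x h (gpair (L h) (M h))" if "h \<in> spts V n" for h
    using L(1)[OF that] M(1)[OF that] unfolding has_dir_deriv_gderiv gderiv_def gpair_def
    by (simp add: has_vector_derivative_Pair)
  moreover have "even_linear V (ssum W X) n (\<lambda>h. gpair (L h) (M h))"
    unfolding even_linear_def gsmult_gpair[OF W X]
    by (simp add: even_linearD[OF L(2)] even_linearD[OF M(2)]) (simp add: gpair_def)
  ultimately show "\<exists>L. (\<forall>h\<in>spts V n. has_dir_deriv (\<lambda>x. gpair (f n x) (g n x)) x h (L h)) \<and> even_linear V (ssum W X) n L"
    by (intro exI[of _ "\<lambda>h. gpair (L h) (M h)"]) simp
qed

lemma supersmooth_add: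
  assumes V: "vector_superspace V" and W: "vector_superspace W"
    and f: "supersmooth V D W D1 f" and g: "supersmooth V D W D2 g"
  shows "supersmooth V D W (ev W) (\<lambda>n x I. f n x I + g n x I)"
proof (rule supersmoothI[OF supersmoothD(1)[OF f] openin_subtopology_self])
  show "(\<lambda>I. f n x I + g n x I) \<in> dpts W (ev W) n" if "x \<in> dpts V D n" for n x
    using spts_add[OF W dpts_spts[OF supersmoothD(3)[OF f that]] dpts_spts[OF supersmoothD(3)[OF g that]]] spts_empty
    by (auto simp: dpts_def)
  show "(\<lambda>I. f n (gpush (scl V) m \<rho> x) I + g n (gpush (scl V) m \<rho> x) I) =
      gpush (scl W) m \<rho> (\<lambda>I. f m x I + g m x I)" if "Grass_hom m n \<rho>" "x \<in> dpts V D m" for m n \<rho> x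
    by (simp add: supersmoothD(4)[OF f that] supersmoothD(4)[OF g that] gpush_add[OF vector_superspaceD(1)[OF W]])
  show "Ck_on k (spts V n) (dpts V D n) (\<lambda>x I. f n x I + g n x I)" for k n
    by (intro Ck_on_add supersmoothD(5)[OF f] supersmoothD(5)[OF g])
  fix n x assume x: "x \<in> dpts V D n"
  obtain L where L: "\<And>h. h \<in> spts V n \<Longrightarrow> has_dir_deriv (f n) x h (L h)" "even_linear V W n L"
    using supersmoothD(6)[OF f x] by blast
  obtain M where M: "\<And>h. h \<in> spts V n \<Longrightarrow> has_dir_deriv (g n) x h (M h)" "even_linear V W n M"
    using supersmoothD(6)[OF g x] by blast
  show "\<exists>L. (\<forall>h\<in>spts V n. has_dir_deriv (\<lambda>x I. f n x I + g n x I) x h (L h)) \<and> even_linear V W n L"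
    using L(1) M(1)
    by (intro exI[of _ "\<lambda>h I. L h I + M h I"])
      (simp add: has_dir_deriv_gderiv gderiv_add even_linear_def even_linearD[OF L(2)] even_linearD[OF M(2)]
        gsmult_add_right[OF vector_superspaceD(1)[OF W]] add_ac)
qed

text \<open>The subsets of a finite \<open>J\<close> label the terms of the product at
  \<open>J\<close>; for infinite \<open>J\<close> the product vanishes, which is the empty
  sum.\<close>

lemma gbilinear_gsmult:
  assumes V: "vector_superspace V"
  shows "gbilinear (gsmult (scl V))"
  unfolding gbilinear_def
proof
  fix J :: "nat set"
  interpret V: module "scl V" by (rule vector_superspace_module[OF V])
  have bil: "bounded_bilinear (\<lambda>a v. scl V (c * a) v)" for c
  proof -
    have "scl V (c * (r *\<^sub>R a)) v = r *\<^sub>R scl V (c * a) v" "scl V (c * a) (r *\<^sub>R v) = r *\<^sub>R scl V (c * a) v" for r a v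
      unfolding vector_superspaceD(2)[OF V, symmetric] scaleR_conv_of_real[of r a]
      by (simp_all add: mult_ac)
    then have "bilinear (\<lambda>a v. scl V (c * a) v)"
      unfolding bilinear_def
      by (intro conjI allI linearI) (simp_all add: V.scale_right_distrib V.scale_left_distrib distrib_left)
    then show ?thesis by (simp only: bilinear_conv_bounded_bilinear)
  qed
  show "\<exists>(S :: nat set set) p q \<beta>. finite S \<and> (\<forall>i\<in>S. bounded_bilinear (\<beta> i)) \<and>
      (\<forall>x y. gsmult (scl V) x y J = (\<Sum>i\<in>S. \<beta> i (x (p i)) (y (q i))))"
  proof (cases "finite J")
    case True
    then show ?thesis
      by (intro exI[of _ "Pow J"] exI[of _ "\<lambda>I. I"] exI[of _ "\<lambda>I. J - I"] exI[of _ "\<lambda>I a v. scl V (gsgn I (J - I) * a) v"])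
        (simp add: gsmult_def bil)
  next
    case False
    then show ?thesis by (intro exI[of _ "{}"]) simp
  qed
qed

lemma gsmult_commute:
  assumes "vector_space sc" "a \<in> Grass_even n"
  shows "gsmult sc a (gsmult sc b x) = gsmult sc b (gsmult sc a x)"
  by (simp add: gsmult_assoc[OF assms(1), symmetric] Grass_even_commute[OF assms(2)])

text \<open>The differential is \<open>f * M h + L h * g\<close> by the product rule. An even scalar
  can be pulled out of the first summand because even elements are central.\<close>

lemma supersmooth_gsmult:
  assumes V: "vector_superspace V" and W: "vector_superspace W"
    and f: "supersmooth V D sfield D1 f" and g: "supersmooth V D W D2 g"
  shows "supersmooth V D W (ev W) (\<lambda>n x. gsmult (scl W) (f n x) (g n x))"
proof (rule supersmoothI[OF supersmoothD(1)[OF f] openin_subtopology_self])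
  have fe: "f n x \<in> Grass_even n" if "x \<in> dpts V D n" for n x
    using dpts_spts[OF supersmoothD(3)[OF f that]] by (simp add: spts_sfield)
  note Ws = vector_superspaceD(1)[OF W]
  show "gsmult (scl W) (f n x) (g n x) \<in> dpts W (ev W) n" if "x \<in> dpts V D n" for n x
    using gsmult_spts[OF W fe[OF that] dpts_spts[OF supersmoothD(3)[OF g that]]] spts_empty
    by (auto simp: dpts_def)
  show "gsmult (scl W) (f n (gpush (scl V) m \<rho> x)) (g n (gpush (scl V) m \<rho> x)) =
      gpush (scl W) m \<rho> (gsmult (scl W) (f m x) (g m x))" if "Grass_hom m n \<rho>" "x \<in> dpts V D m" for m n \<rho> x
    using Grass_even_gsupported[OF fe[OF that(2)]] spts_gsupported[OF dpts_spts[OF supersmoothD(3)[OF g that(2)]]]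
    by (simp add: supersmoothD(4)[OF f that] supersmoothD(4)[OF g that] gpush_gsmult[OF that(1) Ws] Grass_hom_gpush[OF that(1)])
  show "Ck_on k (spts V n) (dpts V D n) (\<lambda>x. gsmult (scl W) (f n x) (g n x))" for k n
    by (rule Ck_on_gbilinear[OF gbilinear_gsmult[OF W] supersmoothD(5)[OF f] supersmoothD(5)[OF g]])
  fix n x assume x: "x \<in> dpts V D n"
  obtain L where L: "\<And>h. h \<in> spts V n \<Longrightarrow> has_dir_deriv (f n) x h (L h)" "even_linear V sfield n L"
    using supersmoothD(6)[OF f x] by blast
  obtain M where M: "\<And>h. h \<in> spts V n \<Longrightarrow> has_dir_deriv (g n) x h (M h)" "even_linear V W n M"
    using supersmoothD(6)[OF g x] by blast
  let ?L = "\<lambda>h I. gsmult (scl W) (f n x) (M h) I + gsmult (scl W) (L h) (g n x) I"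
  have "has_dir_deriv (\<lambda>x. gsmult (scl W) (f n x) (g n x)) x h (?L h)" if "h \<in> spts V n" for h
    using gderiv_gbilinear[OF gbilinear_gsmult[OF W], of "\<lambda>t. f n (\<lambda>J. x J + t *\<^sub>R h J)" "L h"
        "\<lambda>t. g n (\<lambda>J. x J + t *\<^sub>R h J)" "M h"] L(1)[OF that] M(1)[OF that]
    by (simp add: has_dir_deriv_gderiv)
  moreover have "even_linear V W n ?L"
    unfolding even_linear_def
    using gsmult_commute[OF Ws fe[OF x], of _ "M _"]
    by (simp add: even_linearD[OF L(2)] even_linearD[OF M(2)] gsmult_add_right[OF Ws] gsmult_add_left[OF Ws]
        gsmult_assoc[OF Ws] add_ac)
  ultimately show "\<exists>L. (\<forall>h\<in>spts V n. has_dir_deriv (\<lambda>x. gsmult (scl W) (f n x) (g n x)) x h (L h)) \<and> even_linear V W n L"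
    by (intro exI[of _ ?L]) simp
qed

section \<open>Inversion of units as a supersmooth map\<close>

lemma ginv_component:
  assumes a: "a \<in> Grass_units n" and K: "finite K"
  shows "ginv n a K = (gconst 1 K - (\<Sum>I\<in>Pow K - {{}}. gsgn I (K - I) * a I * ginv n a (K - I))) / a {}"
proof -
  have "gconst 1 K = (\<Sum>I\<in>Pow K. gsgn I (K - I) * a I * ginv n a (K - I))"
    using fun_cong[OF gmult_ginv[OF a], of K] by (simp add: gsmult_def)
  also have "\<dots> = a {} * ginv n a K + (\<Sum>I\<in>Pow K - {{}}. gsgn I (K - I) * a I * ginv n a (K - I))"
    using K by (subst sum.remove[of _ "{}"]) auto
  finally show ?thesis using a by (simp add: Grass_units_iff field_simps)
qed

text \<open>Solving a b = 1 for the coefficient of b at \<open>K\<close> expresses it rationally by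
  coefficients of a and by coefficients of b at proper subsets of \<open>K\<close>, with the
  constant term of a as the only denominator. This permits induction over \<open>K\<close>.\<close>

lemma continuous_on_ginv: "continuous_on (Grass_units n) (ginv n)"
proof (rule continuous_on_coordinatewise_then_product)
  fix K :: "nat set"
  show "continuous_on (Grass_units n) (\<lambda>a :: 'a gr. ginv n a K)"
  proof (cases "finite K")
    case True
    then show ?thesis
    proof (induction K rule: finite_psubset_induct)
      case (psubset K)
      have comp: "continuous_on (Grass_units n) (\<lambda>a :: 'a gr. a I)" for I
        by (rule continuous_on_subset[OF continuous_on_product_coordinates]) simp
      have "continuous_on (Grass_units n) (\<lambda>a :: 'a gr. (gconst 1 K -
          (\<Sum>I\<in>Pow K - {{}}. gsgn I (K - I) * a I * ginv n a (K - I))) / a {})"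
      proof (intro continuous_on_divide continuous_on_diff continuous_on_sum continuous_on_mult continuous_on_const)
        show "continuous_on (Grass_units n) (\<lambda>a :: 'a gr. a I)" for I by (rule comp)
        show "continuous_on (Grass_units n) (\<lambda>a :: 'a gr. a {})" by (rule comp)
        show "continuous_on (Grass_units n) (\<lambda>a :: 'a gr. ginv n a (K - I))" if "I \<in> Pow K - {{}}" for I
          using that by (intro psubset.IH) auto
        show "\<forall>a\<in>Grass_units n. a {} \<noteq> (0 :: 'a)" by (simp add: Grass_units_iff)
      qed
      with continuous_on_cong[OF refl ginv_component[OF _ psubset.hyps(1)]] show ?case by (rule iffD2)
    qed
  next
    case False
    have "ginv n a K = 0" if "a \<in> Grass_units n" for a :: "'a gr"
      using gsupported_infinite[OF Grass_even_gsupported[OF ginv_even[OF that]] False] by simp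
    from continuous_on_cong[OF refl this] continuous_on_const show ?thesis by (rule iffD2)
  qed
qed

text \<open>\<open>b - b\<^sub>0 = - b (a - a\<^sub>0) b\<^sub>0\<close> for the inverses \<open>b\<close>, \<open>b\<^sub>0\<close> of \<open>a\<close>, \<open>a\<^sub>0\<close>: the difference quotients of the
  inverse are continuous.\<close>

lemma has_dir_deriv_ginv:
  fixes a :: "'k::{real_normed_field, euclidean_space} gr"
  assumes a: "a \<in> Grass_units n" and h: "h \<in> Grass_even n"
  shows "has_dir_deriv (ginv n) a h (gmult (ginv n a) (gmult (\<lambda>I. - h I) (ginv n a)))"
proof -
  let ?p = "\<lambda>t I. a I + t *\<^sub>R h I"
  note hv = vector_superspace_sfield
  have op: "openin (top_of_set (spts sfield n)) (Grass_units n :: 'k gr set)"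
    unfolding Grass_units_eq by (intro openin_dpts) (simp add: open_Compl)
  have u: "eventually (\<lambda>t. ?p t \<in> Grass_units n) (nhds 0)"
    using h by (intro eventually_line[OF gsubspace_spts[OF hv] op a]) (simp add: spts_sfield)
  let ?h = "\<lambda>I. - h I"
  have h': "?h \<in> Grass_even n" using Grass_even_scale[OF h, of "- 1"] by simp
  define c where "c t = gmult (ginv n (?p t)) (gmult ?h (ginv n a))" for t
  \<comment> \<open>An exact formula for the increment: t times a factor \<open>c t\<close> that is
    continuous at 0, so that the derivative can be read off.\<close>
  have lin: "ginv n (?p t) I = ginv n a I + t *\<^sub>R c t I" if t: "?p t \<in> Grass_units n" for t I
  proof -
    let ?b = "ginv n (?p t)" and ?c = "ginv n a"
    have "gmult ?b (gmult (?p t) ?c) = ?c"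
      by (simp only: gmult_assoc[symmetric] ginv_gmult[OF t] gmult_one[OF Grass_even_gsupported[OF ginv_even[OF a]]])
    moreover have "gmult (?p t) ?c = (\<lambda>I. gconst 1 I - t *\<^sub>R gmult ?h ?c I)"
    proof -
      have "?p t = (\<lambda>I. a I - of_real t * ?h I)" by (simp add: scaleR_conv_of_real)
      then show ?thesis
        by (simp only: gsmult_diff_left[OF vector_space_mult] gsmult_scale_left[OF vector_space_mult] gmult_ginv[OF a]
            scaleR_conv_of_real)
    qed
    moreover have "gmult ?b (\<lambda>I. gconst 1 I - of_real t * gmult ?h ?c I) = (\<lambda>I. ?b I - of_real t * c t I)"
      by (simp only: gsmult_diff_right[OF vector_space_mult] gsmult_scale_right[OF vector_space_mult] c_def
          gmult_one_right[OF Grass_even_gsupported[OF ginv_even[OF t]]])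
    ultimately have "?c = (\<lambda>I. ?b I - of_real t * c t I)" by (simp only: scaleR_conv_of_real)
    then have "?c I = ?b I - of_real t * c t I" by (rule fun_cong)
    then show ?thesis by (simp add: scaleR_conv_of_real)
  qed
  have c0: "c 0 = gmult (ginv n a) (gmult ?h (ginv n a))" by (simp add: c_def)
  have "gderiv (\<lambda>t. ginv n (?p t)) (c 0)"
    unfolding gderiv_def
  proof
    fix I
    have tl: "((\<lambda>t. c t I) \<longlongrightarrow> c 0 I) (nhds 0)"
    proof -
      have "continuous_on (Grass_units n) (\<lambda>x. gmult (ginv n x) (gmult ?h (ginv n a)) I)"
        by (rule continuous_on_product_then_coordinatewise[OF
              continuous_on_gbilinear[OF gbilinear_gsmult[OF hv, unfolded sfield_simps] continuous_on_ginv continuous_on_const]])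
      note cont = continuous_on_topological[THEN iffD1, rule_format, OF this a]
      show ?thesis
      proof (rule topological_tendstoI)
        fix B assume B: "open B" "c 0 I \<in> B"
        obtain A where A: "open A" "a \<in> A"
            "\<forall>y\<in>Grass_units n. y \<in> A \<longrightarrow> gmult (ginv n y) (gmult ?h (ginv n a)) I \<in> B"
          using cont[OF B(1)] B(2) unfolding c0 by blast
        have "eventually (\<lambda>t. ?p t \<in> A) (nhds 0)"
          using A(1,2) gderiv_tendsto[OF gderiv_line[of a h]] by (intro eventually_open_gr[of _ a]) auto
        with u show "eventually (\<lambda>t. c t I \<in> B) (nhds 0)"
          by eventually_elim (use A(3) in \<open>auto simp: c_def\<close>)
      qed
    qed
    \<comment> \<open>The product t c(t) has derivative c(0) at 0 as soon as c is continuous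
      there.\<close>
    have "((\<lambda>t. t *\<^sub>R c t I) has_vector_derivative c 0 I) (at 0)"
      unfolding has_vector_derivative_def has_derivative_at_alt
    proof (intro conjI allI impI bounded_linear_scaleR_left)
      fix e :: real assume "e > 0"
      then have "eventually (\<lambda>t. dist (c t I) (c 0 I) < e) (nhds 0)" by (rule tendstoD[OF tl])
      then obtain d where d: "d > 0" "\<And>t. \<bar>t\<bar> < d \<Longrightarrow> dist (c t I) (c 0 I) < e"
        by (auto simp: eventually_nhds_metric)
      have "norm (t *\<^sub>R c t I - t *\<^sub>R c 0 I) \<le> e * \<bar>t\<bar>" if "\<bar>t\<bar> < d" for t
        using mult_left_mono[OF less_imp_le[OF d(2)[OF that]], of "\<bar>t\<bar>"]
        by (simp add: dist_norm mult.commute flip: scaleR_diff_right)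
      then show "\<exists>d>0. \<forall>y. norm (y - 0) < d \<longrightarrow>
          norm (y *\<^sub>R c y I - 0 *\<^sub>R c 0 I - (y - 0) *\<^sub>R c 0 I) \<le> e * norm (y - 0)"
        using d(1) by auto
    qed
    from has_vector_derivative_add[OF has_vector_derivative_const[of "ginv n a I"] this]
    have "((\<lambda>t. ginv n a I + t *\<^sub>R c t I) has_vector_derivative c 0 I) (at 0)" by simp
    moreover have "eventually (\<lambda>t. t \<in> UNIV \<longrightarrow> ginv n a I + t *\<^sub>R c t I = ginv n (?p t) I) (nhds 0)"
      using u by (rule eventually_mono) (simp add: lin)
    ultimately show "((\<lambda>t. ginv n (?p t) I) has_vector_derivative c 0 I) (at 0)"
      using has_vector_derivative_cong_ev[of UNIV "\<lambda>t. ginv n a I + t *\<^sub>R c t I" "\<lambda>t. ginv n (?p t) I" 0 "c 0 I"]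
      by simp
  qed
  then show ?thesis unfolding c0 has_dir_deriv_gderiv .
qed

text \<open>The derivative of inversion is a bilinear expression in inversion itself, so continuity
  bootstraps to all orders.\<close>

lemma supersmooth_ginv: "supersmooth (sfield :: ('k::{real_normed_field, euclidean_space}, 'k) sspace) (- {0}) sfield (- {0}) ginv"
proof (rule supersmoothI)
  note hv = vector_superspace_sfield
  note gb = gbilinear_gsmult[OF hv, unfolded sfield_simps]
  show "openin (top_of_set (ev sfield)) (- {0 :: 'k})" "openin (top_of_set (ev sfield)) (- {0 :: 'k})"
    by (simp_all add: open_Compl)
  show "ginv n x \<in> dpts sfield (- {0}) n" if "x \<in> dpts sfield (- {0}) n" for n and x :: "'k gr"
    using that ginv_units by (simp add: Grass_units_eq[symmetric])
  show "ginv n (gpush (scl sfield) m \<rho> x) = gpush (scl sfield) m \<rho> (ginv m x)"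
    if "Grass_hom m n \<rho>" "x \<in> dpts sfield (- {0}) m" for m n \<rho> and x :: "'k gr"
  proof -
    have x: "x \<in> Grass_units m" using that(2) by (simp add: Grass_units_eq)
    then show ?thesis
      using Grass_hom_ginv[OF that(1) x] Grass_even_gsupported[OF ginv_even[OF x]] Grass_even_gsupported[OF Grass_units_even[OF x]]
      by (simp add: Grass_hom_gpush[OF that(1)])
  qed
  show "Ck_on k (spts sfield n) (dpts sfield (- {0}) n) (ginv n :: 'k gr \<Rightarrow> 'k gr)" for k n
    unfolding Grass_units_eq[symmetric] spts_sfield
  proof (induction k)
    case 0
    show ?case by (simp add: continuous_on_ginv)
  next
    case (Suc k)
    show ?case unfolding Ck_on.simps(2)
    proof (intro conjI ballI continuous_on_ginv)
      fix h :: "'k gr" assume h: "h \<in> Grass_even n"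
      have "Ck_on k (Grass_even n) (Grass_units n) (\<lambda>a. gmult (ginv n a) (gmult (\<lambda>I. - h I) (ginv n a)))"
        by (intro Ck_on_gbilinear[OF gb] Suc Ck_on_const)
      then show "\<exists>g. (\<forall>x\<in>Grass_units n. has_dir_deriv (ginv n) x h (g x)) \<and> Ck_on k (Grass_even n) (Grass_units n) g"
        using has_dir_deriv_ginv[OF _ h]
        by (intro exI[of _ "\<lambda>a. gmult (ginv n a) (gmult (\<lambda>I. - h I) (ginv n a))"]) simp
    qed
  qed
  fix n and x :: "'k gr" assume "x \<in> dpts sfield (- {0}) n"
  then have x: "x \<in> Grass_units n" by (simp add: Grass_units_eq)
  let ?L = "\<lambda>h. gmult (ginv n x) (gmult (\<lambda>I. - h I) (ginv n x))"
  have neg: "(\<lambda>I. - gmult a h I) = gmult a (\<lambda>I. - h I)" for a h :: "'k gr"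
    by (simp add: gsmult_def sum_negf)
  have "even_linear sfield sfield n ?L"
    unfolding even_linear_def sfield_simps neg
    using gsmult_commute[OF vector_space_mult ginv_even[OF x]]
    by (simp add: gmult_assoc gsmult_add_left[OF vector_space_mult] gsmult_add_right[OF vector_space_mult] spts_sfield)
      (simp add: gsmult_def algebra_simps sum.distrib sum_subtractf sum_negf)
  then show "\<exists>L. (\<forall>h\<in>spts sfield n. has_dir_deriv (ginv n) x h (L h)) \<and> even_linear sfield sfield n L"
    using has_dir_deriv_ginv[OF x] by (intro exI[of _ ?L]) (simp add: spts_sfield)
qed

section \<open>Charts\<close>

abbreviation cpt :: "('k, 'x, 'm) chart \<Rightarrow> 'x \<Rightarrow> 'm" where
  "cpt c x \<equiv> cmap c 0 x {}"

lemma gfunctorD: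
  assumes "is_gfunctor F"
  shows "Grass_hom m n \<rho> \<Longrightarrow> x \<in> pts F m \<Longrightarrow> act F m n \<rho> x \<in> pts F n"
    and "Grass_hom n n \<rho> \<Longrightarrow> (\<And>a. a \<in> Grass n \<Longrightarrow> \<rho> a = a) \<Longrightarrow> x \<in> pts F n \<Longrightarrow> act F n n \<rho> x = x"
    and "Grass_hom l m \<rho> \<Longrightarrow> Grass_hom m n \<sigma> \<Longrightarrow> Grass_hom l n \<tau> \<Longrightarrow>
      (\<And>a. a \<in> Grass l \<Longrightarrow> \<tau> a = \<sigma> (\<rho> a)) \<Longrightarrow> x \<in> pts F l \<Longrightarrow> act F l n \<tau> x = act F m n \<sigma> (act F l m \<rho> x)"
  using assms unfolding is_gfunctor_def by (blast, blast, blast)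

lemma rpts_pts: "x \<in> rpts F U n \<Longrightarrow> x \<in> pts F n"
  and rpts_body: "x \<in> rpts F U n \<Longrightarrow> act F n 0 gaug x \<in> U"
  and rptsI: "x \<in> pts F n \<Longrightarrow> act F n 0 gaug x \<in> U \<Longrightarrow> x \<in> rpts F U n"
  by (simp_all add: rpts_def)

lemma rpts_mono: "U \<subseteq> U' \<Longrightarrow> x \<in> rpts F U n \<Longrightarrow> x \<in> rpts F U' n"
  by (auto simp: rpts_def)

context
  fixes F :: "('k::{real_normed_field, euclidean_space}, 'x, 'z) gfunctor_scheme"
  assumes F: "is_gfunctor F"
begin

lemma act_gaug_0: "x \<in> pts F 0 \<Longrightarrow> act F 0 0 gaug x = x"
  by (rule gfunctorD(2)[OF F gaug_hom]) (simp_all add: Grass_eq gaug_def spts_0[symmetric])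

lemma rpts_0: "U \<subseteq> pts F 0 \<Longrightarrow> rpts F U 0 = U"
  using act_gaug_0 by (auto simp: rpts_def)

text \<open>Homomorphisms preserve the constant terms of scalars, so augmenting after \<rho> is the
  same as augmenting at once: moving a point along \<rho> does not change its underlying ordinary
  point.\<close>

lemma act_gaug_act:
  assumes "Grass_hom m n \<rho>" "x \<in> pts F m"
  shows "act F n 0 gaug (act F m n \<rho> x) = act F m 0 gaug x"
proof -
  have "gaug a = gaug (\<rho> a)" if "a \<in> Grass m" for a
    using gpush_body[OF assms(1) vector_space_mult, of a] Grass_hom_gpush[OF assms(1), of a] that
    by (simp add: gaug_def Grass_eq)
  then show ?thesis
    by (rule gfunctorD(3)[OF F assms(1) gaug_hom gaug_hom _ assms(2), symmetric])
qed

lemma act_rpts: "Grass_hom m n \<rho> \<Longrightarrow> x \<in> rpts F U m \<Longrightarrow> act F m n \<rho> x \<in> rpts F U n"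
  by (simp add: rpts_def gfunctorD(1)[OF F] act_gaug_act)

context
  fixes c :: "('k, 'x, 'm::euclidean_space) chart"
  assumes c: "is_chart F c"
begin

lemma chart_dom: "cdom c \<subseteq> pts F 0"
  and chart_model: "vector_superspace (cmodel c)"
  and chart_open: "openin (top_of_set (ev (cmodel c))) (cimg c)"
  and chart_bij: "bij_betw (cmap c n) (rpts F (cdom c) n) (dpts (cmodel c) (cimg c) n)"
  and chart_nat: "Grass_hom m n \<rho> \<Longrightarrow> x \<in> rpts F (cdom c) m \<Longrightarrow>
    cmap c n (act F m n \<rho> x) = gpush (scl (cmodel c)) m \<rho> (cmap c m x)"
  using c unfolding is_chart_def by blast+

lemma chart_in: "x \<in> rpts F (cdom c) n \<Longrightarrow> cmap c n x \<in> dpts (cmodel c) (cimg c) n"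
  using chart_bij by (rule bij_betwE[THEN bspec])

lemma chart_inj: "x \<in> rpts F (cdom c) n \<Longrightarrow> y \<in> rpts F (cdom c) n \<Longrightarrow> cmap c n x = cmap c n y \<Longrightarrow> x = y"
  using bij_betw_imp_inj_on[OF chart_bij] by (rule inj_onD)

lemma cinv_cmap: "x \<in> rpts F (cdom c) n \<Longrightarrow> cinv F c n (cmap c n x) = x"
  unfolding cinv_def by (rule inv_into_f_f[OF bij_betw_imp_inj_on[OF chart_bij]])

lemma cdom_rpts: "x \<in> cdom c \<Longrightarrow> x \<in> rpts F (cdom c) 0"
  using rpts_0[OF chart_dom] by simp

lemma cpt_gaug:
  assumes "x \<in> rpts F (cdom c) n"
  shows "cmap c n x {} = cpt c (act F n 0 gaug x)"
  using chart_nat[OF gaug_hom assms] by (simp add: gpush_gaug vector_superspaceD chart_model)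

lemma cmap_gconst: "x \<in> cdom c \<Longrightarrow> cmap c 0 x = gconst (cpt c x)"
  by (rule spts_0[OF spts_gsupported[OF dpts_spts[OF chart_in[OF cdom_rpts]]]])

lemma cpt_in: "x \<in> cdom c \<Longrightarrow> cpt c x \<in> cimg c"
  using chart_in[OF cdom_rpts] by (simp add: dpts_def)

lemma cpt_inj:
  assumes x: "x \<in> cdom c" and y: "y \<in> cdom c" and eq: "cpt c x = cpt c y"
  shows "x = y"
  by (rule chart_inj[OF cdom_rpts[OF x] cdom_rpts[OF y]])
    (rule trans[OF cmap_gconst[OF x] trans[OF arg_cong[where f = gconst, OF eq] cmap_gconst[OF y, symmetric]]])

lemma cpt_mem_cbody: "x \<in> cdom c \<Longrightarrow> S \<subseteq> cdom c \<Longrightarrow> cpt c x \<in> cbody c S \<longleftrightarrow> x \<in> S"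
  unfolding cbody_def using cpt_inj by blast

lemma cinv_gconst:
  assumes "x \<in> cdom c"
  shows "cinv F c 0 (gconst (cpt c x)) = x"
  unfolding cmap_gconst[OF assms, symmetric] by (rule cinv_cmap[OF cdom_rpts[OF assms]])

lemma cbody_cdom: "cbody c (cdom c) = cimg c"
proof
  show "cbody c (cdom c) \<subseteq> cimg c" unfolding cbody_def using cpt_in by blast
  show "cimg c \<subseteq> cbody c (cdom c)"
  proof
    fix y assume y: "y \<in> cimg c"
    have "gconst y \<in> dpts (cmodel c) (cimg c) 0"
      using openin_imp_subset[OF chart_open] by (rule gconst_dpts[OF chart_model y])
    then obtain x where "x \<in> rpts F (cdom c) 0" "cmap c 0 x = gconst y"
      using bij_betw_imp_surj_on[OF chart_bij, of 0] by (metis imageE)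
    then show "y \<in> cbody c (cdom c)"
      unfolding cbody_def rpts_0[OF chart_dom] by (intro image_eqI[of _ _ x]) simp_all
  qed
qed

text \<open>A chart is given as a bijection over its full domain. Its compatibility with the
  augmentation shows that it matches the points over a smaller set \<open>S\<close> with the points
  over the chart image of \<open>S\<close>.\<close>

lemma
  assumes "S \<subseteq> cdom c" "y \<in> dpts (cmodel c) (cbody c S) n"
  shows cinv_rpts: "cinv F c n y \<in> rpts F S n" and cmap_cinv: "cmap c n (cinv F c n y) = y"
proof -
  have "cbody c S \<subseteq> cimg c" unfolding cbody_cdom[symmetric] cbody_def using assms(1) by (rule image_mono)
  then have y: "y \<in> dpts (cmodel c) (cimg c) n" using assms(2) by (rule dpts_mono)
  then have "y \<in> cmap c n ` rpts F (cdom c) n" using bij_betw_imp_surj_on[OF chart_bij] by simp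
  then have 1: "cinv F c n y \<in> rpts F (cdom c) n" "cmap c n (cinv F c n y) = y"
    unfolding cinv_def by (rule inv_into_into, rule f_inv_into_f)
  then show "cmap c n (cinv F c n y) = y" by simp
  have "cpt c (act F n 0 gaug (cinv F c n y)) \<in> cbody c S"
    using cpt_gaug[OF 1(1)] 1(2) assms(2) by (simp add: dpts_def)
  then have "act F n 0 gaug (cinv F c n y) \<in> S"
    by (simp add: cpt_mem_cbody[OF rpts_body[OF 1(1)] assms(1)])
  then show "cinv F c n y \<in> rpts F S n" by (rule rptsI[OF rpts_pts[OF 1(1)]])
qed

lemma cinv_in: "y \<in> dpts (cmodel c) (cimg c) n \<Longrightarrow> cinv F c n y \<in> rpts F (cdom c) n"
  and cmap_cinv_in: "y \<in> dpts (cmodel c) (cimg c) n \<Longrightarrow> cmap c n (cinv F c n y) = y"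
  using cinv_rpts[OF order_refl] cmap_cinv[OF order_refl] unfolding cbody_cdom by blast+

lemma cinv_nat:
  assumes "Grass_hom m n \<rho>" "y \<in> dpts (cmodel c) (cimg c) m"
  shows "cinv F c n (gpush (scl (cmodel c)) m \<rho> y) = act F m n \<rho> (cinv F c m y)"
  using chart_nat[OF assms(1) cinv_in[OF assms(2)]] cinv_cmap[OF act_rpts[OF assms(1) cinv_in[OF assms(2)]]]
  by (simp add: cmap_cinv_in[OF assms(2)])

end

end

section \<open>Supermanifolds without separation axioms\<close>

text \<open>Charts, products and smooth maps are handled at this level; the separation axioms are
  verified afterwards, when open sets have been described through charts.\<close>

definition premfd :: "('k::{real_normed_field, euclidean_space}, 'x, 'm::euclidean_space) smfd \<Rightarrow> bool" where
  "premfd M \<longleftrightarrow>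
     is_gfunctor M \<and> (\<forall>c\<in>charts M. is_chart M c) \<and> \<Union> (cdom ` charts M) = pts M 0 \<and>
     (\<forall>c\<in>charts M. \<forall>d\<in>charts M.
        supersmooth (cmodel c) (cbody c (cdom c \<inter> cdom d)) (cmodel d) (cimg d)
          (\<lambda>n y. cmap d n (cinv M c n y)))"

lemma supermanifold_iff:
  "supermanifold M \<longleftrightarrow> premfd M \<and> Hausdorff_space (mtop M) \<and> second_countable (mtop M)"
  unfolding supermanifold_def premfd_def by blast

lemma premfdD:
  assumes "premfd M"
  shows "is_gfunctor M" "c \<in> charts M \<Longrightarrow> is_chart M c" "x \<in> pts M 0 \<Longrightarrow> \<exists>c\<in>charts M. x \<in> cdom c"
    "c \<in> charts M \<Longrightarrow> d \<in> charts M \<Longrightarrow> supersmooth (cmodel c) (cbody c (cdom c \<inter> cdom d)) (cmodel d) (cimg d)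
          (\<lambda>n y. cmap d n (cinv M c n y))"
  using assms unfolding premfd_def by (blast, blast, blast, blast)

context
  fixes M :: "('k::{real_normed_field, euclidean_space}, 'x, 'm::euclidean_space) smfd"
  assumes M: "premfd M"
begin

lemma M_chart: "c \<in> charts M \<Longrightarrow> is_chart M c"
  by (rule premfdD(2)[OF M])

lemma transition_body:
  assumes "c \<in> charts M" "d \<in> charts M" "x \<in> cdom c"
  shows "fbody (\<lambda>n y. cmap d n (cinv M c n y)) (cpt c x) = cpt d x"
  by (simp add: fbody_def cinv_gconst[OF premfdD(1)[OF M] M_chart[OF assms(1)] assms(3)])

lemma chart_generator_open:
  assumes c: "c \<in> charts M" and d: "d \<in> charts M" and D: "openin (top_of_set (ev (cmodel d))) D"
  shows "openin (top_of_set (ev (cmodel c))) (cbody c (cdom c \<inter> {x \<in> cdom d. cpt d x \<in> D}))"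
proof -
  have "cbody c (cdom c \<inter> {x \<in> cdom d. cpt d x \<in> D}) =
      {y \<in> cbody c (cdom c \<inter> cdom d). fbody (\<lambda>n y. cmap d n (cinv M c n y)) y \<in> D}"
    unfolding cbody_def using transition_body[OF c d] by auto
  then show ?thesis
    using openin_fbody_vimage[OF chart_model[OF premfdD(1)[OF M] M_chart[OF c]] premfdD(4)[OF M c d] D] by simp
qed

lemma cbody_Int:
  "c \<in> charts M \<Longrightarrow> A \<subseteq> cdom c \<Longrightarrow> B \<subseteq> cdom c \<Longrightarrow> cbody c (A \<inter> B) = cbody c A \<inter> cbody c B"
  unfolding cbody_def using cpt_inj[OF premfdD(1)[OF M] M_chart]
  by (intro inj_on_image_Int[of _ "cdom c"]) (auto simp: inj_on_def)

lemma mtop_chart_open: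
  assumes c: "c \<in> charts M" and D: "openin (top_of_set (ev (cmodel c))) D"
  shows "openin (mtop M) {x \<in> cdom c. cpt c x \<in> D}"
proof -
  have "{x \<in> cdom c. cpt c x \<in> D} = {x \<in> cdom c. cpt c x \<in> D \<inter> cimg c}"
    using cpt_in[OF premfdD(1)[OF M] M_chart[OF c]] by auto
  moreover have "openin (top_of_set (ev (cmodel c))) (D \<inter> cimg c)"
    using D chart_open[OF premfdD(1)[OF M] M_chart[OF c]] by (rule openin_Int)
  ultimately show ?thesis
    unfolding mtop_def using c by (intro topology_generated_by_Basis) blast
qed

text \<open>The topology is defined by generators, and the description by chart images makes it
  usable. One direction is an induction over the generation of open sets: intersections are
  respected since charts are injective on points, generators since the transition maps are
  continuous. Conversely every point of \<open>U\<close> has a chart neighbourhood inside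
  \<open>U\<close>.\<close>

lemma openin_mtop_iff:
  "openin (mtop M) U \<longleftrightarrow> U \<subseteq> pts M 0 \<and>
     (\<forall>c\<in>charts M. openin (top_of_set (ev (cmodel c))) (cbody c (cdom c \<inter> U)))"
proof
  assume "openin (mtop M) U"
  then have "generate_topology_on {{x \<in> cdom c. cpt c x \<in> D} | c D.
        c \<in> charts M \<and> openin (top_of_set (ev (cmodel c))) D \<and> D \<subseteq> cimg c} U"
    unfolding mtop_def openin_topology_generated_by_iff .
  then show "U \<subseteq> pts M 0 \<and> (\<forall>c\<in>charts M. openin (top_of_set (ev (cmodel c))) (cbody c (cdom c \<inter> U)))"
  proof induction
    case Empty
    show ?case by (simp add: cbody_def)
  next
    case (Int a b)
    have "cbody c (cdom c \<inter> (a \<inter> b)) = cbody c (cdom c \<inter> a) \<inter> cbody c (cdom c \<inter> b)" if "c \<in> charts M" for c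
    proof -
      have "cdom c \<inter> (a \<inter> b) = (cdom c \<inter> a) \<inter> (cdom c \<inter> b)" by blast
      then show ?thesis using cbody_Int[OF that, of "cdom c \<inter> a" "cdom c \<inter> b"] by simp
    qed
    then show ?case using Int.IH by (auto intro: openin_Int)
  next
    case (UN K)
    have "cbody c (cdom c \<inter> \<Union> K) = (\<Union>k\<in>K. cbody c (cdom c \<inter> k))" for c :: "('k, 'x, 'm) chart"
      unfolding cbody_def by blast
    moreover have "openin (top_of_set (ev (cmodel c))) (\<Union>k\<in>K. cbody c (cdom c \<inter> k))" if "c \<in> charts M" for c
      using UN.IH that by (intro openin_Union) blast
    ultimately show ?case using UN.IH by (intro conjI ballI) (blast, simp)
  next
    case (Basis s)
    then obtain d D where d: "s = {x \<in> cdom d. cpt d x \<in> D}" "d \<in> charts M" "openin (top_of_set (ev (cmodel d))) D"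
      by blast
    show ?case unfolding d(1)
      using chart_generator_open[OF _ d(2,3)] chart_dom[OF premfdD(1)[OF M] M_chart[OF d(2)]] by blast
  qed
next
  assume U: "U \<subseteq> pts M 0 \<and> (\<forall>c\<in>charts M. openin (top_of_set (ev (cmodel c))) (cbody c (cdom c \<inter> U)))"
  have "\<exists>T. openin (mtop M) T \<and> x \<in> T \<and> T \<subseteq> U" if x: "x \<in> U" for x
  proof -
    obtain c where c: "c \<in> charts M" "x \<in> cdom c" using premfdD(3)[OF M] U x by blast
    have "{x \<in> cdom c. cpt c x \<in> cbody c (cdom c \<inter> U)} = cdom c \<inter> U"
      using cpt_mem_cbody[OF premfdD(1)[OF M] M_chart[OF c(1)], of _ "cdom c \<inter> U"] by auto
    moreover have "openin (mtop M) {x \<in> cdom c. cpt c x \<in> cbody c (cdom c \<inter> U)}"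
      using U c by (intro mtop_chart_open) auto
    ultimately show ?thesis using c x by (intro exI[of _ "cdom c \<inter> U"]) auto
  qed
  then show "openin (mtop M) U" by (subst openin_subopen) blast
qed

lemma mtop_cdom: "c \<in> charts M \<Longrightarrow> openin (mtop M) (cdom c)"
proof -
  assume c: "c \<in> charts M"
  have "{x \<in> cdom c. cpt c x \<in> cimg c} = cdom c" using cpt_in[OF premfdD(1)[OF M] M_chart[OF c]] by blast
  then show ?thesis using mtop_chart_open[OF c chart_open[OF premfdD(1)[OF M] M_chart[OF c]]] by simp
qed

lemma mtop_cbody: "openin (mtop M) U \<Longrightarrow> c \<in> charts M \<Longrightarrow> openin (top_of_set (ev (cmodel c))) (cbody c (cdom c \<inter> U))"
  by (simp add: openin_mtop_iff)

lemma cbody_open_mtop: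
  assumes "c \<in> charts M" "S \<subseteq> cdom c" "openin (top_of_set (ev (cmodel c))) (cbody c S)"
  shows "openin (mtop M) S"
proof -
  have "{x \<in> cdom c. cpt c x \<in> cbody c S} = S"
    using cpt_mem_cbody[OF premfdD(1)[OF M] M_chart[OF assms(1)] _ assms(2)] assms(2) by auto
  then show ?thesis using mtop_chart_open[OF assms(1,3)] by simp
qed

lemma pts_open: "openin (mtop M) (pts M 0)"
proof -
  have "pts M 0 = \<Union> (cdom ` charts M)" using M by (simp add: premfd_def)
  moreover have "openin (mtop M) (\<Union> (cdom ` charts M))" using mtop_cdom by (intro openin_Union) blast
  ultimately show ?thesis by simp
qed

lemma topspace_mtop: "topspace (mtop M) = pts M 0"
  using openin_subset[OF pts_open] openin_mtop_iff[THEN iffD1, OF openin_topspace] by (intro equalityI) simp_all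

text \<open>Being Hausdorff is not a local property. Two points have to be caught in a single chart,
  where the topology of the model space separates them.\<close>

lemma Hausdorff_mtop:
  assumes common: "\<And>x y. x \<in> pts M 0 \<Longrightarrow> y \<in> pts M 0 \<Longrightarrow> \<exists>c\<in>charts M. x \<in> cdom c \<and> y \<in> cdom c"
  shows "Hausdorff_space (mtop M)"
  unfolding Hausdorff_space_def topspace_mtop
proof (intro allI impI, elim conjE)
  fix x y assume "x \<in> pts M 0" "y \<in> pts M 0" and ne: "x \<noteq> y"
  then obtain c where c: "c \<in> charts M" "x \<in> cdom c" "y \<in> cdom c" using common by blast
  have "cpt c x \<noteq> cpt c y" using cpt_inj[OF premfdD(1)[OF M] M_chart[OF c(1)] c(2,3)] ne by blast
  from hausdorff[OF this]
  obtain A B where AB: "open A" "open B" "cpt c x \<in> A" "cpt c y \<in> B" "A \<inter> B = {}" by blast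
  let ?T = "\<lambda>A. {x \<in> cdom c. cpt c x \<in> ev (cmodel c) \<inter> A}"
  have "cpt c z \<in> ev (cmodel c)" if "z \<in> cdom c" for z
    using cpt_in[OF premfdD(1)[OF M] M_chart[OF c(1)] that]
      openin_imp_subset[OF chart_open[OF premfdD(1)[OF M] M_chart[OF c(1)]]] by blast
  then show "\<exists>U V. openin (mtop M) U \<and> openin (mtop M) V \<and> x \<in> U \<and> y \<in> V \<and> disjnt U V"
    using AB c mtop_chart_open[OF c(1) openin_open_Int[OF AB(1)]] mtop_chart_open[OF c(1) openin_open_Int[OF AB(2)]]
    by (intro exI[of _ "?T A"] exI[of _ "?T B"]) (auto simp: disjnt_def)
qed

text \<open>A countable basis of the model space, pulled back along countably many charts that
  cover, is a countable basis.\<close>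

lemma second_countable_mtop:
  assumes C: "countable C" "C \<subseteq> charts M" "pts M 0 \<subseteq> \<Union> (cdom ` C)"
  shows "second_countable (mtop M)"
proof -
  obtain \<B> :: "'m set set" where \<B>: "countable \<B>" "topological_basis \<B>" using ex_countable_basis by blast
  let ?T = "\<lambda>c T. {x \<in> cdom c. cpt c x \<in> ev (cmodel c) \<inter> T}"
  let ?S = "(\<lambda>(c, T). ?T c T) ` (C \<times> \<B>)"
  show ?thesis unfolding second_countable_def
  proof (intro exI[of _ ?S] conjI ballI allI impI)
    show "countable ?S" using C(1) \<B>(1) by (intro countable_image countable_SIGMA)
    show "openin (mtop M) V" if V: "V \<in> ?S" for V
    proof -
      obtain c T where "c \<in> C" "T \<in> \<B>" "V = ?T c T" using V by blast
      then show ?thesis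
        using C(2) mtop_chart_open[OF _ openin_open_Int[OF topological_basis_open[OF \<B>(2)]], of c T] by blast
    qed
    fix U x assume "openin (mtop M) U \<and> x \<in> U"
    then have U: "openin (mtop M) U" "x \<in> U" "x \<in> pts M 0" by (auto simp: openin_mtop_iff)
    then obtain c where c: "c \<in> C" "x \<in> cdom c" using C(3) by blast
    have cM: "c \<in> charts M" using c C(2) by blast
    have im: "cpt c z \<in> ev (cmodel c)" if "z \<in> cdom c" for z
      using cpt_in[OF premfdD(1)[OF M] M_chart[OF cM] that]
        openin_imp_subset[OF chart_open[OF premfdD(1)[OF M] M_chart[OF cM]]] by blast
    obtain T' where T': "open T'" "cbody c (cdom c \<inter> U) = ev (cmodel c) \<inter> T'"
      using mtop_cbody[OF U(1) cM] by (auto simp: openin_open)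
    have mem: "cpt c z \<in> cbody c (cdom c \<inter> U) \<longleftrightarrow> z \<in> U" if "z \<in> cdom c" for z
      using cpt_mem_cbody[OF premfdD(1)[OF M] M_chart[OF cM] that, of "cdom c \<inter> U"] that by simp
    then have "cpt c x \<in> T'" using c U(2) T'(2) by blast
    then obtain T where T: "T \<in> \<B>" "cpt c x \<in> T" "T \<subseteq> T'"
      using topological_basisE[OF \<B>(2) T'(1)] by blast
    have "?T c T \<subseteq> U" using mem T(3) T'(2) by blast
    then show "\<exists>V\<in>?S. x \<in> V \<and> V \<subseteq> U"
      using T c im by (intro bexI[of _ "?T c T"]) auto
  qed
qed

lemma supermanifoldI:
  assumes "\<And>x y. x \<in> pts M 0 \<Longrightarrow> y \<in> pts M 0 \<Longrightarrow> \<exists>c\<in>charts M. x \<in> cdom c \<and> y \<in> cdom c"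
    and "countable C" "C \<subseteq> charts M" "pts M 0 \<subseteq> \<Union> (cdom ` C)"
  shows "supermanifold M"
  unfolding supermanifold_iff using M Hausdorff_mtop[OF assms(1)] second_countable_mtop[OF assms(2-4)] by blast

end

section \<open>Smooth maps\<close>

context
  fixes M :: "('k::{real_normed_field, euclidean_space}, 'x, 'm::euclidean_space) smfd"
    and N :: "('k, 'y, 'l::euclidean_space) smfd"
  assumes M: "premfd M" and N: "premfd N"
begin

text \<open>\<open>smooth_map\<close> speaks of the coordinate expressions in all pairs of charts.
  One pair around each point suffices, since any other expression is locally this one, preceded and
  followed by transition maps.\<close>

lemma smooth_mapI_local:
  assumes U: "U \<subseteq> pts M 0" and fpts: "\<And>n x. x \<in> rpts M U n \<Longrightarrow> f n x \<in> pts N n"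
    and fnat: "\<And>m n \<rho> x. Grass_hom m n \<rho> \<Longrightarrow> x \<in> rpts M U m \<Longrightarrow> f n (act M m n \<rho> x) = act N m n \<rho> (f m x)"
    and loc: "\<And>x. x \<in> U \<Longrightarrow> \<exists>c\<in>charts M. \<exists>d\<in>charts N. \<exists>S. x \<in> S \<and> S \<subseteq> cdom c \<inter> U \<and> f 0 ` S \<subseteq> cdom d \<and>
      supersmooth (cmodel c) (cbody c S) (cmodel d) (cimg d) (\<lambda>n y. cmap d n (f n (cinv M c n y)))"
  shows "smooth_map M U N f"
  unfolding smooth_map_def
proof (intro conjI ballI allI impI)
  note MF = premfdD(1)[OF M] and NF = premfdD(1)[OF N]
  show "openin (mtop M) U"
  proof (subst openin_subopen, intro ballI)
    fix x assume "x \<in> U"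
    from loc[OF this] obtain c d S where *: "c \<in> charts M" "d \<in> charts N" "x \<in> S" "S \<subseteq> cdom c \<inter> U"
      "supersmooth (cmodel c) (cbody c S) (cmodel d) (cimg d) (\<lambda>n y. cmap d n (f n (cinv M c n y)))"
      by (elim bexE exE conjE) (rule that)
    have "openin (mtop M) S"
      using *(4) by (intro cbody_open_mtop[OF M *(1) _ supersmoothD(1)[OF *(5)]]) blast
    then show "\<exists>T. openin (mtop M) T \<and> x \<in> T \<and> T \<subseteq> U" using * by blast
  qed
  show "f n ` rpts M U n \<subseteq> pts N n" for n using fpts by blast
  show "f n (act M m n \<rho> x) = act N m n \<rho> (f m x)" if "Grass_hom m n \<rho>" "x \<in> rpts M U m" for m n \<rho> x
    by (rule fnat[OF that])
  fix c' d' assume c': "c' \<in> charts M" and d': "d' \<in> charts N"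
  let ?A = "{x \<in> cdom c' \<inter> U. f 0 x \<in> cdom d'}"
  let ?F = "\<lambda>n y. cmap d' n (f n (cinv M c' n y))"
  note c'c = M_chart[OF M c'] and d'c = M_chart[OF N d']
  show "supersmooth (cmodel c') (cbody c' ?A) (cmodel d') (cimg d') ?F"
  proof (rule supersmooth_local[OF chart_model[OF MF c'c] chart_open[OF NF d'c]])
    fix y assume "y \<in> cbody c' ?A"
    then obtain x0 where x0: "y = cpt c' x0" "x0 \<in> ?A" unfolding cbody_def by blast
    then obtain c d S where c: "c \<in> charts M" and d: "d \<in> charts N" and S: "x0 \<in> S" "S \<subseteq> cdom c \<inter> U" "f 0 ` S \<subseteq> cdom d"
      and \<phi>: "supersmooth (cmodel c) (cbody c S) (cmodel d) (cimg d) (\<lambda>n y. cmap d n (f n (cinv M c n y)))"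
      using loc[of x0] by blast
    note cc = M_chart[OF M c] and dc = M_chart[OF N d]
    note mods = chart_model[OF MF c'c] chart_model[OF MF cc] chart_model[OF NF dc]
    have Sc: "S \<subseteq> cdom c" using S(2) by blast
    let ?t = "\<lambda>n y. cmap c n (cinv M c' n y)"
    let ?p = "\<lambda>n y. cmap d n (f n (cinv M c n y))"
    let ?u = "\<lambda>n y. cmap d' n (cinv N d n y)"
    let ?D2 = "cbody d (cdom d \<inter> cdom d')"
    let ?D1 = "{y \<in> cbody c' (cdom c' \<inter> cdom c). fbody ?t y \<in> cbody c S}"
    have t: "supersmooth (cmodel c') ?D1 (cmodel c) (cbody c S) ?t"
      by (rule supersmooth_vimage[OF mods(1,2) premfdD(4)[OF M c' c] supersmoothD(1)[OF \<phi>]])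
    have pt: "supersmooth (cmodel c') ?D1 (cmodel d) (cimg d) (\<lambda>n y. ?p n (?t n y))"
      by (rule supersmooth_compose[OF mods(1,2) t \<phi>])
    note u = premfdD(4)[OF N d d']
    let ?D0 = "{y \<in> ?D1. fbody (\<lambda>n y. ?p n (?t n y)) y \<in> ?D2}"
    let ?g = "\<lambda>n y. ?u n (?p n (?t n y))"
    have g: "supersmooth (cmodel c') ?D0 (cmodel d') (cimg d') ?g"
      by (rule supersmooth_compose[OF mods(1,3) supersmooth_vimage[OF mods(1,3) pt supersmoothD(1)[OF u]] u])
    \<comment> \<open>The part of \<open>S\<close> on which all four charts are available. The
      domain of the composite of the three coordinate maps is cut out by conditions on bodies, one
      map at a time, and turns out to be the chart image of this set.\<close>
    let ?S1 = "{x \<in> S \<inter> cdom c'. f 0 x \<in> cdom d'}"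
    have D0: "?D0 = cbody c' ?S1"
    proof -
      have "cpt c' x \<in> ?D0 \<longleftrightarrow> x \<in> ?S1" if x: "x \<in> cdom c'" for x
      proof (cases "x \<in> cdom c")
        case xc: True
        have 1: "cpt c' x \<in> cbody c' (cdom c' \<inter> cdom c)" using x xc by (auto simp: cbody_def)
        have 2: "fbody ?t (cpt c' x) \<in> cbody c S \<longleftrightarrow> x \<in> S"
          by (simp add: transition_body[OF M c' c x] cpt_mem_cbody[OF MF cc xc Sc])
        have "fbody (\<lambda>n y. ?p n (?t n y)) (cpt c' x) = cpt d (f 0 x)"
          by (simp add: fbody_def cinv_gconst[OF MF c'c x] cinv_cmap[OF MF cc cdom_rpts[OF MF cc xc]])
        moreover have "cpt d (f 0 x) \<in> ?D2 \<longleftrightarrow> f 0 x \<in> cdom d'" if "x \<in> S"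
        proof -
          have "f 0 x \<in> cdom d" using that S(3) by blast
          then show ?thesis using cpt_mem_cbody[OF NF dc, of "f 0 x" "cdom d \<inter> cdom d'"] by simp
        qed
        ultimately show ?thesis using 1 2 x by auto
      next
        case False
        then have "cpt c' x \<notin> cbody c' (cdom c' \<inter> cdom c)"
          using cpt_mem_cbody[OF MF c'c x, of "cdom c' \<inter> cdom c"] by simp
        then show ?thesis using False Sc by auto
      qed
      moreover have "?D0 \<subseteq> cpt c' ` cdom c'" "cbody c' ?S1 \<subseteq> cpt c' ` cdom c'" by (auto simp: cbody_def)
      ultimately show ?thesis unfolding cbody_def by blast
    qed
    have S1: "?S1 \<subseteq> cdom c'" "?S1 \<subseteq> ?A" "x0 \<in> ?S1" "?S1 \<subseteq> cdom c" using S x0 Sc by auto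
    have eq: "?F n y = ?g n y" if y: "y \<in> dpts (cmodel c') (cbody c' ?S1) n" for n y
    proof -
      let ?x = "cinv M c' n y"
      have x: "?x \<in> rpts M ?S1 n" by (rule cinv_rpts[OF MF c'c S1(1) y])
      have 1: "cinv M c n (cmap c n ?x) = ?x" by (rule cinv_cmap[OF MF cc rpts_mono[OF S1(4) x]])
      have xU: "?x \<in> rpts M U n" using x by (rule rpts_mono[rotated]) (use S(2) in auto)
      have "f n ?x \<in> rpts N (cdom d) n"
      proof (rule rptsI[OF fpts[OF xU]])
        have "act N n 0 gaug (f n ?x) = f 0 (act M n 0 gaug ?x)" by (rule fnat[OF gaug_hom xU, symmetric])
        then show "act N n 0 gaug (f n ?x) \<in> cdom d" using rpts_body[OF x] S(3) by auto
      qed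
      then have "cinv N d n (cmap d n (f n ?x)) = f n ?x" by (rule cinv_cmap[OF NF dc])
      then show ?thesis by (simp add: 1)
    qed
    show "\<exists>D1 g. y \<in> D1 \<and> D1 \<subseteq> cbody c' ?A \<and> supersmooth (cmodel c') D1 (cmodel d') (cimg d') g \<and>
        (\<forall>n. \<forall>x\<in>dpts (cmodel c') D1 n. ?F n x = g n x)"
    proof (intro exI[of _ "cbody c' ?S1"] exI[of _ ?g] conjI allI ballI eq)
      show "y \<in> cbody c' ?S1" unfolding x0(1) cbody_def using S1(3) by (rule imageI)
      show "cbody c' ?S1 \<subseteq> cbody c' ?A" unfolding cbody_def using S1(2) by (rule image_mono)
      show "supersmooth (cmodel c') (cbody c' ?S1) (cmodel d') (cimg d') ?g" using g unfolding D0 .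
    qed
  qed
qed

lemma smooth_map_charts:
  assumes U: "U \<subseteq> pts M 0" and fpts: "\<And>n x. x \<in> rpts M U n \<Longrightarrow> f n x \<in> pts N n"
    and fnat: "\<And>m n \<rho> x. Grass_hom m n \<rho> \<Longrightarrow> x \<in> rpts M U m \<Longrightarrow> f n (act M m n \<rho> x) = act N m n \<rho> (f m x)"
    and loc: "\<And>x. x \<in> U \<Longrightarrow> \<exists>c\<in>charts M. \<exists>d\<in>charts N. \<exists>\<phi>. x \<in> cdom c \<and> cdom c \<subseteq> U \<and> f 0 ` cdom c \<subseteq> cdom d \<and>
      supersmooth (cmodel c) (cimg c) (cmodel d) (cimg d) \<phi> \<and>
      (\<forall>n. \<forall>x\<in>rpts M (cdom c) n. cmap d n (f n x) = \<phi> n (cmap c n x))"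
  shows "smooth_map M U N f"
proof (rule smooth_mapI_local[OF U fpts fnat])
  fix x assume "x \<in> U"
  from loc[OF this] obtain c d \<phi> where c: "c \<in> charts M" and d: "d \<in> charts N"
    and *: "x \<in> cdom c" "cdom c \<subseteq> U" "f 0 ` cdom c \<subseteq> cdom d"
      "supersmooth (cmodel c) (cimg c) (cmodel d) (cimg d) \<phi>"
      "\<forall>n. \<forall>x\<in>rpts M (cdom c) n. cmap d n (f n x) = \<phi> n (cmap c n x)" by blast
  note MF = premfdD(1)[OF M] and cc = M_chart[OF M c]
  have "supersmooth (cmodel c) (cbody c (cdom c)) (cmodel d) (cimg d) (\<lambda>n y. cmap d n (f n (cinv M c n y)))"
    unfolding cbody_cdom[OF MF cc]
    by (rule supersmooth_cong[OF chart_model[OF MF cc] *(4)])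
      (simp add: *(5) cinv_in[OF MF cc] cmap_cinv_in[OF MF cc])
  then show "\<exists>c\<in>charts M. \<exists>d\<in>charts N. \<exists>S. x \<in> S \<and> S \<subseteq> cdom c \<inter> U \<and> f 0 ` S \<subseteq> cdom d \<and>
      supersmooth (cmodel c) (cbody c S) (cmodel d) (cimg d) (\<lambda>n y. cmap d n (f n (cinv M c n y)))"
    using * by (intro bexI[OF _ c] bexI[OF _ d] exI[of _ "cdom c"]) simp
qed

lemma smooth_mapD:
  assumes "smooth_map M U N f"
  shows "openin (mtop M) U" "x \<in> rpts M U n \<Longrightarrow> f n x \<in> pts N n"
    "Grass_hom m n \<rho> \<Longrightarrow> x \<in> rpts M U m \<Longrightarrow> f n (act M m n \<rho> x) = act N m n \<rho> (f m x)"
    "c \<in> charts M \<Longrightarrow> d \<in> charts N \<Longrightarrow> supersmooth (cmodel c) (cbody c {x \<in> cdom c \<inter> U. f 0 x \<in> cdom d}) (cmodel d) (cimg d)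
          (\<lambda>n y. cmap d n (f n (cinv M c n y)))"
  using assms unfolding smooth_map_def by (blast, blast, blast, blast)

lemma smooth_map_rpts:
  assumes "smooth_map M U N f" "U1 \<subseteq> U" "f 0 ` U1 \<subseteq> U'" "x \<in> rpts M U1 n"
  shows "f n x \<in> rpts N U' n"
proof (rule rptsI)
  have x: "x \<in> rpts M U n" by (rule rpts_mono[OF assms(2,4)])
  show "f n x \<in> pts N n" by (rule smooth_mapD(2)[OF assms(1) x])
  show "act N n 0 gaug (f n x) \<in> U'"
    using smooth_mapD(3)[OF assms(1) gaug_hom x] rpts_body[OF assms(4)] assms(3) by auto
qed

end

text \<open>Around each point the coordinate expression of the composite factors through a chart of
  the manifold in the middle.\<close>

lemma smooth_map_compose:
  fixes M :: "('k::{real_normed_field, euclidean_space}, 'x, 'm::euclidean_space) smfd"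
    and N :: "('k, 'y, 'l::euclidean_space) smfd" and P :: "('k, 'z, 'j::euclidean_space) smfd"
  assumes M: "premfd M" and N: "premfd N" and P: "premfd P"
    and f: "smooth_map M U N f" and g: "smooth_map N U' P g"
    and U1: "openin (mtop M) U1" "U1 \<subseteq> U" "f 0 ` U1 \<subseteq> U'"
  shows "smooth_map M U1 P (\<lambda>n x. g n (f n x))"
proof (rule smooth_mapI_local[OF M P])
  note MF = premfdD(1)[OF M] and NF = premfdD(1)[OF N]
  have fr: "f n x \<in> rpts N U' n" if "x \<in> rpts M U1 n" for n x
    by (rule smooth_map_rpts[OF M N f U1(2,3) that])
  show U1M: "U1 \<subseteq> pts M 0" using U1(1) openin_mtop_iff[OF M] by blast
  show "g n (f n x) \<in> pts P n" if "x \<in> rpts M U1 n" for n x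
    by (rule smooth_mapD(2)[OF N P g fr[OF that]])
  show "g n (f n (act M m n \<rho> x)) = act P m n \<rho> (g m (f m x))" if "Grass_hom m n \<rho>" "x \<in> rpts M U1 m" for m n \<rho> x
    using smooth_mapD(3)[OF M N f that(1) rpts_mono[OF U1(2) that(2)]] smooth_mapD(3)[OF N P g that(1) fr[OF that(2)]]
    by simp
  fix x assume x: "x \<in> U1"
  obtain c where c: "c \<in> charts M" "x \<in> cdom c" using premfdD(3)[OF M] x U1M by blast
  have "f 0 x \<in> U'" using x U1(3) by blast
  moreover have "U' \<subseteq> pts N 0" using smooth_mapD(1)[OF N P g] openin_mtop_iff[OF N] by blast
  ultimately obtain d where d: "d \<in> charts N" "f 0 x \<in> cdom d" using premfdD(3)[OF N] by blast
  have "g 0 (f 0 x) \<in> pts P 0"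
    using \<open>f 0 x \<in> U'\<close> rpts_0[OF NF \<open>U' \<subseteq> pts N 0\<close>] smooth_mapD(2)[OF N P g, of "f 0 x" 0] by simp
  then obtain e where e: "e \<in> charts P" "g 0 (f 0 x) \<in> cdom e" using premfdD(3)[OF P] by blast
  note cc = M_chart[OF M c(1)] and dc = M_chart[OF N d(1)]
  note mods = chart_model[OF MF cc] chart_model[OF NF dc]
  let ?A = "{x \<in> cdom c \<inter> U. f 0 x \<in> cdom d}" and ?B = "{z \<in> cdom d \<inter> U'. g 0 z \<in> cdom e}"
  let ?p = "\<lambda>n y. cmap d n (f n (cinv M c n y))" and ?q = "\<lambda>n y. cmap e n (g n (cinv N d n y))"
  note p = smooth_mapD(4)[OF M N f c(1) d(1)] and q = smooth_mapD(4)[OF N P g d(1) e(1)]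
  let ?D = "{y \<in> cbody c ?A. fbody ?p y \<in> cbody d ?B}"
  have qp: "supersmooth (cmodel c) ?D (cmodel e) (cimg e) (\<lambda>n y. ?q n (?p n y))"
    by (rule supersmooth_compose[OF mods supersmooth_vimage[OF mods p supersmoothD(1)[OF q]] q])
  let ?S = "{x \<in> ?A. x \<in> U1 \<and> f 0 x \<in> ?B}"
  have AB: "?A \<subseteq> cdom c" "?B \<subseteq> cdom d" "?S \<subseteq> cdom c" by auto
  have fb: "fbody ?p (cpt c z) = cpt d (f 0 z)" if "z \<in> cdom c" for z
    by (simp add: fbody_def cinv_gconst[OF MF cc that])
  \<comment> \<open>This exhibits the domain as the intersection of two open sets: the set where
    both coordinate expressions can be composed, and the chart image of \<open>U1\<close>.\<close>
  have "cbody c ?S = ?D \<inter> cbody c (cdom c \<inter> U1)"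
  proof -
    have "cpt c z \<in> ?D \<inter> cbody c (cdom c \<inter> U1) \<longleftrightarrow> z \<in> ?S" if z: "z \<in> cdom c" for z
      using cpt_mem_cbody[OF MF cc z AB(1)] cpt_mem_cbody[OF MF cc z, of "cdom c \<inter> U1"] fb[OF z]
        cpt_mem_cbody[OF NF dc _ AB(2), of "f 0 z"] by auto
    moreover have "?D \<subseteq> cpt c ` cdom c" by (auto simp: cbody_def)
    ultimately show ?thesis unfolding cbody_def[of c ?S] by blast
  qed
  then have opS: "openin (top_of_set (ev (cmodel c))) (cbody c ?S)"
    using openin_Int[OF supersmoothD(1)[OF qp] mtop_cbody[OF M U1(1) c(1)]] by simp
  have SD: "cbody c ?S \<subseteq> ?D" using \<open>cbody c ?S = _\<close> by blast
  have "supersmooth (cmodel c) (cbody c ?S) (cmodel e) (cimg e) (\<lambda>n y. ?q n (?p n y))"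
    using supersmooth_fbody[OF mods(1) qp] SD
    by (intro supersmooth_restrict[OF mods(1) chart_model[OF premfdD(1)[OF P] M_chart[OF P e(1)]] qp opS SD
          supersmoothD(2)[OF qp]]) blast
  then have "supersmooth (cmodel c) (cbody c ?S) (cmodel e) (cimg e) (\<lambda>n y. cmap e n (g n (f n (cinv M c n y))))"
  proof (rule supersmooth_cong[OF mods(1)])
    fix n y assume y: "y \<in> dpts (cmodel c) (cbody c ?S) n"
    have xS: "cinv M c n y \<in> rpts M ?S n" by (rule cinv_rpts[OF MF cc AB(3) y])
    have "f n (cinv M c n y) \<in> rpts N (cdom d) n"
      by (rule smooth_map_rpts[OF M N f _ _ xS]) auto
    then show "cmap e n (g n (f n (cinv M c n y))) = ?q n (?p n y)" by (simp add: cinv_cmap[OF NF dc])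
  qed
  then show "\<exists>c\<in>charts M. \<exists>d\<in>charts P. \<exists>S. x \<in> S \<and> S \<subseteq> cdom c \<inter> U1 \<and> (\<lambda>x. g 0 (f 0 x)) ` S \<subseteq> cdom d \<and>
      supersmooth (cmodel c) (cbody c S) (cmodel d) (cimg d) (\<lambda>n y. cmap d n (g n (f n (cinv M c n y))))"
    using c d e x U1(2) \<open>f 0 x \<in> U'\<close>
    by (intro bexI[OF _ c(1)] bexI[OF _ e(1)] exI[of _ ?S]) auto
qed

section \<open>Products and superdomains\<close>

lemma dpts_ssum_iff:
  "w \<in> dpts (ssum V W) (D \<times> D') n \<longleftrightarrow> (\<lambda>I. fst (w I)) \<in> dpts V D n \<and> (\<lambda>I. snd (w I)) \<in> dpts W D' n"
  using gpair_dpts_iff[of "\<lambda>I. fst (w I)" "\<lambda>I. snd (w I)" V W D D' n] by (simp add: gpair_surj[symmetric])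

lemma premfdI:
  assumes "is_gfunctor M" "\<And>c. c \<in> charts M \<Longrightarrow> is_chart M c" "\<And>x. x \<in> pts M 0 \<Longrightarrow> \<exists>c\<in>charts M. x \<in> cdom c"
    "\<And>c d. c \<in> charts M \<Longrightarrow> d \<in> charts M \<Longrightarrow>
      supersmooth (cmodel c) (cbody c (cdom c \<inter> cdom d)) (cmodel d) (cimg d) (\<lambda>n y. cmap d n (cinv M c n y))"
  shows "premfd M"
  unfolding premfd_def
proof (intro conjI ballI)
  show "\<Union> (cdom ` charts M) = pts M 0"
    using assms(3) chart_dom[OF assms(1,2)] by (intro equalityI subsetI) auto
qed (use assms in blast)+

definition pchart :: "('k::{real_normed_field, euclidean_space}, 'x, 'm::euclidean_space) chart \<Rightarrow>
   ('k, 'y, 'l::euclidean_space) chart \<Rightarrow> ('k, 'x \<times> 'y, 'm \<times> 'l) chart" where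
  "pchart c d = \<lparr>cdom = cdom c \<times> cdom d, cmodel = ssum (cmodel c) (cmodel d),
                 cimg = cimg c \<times> cimg d, cmap = (\<lambda>n (x, y). gpair (cmap c n x) (cmap d n y))\<rparr>"

lemma pchart_simps [simp]:
  "cdom (pchart c d) = cdom c \<times> cdom d" "cmodel (pchart c d) = ssum (cmodel c) (cmodel d)"
  "cimg (pchart c d) = cimg c \<times> cimg d" "cmap (pchart c d) n z = gpair (cmap c n (fst z)) (cmap d n (snd z))"
  by (simp_all add: pchart_def case_prod_beta)

lemma prod_mfd_simps [simp]:
  "pts (prod_mfd M N) n = pts M n \<times> pts N n"
  "act (prod_mfd M N) m n \<rho> z = (act M m n \<rho> (fst z), act N m n \<rho> (snd z))"
  by (simp_all add: prod_mfd_def case_prod_beta)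

lemma charts_prod_mfd: "charts (prod_mfd M N) = {pchart c d | c d. c \<in> charts M \<and> d \<in> charts N}"
  by (simp add: prod_mfd_def pchart_def)

lemma rpts_prod: "rpts (prod_mfd M N) (A \<times> B) n = rpts M A n \<times> rpts N B n"
  by (auto simp: rpts_def)

lemma cbody_pchart: "cbody (pchart c d) (A \<times> B) = cbody c A \<times> cbody d B"
proof -
  have "(\<lambda>z. (cpt c (fst z), cpt d (snd z))) ` (A \<times> B) = (cpt c ` A) \<times> (cpt d ` B)"
    by (force simp: image_iff)
  then show ?thesis by (simp add: cbody_def gpair_def)
qed

lemma premfd_prod:
  fixes M :: "('k::{real_normed_field, euclidean_space}, 'x, 'm::euclidean_space) smfd"
    and N :: "('k, 'y, 'l::euclidean_space) smfd"
  assumes M: "premfd M" and N: "premfd N"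
  shows "premfd (prod_mfd M N)"
proof (rule premfdI)
  note MF = premfdD(1)[OF M] and NF = premfdD(1)[OF N]
  show PF: "is_gfunctor (prod_mfd M N)"
    unfolding is_gfunctor_def
  proof (intro conjI allI impI ballI)
    show "act (prod_mfd M N) m n \<rho> ` pts (prod_mfd M N) m \<subseteq> pts (prod_mfd M N) n" if "Grass_hom m n \<rho>" for m n \<rho>
      using gfunctorD(1)[OF MF that] gfunctorD(1)[OF NF that] by auto
    fix n :: nat and \<rho> :: "'k gr \<Rightarrow> 'k gr" and z
    assume \<rho>: "Grass_hom n n \<rho> \<and> (\<forall>a\<in>Grass n. \<rho> a = a)" and z: "z \<in> pts (prod_mfd M N) n"
    show "act (prod_mfd M N) n n \<rho> z = z"
      using gfunctorD(2)[OF MF, of n \<rho> "fst z"] gfunctorD(2)[OF NF, of n \<rho> "snd z"] \<rho> z by auto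
  next
    fix l m n :: nat and \<rho> \<sigma> \<tau> :: "'k gr \<Rightarrow> 'k gr" and z
    assume *: "Grass_hom l m \<rho> \<and> Grass_hom m n \<sigma> \<and> Grass_hom l n \<tau> \<and> (\<forall>a\<in>Grass l. \<tau> a = \<sigma> (\<rho> a))"
      and z: "z \<in> pts (prod_mfd M N) l"
    show "act (prod_mfd M N) l n \<tau> z = act (prod_mfd M N) m n \<sigma> (act (prod_mfd M N) l m \<rho> z)"
      using gfunctorD(3)[OF MF, of l m \<rho> n \<sigma> \<tau> "fst z"] gfunctorD(3)[OF NF, of l m \<rho> n \<sigma> \<tau> "snd z"] * z by auto
  qed
  show "is_chart (prod_mfd M N) e" if e: "e \<in> charts (prod_mfd M N)" for e
  proof -
    obtain c d where e: "e = pchart c d" and c: "c \<in> charts M" and d: "d \<in> charts N"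
      using e unfolding charts_prod_mfd by blast
    note cc = M_chart[OF M c] and dc = M_chart[OF N d]
    show ?thesis unfolding is_chart_def e
    proof (intro conjI allI impI ballI)
      show "cdom (pchart c d) \<subseteq> pts (prod_mfd M N) 0"
        using chart_dom[OF MF cc] chart_dom[OF NF dc] by auto
      show "vector_superspace (cmodel (pchart c d))"
        unfolding pchart_simps by (rule vector_superspace_ssum[OF chart_model[OF MF cc] chart_model[OF NF dc]])
      show "openin (top_of_set (ev (cmodel (pchart c d)))) (cimg (pchart c d))"
        using openin_Times[OF chart_open[OF MF cc] chart_open[OF NF dc]] by simp
      fix n
      show "bij_betw (cmap (pchart c d) n) (rpts (prod_mfd M N) (cdom (pchart c d)) n)
          (dpts (cmodel (pchart c d)) (cimg (pchart c d)) n)"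
        unfolding pchart_simps(1-3) rpts_prod
      proof (rule bij_betwI')
        fix z z' assume z: "z \<in> rpts M (cdom c) n \<times> rpts N (cdom d) n" and z': "z' \<in> rpts M (cdom c) n \<times> rpts N (cdom d) n"
        show "cmap (pchart c d) n z = cmap (pchart c d) n z' \<longleftrightarrow> z = z'"
          using z z' chart_inj[OF MF cc, of "fst z" n "fst z'"] chart_inj[OF NF dc, of "snd z" n "snd z'"]
          by (auto simp: gpair_eq_iff prod_eq_iff)
        show "cmap (pchart c d) n z \<in> dpts (ssum (cmodel c) (cmodel d)) (cimg c \<times> cimg d) n"
          using z chart_in[OF MF cc, of "fst z" n] chart_in[OF NF dc, of "snd z" n] by (auto simp: gpair_dpts_iff)
      next
        fix w assume "w \<in> dpts (ssum (cmodel c) (cmodel d)) (cimg c \<times> cimg d) n"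
        then have w: "(\<lambda>I. fst (w I)) \<in> dpts (cmodel c) (cimg c) n" "(\<lambda>I. snd (w I)) \<in> dpts (cmodel d) (cimg d) n"
          by (simp_all only: dpts_ssum_iff)
        show "\<exists>z\<in>rpts M (cdom c) n \<times> rpts N (cdom d) n. w = cmap (pchart c d) n z"
          using cinv_in[OF MF cc w(1)] cinv_in[OF NF dc w(2)]
          by (intro bexI[of _ "(cinv M c n (\<lambda>I. fst (w I)), cinv N d n (\<lambda>I. snd (w I)))"])
            (simp_all add: cmap_cinv_in[OF MF cc w(1)] cmap_cinv_in[OF NF dc w(2)] gpair_surj[symmetric])
      qed
    next
      fix m n :: nat and \<rho> :: "'k gr \<Rightarrow> 'k gr" and z
      assume \<rho>: "Grass_hom m n \<rho>" and "z \<in> rpts (prod_mfd M N) (cdom (pchart c d)) m"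
      then have z: "fst z \<in> rpts M (cdom c) m" "snd z \<in> rpts N (cdom d) m" unfolding pchart_simps(1) rpts_prod by auto
      show "cmap (pchart c d) n (act (prod_mfd M N) m n \<rho> z) =
          gpush (scl (cmodel (pchart c d))) m \<rho> (cmap (pchart c d) m z)"
        unfolding pchart_simps(2,4) prod_mfd_simps gpush_gpair[OF chart_model[OF MF cc] chart_model[OF NF dc]]
        using chart_nat[OF MF cc \<rho> z(1)] chart_nat[OF NF dc \<rho> z(2)] by simp
    qed
  qed
  note Pchart = this
  show "\<exists>e\<in>charts (prod_mfd M N). z \<in> cdom e" if z: "z \<in> pts (prod_mfd M N) 0" for z
  proof -
    obtain c where "c \<in> charts M" "fst z \<in> cdom c" using premfdD(3)[OF M, of "fst z"] z by auto
    moreover obtain d where "d \<in> charts N" "snd z \<in> cdom d" using premfdD(3)[OF N, of "snd z"] z by auto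
    ultimately show ?thesis unfolding charts_prod_mfd
      by (intro bexI[of _ "pchart c d"]) (auto simp: mem_Times_iff)
  qed
  fix e e' assume e: "e \<in> charts (prod_mfd M N)" and e': "e' \<in> charts (prod_mfd M N)"
  obtain c d where ecd: "e = pchart c d" and c: "c \<in> charts M" and d: "d \<in> charts N"
    using e unfolding charts_prod_mfd by blast
  obtain c' d' where ecd': "e' = pchart c' d'" and c': "c' \<in> charts M" and d': "d' \<in> charts N"
    using e' unfolding charts_prod_mfd by blast
  note cc = M_chart[OF M c] and dc = M_chart[OF N d] and cc' = M_chart[OF M c'] and dc' = M_chart[OF N d']
  let ?A = "cbody c (cdom c \<inter> cdom c')" and ?B = "cbody d (cdom d \<inter> cdom d')"
  note V = chart_model[OF MF cc] and W = chart_model[OF NF dc]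
  note VW = vector_superspace_ssum[OF V W]
  note t = premfdD(4)[OF M c c'] and u = premfdD(4)[OF N d d']
  have opAB: "openin (top_of_set (ev (ssum (cmodel c) (cmodel d)))) (?A \<times> ?B)"
    using openin_Times[OF supersmoothD(1)[OF t] supersmoothD(1)[OF u]] by simp
  have f: "supersmooth (ssum (cmodel c) (cmodel d)) (?A \<times> ?B) (cmodel c) ?A (\<lambda>n y I. fst (y I))"
    by (rule supersmooth_linear[OF VW V linear_fst[OF V W] _ _ opAB supersmoothD(1)[OF t]]) auto
  have s: "supersmooth (ssum (cmodel c) (cmodel d)) (?A \<times> ?B) (cmodel d) ?B (\<lambda>n y I. snd (y I))"
    by (rule supersmooth_linear[OF VW W linear_snd[OF V W] _ _ opAB supersmoothD(1)[OF u]]) auto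
  have "supersmooth (ssum (cmodel c) (cmodel d)) (?A \<times> ?B) (ssum (cmodel c') (cmodel d')) (cimg c' \<times> cimg d')
      (\<lambda>n y. gpair (cmap c' n (cinv M c n (\<lambda>I. fst (y I)))) (cmap d' n (cinv N d n (\<lambda>I. snd (y I)))))"
    by (rule supersmooth_pair[OF VW chart_model[OF MF cc'] chart_model[OF NF dc']
          supersmooth_compose[OF VW V f t] supersmooth_compose[OF VW W s u]])
  then have "supersmooth (ssum (cmodel c) (cmodel d)) (?A \<times> ?B) (ssum (cmodel c') (cmodel d')) (cimg c' \<times> cimg d')
      (\<lambda>n y. cmap e' n (cinv (prod_mfd M N) e n y))"
  proof (rule supersmooth_cong[OF VW])
    fix n y assume y: "y \<in> dpts (ssum (cmodel c) (cmodel d)) (?A \<times> ?B) n"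
    then have y1: "(\<lambda>I. fst (y I)) \<in> dpts (cmodel c) ?A n" and y2: "(\<lambda>I. snd (y I)) \<in> dpts (cmodel d) ?B n"
      by (simp_all only: dpts_ssum_iff)
    let ?z = "(cinv M c n (\<lambda>I. fst (y I)), cinv N d n (\<lambda>I. snd (y I)))"
    have 1: "?z \<in> rpts (prod_mfd M N) (cdom e) n"
      unfolding ecd pchart_simps rpts_prod
      using rpts_mono[OF Int_lower1 cinv_rpts[OF MF cc Int_lower1 y1]] rpts_mono[OF Int_lower1 cinv_rpts[OF NF dc Int_lower1 y2]]
      by simp
    have "cmap e n ?z = y"
      unfolding ecd by (simp add: cmap_cinv[OF MF cc Int_lower1 y1] cmap_cinv[OF NF dc Int_lower1 y2] gpair_surj[symmetric])
    then have "cinv (prod_mfd M N) e n y = ?z" using cinv_cmap[OF PF Pchart[OF e] 1] by simp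
    then show "cmap e' n (cinv (prod_mfd M N) e n y) =
        gpair (cmap c' n (cinv M c n (\<lambda>I. fst (y I)))) (cmap d' n (cinv N d n (\<lambda>I. snd (y I))))"
      by (simp add: ecd')
  qed
  moreover have "cdom e \<inter> cdom e' = (cdom c \<inter> cdom c') \<times> (cdom d \<inter> cdom d')" by (auto simp: ecd ecd')
  ultimately show "supersmooth (cmodel e) (cbody e (cdom e \<inter> cdom e')) (cmodel e') (cimg e')
      (\<lambda>n y. cmap e' n (cinv (prod_mfd M N) e n y))"
    by (simp only: ecd ecd' cbody_pchart pchart_simps)
qed

lemma supersmooth_same:
  assumes "vector_superspace V" "openin (top_of_set (ev V)) D"
  shows "supersmooth V D V D (\<lambda>n x. x)"
  by (rule supersmooth_inclusion[OF assms(1,1) refl order_refl order_refl assms(2,2) order_refl])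

section \<open>Superdomains as supermanifolds with a single chart\<close>

definition dchart :: "('k, 'v::zero) sspace \<Rightarrow> 'v set \<Rightarrow> ('k, 'v gr, 'v) chart" where
  "dchart V D = \<lparr>cdom = dpts V D 0, cmodel = V, cimg = D, cmap = (\<lambda>n x. x)\<rparr>"

lemma dchart_simps [simp]:
  "cdom (dchart V D) = dpts V D 0" "cmodel (dchart V D) = V" "cimg (dchart V D) = D" "cmap (dchart V D) n x = x"
  by (simp_all add: dchart_def)

lemma domain_mfd_simps [simp]:
  "pts (domain_mfd V D) = dpts V D" "act (domain_mfd V D) m n = gpush (scl V) m"
  "charts (domain_mfd V D) = {dchart V D}"
  by (simp_all add: domain_mfd_def dchart_def)

lemma rpts_domain:
  assumes "vector_superspace V"
  shows "rpts (domain_mfd V D) (dpts V D 0) n = dpts V D n"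
  using gpush_dpts[OF gaug_hom assms] by (auto simp: rpts_def)

lemma premfd_domain:
  assumes V: "vector_superspace V" and D: "openin (top_of_set (ev V)) D"
  shows "premfd (domain_mfd V D)"
proof (rule premfdI)
  note Vs = vector_superspaceD(1)[OF V]
  show DF: "is_gfunctor (domain_mfd V D)"
    unfolding is_gfunctor_def
  proof (intro conjI allI impI ballI)
    show "act (domain_mfd V D) m n \<rho> ` pts (domain_mfd V D) m \<subseteq> pts (domain_mfd V D) n" if "Grass_hom m n \<rho>" for m n \<rho>
      using gpush_dpts[OF that V] by auto
    show "act (domain_mfd V D) n n \<rho> x = x"
      if "Grass_hom n n \<rho> \<and> (\<forall>a\<in>Grass n. \<rho> a = a)" "x \<in> pts (domain_mfd V D) n" for n \<rho> x
      using that gpush_id[of n \<rho>, OF _ Vs spts_gsupported[OF dpts_spts]] by simp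
    show "act (domain_mfd V D) l n \<tau> x = act (domain_mfd V D) m n \<sigma> (act (domain_mfd V D) l m \<rho> x)"
      if "Grass_hom l m \<rho> \<and> Grass_hom m n \<sigma> \<and> Grass_hom l n \<tau> \<and> (\<forall>a\<in>Grass l. \<tau> a = \<sigma> (\<rho> a))" for l m n \<rho> \<sigma> \<tau> x
      using that gpush_comp[of l m \<rho> n \<sigma> \<tau>, OF _ _ _ _ Vs] by simp
  qed
  show ch: "is_chart (domain_mfd V D) c" if "c \<in> charts (domain_mfd V D)" for c
  proof -
    have c: "c = dchart V D" using that by simp
    show ?thesis
      unfolding is_chart_def c dchart_simps rpts_domain[OF V] using V D by (simp add: bij_betw_def)
  qed
  show "\<exists>c\<in>charts (domain_mfd V D). x \<in> cdom c" if "x \<in> pts (domain_mfd V D) 0" for x using that by simp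
  fix c d assume "c \<in> charts (domain_mfd V D)" "d \<in> charts (domain_mfd V D)"
  then have cd: "c = dchart V D" "d = dchart V D" by simp_all
  have "supersmooth V D V D (\<lambda>n y. cmap d n (cinv (domain_mfd V D) c n y))"
    using cmap_cinv_in[OF DF ch[of "dchart V D"]] unfolding cd
    by (intro supersmooth_cong[OF V supersmooth_same[OF V D]]) simp
  then show "supersmooth (cmodel c) (cbody c (cdom c \<inter> cdom d)) (cmodel d) (cimg d)
      (\<lambda>n y. cmap d n (cinv (domain_mfd V D) c n y))"
    using cbody_cdom[OF DF ch[of "dchart V D"]] by (simp add: cd)
qed

lemma supermanifold_domain:
  assumes V: "vector_superspace V" and D: "openin (top_of_set (ev V)) D"
  shows "supermanifold (domain_mfd V D)"
  by (rule supermanifoldI[OF premfd_domain[OF V D], of "{dchart V D}"]) auto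

section \<open>Fiber bundles that are trivial over charts\<close>

text \<open>A chart of E that lies over a chart of B and begins with its coordinates already is a
  local trivialization: the remaining coordinates are the fiber component. In such charts the
  trivialization and its inverse are the identity, and the projection forgets the last
  coordinates.\<close>

lemma fiber_bundle_charts:
  fixes E :: "('k::{real_normed_field, euclidean_space}, 'x, 'm::euclidean_space \<times> 'w::euclidean_space) smfd"
    and B :: "('k, 'b, 'm) smfd" and W :: "('k, 'w) sspace"
  assumes E: "supermanifold E" and B: "supermanifold B" and W: "vector_superspace W"
    and D: "openin (top_of_set (ev W)) D"
    and ppts: "\<And>n x. x \<in> pts E n \<Longrightarrow> p n x \<in> pts B n"
    and pnat: "\<And>m n \<rho> x. Grass_hom m n \<rho> \<Longrightarrow> x \<in> pts E m \<Longrightarrow> p n (act E m n \<rho> x) = act B m n \<rho> (p m x)"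
    and ch: "\<And>b. b \<in> pts B 0 \<Longrightarrow> \<exists>cb\<in>charts B. \<exists>ce\<in>charts E. b \<in> cdom cb \<and>
      cdom ce = {x \<in> pts E 0. p 0 x \<in> cdom cb} \<and> cmodel ce = ssum (cmodel cb) W \<and> cimg ce = cimg cb \<times> D \<and>
      (\<forall>n. \<forall>x\<in>rpts E (cdom ce) n. (\<lambda>I. fst (cmap ce n x I)) = cmap cb n (p n x))"
  shows "fiber_bundle E B (domain_mfd W D) p"
proof -
  have Ep: "premfd E" and Bp: "premfd B" using E B by (simp_all add: supermanifold_iff)
  note EF = premfdD(1)[OF Ep] and BF = premfdD(1)[OF Bp]
  let ?F = "domain_mfd W D"
  note Fp = premfd_domain[OF W D]
  note Pp = premfd_prod[OF Bp Fp]
  note PF = premfdD(1)[OF Pp]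
  have prpts: "p n x \<in> rpts B U n" if "x \<in> rpts E {x \<in> pts E 0. p 0 x \<in> U} n" for n x U
  proof (rule rptsI[OF ppts[OF rpts_pts[OF that]]])
    show "act B n 0 gaug (p n x) \<in> U"
      using pnat[OF gaug_hom rpts_pts[OF that]] rpts_body[OF that] by simp
  qed
  have psm: "smooth_map E (pts E 0) B p"
  proof (rule smooth_map_charts[OF Ep Bp order_refl])
    show "p n x \<in> pts B n" if "x \<in> rpts E (pts E 0) n" for n x by (rule ppts[OF rpts_pts[OF that]])
    show "p n (act E m n \<rho> x) = act B m n \<rho> (p m x)" if "Grass_hom m n \<rho>" "x \<in> rpts E (pts E 0) m" for m n \<rho> x
      by (rule pnat[OF that(1) rpts_pts[OF that(2)]])
    fix x assume x: "x \<in> pts E 0"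
    from ch[OF ppts[OF x]] obtain cb ce where cb: "cb \<in> charts B" and ce: "ce \<in> charts E" and *: "p 0 x \<in> cdom cb"
      "cdom ce = {x \<in> pts E 0. p 0 x \<in> cdom cb}" "cmodel ce = ssum (cmodel cb) W" "cimg ce = cimg cb \<times> D"
      "\<forall>n. \<forall>x\<in>rpts E (cdom ce) n. (\<lambda>I. fst (cmap ce n x I)) = cmap cb n (p n x)" by blast
    note V = chart_model[OF BF M_chart[OF Bp cb]]
    have "supersmooth (ssum (cmodel cb) W) (cimg cb \<times> D) (cmodel cb) (cimg cb) (\<lambda>n y I. fst (y I))"
      by (rule supersmooth_linear[OF vector_superspace_ssum[OF V W] V linear_fst[OF V W] _ _ _ chart_open[OF BF M_chart[OF Bp cb]]])
        (use chart_open[OF EF M_chart[OF Ep ce]] * in auto)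
    then show "\<exists>c\<in>charts E. \<exists>d\<in>charts B. \<exists>\<phi>. x \<in> cdom c \<and> cdom c \<subseteq> pts E 0 \<and> p 0 ` cdom c \<subseteq> cdom d \<and>
      supersmooth (cmodel c) (cimg c) (cmodel d) (cimg d) \<phi> \<and>
      (\<forall>n. \<forall>x\<in>rpts E (cdom c) n. cmap d n (p n x) = \<phi> n (cmap c n x))"
      using * x by (intro bexI[OF _ ce] bexI[OF _ cb] exI[of _ "\<lambda>n y I. fst (y I)"]) auto
  qed
  have "\<exists>U \<tau> \<sigma>. b \<in> U \<and> openin (mtop B) U \<and>
        smooth_map E {x \<in> pts E 0. p 0 x \<in> U} (prod_mfd B ?F) \<tau> \<and>
        smooth_map (prod_mfd B ?F) (U \<times> pts ?F 0) E \<sigma> \<and>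
        (\<forall>n. \<forall>x\<in>rpts E {x \<in> pts E 0. p 0 x \<in> U} n. fst (\<tau> n x) = p n x \<and> \<sigma> n (\<tau> n x) = x) \<and>
        (\<forall>n. \<forall>y\<in>rpts (prod_mfd B ?F) (U \<times> pts ?F 0) n. p n (\<sigma> n y) = fst y \<and> \<tau> n (\<sigma> n y) = y)"
    if b: "b \<in> pts B 0" for b
  proof -
    from ch[OF b] obtain cb ce where cb: "cb \<in> charts B" and ce: "ce \<in> charts E" and bU: "b \<in> cdom cb"
      and dom: "cdom ce = {x \<in> pts E 0. p 0 x \<in> cdom cb}" and mod: "cmodel ce = ssum (cmodel cb) W"
      and img: "cimg ce = cimg cb \<times> D"
      and map: "\<And>n x. x \<in> rpts E (cdom ce) n \<Longrightarrow> (\<lambda>I. fst (cmap ce n x I)) = cmap cb n (p n x)" by blast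
    note cbc = M_chart[OF Bp cb] and cec = M_chart[OF Ep ce]
    note V = chart_model[OF BF cbc]
    note VW = vector_superspace_ssum[OF V W]
    let ?pc = "pchart cb (dchart W D)"
    have pc: "?pc \<in> charts (prod_mfd B ?F)" unfolding charts_prod_mfd using cb by auto
    note pcc = M_chart[OF Pp pc]
    \<comment> \<open>\<open>\<tau>\<close> pairs the base point with the remaining coordinates;
      \<open>\<sigma>\<close> reads coordinates on the product as coordinates on E.\<close>
    define \<tau> where "\<tau> n x = (p n x, \<lambda>I. snd (cmap ce n x I))" for n x
    define \<sigma> where "\<sigma> n y = cinv E ce n (cmap ?pc n y)" for n y
    have id: "supersmooth (ssum (cmodel cb) W) (cimg cb \<times> D) (ssum (cmodel cb) W) (cimg cb \<times> D) (\<lambda>n x. x)"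
      using supersmooth_same[OF VW] chart_open[OF EF cec] by (simp add: mod img)
    have \<tau>map: "cmap ?pc n (\<tau> n x) = cmap ce n x" if "x \<in> rpts E (cdom ce) n" for n x
      by (simp add: \<tau>_def map[OF that, symmetric] gpair_surj[symmetric])
    have \<tau>pts: "\<tau> n x \<in> rpts (prod_mfd B ?F) (cdom ?pc) n" if x: "x \<in> rpts E (cdom ce) n" for n x
    proof -
      have "gpair (\<lambda>I. fst (cmap ce n x I)) (\<lambda>I. snd (cmap ce n x I)) \<in> dpts (ssum (cmodel cb) W) (cimg cb \<times> D) n"
        using chart_in[OF EF cec x] by (simp add: mod img gpair_surj[symmetric])
      then have "(\<lambda>I. snd (cmap ce n x I)) \<in> dpts W D n" by (simp only: gpair_dpts_iff)
      then show ?thesis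
        using prpts[of x "cdom cb" n] x unfolding pchart_simps(1) dchart_simps(1) rpts_prod rpts_domain[OF W]
        by (simp add: \<tau>_def dom)
    qed
    have Fp0: "cdom cb \<times> pts ?F 0 = cdom ?pc" by simp
    have \<sigma>in: "cmap ?pc n y \<in> dpts (cmodel ce) (cimg ce) n" if "y \<in> rpts (prod_mfd B ?F) (cdom ?pc) n" for n y
      using chart_in[OF PF pcc that] by (simp only: mod img pchart_simps dchart_simps)
    have \<sigma>map: "cmap ce n (\<sigma> n y) = cmap ?pc n y" if "y \<in> rpts (prod_mfd B ?F) (cdom ?pc) n" for n y
      unfolding \<sigma>_def by (rule cmap_cinv_in[OF EF cec \<sigma>in[OF that]])
    have \<sigma>pts: "\<sigma> n y \<in> rpts E (cdom ce) n" if "y \<in> rpts (prod_mfd B ?F) (cdom ?pc) n" for n y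
      unfolding \<sigma>_def by (rule cinv_in[OF EF cec \<sigma>in[OF that]])
    have \<tau>sm: "smooth_map E (cdom ce) (prod_mfd B ?F) \<tau>"
    proof (rule smooth_map_charts[OF Ep Pp chart_dom[OF EF cec]])
      show "\<tau> n x \<in> pts (prod_mfd B ?F) n" if "x \<in> rpts E (cdom ce) n" for n x
        by (rule rpts_pts[OF \<tau>pts[OF that]])
      show "\<tau> n (act E m n \<rho> x) = act (prod_mfd B ?F) m n \<rho> (\<tau> m x)" if \<rho>: "Grass_hom m n \<rho>" and x: "x \<in> rpts E (cdom ce) m" for m n \<rho> x
        using pnat[OF \<rho> rpts_pts[OF x]] chart_nat[OF EF cec \<rho> x] gpush_linear[OF linear_snd[OF V W], of m \<rho> "cmap ce m x"]
        by (simp add: \<tau>_def mod del: ssum_simps)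
      fix x assume x: "x \<in> cdom ce"
      have "\<tau> 0 z \<in> cdom ?pc" if "z \<in> cdom ce" for z
        using \<tau>pts[OF cdom_rpts[OF EF cec that]] rpts_0[OF PF chart_dom[OF PF pcc]] by blast
      then show "\<exists>c\<in>charts E. \<exists>d\<in>charts (prod_mfd B ?F). \<exists>\<phi>. x \<in> cdom c \<and> cdom c \<subseteq> cdom ce \<and> \<tau> 0 ` cdom c \<subseteq> cdom d \<and>
          supersmooth (cmodel c) (cimg c) (cmodel d) (cimg d) \<phi> \<and>
          (\<forall>n. \<forall>x\<in>rpts E (cdom c) n. cmap d n (\<tau> n x) = \<phi> n (cmap c n x))"
        using id x \<tau>map
        by (intro bexI[OF _ ce] bexI[OF _ pc] exI[of _ "\<lambda>n y. y"]) (simp add: mod img image_subset_iff del: pchart_simps(1,4))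
    qed
    have \<sigma>sm: "smooth_map (prod_mfd B ?F) (cdom ?pc) E \<sigma>"
    proof (rule smooth_map_charts[OF Pp Ep chart_dom[OF PF pcc]])
      show "\<sigma> n y \<in> pts E n" if "y \<in> rpts (prod_mfd B ?F) (cdom ?pc) n" for n y
        by (rule rpts_pts[OF \<sigma>pts[OF that]])
      show "\<sigma> n (act (prod_mfd B ?F) m n \<rho> y) = act E m n \<rho> (\<sigma> m y)"
        if \<rho>: "Grass_hom m n \<rho>" and y: "y \<in> rpts (prod_mfd B ?F) (cdom ?pc) m" for m n \<rho> y
      proof -
        have "cmap ?pc n (act (prod_mfd B ?F) m n \<rho> y) = gpush (scl (cmodel ce)) m \<rho> (cmap ?pc m y)"
          using chart_nat[OF PF pcc \<rho> y] by (simp only: mod pchart_simps dchart_simps)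
        then show ?thesis unfolding \<sigma>_def using cinv_nat[OF EF cec \<rho> \<sigma>in[OF y]] by simp
      qed
      fix y assume y: "y \<in> cdom ?pc"
      have "\<sigma> 0 z \<in> cdom ce" if "z \<in> cdom ?pc" for z
        using \<sigma>pts[OF cdom_rpts[OF PF pcc that]] rpts_0[OF EF chart_dom[OF EF cec]] by blast
      then show "\<exists>c\<in>charts (prod_mfd B ?F). \<exists>d\<in>charts E. \<exists>\<phi>. y \<in> cdom c \<and> cdom c \<subseteq> cdom ?pc \<and> \<sigma> 0 ` cdom c \<subseteq> cdom d \<and>
          supersmooth (cmodel c) (cimg c) (cmodel d) (cimg d) \<phi> \<and>
          (\<forall>n. \<forall>x\<in>rpts (prod_mfd B ?F) (cdom c) n. cmap d n (\<sigma> n x) = \<phi> n (cmap c n x))"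
        using id y \<sigma>map
        by (intro bexI[OF _ ce] bexI[OF _ pc] exI[of _ "\<lambda>n y. y"]) (simp add: mod img image_subset_iff del: pchart_simps(1,4))
    qed
    have inv1: "fst (\<tau> n x) = p n x \<and> \<sigma> n (\<tau> n x) = x" if "x \<in> rpts E (cdom ce) n" for n x
      by (simp add: \<sigma>_def \<tau>map[OF that] cinv_cmap[OF EF cec that] del: pchart_simps) (simp add: \<tau>_def)
    have inv2: "p n (\<sigma> n y) = fst y \<and> \<tau> n (\<sigma> n y) = y" if y: "y \<in> rpts (prod_mfd B ?F) (cdom ?pc) n" for n y
    proof -
      have "cmap ?pc n (\<tau> n (\<sigma> n y)) = cmap ?pc n y"
        using \<tau>map[OF \<sigma>pts[OF y]] \<sigma>map[OF y] by (rule trans)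
      then have "\<tau> n (\<sigma> n y) = y" by (rule chart_inj[OF PF pcc \<tau>pts[OF \<sigma>pts[OF y]] y])
      moreover have "fst (\<tau> n (\<sigma> n y)) = p n (\<sigma> n y)" by (simp add: \<tau>_def)
      ultimately show ?thesis by simp
    qed
    show ?thesis
      using bU mtop_cdom[OF Bp cb] \<tau>sm \<sigma>sm inv1 inv2
      unfolding dom[symmetric] Fp0[symmetric]
      by (intro exI[of _ "cdom cb"] exI[of _ \<tau>] exI[of _ \<sigma>]) (simp only: dom[symmetric], blast)
  qed
  then show ?thesis
    unfolding fiber_bundle_def using E B supermanifold_domain[OF W D] psm by blast
qed

text \<open>In matched charts f is the identity in coordinates, so f and its inverse are smooth for
  the same reason.\<close>

lemma bundle_isomorphic_charts:
  fixes E :: "('k::{real_normed_field, euclidean_space}, 'x, 'm::euclidean_space) smfd"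
    and E' :: "('k, 'y, 'm) smfd"
  assumes E: "premfd E" and E': "premfd E'"
    and bij: "\<And>n. bij_betw (f n) (pts E n) (pts E' n)"
    and nat: "\<And>m n \<rho> x. Grass_hom m n \<rho> \<Longrightarrow> x \<in> pts E m \<Longrightarrow> f n (act E m n \<rho> x) = act E' m n \<rho> (f m x)"
    and proj: "\<And>n x. x \<in> pts E n \<Longrightarrow> p' n (f n x) = p n x"
    and ch: "\<And>x. x \<in> pts E 0 \<Longrightarrow> \<exists>c\<in>charts E. \<exists>d\<in>charts E'. x \<in> cdom c \<and> cdom d = f 0 ` cdom c \<and>
      cmodel d = cmodel c \<and> cimg d = cimg c \<and> (\<forall>n. \<forall>x\<in>rpts E (cdom c) n. cmap d n (f n x) = cmap c n x)"
  shows "bundle_isomorphic E p E' p'"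
proof -
  note EF = premfdD(1)[OF E] and EF' = premfdD(1)[OF E']
  let ?g = "\<lambda>n. inv_into (pts E n) (f n)"
  have gf: "?g n (f n x) = x" if "x \<in> pts E n" for n x
    by (rule inv_into_f_f[OF bij_betw_imp_inj_on[OF bij] that])
  have fpts: "f n x \<in> pts E' n" if "x \<in> pts E n" for n x
    using bij_betwE[OF bij] that by blast
  have gpts: "?g n y \<in> pts E n" and fg: "f n (?g n y) = y" if "y \<in> pts E' n" for n y
    using that bij_betw_imp_surj_on[OF bij[of n]] by (auto intro: inv_into_into f_inv_into_f)
  have ch': "\<exists>c\<in>charts E. \<exists>d\<in>charts E'. x \<in> cdom c \<and> cdom d = f 0 ` cdom c \<and>
      supersmooth (cmodel c) (cimg c) (cmodel d) (cimg d) (\<lambda>n y. y) \<and>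
      supersmooth (cmodel d) (cimg d) (cmodel c) (cimg c) (\<lambda>n y. y) \<and>
      (\<forall>n. \<forall>x\<in>rpts E (cdom c) n. cmap d n (f n x) = cmap c n x)" if "x \<in> pts E 0" for x
  proof -
    from ch[OF that] obtain c d where c: "c \<in> charts E" and d: "d \<in> charts E'" and *: "x \<in> cdom c" "cdom d = f 0 ` cdom c"
      "cmodel d = cmodel c" "cimg d = cimg c" "\<forall>n. \<forall>x\<in>rpts E (cdom c) n. cmap d n (f n x) = cmap c n x" by blast
    have "supersmooth (cmodel c) (cimg c) (cmodel c) (cimg c) (\<lambda>n y. y)"
      by (rule supersmooth_same[OF chart_model[OF EF M_chart[OF E c]] chart_open[OF EF M_chart[OF E c]]])
    then show ?thesis using * by (intro bexI[OF _ c] bexI[OF _ d]) simp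
  qed
  have fsm: "smooth_map E (pts E 0) E' f"
  proof (rule smooth_map_charts[OF E E' order_refl])
    show "f n x \<in> pts E' n" if "x \<in> rpts E (pts E 0) n" for n x by (rule fpts[OF rpts_pts[OF that]])
    show "f n (act E m n \<rho> x) = act E' m n \<rho> (f m x)" if "Grass_hom m n \<rho>" "x \<in> rpts E (pts E 0) m" for m n \<rho> x
      by (rule nat[OF that(1) rpts_pts[OF that(2)]])
    fix x assume x: "x \<in> pts E 0"
    from ch'[OF this] obtain c d where c: "c \<in> charts E" and d: "d \<in> charts E'" and *: "x \<in> cdom c" "cdom d = f 0 ` cdom c"
      "supersmooth (cmodel c) (cimg c) (cmodel d) (cimg d) (\<lambda>n y. y)"
      "\<forall>n. \<forall>x\<in>rpts E (cdom c) n. cmap d n (f n x) = cmap c n x"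
      by (elim bexE conjE) (rule that)
    show "\<exists>c\<in>charts E. \<exists>d\<in>charts E'. \<exists>\<phi>. x \<in> cdom c \<and> cdom c \<subseteq> pts E 0 \<and> f 0 ` cdom c \<subseteq> cdom d \<and>
        supersmooth (cmodel c) (cimg c) (cmodel d) (cimg d) \<phi> \<and>
        (\<forall>n. \<forall>x\<in>rpts E (cdom c) n. cmap d n (f n x) = \<phi> n (cmap c n x))"
      using * chart_dom[OF EF M_chart[OF E c]]
      by (intro bexI[OF _ c] bexI[OF _ d] exI[of _ "\<lambda>n y. y"]) simp
  qed
  have gsm: "smooth_map E' (pts E' 0) E ?g"
  proof (rule smooth_map_charts[OF E' E order_refl])
    show "?g n y \<in> pts E n" if "y \<in> rpts E' (pts E' 0) n" for n y by (rule gpts[OF rpts_pts[OF that]])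
    show "?g n (act E' m n \<rho> y) = act E m n \<rho> (?g m y)" if \<rho>: "Grass_hom m n \<rho>" and y: "y \<in> rpts E' (pts E' 0) m" for m n \<rho> y
    proof -
      note y' = rpts_pts[OF y]
      have "f n (act E m n \<rho> (?g m y)) = act E' m n \<rho> y"
        using nat[OF \<rho> gpts[OF y']] fg[OF y'] by simp
      then show ?thesis using gf[OF gfunctorD(1)[OF EF \<rho> gpts[OF y']]] by simp
    qed
    fix y assume y: "y \<in> pts E' 0"
    from ch'[OF gpts[OF y]] obtain c d where c: "c \<in> charts E" and d: "d \<in> charts E'" and *: "?g 0 y \<in> cdom c" "cdom d = f 0 ` cdom c"
      "supersmooth (cmodel d) (cimg d) (cmodel c) (cimg c) (\<lambda>n y. y)"
      "\<forall>n. \<forall>x\<in>rpts E (cdom c) n. cmap d n (f n x) = cmap c n x"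
      by (elim bexE conjE) (rule that)
    note cE = chart_dom[OF EF M_chart[OF E c]]
    have g0: "?g 0 z \<in> cdom c" if z: "z \<in> cdom d" for z
    proof -
      obtain w where "w \<in> cdom c" "z = f 0 w" using z *(2) by blast
      then show ?thesis using gf[of w 0] cE by auto
    qed
    have gr: "?g n z \<in> rpts E (cdom c) n" if z: "z \<in> rpts E' (cdom d) n" for n z
    proof (rule rptsI[OF gpts[OF rpts_pts[OF z]]])
      have "f 0 (act E n 0 gaug (?g n z)) = act E' n 0 gaug z"
        using nat[OF gaug_hom gpts[OF rpts_pts[OF z]]] fg[OF rpts_pts[OF z]] by simp
      moreover have "act E n 0 gaug (?g n z) \<in> pts E 0"
        by (rule gfunctorD(1)[OF EF gaug_hom gpts[OF rpts_pts[OF z]]])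
      ultimately have "act E n 0 gaug (?g n z) = ?g 0 (act E' n 0 gaug z)"
        using gf[of "act E n 0 gaug (?g n z)" 0] by simp
      then show "act E n 0 gaug (?g n z) \<in> cdom c" using g0[OF rpts_body[OF z]] by simp
    qed
    have "cmap c n (?g n z) = cmap d n z" if z: "z \<in> rpts E' (cdom d) n" for n z
      using *(4) gr[OF z] fg[OF rpts_pts[OF z]] by metis
    moreover have "y \<in> cdom d" using *(1,2) fg[OF y] by (metis imageI)
    ultimately show "\<exists>c\<in>charts E'. \<exists>d\<in>charts E. \<exists>\<phi>. y \<in> cdom c \<and> cdom c \<subseteq> pts E' 0 \<and> ?g 0 ` cdom c \<subseteq> cdom d \<and>
        supersmooth (cmodel c) (cimg c) (cmodel d) (cimg d) \<phi> \<and>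
        (\<forall>n. \<forall>x\<in>rpts E' (cdom c) n. cmap d n (?g n x) = \<phi> n (cmap c n x))"
      using *(3) g0 chart_dom[OF EF' M_chart[OF E' d]]
      by (intro bexI[OF _ d] bexI[OF _ c] exI[of _ "\<lambda>n y. y"]) (simp add: image_subset_iff)
  qed
  show ?thesis unfolding bundle_isomorphic_def
  proof (intro exI[of _ f] exI[of _ ?g] conjI allI ballI fsm gsm)
    show "?g n (f n x) = x" "p' n (f n x) = p n x" if "x \<in> pts E n" for n x by (rule gf[OF that], rule proj[OF that])
    show "f n (?g n y) = y" if "y \<in> pts E' n" for n y by (rule fg[OF that])
    show "p n (?g n y) = p' n y" if "y \<in> pts E' n" for n y using proj[OF gpts[OF that]] fg[OF that] by simp
  qed
qed

section \<open>Quotients with slices\<close>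

text \<open>Vanishing on the odd part ensures that \<alpha>, applied to the coefficients of a point,
  gives an even Grassmann element. Such elements are central, and they are units when the constant
  term is non-zero.\<close>

definition even_functional :: "('k::real_normed_field, 'v::euclidean_space) sspace \<Rightarrow> ('v \<Rightarrow> 'k) \<Rightarrow> bool" where
  "even_functional V \<alpha> \<longleftrightarrow> Vector_Spaces.linear (scl V) (*) \<alpha> \<and> (\<forall>v\<in>od V. \<alpha> v = 0)"

lemma even_functional_linear: "even_functional V \<alpha> \<Longrightarrow> Vector_Spaces.linear (scl V) (*) \<alpha>"
  by (simp add: even_functional_def)

lemma even_functional_0: "even_functional V \<alpha> \<Longrightarrow> \<alpha> 0 = 0"
  using module_hom.zero[of "scl V" "(*)" \<alpha>] by (simp add: even_functional_def linear_iff_module_hom)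

lemma even_functional_add: "even_functional V \<alpha> \<Longrightarrow> \<alpha> (v + w) = \<alpha> v + \<alpha> w"
  and even_functional_diff: "even_functional V \<alpha> \<Longrightarrow> \<alpha> (v - w) = \<alpha> v - \<alpha> w"
  and even_functional_scale: "even_functional V \<alpha> \<Longrightarrow> \<alpha> (scl V c v) = c * \<alpha> v"
  using module_hom.add[of "scl V" "(*)" \<alpha>] module_hom.diff[of "scl V" "(*)" \<alpha>] module_hom.scale[of "scl V" "(*)" \<alpha>]
  by (simp_all add: even_functional_def linear_iff_module_hom)

lemma even_functional_spts:
  assumes "even_functional V \<alpha>" "x \<in> spts V n"
  shows "(\<lambda>I. \<alpha> (x I)) \<in> Grass_even n"
  using spts_linear[of \<alpha> V sfield x n] even_functional_0[OF assms(1)] assms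
  by (auto simp: spts_sfield even_functional_def)

lemma even_functional_units:
  assumes "even_functional V \<alpha>" "x \<in> spts V n" "\<alpha> (x {}) \<noteq> 0"
  shows "(\<lambda>I. \<alpha> (x I)) \<in> Grass_units n"
  using even_functional_spts[OF assms(1,2)] assms(3) by (simp add: Grass_units_iff)

lemma even_functional_gsmult:
  "even_functional V \<alpha> \<Longrightarrow> (\<lambda>I. \<alpha> (gsmult (scl V) a x I)) = gmult a (\<lambda>I. \<alpha> (x I))"
  by (rule gsmult_linear[OF even_functional_linear])

lemma supersmooth_functional:
  assumes V: "vector_superspace V" and \<alpha>: "even_functional V \<alpha>"
    and D: "openin (top_of_set (ev V)) D" "\<And>v. v \<in> D \<Longrightarrow> \<alpha> v \<in> D'" "open D'"
  shows "supersmooth V D sfield D' (\<lambda>n x I. \<alpha> (x I))"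
  using \<alpha> D by (intro supersmooth_linear[OF V vector_superspace_sfield]) (auto simp: even_functional_def)

lemma even_functional_continuous:
  assumes V: "vector_superspace V" and \<alpha>: "even_functional V \<alpha>"
  shows "continuous_on UNIV \<alpha>"
  using linear_real[OF V vector_superspace_sfield, of \<alpha>] even_functional_linear[OF \<alpha>]
  by (simp add: linear_continuous_on)

text \<open>\<alpha> is zero on the odd part, so passing to its kernel shrinks the even part
  alone.\<close>

definition ker_superspace :: "('k, 'v) sspace \<Rightarrow> ('v \<Rightarrow> 'k::zero) \<Rightarrow> ('k, 'v) sspace" where
  "ker_superspace V \<alpha> = \<lparr>scl = scl V, ev = {v \<in> ev V. \<alpha> v = 0}, od = od V\<rparr>"

lemma ker_superspace_simps [simp]:
  "scl (ker_superspace V \<alpha>) = scl V" "ev (ker_superspace V \<alpha>) = {v \<in> ev V. \<alpha> v = 0}" "od (ker_superspace V \<alpha>) = od V"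
  by (simp_all add: ker_superspace_def)

lemma vector_superspace_ker:
  assumes V: "vector_superspace V" and \<alpha>: "even_functional V \<alpha>"
  shows "vector_superspace (ker_superspace V \<alpha>)"
proof -
  interpret V: module "scl V" by (rule vector_superspace_module[OF V])
  have "V.subspace {v \<in> ev V. \<alpha> v = 0}"
    using vector_superspaceD(3)[OF V] unfolding V.subspace_def
    by (simp add: even_functional_0[OF \<alpha>] even_functional_add[OF \<alpha>] even_functional_scale[OF \<alpha>])
  moreover have "{v \<in> ev V. \<alpha> v = 0} \<inter> od V = {0}"
    using vector_superspaceD(5)[OF V] even_functional_0[OF \<alpha>] by blast
  ultimately show ?thesis
    using vector_superspaceD(1,2,4)[OF V] unfolding vector_superspace_def by simp
qed

lemma ker_spts_iff:
  assumes "even_functional V \<alpha>"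
  shows "x \<in> spts (ker_superspace V \<alpha>) n \<longleftrightarrow> x \<in> spts V n \<and> (\<forall>I. \<alpha> (x I) = 0)"
proof
  assume x: "x \<in> spts (ker_superspace V \<alpha>) n"
  have "\<alpha> (x I) = 0" for I
  proof (cases "I \<subseteq> {..<n}")
    case True
    then have "x I \<in> spart (ker_superspace V \<alpha>) I" using x by (simp add: spts_iff)
    then show ?thesis using assms by (cases "even (card I)") (simp_all add: spart_def even_functional_def)
  next
    case False
    then show ?thesis using x even_functional_0[OF assms] by (simp add: spts_def)
  qed
  moreover have "spart (ker_superspace V \<alpha>) I \<subseteq> spart V I" for I by (auto simp: spart_def)
  ultimately show "x \<in> spts V n \<and> (\<forall>I. \<alpha> (x I) = 0)" using x unfolding spts_iff by blast
qed (auto simp: spts_iff spart_def split: if_splits)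

text \<open>Every orbit on which \<open>\<alpha>\<close> does not vanish meets the slice \<open>\<alpha> = 1\<close> in exactly one point, since \<open>\<alpha>\<close>
  is equivariant.  Subtracting \<open>e\<close> from this point gives a chart with values in the kernel of \<open>\<alpha>\<close>.\<close>

locale slice_quotient =
  fixes X :: "('k::{real_normed_field, euclidean_space}, 'x::euclidean_space) sspace" and D :: "'x set"
    and g :: "nat \<Rightarrow> 'k gr \<Rightarrow> 'x gr \<Rightarrow> 'x gr" and A :: "(('x \<Rightarrow> 'k) \<times> 'x) set"
  assumes X: "vector_superspace X" and D: "openin (top_of_set (ev X)) D"
    and g_dom: "a \<in> Grass_units n \<Longrightarrow> x \<in> dpts X D n \<Longrightarrow> g n a x \<in> dpts X D n"
    and g_one: "x \<in> dpts X D n \<Longrightarrow> g n (gconst 1) x = x"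
    and g_mult: "a \<in> Grass_units n \<Longrightarrow> b \<in> Grass_units n \<Longrightarrow> x \<in> dpts X D n \<Longrightarrow> g n a (g n b x) = g n (gmult a b) x"
    and g_nat: "Grass_hom m n \<rho> \<Longrightarrow> a \<in> Grass_units m \<Longrightarrow> x \<in> dpts X D m \<Longrightarrow>
      gpush (scl X) m \<rho> (g m a x) = g n (\<rho> a) (gpush (scl X) m \<rho> x)"
    and A: "(\<alpha>, e) \<in> A \<Longrightarrow> even_functional X \<alpha>" "(\<alpha>, e) \<in> A \<Longrightarrow> e \<in> ev X" "(\<alpha>, e) \<in> A \<Longrightarrow> \<alpha> e = 1"
    and A_equivariant: "(\<alpha>, e) \<in> A \<Longrightarrow> a \<in> Grass_units n \<Longrightarrow> x \<in> dpts X D n \<Longrightarrow>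
      (\<lambda>I. \<alpha> (g n a x I)) = gmult a (\<lambda>I. \<alpha> (x I))"
    and g_smooth: "(\<alpha>, e) \<in> A \<Longrightarrow> supersmooth X {x \<in> D. \<alpha> x \<noteq> 0} X D (\<lambda>n x. g n (ginv n (\<lambda>I. \<alpha> (x I))) x)"
    and common: "v \<in> D \<Longrightarrow> w \<in> D \<Longrightarrow> \<exists>(\<alpha>, e)\<in>A. \<alpha> v \<noteq> 0 \<and> \<alpha> w \<noteq> 0"
begin

abbreviation "F \<equiv> quot_functor X D g"
abbreviation "Q \<equiv> quot_mfd X D g"
abbreviation "cl \<equiv> orbit g"

lemma D_ev: "D \<subseteq> ev X" by (rule openin_imp_subset[OF D])

lemma cl_self: "x \<in> dpts X D n \<Longrightarrow> x \<in> cl n x"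
  unfolding orbit_def using g_one[of x n] one_units by (metis imageI)

lemma cl_act:
  assumes a: "a \<in> Grass_units n" and x: "x \<in> dpts X D n"
  shows "cl n (g n a x) = cl n x"
proof
  show "cl n (g n a x) \<subseteq> cl n x"
    unfolding orbit_def using g_mult[OF _ a x] Grass_units_gmult[OF _ a] by auto
  show "cl n x \<subseteq> cl n (g n a x)"
  proof
    fix y assume "y \<in> cl n x"
    then obtain b where b: "b \<in> Grass_units n" "y = g n b x" unfolding orbit_def by blast
    have "gmult (gmult b (ginv n a)) a = b"
      by (simp add: gmult_assoc ginv_gmult[OF a] gmult_one_right[OF Grass_even_gsupported[OF Grass_units_even[OF b(1)]]])
    moreover have u: "gmult b (ginv n a) \<in> Grass_units n" by (rule Grass_units_gmult[OF b(1) ginv_units[OF a]])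
    ultimately have "y = g n (gmult b (ginv n a)) (g n a x)" by (simp add: g_mult[OF u a x] b(2))
    then show "y \<in> cl n (g n a x)" unfolding orbit_def using u by blast
  qed
qed

lemma cl_E:
  assumes "y \<in> cl n x"
  obtains a where "a \<in> Grass_units n" "y = g n a x"
  using assms unfolding orbit_def by blast

lemma pts_F: "pts F n = cl n ` dpts X D n"
  by (simp add: quot_functor_def)

text \<open>The action on an orbit is defined as a union over all representatives. The group action
  commutes with \<open>gpush\<close>, so the members of this union are one and the same
  orbit.\<close>

lemma act_F:
  assumes "Grass_hom m n \<rho>" "x \<in> dpts X D m"
  shows "act F m n \<rho> (cl m x) = cl n (gpush (scl X) m \<rho> x)"
proof -
  have "cl n (gpush (scl X) m \<rho> z) = cl n (gpush (scl X) m \<rho> x)" if z: "z \<in> cl m x" for z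
  proof -
    obtain a where a: "a \<in> Grass_units m" "z = g m a x" using cl_E[OF z] .
    show ?thesis unfolding a(2) g_nat[OF assms(1) a(1) assms(2)]
      by (rule cl_act[OF Grass_hom_units[OF assms(1) a(1)] gpush_dpts[OF assms(1) X assms(2)]])
  qed
  moreover have "act F m n \<rho> (cl m x) = (\<Union>z\<in>cl m x. cl n (gpush (scl X) m \<rho> z))"
    by (simp add: quot_functor_def)
  ultimately show ?thesis using cl_self[OF assms(2)] by blast
qed

lemma functor_F: "is_gfunctor F"
  unfolding is_gfunctor_def pts_F
proof (intro conjI allI impI ballI)
  show "act F m n \<rho> ` cl m ` dpts X D m \<subseteq> cl n ` dpts X D n" if "Grass_hom m n \<rho>" for m n \<rho>
    using act_F[OF that] gpush_dpts[OF that X] by auto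
  show "act F n n \<rho> C = C" if \<rho>: "Grass_hom n n \<rho> \<and> (\<forall>a\<in>Grass n. \<rho> a = a)" and C: "C \<in> cl n ` dpts X D n" for n \<rho> C
  proof -
    obtain x where x: "x \<in> dpts X D n" "C = cl n x" using C by blast
    have "gpush (scl X) n \<rho> x = x"
      using \<rho> by (intro gpush_id[OF _ vector_superspaceD(1)[OF X] spts_gsupported[OF dpts_spts[OF x(1)]]]) blast
    then show ?thesis using act_F[OF conjunct1[OF \<rho>] x(1)] x(2) by simp
  qed
  show "act F l n \<tau> C = act F m n \<sigma> (act F l m \<rho> C)"
    if *: "Grass_hom l m \<rho> \<and> Grass_hom m n \<sigma> \<and> Grass_hom l n \<tau> \<and> (\<forall>a\<in>Grass l. \<tau> a = \<sigma> (\<rho> a))"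
      and C: "C \<in> cl l ` dpts X D l" for l m n \<rho> \<sigma> \<tau> C
  proof -
    obtain x where x: "x \<in> dpts X D l" "C = cl l x" using C by blast
    show ?thesis
      using * act_F[of l n \<tau> x] act_F[of l m \<rho> x] act_F[of m n \<sigma> "gpush (scl X) l \<rho> x"] x
        gpush_dpts[of l m \<rho> X x D, OF _ X] gpush_comp[of l m \<rho> n \<sigma> \<tau>, OF _ _ _ _ vector_superspaceD(1)[OF X], of x]
      by simp
  qed
qed

lemma rpts_F:
  assumes "x \<in> dpts X D n"
  shows "cl n x \<in> rpts F U n \<longleftrightarrow> x {} \<in> quot_preimage D g U"
  using assms act_F[OF gaug_hom assms, of 0]
  by (auto simp: rpts_def pts_F quot_preimage_def gpush_gaug[OF vector_superspaceD(1)[OF X]] dpts_def)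

lemma quot_preimage_subset: "quot_preimage D g U \<subseteq> D"
  by (auto simp: quot_preimage_def)

lemma rpts_F_cl: "x \<in> dpts X (quot_preimage D g U) n \<Longrightarrow> cl n x \<in> rpts F U n"
  using rpts_F[OF dpts_mono[OF quot_preimage_subset], of x U n U] by (simp add: dpts_def)

lemma rpts_F_E:
  assumes "C \<in> rpts F U n"
  obtains x where "x \<in> dpts X (quot_preimage D g U) n" "C = cl n x"
proof -
  obtain x where x: "x \<in> dpts X D n" "C = cl n x" using rpts_pts[OF assms] unfolding pts_F by blast
  then have "x {} \<in> quot_preimage D g U" using assms by (simp add: rpts_F)
  then show thesis using x by (intro that[of x]) (simp add: dpts_def)
qed

lemma quot_mfd_simps [simp]: "pts Q = pts F" "act Q = act F" "charts Q = Collect (quot_chart X D g)"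
  by (simp_all add: quot_mfd_def)

lemma rpts_Q [simp]: "rpts Q U n = rpts F U n"
  by (simp add: rpts_def)

lemma functor_Q: "is_gfunctor Q"
  using functor_F by (simp add: is_gfunctor_def)

lemma cinv_Q: "cinv Q c n = cinv F c n"
  by (simp add: cinv_def)

lemma quot_chart_is_chart: "quot_chart X D g c \<Longrightarrow> is_chart F c"
  by (simp add: quot_chart_def)

lemma quot_chart_lift:
  assumes "quot_chart X D g c" "y \<in> cimg c"
  shows "\<exists>D' s. y \<in> D' \<and> D' \<subseteq> cimg c \<and> supersmooth (cmodel c) D' X (quot_preimage D g (cdom c)) s \<and>
    (\<forall>n. \<forall>x\<in>dpts (cmodel c) D' n. cmap c n (orbit g n (s n x)) = x)"
  using assms(1)[unfolded quot_chart_def, THEN conjunct2, THEN conjunct2] assms(2) by (rule bspec)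

lemma is_chart_Q: "is_chart Q c \<longleftrightarrow> is_chart F c"
  by (simp add: is_chart_def)

text \<open>The local lifts of the inverse of a chart express a function on the quotient by its pullback.\<close>

lemma supersmooth_descend:
  assumes c: "quot_chart X D g c" and S: "S \<subseteq> cdom c"
    and \<psi>: "supersmooth X (quot_preimage D g S) Y T \<psi>"
    and eq: "\<And>n x. x \<in> dpts X (quot_preimage D g S) n \<Longrightarrow> f n (cl n x) = \<psi> n x"
  shows "supersmooth (cmodel c) (cbody c S) Y T (\<lambda>n y. f n (cinv F c n y))"
proof -
  note cF = quot_chart_is_chart[OF c]
  note M = chart_model[OF functor_F cF]
  let ?P = "quot_preimage D g (cdom c)" and ?P' = "quot_preimage D g S"
  show ?thesis
  proof (rule supersmooth_local[OF M supersmoothD(2)[OF \<psi>]])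
    fix y0 assume "y0 \<in> cbody c S"
    then obtain C0 where C0: "C0 \<in> S" "y0 = cpt c C0" unfolding cbody_def by blast
    have "y0 \<in> cimg c" using C0 S cpt_in[OF functor_F cF] by blast
    from quot_chart_lift[OF c this]
    obtain D' s where s: "y0 \<in> D'" "D' \<subseteq> cimg c" "supersmooth (cmodel c) D' X ?P s"
        "\<And>n x. x \<in> dpts (cmodel c) D' n \<Longrightarrow> cmap c n (cl n (s n x)) = x"
      by blast
    have D'ev: "D' \<subseteq> ev (cmodel c)" by (rule openin_imp_subset[OF supersmoothD(1)[OF s(3)]])
    \<comment> \<open>The lift need not stay in the part over \<open>S\<close>; the preimage under
      its body cuts it back to an open set where it does.\<close>
    let ?D1 = "{y \<in> D'. fbody s y \<in> ?P'}"
    note s1 = supersmooth_vimage[OF M X s(3) supersmoothD(1)[OF \<psi>]]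
    have sm: "supersmooth (cmodel c) ?D1 Y T (\<lambda>n y. \<psi> n (s n y))" by (rule supersmooth_compose[OF M X s1 \<psi>])
    have inv: "cinv F c n y = cl n (s n y)" if y: "y \<in> dpts (cmodel c) D' n" for n y
      using cinv_cmap[OF functor_F cF rpts_F_cl[OF supersmoothD(3)[OF s(3) y]]] s(4)[OF y] by simp
    have body: "cl 0 (gconst (fbody s y)) \<in> cdom c \<and> cpt c (cl 0 (gconst (fbody s y))) = y" if y: "y \<in> D'" for y
    proof -
      have gy: "gconst y \<in> dpts (cmodel c) D' 0" by (rule gconst_dpts[OF M y D'ev])
      have "s 0 (gconst y) = gconst (fbody s y)"
        unfolding fbody_def by (rule spts_0[OF spts_gsupported[OF dpts_spts[OF supersmoothD(3)[OF s(3) gy]]]])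
      then have "cmap c 0 (cl 0 (gconst (fbody s y))) = gconst y" using s(4)[OF gy] by simp
      moreover have "fbody s y \<in> ?P" by (rule supersmooth_fbody[OF M s(3) y])
      ultimately show ?thesis by (simp add: quot_preimage_def)
    qed
    show "\<exists>D1 h. y0 \<in> D1 \<and> D1 \<subseteq> cbody c S \<and> supersmooth (cmodel c) D1 Y T h \<and>
        (\<forall>n. \<forall>x\<in>dpts (cmodel c) D1 n. f n (cinv F c n x) = h n x)"
    proof (intro exI[of _ ?D1] exI[of _ "\<lambda>n y. \<psi> n (s n y)"] conjI allI ballI sm)
      \<comment> \<open>The lift of \<open>y0\<close> represents the class \<open>C0\<close>: both
        have the coordinate \<open>y0\<close>, and a chart is injective.\<close>
      have "cl 0 (gconst (fbody s y0)) = C0"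
        using body[OF s(1)] C0 S by (intro cpt_inj[OF functor_F cF]) auto
      moreover have "fbody s y0 \<in> D" using supersmooth_fbody[OF M s(3,1)] quot_preimage_subset by blast
      ultimately show "y0 \<in> ?D1" using C0(1) s(1) by (simp add: quot_preimage_def)
      show "?D1 \<subseteq> cbody c S"
      proof
        fix y assume "y \<in> ?D1"
        then have "y \<in> D'" "cl 0 (gconst (fbody s y)) \<in> S" by (simp_all add: quot_preimage_def)
        then show "y \<in> cbody c S" unfolding cbody_def using body[of y] by (metis imageI)
      qed
      fix n y assume y: "y \<in> dpts (cmodel c) ?D1 n"
      have "s n y \<in> dpts X ?P' n" by (rule supersmoothD(3)[OF s1 y])
      then show "f n (cinv F c n y) = \<psi> n (s n y)"
        using inv[of y n] y eq by (simp add: dpts_def)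
    qed
  qed
qed

lemma quot_chart_smooth:
  "quot_chart X D g c \<Longrightarrow> supersmooth X (quot_preimage D g (cdom c)) (cmodel c) (cimg c) (\<lambda>n x. cmap c n (cl n x))"
  by (simp add: quot_chart_def)

text \<open>The two halves of \<open>quot_chart\<close> meet here: of the target chart d it matters
  that it is supersmooth on the superdomain, of the source chart c that its inverse lifts.\<close>

lemma quot_transition:
  assumes c: "quot_chart X D g c" and d: "quot_chart X D g d"
  shows "supersmooth (cmodel c) (cbody c (cdom c \<inter> cdom d)) (cmodel d) (cimg d) (\<lambda>n y. cmap d n (cinv F c n y))"
proof (rule supersmooth_descend[OF c Int_lower1])
  have "quot_preimage D g (cdom c \<inter> cdom d) = quot_preimage D g (cdom c) \<inter> quot_preimage D g (cdom d)"
    by (auto simp: quot_preimage_def)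
  then have "openin (top_of_set (ev X)) (quot_preimage D g (cdom c \<inter> cdom d))"
    using openin_Int[OF supersmoothD(1)[OF quot_chart_smooth[OF c]] supersmoothD(1)[OF quot_chart_smooth[OF d]]] by simp
  then show "supersmooth X (quot_preimage D g (cdom c \<inter> cdom d)) (cmodel d) (cimg d) (\<lambda>n x. cmap d n (cl n x))"
    using supersmooth_fbody[OF X quot_chart_smooth[OF d]] supersmoothD(2)[OF quot_chart_smooth[OF d]]
    by (intro supersmooth_restrict[OF X chart_model[OF functor_F quot_chart_is_chart[OF d]] quot_chart_smooth[OF d]])
      (auto simp: quot_preimage_def)
qed simp

definition slice_map :: "('x \<Rightarrow> 'k) \<Rightarrow> 'x \<Rightarrow> nat \<Rightarrow> 'x gr \<Rightarrow> 'x gr" where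
  "slice_map \<alpha> e n x = (\<lambda>I. g n (ginv n (\<lambda>I. \<alpha> (x I))) x I + gconst (- e) I)"

text \<open>The kernel of \<alpha> is modelled inside the ambient type of \<open>X\<close>, as the
  charts of a quotient require. The choice of the representative is harmless because
  \<open>slice_map\<close> is constant on the orbits in question.\<close>

definition slice_chart :: "('x \<Rightarrow> 'k) \<Rightarrow> 'x \<Rightarrow> ('k, 'x gr set, 'x) chart" where
  "slice_chart \<alpha> e = \<lparr>cdom = {C \<in> pts F 0. \<forall>x\<in>C. \<alpha> (x {}) \<noteq> 0}, cmodel = ker_superspace X \<alpha>,
     cimg = {y \<in> ev X. \<alpha> y = 0 \<and> e + y \<in> D}, cmap = (\<lambda>n C. slice_map \<alpha> e n (SOME x. x \<in> C))\<rparr>"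

context
  fixes \<alpha> e
  assumes \<alpha>e: "(\<alpha>, e) \<in> A"
begin

abbreviation "P \<equiv> {x \<in> D. \<alpha> x \<noteq> 0}"

lemma slice_preimage: "quot_preimage D g (cdom (slice_chart \<alpha> e)) = P"
proof -
  have "(\<forall>x\<in>cl 0 (gconst v). \<alpha> (x {}) \<noteq> 0) \<longleftrightarrow> \<alpha> v \<noteq> 0" if v: "v \<in> D" for v
  proof -
    have gv: "gconst v \<in> dpts X D 0" by (rule gconst_dpts[OF X v D_ev])
    have "\<alpha> (g 0 a (gconst v) {}) = a {} * \<alpha> v" if "a \<in> Grass_units 0" for a
      using fun_cong[OF A_equivariant[OF \<alpha>e that gv], of "{}"] by simp
    then show ?thesis
      using cl_self[OF gv] unfolding orbit_def by (auto simp: Grass_units_iff)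
  qed
  moreover have "cl 0 (gconst v) \<in> pts F 0" if "v \<in> D" for v
    unfolding pts_F using gconst_dpts[OF X that D_ev] by blast
  ultimately show ?thesis by (auto simp: quot_preimage_def slice_chart_def)
qed

lemma slice_units: "x \<in> dpts X P n \<Longrightarrow> (\<lambda>I. \<alpha> (x I)) \<in> Grass_units n"
  by (rule even_functional_units[OF A(1)[OF \<alpha>e] dpts_spts]) (assumption, simp add: dpts_def)

lemma P_D: "x \<in> dpts X P n \<Longrightarrow> x \<in> dpts X D n"
  by (simp add: dpts_def)

text \<open>For y = a x, equivariance gives \<alpha>(y)^(-1) a = \<alpha>(x)^(-1), so both points
  are normalized to the same point of the slice.\<close>

lemma slice_map_invariant:
  assumes x: "x \<in> dpts X P n" and y: "y \<in> cl n x"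
  shows "slice_map \<alpha> e n y = slice_map \<alpha> e n x"
proof -
  obtain a where a: "a \<in> Grass_units n" "y = g n a x" using y unfolding orbit_def by blast
  note u = slice_units[OF x]
  have 1: "(\<lambda>I. \<alpha> (y I)) = gmult a (\<lambda>I. \<alpha> (x I))" unfolding a(2) by (rule A_equivariant[OF \<alpha>e a(1) P_D[OF x]])
  have "ginv n (gmult a (\<lambda>I. \<alpha> (x I))) = gmult (ginv n (\<lambda>I. \<alpha> (x I))) (ginv n a)"
    by (simp add: ginv_gmult_distrib[OF a(1) u] Grass_even_commute[OF ginv_even[OF a(1)]])
  then have "gmult (ginv n (\<lambda>I. \<alpha> (y I))) a = ginv n (\<lambda>I. \<alpha> (x I))"
    by (simp add: 1 gmult_assoc ginv_gmult[OF a(1)] gmult_one_right[OF Grass_even_gsupported[OF ginv_even[OF u]]])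
  moreover have "ginv n (\<lambda>I. \<alpha> (y I)) \<in> Grass_units n" unfolding 1 by (rule ginv_units[OF Grass_units_gmult[OF a(1) u]])
  ultimately have "g n (ginv n (\<lambda>I. \<alpha> (y I))) y = g n (ginv n (\<lambda>I. \<alpha> (x I))) x"
    unfolding a(2) by (simp add: g_mult[OF _ a(1) P_D[OF x]])
  then show ?thesis by (simp add: slice_map_def)
qed

lemma slice_cmap: "x \<in> dpts X P n \<Longrightarrow> cmap (slice_chart \<alpha> e) n (cl n x) = slice_map \<alpha> e n x"
  using slice_map_invariant[of x n "SOME y. y \<in> cl n x"] someI[of "\<lambda>y. y \<in> cl n x" x] cl_self[OF P_D]
  by (simp add: slice_chart_def)

lemma slice_norm:
  assumes x: "x \<in> dpts X P n"
  defines "z \<equiv> g n (ginv n (\<lambda>I. \<alpha> (x I))) x"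
  shows "z \<in> dpts X D n" "(\<lambda>I. \<alpha> (z I)) = gconst 1" "cl n z = cl n x"
proof -
  note u = slice_units[OF x]
  show "z \<in> dpts X D n" "cl n z = cl n x" unfolding z_def
    by (rule g_dom[OF ginv_units[OF u] P_D[OF x]], rule cl_act[OF ginv_units[OF u] P_D[OF x]])
  show "(\<lambda>I. \<alpha> (z I)) = gconst 1"
    unfolding z_def A_equivariant[OF \<alpha>e ginv_units[OF u] P_D[OF x]] by (rule ginv_gmult[OF u])
qed

abbreviation "K \<equiv> ker_superspace X \<alpha>"
abbreviation "T \<equiv> {y \<in> ev X. \<alpha> y = 0 \<and> e + y \<in> D}"

lemma K: "vector_superspace K"
  by (rule vector_superspace_ker[OF X A(1)[OF \<alpha>e]])

lemma uminus_e: "- e \<in> ev X"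
  using spart_scale[OF X, of e "{}" "- 1"] A(2)[OF \<alpha>e]
  by (simp add: module.scale_minus_left[OF vector_superspace_module[OF X]] module.scale_one[OF vector_superspace_module[OF X]])

lemma slice_map_in: assumes x: "x \<in> dpts X P n" shows "slice_map \<alpha> e n x \<in> dpts K T n"
proof -
  let ?z = "g n (ginv n (\<lambda>I. \<alpha> (x I))) x"
  note z = slice_norm[OF x]
  have "slice_map \<alpha> e n x \<in> spts X n"
    unfolding slice_map_def by (rule spts_add[OF X dpts_spts[OF z(1)] gconst_spts[OF X uminus_e]])
  moreover have "\<alpha> (slice_map \<alpha> e n x I) = 0" for I
  proof -
    have "\<alpha> (gconst (- e) I) = - gconst 1 I"
      using even_functional_diff[OF A(1)[OF \<alpha>e], of 0 e] A(3)[OF \<alpha>e] even_functional_0[OF A(1)[OF \<alpha>e]]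
      by (simp add: gconst_def)
    then show ?thesis
      using fun_cong[OF z(2), of I] by (simp add: slice_map_def even_functional_add[OF A(1)[OF \<alpha>e]])
  qed
  moreover have "e + slice_map \<alpha> e n x {} \<in> D" using z(1) by (simp add: slice_map_def dpts_def)
  ultimately show ?thesis
    using spts_empty[of "slice_map \<alpha> e n x" X n] by (simp add: dpts_def ker_spts_iff[OF A(1)[OF \<alpha>e]])
qed

text \<open>The slice \<alpha> = 1, parametrized by the kernel. It is a section over the whole
  chart, and so provides the lifts demanded by \<open>quot_chart\<close>.\<close>

definition lift :: "nat \<Rightarrow> 'x gr \<Rightarrow> 'x gr" where
  "lift n y = (\<lambda>I. gconst e I + y I)"

lemma lift_in: assumes y: "y \<in> dpts K T n" shows "lift n y \<in> dpts X P n" "slice_map \<alpha> e n (lift n y) = y"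
proof -
  have yX: "y \<in> spts X n" "\<And>I. \<alpha> (y I) = 0" "e + y {} \<in> D"
    using y by (simp_all add: dpts_def ker_spts_iff[OF A(1)[OF \<alpha>e]])
  have \<alpha>l: "(\<lambda>I. \<alpha> (lift n y I)) = gconst 1"
    using yX(2) even_functional_0[OF A(1)[OF \<alpha>e]] A(3)[OF \<alpha>e]
    by (auto simp: lift_def even_functional_add[OF A(1)[OF \<alpha>e]] gconst_def)
  have "lift n y \<in> spts X n" unfolding lift_def by (rule spts_add[OF X gconst_spts[OF X A(2)[OF \<alpha>e]] yX(1)])
  then show 1: "lift n y \<in> dpts X P n"
    using yX(3) fun_cong[OF \<alpha>l, of "{}"] by (simp add: dpts_def lift_def)
  show "slice_map \<alpha> e n (lift n y) = y"
    unfolding slice_map_def \<alpha>l ginv_one g_one[OF P_D[OF 1]] by (auto simp: lift_def gconst_def)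
qed

lemma P_open: "openin (top_of_set (ev X)) P"
  by (rule supersmoothD(1)[OF g_smooth[OF \<alpha>e]])

lemma T_open: "openin (top_of_set (ev K)) T"
proof -
  have "continuous_on (ev K) (\<lambda>y. e + y)" by (intro continuous_on_add continuous_on_const continuous_on_id)
  moreover have "(\<lambda>y. e + y) \<in> ev K \<rightarrow> ev X"
    using spart_add[OF X, of e "{}"] A(2)[OF \<alpha>e] by auto
  ultimately have "openin (top_of_set (ev K)) (ev K \<inter> (\<lambda>y. e + y) -` D)" using D by (rule continuous_openin_preimage)
  moreover have "ev K \<inter> (\<lambda>y. e + y) -` D = T" by auto
  ultimately show ?thesis by simp
qed

lemma slice_map_smooth: "supersmooth X P K T (slice_map \<alpha> e)"
proof -
  have "supersmooth X P X (ev X) (\<lambda>n x I. g n (ginv n (\<lambda>I. \<alpha> (x I))) x I + gconst (- e) I)"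
    by (rule supersmooth_add[OF X X g_smooth[OF \<alpha>e] supersmooth_const[OF X X P_open openin_subtopology_self uminus_e]])
  then have "supersmooth X P X (ev X) (slice_map \<alpha> e)" by (simp only: slice_map_def[abs_def])
  then show ?thesis by (rule supersmooth_into[OF _ ker_superspace_simps(1) T_open slice_map_in])
qed

lemma lift_smooth: "supersmooth K T X P lift"
proof -
  have inc: "supersmooth K T X (ev X) (\<lambda>n y. y)"
    by (rule supersmooth_inclusion[OF K X _ _ _ T_open openin_subtopology_self]) auto
  have "supersmooth K T X (ev X) (\<lambda>n y I. gconst e I + y I)"
    by (rule supersmooth_add[OF K X supersmooth_const[OF K X T_open openin_subtopology_self A(2)[OF \<alpha>e]] inc])
  then have "supersmooth K T X (ev X) lift" by (simp only: lift_def[abs_def])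
  then show ?thesis by (rule supersmooth_into[OF _ refl P_open lift_in(1)])
qed

lemma slice_chart_simps [simp]:
  "cmodel (slice_chart \<alpha> e) = K" "cimg (slice_chart \<alpha> e) = T"
  by (simp_all add: slice_chart_def)

lemma slice_rpts_E:
  assumes "C \<in> rpts F (cdom (slice_chart \<alpha> e)) n"
  obtains x where "x \<in> dpts X P n" "C = cl n x"
  using rpts_F_E[OF assms] unfolding slice_preimage by blast

lemma slice_rpts: "x \<in> dpts X P n \<Longrightarrow> cl n x \<in> rpts F (cdom (slice_chart \<alpha> e)) n"
  by (rule rpts_F_cl) (simp only: slice_preimage)

lemma slice_is_chart: "is_chart F (slice_chart \<alpha> e)"
  unfolding is_chart_def
proof (intro conjI allI impI ballI)
  show "cdom (slice_chart \<alpha> e) \<subseteq> pts F 0" by (auto simp: slice_chart_def)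
  show "vector_superspace (cmodel (slice_chart \<alpha> e))" by (simp add: K)
  show "openin (top_of_set (ev (cmodel (slice_chart \<alpha> e)))) (cimg (slice_chart \<alpha> e))" using T_open by simp
  fix n
  show "bij_betw (cmap (slice_chart \<alpha> e) n) (rpts F (cdom (slice_chart \<alpha> e)) n) (dpts (cmodel (slice_chart \<alpha> e)) (cimg (slice_chart \<alpha> e)) n)"
    unfolding slice_chart_simps
  proof (rule bij_betwI')
    fix C C' assume C: "C \<in> rpts F (cdom (slice_chart \<alpha> e)) n" "C' \<in> rpts F (cdom (slice_chart \<alpha> e)) n"
    obtain x where x: "x \<in> dpts X P n" "C = cl n x" using slice_rpts_E[OF C(1)] .
    obtain x' where x': "x' \<in> dpts X P n" "C' = cl n x'" using slice_rpts_E[OF C(2)] .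
    show "cmap (slice_chart \<alpha> e) n C = cmap (slice_chart \<alpha> e) n C' \<longleftrightarrow> C = C'"
    proof
      assume "cmap (slice_chart \<alpha> e) n C = cmap (slice_chart \<alpha> e) n C'"
      then have "slice_map \<alpha> e n x = slice_map \<alpha> e n x'" by (simp add: x x' slice_cmap)
      then have "g n (ginv n (\<lambda>I. \<alpha> (x I))) x = g n (ginv n (\<lambda>I. \<alpha> (x' I))) x'"
        by (simp add: slice_map_def fun_eq_iff)
      then show "C = C'" using slice_norm(3)[OF x(1)] slice_norm(3)[OF x'(1)] x(2) x'(2) by simp
    qed simp
    show "cmap (slice_chart \<alpha> e) n C \<in> dpts K T n" using slice_map_in[OF x(1)] by (simp add: x slice_cmap)
  next
    fix y assume y: "y \<in> dpts K T n"
    show "\<exists>C\<in>rpts F (cdom (slice_chart \<alpha> e)) n. y = cmap (slice_chart \<alpha> e) n C"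
      by (rule bexI[OF _ slice_rpts[OF lift_in(1)[OF y]]]) (simp add: slice_cmap lift_in[OF y])
  qed
next
  show "cmap (slice_chart \<alpha> e) n (act F m n \<rho> C) = gpush (scl (cmodel (slice_chart \<alpha> e))) m \<rho> (cmap (slice_chart \<alpha> e) m C)"
    if \<rho>: "Grass_hom m n \<rho>" and C: "C \<in> rpts F (cdom (slice_chart \<alpha> e)) m" for m n \<rho> C
  proof -
    obtain x where x: "x \<in> dpts X P m" "C = cl m x" using slice_rpts_E[OF C] .
    show ?thesis
      unfolding x(2) act_F[OF \<rho> P_D[OF x(1)]] slice_cmap[OF x(1)] slice_cmap[OF gpush_dpts[OF \<rho> X x(1)]]
      using supersmoothD(4)[OF slice_map_smooth \<rho> x(1)] by simp
  qed
qed

lemma slice_quot_chart: "quot_chart X D g (slice_chart \<alpha> e)"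
  unfolding quot_chart_def slice_preimage slice_chart_simps
proof (intro conjI slice_is_chart ballI)
  show "supersmooth X P K T (\<lambda>n x. cmap (slice_chart \<alpha> e) n (cl n x))"
    by (rule supersmooth_cong[OF X slice_map_smooth slice_cmap])
  fix y assume "y \<in> T"
  then show "\<exists>D' s. y \<in> D' \<and> D' \<subseteq> T \<and> supersmooth K D' X P s \<and>
      (\<forall>n. \<forall>x\<in>dpts K D' n. cmap (slice_chart \<alpha> e) n (cl n (s n x)) = x)"
    by (intro exI[of _ T] exI[of _ lift] conjI order_refl lift_smooth) (simp_all add: slice_cmap lift_in)
qed

end

lemma slice_cdom_iff:
  assumes "(\<alpha>, e) \<in> A" "x \<in> dpts X D 0"
  shows "cl 0 x \<in> cdom (slice_chart \<alpha> e) \<longleftrightarrow> \<alpha> (x {}) \<noteq> 0"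
proof -
  have gx: "x = gconst (x {})" by (rule spts_0[OF spts_gsupported[OF dpts_spts[OF assms(2)]]])
  have xD: "x {} \<in> D" using assms(2) by (simp add: dpts_def)
  have "cl 0 (gconst (x {})) \<in> cdom (slice_chart \<alpha> e) \<longleftrightarrow> x {} \<in> quot_preimage D g (cdom (slice_chart \<alpha> e))"
    using xD by (simp add: quot_preimage_def)
  also have "\<dots> \<longleftrightarrow> \<alpha> (x {}) \<noteq> 0" unfolding slice_preimage[OF assms(1)] using xD by simp
  finally show ?thesis using gx by metis
qed

lemma premfd_Q: "premfd Q"
proof (rule premfdI[OF functor_Q])
  show "is_chart Q c" if "c \<in> charts Q" for c
    using that quot_chart_is_chart by (simp add: is_chart_Q)
  show "\<exists>c\<in>charts Q. C \<in> cdom c" if C: "C \<in> pts Q 0" for C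
  proof -
    obtain x where x: "x \<in> dpts X D 0" "C = cl 0 x" using C by (auto simp: pts_F)
    then have "x {} \<in> D" by (simp add: dpts_def)
    from common[OF this this] obtain \<alpha> e where "(\<alpha>, e) \<in> A" "\<alpha> (x {}) \<noteq> 0" by blast
    then show ?thesis using slice_quot_chart x slice_cdom_iff by (intro bexI[of _ "slice_chart \<alpha> e"]) simp_all
  qed
  show "supersmooth (cmodel c) (cbody c (cdom c \<inter> cdom d)) (cmodel d) (cimg d) (\<lambda>n y. cmap d n (cinv Q c n y))"
    if "c \<in> charts Q" "d \<in> charts Q" for c d
    using quot_transition[of c d] that by (simp add: cinv_Q)
qed

text \<open>The sets on which the functionals are non-zero are open, since linear functionals on a
  finite-dimensional space are continuous; by the Lindelof property countably many of them have the
  same union.\<close>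

lemma countable_slices: "\<exists>A'\<subseteq>A. countable A' \<and> (\<forall>v\<in>D. \<exists>(\<alpha>, e)\<in>A'. \<alpha> v \<noteq> 0)"
proof -
  let ?U = "\<lambda>p :: ('x \<Rightarrow> 'k) \<times> 'x. {v. fst p v \<noteq> 0}"
  have "open (?U p)" if "p \<in> A" for p
  proof -
    have "continuous_on UNIV (fst p)"
      using even_functional_continuous[OF X A(1)[of "fst p" "snd p"]] that by simp
    then have "open (fst p -` (- {0}))" by (intro open_vimage) auto
    moreover have "fst p -` (- {0}) = ?U p" by auto
    ultimately show ?thesis by simp
  qed
  then obtain \<F> where \<F>: "\<F> \<subseteq> ?U ` A" "countable \<F>" "\<Union>\<F> = \<Union> (?U ` A)"
    by (metis (no_types, lifting) Lindelof imageE)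
  then obtain A' where A': "A' \<subseteq> A" "countable A'" "\<F> = ?U ` A'"
    using countable_subset_image[of \<F> ?U A] by auto
  have "\<exists>(\<alpha>, e)\<in>A'. \<alpha> v \<noteq> 0" if v: "v \<in> D" for v
  proof -
    from common[OF v v] have "v \<in> \<Union> (?U ` A)" by force
    then have "v \<in> \<Union> (?U ` A')" using \<F>(3) A'(3) by simp
    then show ?thesis by force
  qed
  then show ?thesis using A' by blast
qed

lemma supermanifold_Q: "supermanifold Q"
proof -
  obtain A' where A': "A' \<subseteq> A" "countable A'" "\<And>v. v \<in> D \<Longrightarrow> \<exists>(\<alpha>, e)\<in>A'. \<alpha> v \<noteq> 0"
    using countable_slices by blast
  let ?C = "(\<lambda>(\<alpha>, e). slice_chart \<alpha> e) ` A'"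
  show ?thesis
  proof (rule supermanifoldI[OF premfd_Q])
    show "countable ?C" using A'(2) by simp
    show "?C \<subseteq> charts Q" using A'(1) slice_quot_chart by auto
    show "pts Q 0 \<subseteq> \<Union> (cdom ` ?C)"
    proof
      fix C assume "C \<in> pts Q 0"
      then obtain x where x: "x \<in> dpts X D 0" "C = cl 0 x" by (auto simp: pts_F)
      then have "x {} \<in> D" by (simp add: dpts_def)
      from A'(3)[OF this] obtain \<alpha> e where ae: "(\<alpha>, e) \<in> A'" "\<alpha> (x {}) \<noteq> 0" by blast
      then have "C \<in> cdom (slice_chart \<alpha> e)" using slice_cdom_iff[OF _ x(1)] A'(1) x(2) by blast
      then show "C \<in> \<Union> (cdom ` ?C)" using ae(1) by force
    qed
    fix C C' assume "C \<in> pts Q 0" "C' \<in> pts Q 0"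
    then obtain x x' where x: "x \<in> dpts X D 0" "C = cl 0 x" and x': "x' \<in> dpts X D 0" "C' = cl 0 x'" by (auto simp: pts_F)
    then have "x {} \<in> D" "x' {} \<in> D" by (simp_all add: dpts_def)
    from common[OF this] obtain \<alpha> e where "(\<alpha>, e) \<in> A" "\<alpha> (x {}) \<noteq> 0" "\<alpha> (x' {}) \<noteq> 0" by blast
    then show "\<exists>c\<in>charts Q. C \<in> cdom c \<and> C' \<in> cdom c"
      using slice_quot_chart x x' slice_cdom_iff by (intro bexI[of _ "slice_chart \<alpha> e"]) simp_all
  qed
qed

end

text \<open>Pulled back to the superdomain, a coordinate expression of f is \<phi> followed by a
  chart of the target. \<open>supersmooth_descend\<close> brings it back down to the
  quotient.\<close>

lemma smooth_map_quotient:
  assumes Q: "slice_quotient X D g A" and Q': "slice_quotient X' D' g' A'"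
    and \<phi>: "supersmooth X D X' D' \<phi>"
    and f: "\<And>n x. x \<in> dpts X D n \<Longrightarrow> f n (orbit g n x) = orbit g' n (\<phi> n x)"
  shows "smooth_map (quot_mfd X D g) (pts (quot_mfd X D g) 0) (quot_mfd X' D' g') f"
proof -
  interpret Q: slice_quotient X D g A by (rule Q)
  interpret Q': slice_quotient X' D' g' A' by (rule Q')
  have fpts: "f n C \<in> pts Q'.Q n" if "C \<in> pts Q.Q n" for n C
    using that f supersmoothD(3)[OF \<phi>] by (auto simp: Q.pts_F Q'.pts_F)
  show ?thesis
  proof (rule smooth_mapI_local[OF Q.premfd_Q Q'.premfd_Q order_refl])
    show "f n C \<in> pts Q'.Q n" if "C \<in> rpts Q.Q (pts Q.Q 0) n" for n C
      by (rule fpts[OF rpts_pts[OF that]])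
    show "f n (act Q.Q m n \<rho> C) = act Q'.Q m n \<rho> (f m C)" if \<rho>: "Grass_hom m n \<rho>" and C: "C \<in> rpts Q.Q (pts Q.Q 0) m" for m n \<rho> C
    proof -
      obtain x where x: "x \<in> dpts X D m" "C = orbit g m x" using rpts_pts[OF C] by (auto simp: Q.pts_F)
      show ?thesis
        using Q.act_F[OF \<rho> x(1)] Q'.act_F[OF \<rho> supersmoothD(3)[OF \<phi> x(1)]] f[OF x(1)] f[OF gpush_dpts[OF \<rho> Q.X x(1)]]
          supersmoothD(4)[OF \<phi> \<rho> x(1)] x(2) by simp
    qed
    fix C assume C: "C \<in> pts Q.Q 0"
    obtain c where c: "c \<in> charts Q.Q" "C \<in> cdom c" using premfdD(3)[OF Q.premfd_Q C] by blast
    obtain d where d: "d \<in> charts Q'.Q" "f 0 C \<in> cdom d" using premfdD(3)[OF Q'.premfd_Q fpts[OF C]] by blast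
    have cq: "quot_chart X D g c" and dq: "quot_chart X' D' g' d" using c d by simp_all
    note cF = Q.quot_chart_is_chart[OF cq]
    let ?S = "{C \<in> cdom c. f 0 C \<in> cdom d}"
    let ?P = "quot_preimage D g (cdom c)" and ?P' = "quot_preimage D' g' (cdom d)"
    note \<phi>c = supersmooth_restrict[OF Q.X Q'.X \<phi> supersmoothD(1)[OF Q.quot_chart_smooth[OF cq]] Q.quot_preimage_subset Q'.D
        supersmooth_fbody[OF Q.X \<phi> subsetD[OF Q.quot_preimage_subset]]]
    have pre: "quot_preimage D g ?S = {y \<in> ?P. fbody \<phi> y \<in> ?P'}"
    proof -
      have "f 0 (orbit g 0 (gconst v)) = orbit g' 0 (gconst (fbody \<phi> v))" if v: "v \<in> D" for v
      proof -
        have gv: "gconst v \<in> dpts X D 0" by (rule gconst_dpts[OF Q.X v Q.D_ev])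
        have "\<phi> 0 (gconst v) = gconst (fbody \<phi> v)"
          unfolding fbody_def by (rule spts_0[OF spts_gsupported[OF dpts_spts[OF supersmoothD(3)[OF \<phi> gv]]]])
        then show ?thesis using f[OF gv] by simp
      qed
      then show ?thesis using supersmooth_fbody[OF Q.X \<phi>] by (auto simp: quot_preimage_def)
    qed
    have "supersmooth X (quot_preimage D g ?S) (cmodel d) (cimg d) (\<lambda>n x. cmap d n (orbit g' n (\<phi> n x)))"
      unfolding pre
      by (rule supersmooth_compose[OF Q.X Q'.X supersmooth_vimage[OF Q.X Q'.X \<phi>c supersmoothD(1)[OF Q'.quot_chart_smooth[OF dq]]]
            Q'.quot_chart_smooth[OF dq]])
    then have "supersmooth (cmodel c) (cbody c ?S) (cmodel d) (cimg d) (\<lambda>n y. cmap d n (f n (cinv Q.F c n y)))"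
    proof (rule Q.supersmooth_descend[OF cq, rotated])
      show "?S \<subseteq> cdom c" by blast
      show "cmap d n (f n (orbit g n x)) = cmap d n (orbit g' n (\<phi> n x))" if "x \<in> dpts X (quot_preimage D g ?S) n" for n x
        by (simp add: f[OF dpts_mono[OF Q.quot_preimage_subset that]])
    qed
    then show "\<exists>c\<in>charts Q.Q. \<exists>d\<in>charts Q'.Q. \<exists>S. C \<in> S \<and> S \<subseteq> cdom c \<inter> pts Q.Q 0 \<and> f 0 ` S \<subseteq> cdom d \<and>
        supersmooth (cmodel c) (cbody c S) (cmodel d) (cimg d) (\<lambda>n y. cmap d n (f n (cinv Q.Q c n y)))"
      using c d chart_dom[OF Q.functor_F cF]
      by (intro bexI[OF _ c(1)] bexI[OF _ d(1)] exI[of _ ?S]) (auto simp: Q.cinv_Q)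
  qed
qed

section \<open>Transport of bundles along isomorphisms\<close>

text \<open>Continuity of smooth maps: in charts the preimage is one under the underlying map of a
  supersmooth map.\<close>

lemma smooth_map_vimage_open:
  fixes M :: "('k::{real_normed_field, euclidean_space}, 'x, 'm::euclidean_space) smfd"
    and N :: "('k, 'y, 'l::euclidean_space) smfd"
  assumes M: "premfd M" and N: "premfd N" and f: "smooth_map M U N f" and V: "openin (mtop N) V"
  shows "openin (mtop M) {x \<in> U. f 0 x \<in> V}"
proof (subst openin_subopen, intro ballI)
  note MF = premfdD(1)[OF M] and NF = premfdD(1)[OF N]
  fix x assume "x \<in> {x \<in> U. f 0 x \<in> V}"
  then have x: "x \<in> U" "f 0 x \<in> V" by auto
  have "U \<subseteq> pts M 0" "V \<subseteq> pts N 0" using smooth_mapD(1)[OF M N f] V openin_mtop_iff[OF M] openin_mtop_iff[OF N] by blast+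
  then obtain c d where c: "c \<in> charts M" "x \<in> cdom c" and d: "d \<in> charts N" "f 0 x \<in> cdom d"
    using premfdD(3)[OF M, of x] premfdD(3)[OF N, of "f 0 x"] x by blast
  note cc = M_chart[OF M c(1)] and dc = M_chart[OF N d(1)]
  let ?A = "{x \<in> cdom c \<inter> U. f 0 x \<in> cdom d}" and ?p = "\<lambda>n y. cmap d n (f n (cinv M c n y))"
  let ?S = "{x \<in> ?A. f 0 x \<in> V}"
  have fb: "fbody ?p (cpt c z) = cpt d (f 0 z)" if "z \<in> cdom c" for z
    by (simp add: fbody_def cinv_gconst[OF MF cc that])
  have "cbody c ?S = {y \<in> cbody c ?A. fbody ?p y \<in> cbody d (cdom d \<inter> V)}"
  proof -
    have "cpt d (f 0 z) \<in> cbody d (cdom d \<inter> V) \<longleftrightarrow> f 0 z \<in> V" if "z \<in> ?A" for z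
      using cpt_mem_cbody[OF NF dc, of "f 0 z" "cdom d \<inter> V"] that by simp
    then have "fbody ?p (cpt c z) \<in> cbody d (cdom d \<inter> V) \<longleftrightarrow> f 0 z \<in> V" if "z \<in> ?A" for z
      using fb[of z] that by simp
    then show ?thesis unfolding cbody_def[of c] by blast
  qed
  then have "openin (top_of_set (ev (cmodel c))) (cbody c ?S)"
    using openin_fbody_vimage[OF chart_model[OF MF cc] smooth_mapD(4)[OF M N f c(1) d(1)] mtop_cbody[OF N V d(1)]] by simp
  then have "openin (mtop M) ?S" by (intro cbody_open_mtop[OF M c(1)]) auto
  then show "\<exists>T. openin (mtop M) T \<and> x \<in> T \<and> T \<subseteq> {x \<in> U. f 0 x \<in> V}"
    using x c d by (intro exI[of _ ?S]) auto
qed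

text \<open>Local trivializations, or the bundle isomorphism, are preceded by \<open>S\<close>, and
  their inverses are followed by \<open>R\<close>. In this way the statements over P(W) follow from
  those with V and W exchanged.\<close>

lemma
  fixes E :: "('k::{real_normed_field, euclidean_space}, 'x, 'm::euclidean_space) smfd"
    and E' :: "('k, 'y, 'l::euclidean_space) smfd"
  assumes E: "supermanifold E" and E': "supermanifold E'"
    and S: "smooth_map E (pts E 0) E' S" and R: "smooth_map E' (pts E' 0) E R"
    and RS: "\<And>n x. x \<in> pts E n \<Longrightarrow> R n (S n x) = x" and SR: "\<And>n y. y \<in> pts E' n \<Longrightarrow> S n (R n y) = y"
  shows fiber_bundle_transport: "fiber_bundle E' (B :: ('k, 'b, 'c::euclidean_space) smfd) (F :: ('k, 'f, 'j::euclidean_space) smfd) p \<Longrightarrow>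
      fiber_bundle E B F (\<lambda>n x. p n (S n x))"
    and bundle_isomorphic_transport: "supermanifold (T :: ('k, 't, 'i::euclidean_space) smfd) \<Longrightarrow>
      bundle_isomorphic E' p T q \<Longrightarrow> bundle_isomorphic E (\<lambda>n x. p n (S n x)) T q"
proof -
  have Ep: "premfd E" and Ep': "premfd E'" using E E' by (simp_all add: supermanifold_iff)
  note EF = premfdD(1)[OF Ep] and EF' = premfdD(1)[OF Ep']
  have Sp: "S n x \<in> pts E' n" if "x \<in> pts E n" for n x
    by (rule smooth_mapD(2)[OF Ep Ep' S rptsI[OF that gfunctorD(1)[OF EF gaug_hom that]]])
  have Rp: "R n x \<in> pts E n" if "x \<in> pts E' n" for n x
    by (rule smooth_mapD(2)[OF Ep' Ep R rptsI[OF that gfunctorD(1)[OF EF' gaug_hom that]]])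
  have S0: "S 0 ` pts E 0 \<subseteq> pts E' 0" and R0: "R 0 ` pts E' 0 \<subseteq> pts E 0" using Sp Rp by auto
  {
    assume fb: "fiber_bundle E' B F p"
    have BF: "supermanifold B" "supermanifold F" and p: "smooth_map E' (pts E' 0) B p"
      using fb by (auto simp: fiber_bundle_def)
    then have Bp: "premfd B" and Pp: "premfd (prod_mfd B F)" using premfd_prod by (auto simp: supermanifold_iff)
    show "fiber_bundle E B F (\<lambda>n x. p n (S n x))" unfolding fiber_bundle_def
    proof (intro conjI ballI E BF)
      show "smooth_map E (pts E 0) B (\<lambda>n x. p n (S n x))"
        by (rule smooth_map_compose[OF Ep Ep' Bp S p pts_open[OF Ep] order_refl S0])
      fix b assume "b \<in> pts B 0"
      with fb[unfolded fiber_bundle_def, THEN conjunct2, THEN conjunct2, THEN conjunct2, THEN conjunct2]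
      have "\<exists>U \<tau> \<sigma>. b \<in> U \<and> openin (mtop B) U \<and>
        smooth_map E' {x \<in> pts E' 0. p 0 x \<in> U} (prod_mfd B F) \<tau> \<and>
        smooth_map (prod_mfd B F) (U \<times> pts F 0) E' \<sigma> \<and>
        (\<forall>n. \<forall>x\<in>rpts E' {x \<in> pts E' 0. p 0 x \<in> U} n. fst (\<tau> n x) = p n x \<and> \<sigma> n (\<tau> n x) = x) \<and>
        (\<forall>n. \<forall>y\<in>rpts (prod_mfd B F) (U \<times> pts F 0) n. p n (\<sigma> n y) = fst y \<and> \<tau> n (\<sigma> n y) = y)"
        by (rule bspec)
      then obtain U \<tau> \<sigma> where U: "b \<in> U" "openin (mtop B) U" and \<tau>: "smooth_map E' {x \<in> pts E' 0. p 0 x \<in> U} (prod_mfd B F) \<tau>"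
        and \<sigma>: "smooth_map (prod_mfd B F) (U \<times> pts F 0) E' \<sigma>"
        and i1': "\<forall>n. \<forall>x\<in>rpts E' {x \<in> pts E' 0. p 0 x \<in> U} n. fst (\<tau> n x) = p n x \<and> \<sigma> n (\<tau> n x) = x"
        and i2': "\<forall>n. \<forall>y\<in>rpts (prod_mfd B F) (U \<times> pts F 0) n. p n (\<sigma> n y) = fst y \<and> \<tau> n (\<sigma> n y) = y"
        by (elim exE conjE) (rule that)
      note i1 = i1'[rule_format] and i2 = i2'[rule_format]
      let ?U1 = "{x \<in> pts E 0. p 0 (S 0 x) \<in> U}" and ?U2 = "{x \<in> pts E' 0. p 0 x \<in> U}"
      have U1: "openin (mtop E) ?U1"
      proof -
        have "openin (mtop E) {x \<in> pts E 0. S 0 x \<in> ?U2}"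
          by (rule smooth_map_vimage_open[OF Ep Ep' S smooth_mapD(1)[OF Ep' Pp \<tau>]])
        moreover have "{x \<in> pts E 0. S 0 x \<in> ?U2} = ?U1" using S0 by auto
        ultimately show ?thesis by simp
      qed
      have im: "S 0 ` ?U1 \<subseteq> ?U2" using S0 by auto
      have \<tau>1: "smooth_map E ?U1 (prod_mfd B F) (\<lambda>n x. \<tau> n (S n x))"
        by (rule smooth_map_compose[OF Ep Ep' Pp S \<tau> U1 _ im]) auto
      have UP: "openin (mtop (prod_mfd B F)) (U \<times> pts F 0)" by (rule smooth_mapD(1)[OF Pp Ep' \<sigma>])
      have \<sigma>rp: "\<sigma> n y \<in> rpts E' (pts E' 0) n" if "y \<in> rpts (prod_mfd B F) (U \<times> pts F 0) n" for n y
      proof (rule rptsI)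
        show "\<sigma> n y \<in> pts E' n" by (rule smooth_mapD(2)[OF Pp Ep' \<sigma> that])
        then show "act E' n 0 gaug (\<sigma> n y) \<in> pts E' 0" by (rule gfunctorD(1)[OF EF' gaug_hom])
      qed
      have UPp: "U \<times> pts F 0 \<subseteq> pts (prod_mfd B F) 0"
        using UP unfolding openin_mtop_iff[OF Pp] by (rule conjunct1)
      have \<sigma>0: "\<sigma> 0 ` (U \<times> pts F 0) \<subseteq> pts E' 0"
        using smooth_mapD(2)[OF Pp Ep' \<sigma>, of _ 0] rpts_0[OF premfdD(1)[OF Pp] UPp] by auto
      have \<sigma>1: "smooth_map (prod_mfd B F) (U \<times> pts F 0) E (\<lambda>n y. R n (\<sigma> n y))"
        by (rule smooth_map_compose[OF Pp Ep' Ep \<sigma> R UP order_refl \<sigma>0])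
      have 1: "fst (\<tau> n (S n x)) = p n (S n x) \<and> R n (\<sigma> n (\<tau> n (S n x))) = x" if x: "x \<in> rpts E ?U1 n" for n x
        using i1[OF smooth_map_rpts[OF Ep Ep' S Collect_restrict im x]] RS[OF rpts_pts[OF x]] by simp
      have 2: "p n (S n (R n (\<sigma> n y))) = fst y \<and> \<tau> n (S n (R n (\<sigma> n y))) = y"
        if y: "y \<in> rpts (prod_mfd B F) (U \<times> pts F 0) n" for n y
        using i2[OF y] SR[OF rpts_pts[OF \<sigma>rp[OF y]]] by simp
      show "\<exists>U \<tau> \<sigma>. b \<in> U \<and> openin (mtop B) U \<and>
        smooth_map E {x \<in> pts E 0. p 0 (S 0 x) \<in> U} (prod_mfd B F) \<tau> \<and>
        smooth_map (prod_mfd B F) (U \<times> pts F 0) E \<sigma> \<and>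
        (\<forall>n. \<forall>x\<in>rpts E {x \<in> pts E 0. p 0 (S 0 x) \<in> U} n. fst (\<tau> n x) = p n (S n x) \<and> \<sigma> n (\<tau> n x) = x) \<and>
        (\<forall>n. \<forall>y\<in>rpts (prod_mfd B F) (U \<times> pts F 0) n. p n (S n (\<sigma> n y)) = fst y \<and> \<tau> n (\<sigma> n y) = y)"
        by (intro exI[of _ U] exI[of _ "\<lambda>n x. \<tau> n (S n x)"] exI[of _ "\<lambda>n y. R n (\<sigma> n y)"] conjI allI ballI U \<tau>1 \<sigma>1)
          (simp_all add: 1 2)
    qed
  }
  assume T: "supermanifold T" and "bundle_isomorphic E' p T q"
  then obtain \<tau> \<sigma> where \<tau>: "smooth_map E' (pts E' 0) T \<tau>" and \<sigma>: "smooth_map T (pts T 0) E' \<sigma>"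
    and i1: "\<And>n x. x \<in> pts E' n \<Longrightarrow> \<sigma> n (\<tau> n x) = x \<and> q n (\<tau> n x) = p n x"
    and i2: "\<And>n y. y \<in> pts T n \<Longrightarrow> \<tau> n (\<sigma> n y) = y \<and> p n (\<sigma> n y) = q n y"
    unfolding bundle_isomorphic_def by blast
  have Tp: "premfd T" using T by (simp add: supermanifold_iff)
  note TF = premfdD(1)[OF Tp]
  have \<sigma>p: "\<sigma> n y \<in> pts E' n" if "y \<in> pts T n" for n y
    by (rule smooth_mapD(2)[OF Tp Ep' \<sigma> rptsI[OF that gfunctorD(1)[OF TF gaug_hom that]]])
  then have \<sigma>0: "\<sigma> 0 ` pts T 0 \<subseteq> pts E' 0" by auto
  have \<tau>1: "smooth_map E (pts E 0) T (\<lambda>n x. \<tau> n (S n x))"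
    by (rule smooth_map_compose[OF Ep Ep' Tp S \<tau> pts_open[OF Ep] order_refl S0])
  have \<sigma>1: "smooth_map T (pts T 0) E (\<lambda>n y. R n (\<sigma> n y))"
    by (rule smooth_map_compose[OF Tp Ep' Ep \<sigma> R pts_open[OF Tp] order_refl \<sigma>0])
  show "bundle_isomorphic E (\<lambda>n x. p n (S n x)) T q" unfolding bundle_isomorphic_def
    by (intro exI[of _ "\<lambda>n x. \<tau> n (S n x)"] exI[of _ "\<lambda>n y. R n (\<sigma> n y)"] conjI allI ballI \<tau>1 \<sigma>1)
      (simp_all add: i1 i2 Sp \<sigma>p RS SR)
qed

section \<open>Projective superspaces\<close>

text \<open>A basis of the odd part together with v is independent, and \<alpha> is prescribed as 0
  on the basis and 1 on v. If w is independent of these it receives the value 1 as well; otherwise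
  it is a multiple of v. That one functional detects both vectors places any two points of a
  projective superspace in one chart.\<close>

lemma exists_even_functional:
  assumes V: "vector_superspace V" and v: "v \<in> nonzero V" and w: "w \<in> nonzero V"
  shows "\<exists>\<alpha>. even_functional V \<alpha> \<and> \<alpha> v = 1 \<and> \<alpha> w \<noteq> 0"
proof -
  interpret vector_space_pair "scl V" "(*)"
    using vector_superspaceD(1)[OF V] vector_space_mult unfolding vector_space_pair_def by blast
  obtain B where B: "B \<subseteq> od V" "vs1.independent B" "od V \<subseteq> vs1.span B"
    using vs1.maximal_independent_subset[of "od V"] by blast
  have span: "vs1.span B = od V"
    using vs1.span_minimal[OF B(1) vector_superspaceD(4)[OF V]] B(3) by blast
  have vB: "v \<notin> vs1.span B" using v vector_superspaceD(5)[OF V] by (auto simp: span nonzero_def)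
  then have vB': "v \<notin> B" using vs1.span_base by blast
  note ind = vs1.independent_insertI[OF vB B(2)]
  have ext: "even_functional V \<alpha>" if "Vector_Spaces.linear (scl V) (*) \<alpha>" "\<And>b. b \<in> B \<Longrightarrow> \<alpha> b = 0" for \<alpha>
  proof -
    have "\<alpha> u = 0" if "u \<in> od V" for u
      using module_hom.eq_0_on_span[of "scl V" "(*)" \<alpha> B u] \<open>Vector_Spaces.linear (scl V) (*) \<alpha>\<close> \<open>\<And>b. b \<in> B \<Longrightarrow> \<alpha> b = 0\<close> that
      by (simp add: linear_iff_module_hom span)
    then show ?thesis using that(1) by (simp add: even_functional_def)
  qed
  show ?thesis
  proof (cases "w \<in> vs1.span (insert v B)")
    case True
    then obtain k where k: "w - scl V k v \<in> od V" unfolding vs1.span_breakdown_eq span by blast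
    \<comment> \<open>The difference is even as well as odd, hence 0.\<close>
    have "w - scl V k v \<in> ev V"
      using spart_diff[OF V, of w "{}"] spart_scale[OF V, of v "{}"] v w by (simp add: nonzero_def)
    then have "w - scl V k v \<in> {0}" unfolding vector_superspaceD(5)[OF V, symmetric] using k by (rule IntI)
    then have wk: "w = scl V k v" by simp
    obtain \<alpha> where \<alpha>: "Vector_Spaces.linear (scl V) (*) \<alpha>" "\<forall>x\<in>insert v B. \<alpha> x = (if x = v then 1 else 0)"
      using linear_independent_extend[OF ind, of "\<lambda>x. if x = v then 1 else 0"] by blast
    have e: "even_functional V \<alpha>" using \<alpha>(2) vB' by (intro ext[OF \<alpha>(1)]) auto
    have "k \<noteq> 0" using wk w vs1.scale_zero_left by (auto simp: nonzero_def)
    then show ?thesis using e \<alpha>(2) even_functional_scale[OF e, of k v] wk by (intro exI[of _ \<alpha>]) simp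
  next
    case False
    obtain \<alpha> where \<alpha>: "Vector_Spaces.linear (scl V) (*) \<alpha>"
        "\<forall>x\<in>insert w (insert v B). \<alpha> x = (if x = v \<or> x = w then 1 else 0)"
      using linear_independent_extend[OF vs1.independent_insertI[OF False ind], of "\<lambda>x. if x = v \<or> x = w then 1 else 0"]
      by blast
    have "w \<notin> B" using False vs1.span_base by blast
    then have "even_functional V \<alpha>" using \<alpha>(2) vB' by (intro ext[OF \<alpha>(1)]) auto
    then show ?thesis using \<alpha>(2) by (intro exI[of _ \<alpha>]) simp
  qed
qed

definition unit_functionals :: "('k::real_normed_field, 'v::euclidean_space) sspace \<Rightarrow> (('v \<Rightarrow> 'k) \<times> 'v) set" where
  "unit_functionals V = {(\<alpha>, e). even_functional V \<alpha> \<and> e \<in> ev V \<and> \<alpha> e = 1}"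

lemma unit_functionals_common:
  assumes "vector_superspace V" "v \<in> nonzero V" "w \<in> nonzero V"
  shows "\<exists>(\<alpha>, e)\<in>unit_functionals V. \<alpha> v \<noteq> 0 \<and> \<alpha> w \<noteq> 0"
proof -
  obtain \<alpha> where "even_functional V \<alpha>" "\<alpha> v = 1" "\<alpha> w \<noteq> 0" using exists_even_functional[OF assms] by blast
  then show ?thesis using assms(2)
    by (intro bexI[of _ "(\<alpha>, v)"]) (simp_all add: unit_functionals_def nonzero_def)
qed

lemma openin_nonzero: "openin (top_of_set (ev V)) (nonzero (V :: ('k, 'v::euclidean_space) sspace))"
proof -
  have "openin (top_of_set (ev V)) (ev V \<inter> - {0})" by (rule openin_open_Int) auto
  moreover have "ev V \<inter> - {0} = nonzero V" by (auto simp: nonzero_def)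
  ultimately show ?thesis by simp
qed

lemma gsmult_nonzero:
  assumes V: "vector_superspace V" and "a \<in> Grass_units n" "x \<in> dpts V (nonzero V) n"
  shows "gsmult (scl V) a x \<in> dpts V (nonzero V) n"
proof -
  have "scl V (a {}) (x {}) \<in> nonzero V"
    using assms spart_scale[OF V, of "x {}" "{}"] vector_space.scale_eq_0_iff[OF vector_superspaceD(1)[OF V]]
    by (simp add: dpts_def nonzero_def Grass_units_iff)
  then show ?thesis
    using gsmult_spts[OF V Grass_units_even[OF assms(2)] dpts_spts[OF assms(3)]]
    by (simp add: dpts_def gsmult_empty[OF vector_superspaceD(1)[OF V]])
qed

lemma supersmooth_gsmult_nonzero:
  assumes V: "vector_superspace V" and W: "vector_superspace W"
    and f: "supersmooth V D sfield (- {0}) f" and g: "supersmooth V D W (nonzero W) g"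
  shows "supersmooth V D W (nonzero W) (\<lambda>n x. gsmult (scl W) (f n x) (g n x))"
  by (rule supersmooth_into[OF supersmooth_gsmult[OF V W f g] refl openin_nonzero])
    (intro gsmult_nonzero W supersmoothD(3)[OF f, folded Grass_units_eq] supersmoothD(3)[OF g])

lemma supersmooth_ginv_comp:
  "vector_superspace V \<Longrightarrow> supersmooth V D sfield (- {0}) f \<Longrightarrow> supersmooth V D sfield (- {0}) (\<lambda>n x. ginv n (f n x))"
  by (rule supersmooth_compose[OF _ vector_superspace_sfield _ supersmooth_ginv])

lemma openin_functional_nonzero:
  assumes V: "vector_superspace V" and \<alpha>: "even_functional V \<alpha>" and D: "openin (top_of_set (ev V)) D"
  shows "openin (top_of_set (ev V)) {x \<in> D. \<alpha> x \<noteq> 0}"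
proof -
  have "open (\<alpha> -` (- {0}))" by (rule open_vimage[OF _ even_functional_continuous[OF V \<alpha>]]) auto
  then have "openin (top_of_set (ev V)) (D \<inter> (\<alpha> -` (- {0})))"
    using D openin_Int[OF D openin_open_Int[of "\<alpha> -` (- {0})" "ev V"]] openin_imp_subset[OF D]
    by (simp add: Int_assoc[symmetric] Int_absorb2)
  moreover have "D \<inter> (\<alpha> -` (- {0})) = {x \<in> D. \<alpha> x \<noteq> 0}" by auto
  ultimately show ?thesis by simp
qed

lemma slice_quotient_proj:
  assumes V: "vector_superspace V"
  shows "slice_quotient V (nonzero V) (proj_action V) (unit_functionals V)"
proof
  note Vs = vector_superspaceD(1)[OF V]
  show "vector_superspace V" "openin (top_of_set (ev V)) (nonzero V)" by (rule V, rule openin_nonzero)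
  show "proj_action V n a x \<in> dpts V (nonzero V) n" if "a \<in> Grass_units n" "x \<in> dpts V (nonzero V) n" for n a x
    unfolding proj_action_def by (rule gsmult_nonzero[OF V that])
  show "proj_action V n (gconst 1) x = x" if "x \<in> dpts V (nonzero V) n" for n x
    unfolding proj_action_def by (rule gsmult_one[OF Vs spts_gsupported[OF dpts_spts[OF that]]])
  show "proj_action V n a (proj_action V n b x) = proj_action V n (gmult a b) x" for n a b x
    unfolding proj_action_def by (rule gsmult_assoc[OF Vs, symmetric])
  show "gpush (scl V) m \<rho> (proj_action V m a x) = proj_action V n (\<rho> a) (gpush (scl V) m \<rho> x)"
    if "Grass_hom m n \<rho>" "a \<in> Grass_units m" "x \<in> dpts V (nonzero V) m" for m n \<rho> a x
    unfolding proj_action_def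
    by (rule gpush_gsmult[OF that(1) Vs Grass_even_gsupported[OF Grass_units_even[OF that(2)]] spts_gsupported[OF dpts_spts[OF that(3)]]])
  fix \<alpha> e assume ae: "(\<alpha>, e) \<in> unit_functionals V"
  then show \<alpha>: "even_functional V \<alpha>" and "e \<in> ev V" "\<alpha> e = 1" by (simp_all add: unit_functionals_def)
  show "(\<lambda>I. \<alpha> (proj_action V n a x I)) = gmult a (\<lambda>I. \<alpha> (x I))" for n a x
    unfolding proj_action_def by (rule even_functional_gsmult[OF \<alpha>])
  let ?P = "{x \<in> nonzero V. \<alpha> x \<noteq> 0}"
  note op = openin_functional_nonzero[OF V \<alpha> openin_nonzero]
  have "supersmooth V ?P sfield (- {0}) (\<lambda>n x I. \<alpha> (x I))"
    by (rule supersmooth_functional[OF V \<alpha> op]) auto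
  note f = supersmooth_ginv_comp[OF V this]
  have "supersmooth V ?P V (nonzero V) (\<lambda>n x. x)"
    by (rule supersmooth_inclusion[OF V V refl order_refl order_refl op openin_nonzero]) auto
  from supersmooth_gsmult_nonzero[OF V V f this]
  show "supersmooth V ?P V (nonzero V) (\<lambda>n x. proj_action V n (ginv n (\<lambda>I. \<alpha> (x I))) x)"
    by (simp only: proj_action_def)
next
  show "\<exists>(\<alpha>, e)\<in>unit_functionals V. \<alpha> v \<noteq> 0 \<and> \<alpha> w \<noteq> 0" if "v \<in> nonzero V" "w \<in> nonzero V" for v w
    by (rule unit_functionals_common[OF V that])
qed

section \<open>The weighted projective superspace\<close>

text \<open>The functional looks at V alone, so the slice leaves the W-direction free: translation
  by (e, 0) does not touch the second component, and the kernel is that of \<alpha> plus all of W.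
  This adapts the charts to the projection onto P(V).\<close>

definition wfunctional :: "('v \<Rightarrow> 'k) \<times> 'v \<Rightarrow> ('v \<times> 'w::zero \<Rightarrow> 'k) \<times> ('v \<times> 'w)" where
  "wfunctional p = ((\<lambda>x. fst p (fst x)), (snd p, 0))"

lemma even_functional_fst:
  assumes V: "vector_superspace V" and W: "vector_superspace W" and \<alpha>: "even_functional V \<alpha>"
  shows "even_functional (ssum V W) (\<lambda>x. \<alpha> (fst x))"
proof -
  have "Vector_Spaces.linear (scl (ssum V W)) (*) (\<alpha> \<circ> fst)"
    by (rule Vector_Spaces.linear_compose[OF linear_fst[OF V W] even_functional_linear[OF \<alpha>]])
  moreover have "\<forall>x\<in>od (ssum V W). \<alpha> (fst x) = 0" using \<alpha> by (auto simp: even_functional_def)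
  ultimately show ?thesis by (simp add: even_functional_def o_def del: ssum_simps)
qed

lemma wproj_action_gpair:
  "wproj_action V W n a (gpair x y) = gpair (gsmult (scl V) a x) (gsmult (scl W) (ginv n a) y)"
  by (simp add: wproj_action_def)

lemma dpts_ssum_E:
  assumes "z \<in> dpts (ssum V W) (D \<times> D') n"
  obtains x y where "z = gpair x y" "x \<in> dpts V D n" "y \<in> dpts W D' n"
  using assms unfolding dpts_ssum_iff by (intro that[OF gpair_surj]) auto

lemma slice_quotient_wproj:
  fixes V :: "('k::{real_normed_field, euclidean_space}, 'v::euclidean_space) sspace"
    and W :: "('k, 'w::euclidean_space) sspace"
  assumes V: "vector_superspace V" and W: "vector_superspace W"
  shows "slice_quotient (ssum V W) (nonzero V \<times> nonzero W) (wproj_action V W) (wfunctional ` unit_functionals V)"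
proof
  let ?X = "ssum V W" and ?D = "nonzero V \<times> nonzero W" and ?g = "wproj_action V W"
  note X = vector_superspace_ssum[OF V W]
  note Vs = vector_superspaceD(1)[OF V] and Ws = vector_superspaceD(1)[OF W]
  show "vector_superspace ?X" by (rule X)
  show op: "openin (top_of_set (ev ?X)) ?D" using openin_Times[OF openin_nonzero openin_nonzero] by simp
  show "?g n a z \<in> dpts ?X ?D n" if "a \<in> Grass_units n" "z \<in> dpts ?X ?D n" for n a z
    using that(2) gsmult_nonzero[OF V that(1)] gsmult_nonzero[OF W ginv_units[OF that(1)]]
    by (elim dpts_ssum_E) (simp add: wproj_action_gpair gpair_dpts_iff)
  show "?g n (gconst 1) z = z" if "z \<in> dpts ?X ?D n" for n z
    using that gsmult_one[OF Vs spts_gsupported[OF dpts_spts[of _ V "nonzero V" n]]]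
      gsmult_one[OF Ws spts_gsupported[OF dpts_spts[of _ W "nonzero W" n]]]
    by (elim dpts_ssum_E) (simp add: wproj_action_gpair)
  show "?g n a (?g n b z) = ?g n (gmult a b) z"
    if "a \<in> Grass_units n" "b \<in> Grass_units n" "z \<in> dpts ?X ?D n" for n a b z
    using that(3)
    by (elim dpts_ssum_E)
      (simp add: wproj_action_gpair gsmult_assoc[OF Vs] gsmult_assoc[OF Ws] ginv_gmult_distrib[OF that(1,2)])
  show "gpush (scl ?X) m \<rho> (?g m a z) = ?g n (\<rho> a) (gpush (scl ?X) m \<rho> z)"
    if \<rho>: "Grass_hom m n \<rho>" and a: "a \<in> Grass_units m" and z: "z \<in> dpts ?X ?D m" for m n \<rho> a z
  proof -
    obtain x y where xy: "z = gpair x y" "x \<in> dpts V (nonzero V) m" "y \<in> dpts W (nonzero W) m"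
      using dpts_ssum_E[OF z] .
    note x = spts_gsupported[OF dpts_spts[OF xy(2)]] and y = spts_gsupported[OF dpts_spts[OF xy(3)]]
    show ?thesis
      unfolding xy(1) wproj_action_gpair gpush_gpair[OF V W]
        gpush_gsmult[OF \<rho> Vs Grass_even_gsupported[OF Grass_units_even[OF a]] x]
        gpush_gsmult[OF \<rho> Ws Grass_even_gsupported[OF ginv_even[OF a]] y] Grass_hom_ginv[OF \<rho> a] ..
  qed
  fix \<beta> :: "'v \<times> 'w \<Rightarrow> 'k" and e assume be: "(\<beta>, e) \<in> wfunctional ` unit_functionals V"
  then obtain \<alpha> e' where ae: "(\<alpha>, e') \<in> unit_functionals V" and be: "\<beta> = (\<lambda>x. \<alpha> (fst x))" "e = (e', 0)"
    by (auto simp: wfunctional_def)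
  have \<alpha>: "even_functional V \<alpha>" "e' \<in> ev V" "\<alpha> e' = 1" using ae by (simp_all add: unit_functionals_def)
  show \<beta>: "even_functional ?X \<beta>" unfolding be by (rule even_functional_fst[OF V W \<alpha>(1)])
  show "e \<in> ev ?X" "\<beta> e = 1" using \<alpha> spart_zero[OF W, of "{}"] by (simp_all add: be)
  show "(\<lambda>I. \<beta> (?g n a z I)) = gmult a (\<lambda>I. \<beta> (z I))" if "z \<in> dpts ?X ?D n" for n a z
    using that even_functional_gsmult[OF \<alpha>(1)] by (elim dpts_ssum_E) (simp add: wproj_action_gpair be(1))
  let ?P = "{x \<in> ?D. \<beta> x \<noteq> 0}"
  note opP = openin_functional_nonzero[OF X \<beta> op]
  have b: "supersmooth ?X ?P sfield (- {0}) (\<lambda>n x I. \<beta> (x I))"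
    by (rule supersmooth_functional[OF X \<beta> opP]) auto
  note b1 = supersmooth_ginv_comp[OF X b]
  \<comment> \<open>Normalizing by 1/\<beta> acts on W through the inverse of 1/\<beta>, so
    inversion is applied twice.\<close>
  note b2 = supersmooth_ginv_comp[OF X b1]
  have f: "supersmooth ?X ?P V (nonzero V) (\<lambda>n x I. fst (x I))"
    by (rule supersmooth_linear[OF X V linear_fst[OF V W] _ _ opP openin_nonzero]) auto
  have s: "supersmooth ?X ?P W (nonzero W) (\<lambda>n x I. snd (x I))"
    by (rule supersmooth_linear[OF X W linear_snd[OF V W] _ _ opP openin_nonzero]) auto
  from supersmooth_pair[OF X V W supersmooth_gsmult_nonzero[OF X V b1 f] supersmooth_gsmult_nonzero[OF X W b2 s]]
  show "supersmooth ?X ?P ?X ?D (\<lambda>n x. ?g n (ginv n (\<lambda>I. \<beta> (x I))) x)"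
    by (simp only: wproj_action_def o_def)
next
  show "\<exists>(\<beta>, e)\<in>wfunctional ` unit_functionals V. \<beta> v \<noteq> 0 \<and> \<beta> w \<noteq> 0"
    if "v \<in> nonzero V \<times> nonzero W" "w \<in> nonzero V \<times> nonzero W" for v w :: "'v \<times> 'w"
  proof -
    have "fst v \<in> nonzero V" "fst w \<in> nonzero V" using that by (simp_all add: mem_Times_iff)
    from unit_functionals_common[OF V this]
    obtain \<alpha> e where "(\<alpha>, e) \<in> unit_functionals V" "\<alpha> (fst v) \<noteq> 0" "\<alpha> (fst w) \<noteq> 0" by blast
    then show ?thesis
      by (intro bexI[of _ "wfunctional (\<alpha>, e)"] imageI) (simp_all add: wfunctional_def)
  qed
qed

text \<open>An arbitrary representative is taken; for classes of points the choice is immaterial,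
  because units act on the first component by scaling.\<close>

definition wproj_fst ::
  "('k::real_normed_field, 'v::euclidean_space) sspace \<Rightarrow> nat \<Rightarrow> ('v \<times> 'w::euclidean_space) gr set \<Rightarrow> 'v gr set" where
  "wproj_fst V n C = proj_class V n (\<lambda>I. fst ((SOME z. z \<in> C) I))"

definition swap_class :: "nat \<Rightarrow> ('v \<times> 'w) gr set \<Rightarrow> ('w \<times> 'v) gr set" where
  "swap_class n C = (\<lambda>z I. prod.swap (z I)) ` C"

lemma swap_gpair: "(\<lambda>I. prod.swap (gpair x y I)) = gpair y x"
  by (simp add: gpair_def)

lemma swap_class_swap_class [simp]: "swap_class n (swap_class n C) = C"
  by (simp add: swap_class_def image_image)

context
  fixes V :: "('k::{real_normed_field, euclidean_space}, 'v::euclidean_space) sspace"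
  assumes V: "vector_superspace V"
begin

interpretation P: slice_quotient V "nonzero V" "proj_action V" "unit_functionals V"
  by (rule slice_quotient_proj[OF V])

lemma supermanifold_proj: "supermanifold (proj_space V)"
  unfolding proj_space_def by (rule P.supermanifold_Q)

lemma pts_proj: "x \<in> dpts V (nonzero V) n \<Longrightarrow> proj_class V n x \<in> pts (proj_space V) n"
  unfolding proj_space_def P.quot_mfd_simps P.pts_F proj_class_def by simp

lemma proj_E:
  assumes "L \<in> pts (proj_space V) n"
  obtains x where "x \<in> dpts V (nonzero V) n" "L = proj_class V n x"
  using assms unfolding proj_space_def P.quot_mfd_simps P.pts_F proj_class_def by blast

lemma act_proj:
  "Grass_hom m n \<rho> \<Longrightarrow> x \<in> dpts V (nonzero V) m \<Longrightarrow>
    act (proj_space V) m n \<rho> (proj_class V m x) = proj_class V n (gpush (scl V) m \<rho> x)"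
  unfolding proj_space_def P.quot_mfd_simps proj_class_def by (rule P.act_F)

definition proj_chart :: "('v \<Rightarrow> 'k) \<Rightarrow> 'v \<Rightarrow> ('k, 'v gr set, 'v) chart" where
  "proj_chart \<alpha> e = P.slice_chart \<alpha> e"

context
  fixes \<alpha> e
  assumes ae: "(\<alpha>, e) \<in> unit_functionals V"
begin

lemma proj_chart_charts: "proj_chart \<alpha> e \<in> charts (proj_space V)"
  unfolding proj_space_def proj_chart_def using P.slice_quot_chart[OF ae] by simp

lemma proj_chart_model: "cmodel (proj_chart \<alpha> e) = ker_superspace V \<alpha>"
  and proj_chart_img: "cimg (proj_chart \<alpha> e) = {y \<in> ev V. \<alpha> y = 0 \<and> e + y \<in> nonzero V}"
  unfolding proj_chart_def by (rule P.slice_chart_simps[OF ae])+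

lemma proj_chart_map: "x \<in> dpts V (nonzero V) n \<Longrightarrow> \<alpha> (x {}) \<noteq> 0 \<Longrightarrow>
    cmap (proj_chart \<alpha> e) n (proj_class V n x) = (\<lambda>I. gsmult (scl V) (ginv n (\<lambda>I. \<alpha> (x I))) x I + gconst (- e) I)"
  using P.slice_cmap[OF ae, of x n]
  by (simp add: proj_chart_def proj_class_def P.slice_map_def proj_action_def dpts_def)

lemma proj_chart_dom: "x \<in> dpts V (nonzero V) 0 \<Longrightarrow> proj_class V 0 x \<in> cdom (proj_chart \<alpha> e) \<longleftrightarrow> \<alpha> (x {}) \<noteq> 0"
  unfolding proj_chart_def proj_class_def by (rule P.slice_cdom_iff[OF ae])

lemma proj_chart_rpts_E:
  assumes "L \<in> rpts (proj_space V) (cdom (proj_chart \<alpha> e)) n"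
  obtains x where "x \<in> dpts V (nonzero V) n" "\<alpha> (x {}) \<noteq> 0" "L = proj_class V n x"
proof -
  have "L \<in> rpts P.F (cdom (P.slice_chart \<alpha> e)) n" using assms by (simp add: proj_space_def proj_chart_def)
  then obtain x where "x \<in> dpts V {x \<in> nonzero V. \<alpha> x \<noteq> 0} n" "L = P.cl n x" by (rule P.slice_rpts_E[OF ae])
  then show thesis by (intro that[of x]) (simp_all add: dpts_def proj_class_def)
qed

lemma proj_chart_cinv:
  assumes y: "y \<in> dpts (cmodel (proj_chart \<alpha> e)) (cimg (proj_chart \<alpha> e)) n"
  shows "(\<lambda>I. gconst e I + y I) \<in> dpts V (nonzero V) n" "(\<lambda>I. \<alpha> (gconst e I + y I)) = gconst 1"
    "cinv (proj_space V) (proj_chart \<alpha> e) n y = proj_class V n (\<lambda>I. gconst e I + y I)"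
proof -
  have y': "y \<in> dpts (ker_superspace V \<alpha>) {y \<in> ev V. \<alpha> y = 0 \<and> e + y \<in> nonzero V} n"
    using y by (simp only: proj_chart_model proj_chart_img)
  note l = P.lift_in[OF ae y', unfolded P.lift_def[OF ae]]
  show "(\<lambda>I. gconst e I + y I) \<in> dpts V (nonzero V) n" using l(1) by (simp add: dpts_def)
  have "\<alpha> (y I) = 0" for I using y' P.A(1)[OF ae] by (simp add: dpts_def ker_spts_iff)
  then show "(\<lambda>I. \<alpha> (gconst e I + y I)) = gconst 1"
    using P.A[OF ae] even_functional_0[OF P.A(1)[OF ae]] by (auto simp: even_functional_add gconst_def)
  have "cinv P.F (P.slice_chart \<alpha> e) n (cmap (P.slice_chart \<alpha> e) n (P.cl n (\<lambda>I. gconst e I + y I))) = P.cl n (\<lambda>I. gconst e I + y I)"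
    by (rule cinv_cmap[OF P.functor_F P.slice_is_chart[OF ae] P.slice_rpts[OF ae l(1)]])
  then show "cinv (proj_space V) (proj_chart \<alpha> e) n y = proj_class V n (\<lambda>I. gconst e I + y I)"
    by (simp add: P.slice_cmap[OF ae l(1)] l(2) proj_chart_def proj_class_def proj_space_def P.cinv_Q)
qed

end

end

section \<open>Coordinates of the weighted projective superspace adapted to the projection onto
  P(V)\<close>

context
  fixes V :: "('k::{real_normed_field, euclidean_space}, 'v::euclidean_space) sspace"
    and W :: "('k, 'w::euclidean_space) sspace"
  assumes V: "vector_superspace V" and W: "vector_superspace W"
begin

interpretation P: slice_quotient V "nonzero V" "proj_action V" "unit_functionals V"
  by (rule slice_quotient_proj[OF V])

interpretation Q: slice_quotient "ssum V W" "nonzero V \<times> nonzero W" "wproj_action V W" "wfunctional ` unit_functionals V"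
  by (rule slice_quotient_wproj[OF V W])

lemma supermanifold_wproj: "supermanifold (wproj_space V W)"
  unfolding wproj_space_def by (rule Q.supermanifold_Q)

lemma wproj_fst_class:
  assumes x: "x \<in> dpts V (nonzero V) n" and y: "y \<in> dpts W (nonzero W) n"
  shows "wproj_fst V n (wproj_class V W n x y) = proj_class V n x"
proof -
  let ?C = "wproj_class V W n x y"
  have xy: "gpair x y \<in> dpts (ssum V W) (nonzero V \<times> nonzero W) n" using x y by (simp add: gpair_dpts_iff)
  have "(SOME z. z \<in> ?C) \<in> ?C" unfolding wproj_class_def by (rule someI[of "\<lambda>z. z \<in> _", OF Q.cl_self[OF xy]])
  then obtain a where a: "a \<in> Grass_units n" "(SOME z. z \<in> ?C) = wproj_action V W n a (gpair x y)"
    unfolding wproj_class_def by (rule Q.cl_E)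
  have "wproj_fst V n ?C = P.cl n (proj_action V n a x)"
    unfolding wproj_fst_def a(2) wproj_action_gpair proj_class_def proj_action_def by simp
  then show ?thesis using P.cl_act[OF a(1) x] by (simp add: proj_class_def)
qed

lemma wproj_E:
  assumes "C \<in> pts (wproj_space V W) n"
  obtains x y where "x \<in> dpts V (nonzero V) n" "y \<in> dpts W (nonzero W) n" "C = wproj_class V W n x y"
proof -
  obtain z where z: "z \<in> dpts (ssum V W) (nonzero V \<times> nonzero W) n" "C = Q.cl n z"
    using assms unfolding wproj_space_def Q.quot_mfd_simps Q.pts_F by blast
  obtain x y where xy: "z = gpair x y" "x \<in> dpts V (nonzero V) n" "y \<in> dpts W (nonzero W) n" using dpts_ssum_E[OF z(1)] .
  show thesis by (rule that[OF xy(2,3)]) (simp add: wproj_class_def z(2) xy(1))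
qed

lemma pts_wproj: "x \<in> dpts V (nonzero V) n \<Longrightarrow> y \<in> dpts W (nonzero W) n \<Longrightarrow> wproj_class V W n x y \<in> pts (wproj_space V W) n"
  unfolding wproj_space_def Q.quot_mfd_simps Q.pts_F wproj_class_def by (simp add: gpair_dpts_iff)

lemma act_wproj:
  assumes "Grass_hom m n \<rho>" "x \<in> dpts V (nonzero V) m" "y \<in> dpts W (nonzero W) m"
  shows "act (wproj_space V W) m n \<rho> (wproj_class V W m x y) =
    wproj_class V W n (gpush (scl V) m \<rho> x) (gpush (scl W) m \<rho> y)"
  using Q.act_F[OF assms(1), of "gpair x y"] assms(2,3)
  unfolding wproj_space_def Q.quot_mfd_simps wproj_class_def gpush_gpair[OF V W] by (simp add: gpair_dpts_iff)

definition wproj_chart :: "('v \<Rightarrow> 'k) \<Rightarrow> 'v \<Rightarrow> ('k, ('v \<times> 'w) gr set, 'v \<times> 'w) chart" where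
  "wproj_chart \<alpha> e = Q.slice_chart (\<lambda>x. \<alpha> (fst x)) (e, 0)"

context
  fixes \<alpha> e
  assumes ae: "(\<alpha>, e) \<in> unit_functionals V"
begin

lemma wfunctional_mem: "((\<lambda>x. \<alpha> (fst x)), (e, 0)) \<in> wfunctional ` unit_functionals V"
  using ae by (force simp: wfunctional_def)

lemma wproj_chart_charts: "wproj_chart \<alpha> e \<in> charts (wproj_space V W)"
  unfolding wproj_space_def wproj_chart_def using Q.slice_quot_chart[OF wfunctional_mem] by simp

lemma wproj_chart_model: "cmodel (wproj_chart \<alpha> e) = ssum (cmodel (proj_chart V \<alpha> e)) W"
  unfolding wproj_chart_def Q.slice_chart_simps[OF wfunctional_mem] proj_chart_model[OF V ae]
  by (auto simp: ker_superspace_def ssum_def)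

lemma wproj_chart_img: "cimg (wproj_chart \<alpha> e) = cimg (proj_chart V \<alpha> e) \<times> nonzero W"
  unfolding wproj_chart_def Q.slice_chart_simps[OF wfunctional_mem] proj_chart_img[OF V ae] by (auto simp: nonzero_def)

text \<open>Scaling x by 1/\<alpha>(x) scales y by the inverse of that factor, which is \<alpha>(x)
  again.\<close>

lemma wproj_chart_map:
  assumes x: "x \<in> dpts V (nonzero V) n" "\<alpha> (x {}) \<noteq> 0" and y: "y \<in> dpts W (nonzero W) n"
  shows "cmap (wproj_chart \<alpha> e) n (wproj_class V W n x y) =
    gpair (cmap (proj_chart V \<alpha> e) n (proj_class V n x)) (gsmult (scl W) (\<lambda>I. \<alpha> (x I)) y)"
proof -
  have u: "(\<lambda>I. \<alpha> (x I)) \<in> Grass_units n" by (rule even_functional_units[OF P.A(1)[OF ae] dpts_spts[OF x(1)] x(2)])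
  have "gpair x y \<in> dpts (ssum V W) {z \<in> nonzero V \<times> nonzero W. \<alpha> (fst z) \<noteq> 0} n"
    using x y by (simp add: dpts_def gpair_spts_iff) (simp add: gpair_def)
  from Q.slice_cmap[OF wfunctional_mem this] show ?thesis
    unfolding proj_chart_map[OF V ae x]
    by (simp add: wproj_chart_def wproj_class_def Q.slice_map_def wproj_action_gpair ginv_ginv[OF u])
      (auto simp: gpair_def gconst_def)
qed

lemma wproj_chart_dom:
  assumes x: "x \<in> dpts V (nonzero V) 0" and y: "y \<in> dpts W (nonzero W) 0"
  shows "wproj_class V W 0 x y \<in> cdom (wproj_chart \<alpha> e) \<longleftrightarrow> \<alpha> (x {}) \<noteq> 0"
  unfolding wproj_chart_def wproj_class_def
  using Q.slice_cdom_iff[OF wfunctional_mem, of "gpair x y"] x y by (simp add: gpair_dpts_iff)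

lemma wproj_chart_rpts_E:
  assumes "C \<in> rpts (wproj_space V W) (cdom (wproj_chart \<alpha> e)) n"
  obtains x y where "x \<in> dpts V (nonzero V) n" "\<alpha> (x {}) \<noteq> 0" "y \<in> dpts W (nonzero W) n" "C = wproj_class V W n x y"
proof -
  have "C \<in> rpts Q.F (cdom (Q.slice_chart (\<lambda>x. \<alpha> (fst x)) (e, 0))) n" using assms by (simp add: wproj_space_def wproj_chart_def)
  then obtain z where z: "z \<in> dpts (ssum V W) {z \<in> nonzero V \<times> nonzero W. \<alpha> (fst z) \<noteq> 0} n" "C = Q.cl n z"
    by (rule Q.slice_rpts_E[OF wfunctional_mem])
  then have "z \<in> dpts (ssum V W) (nonzero V \<times> nonzero W) n" by (simp add: dpts_def)
  then obtain x y where xy: "z = gpair x y" "x \<in> dpts V (nonzero V) n" "y \<in> dpts W (nonzero W) n" by (rule dpts_ssum_E)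
  show thesis using z xy by (intro that[of x y]) (simp_all add: dpts_def wproj_class_def)
qed

end

lemma wproj_chart_cdom:
  assumes ae: "(\<alpha>, e) \<in> unit_functionals V"
  shows "cdom (wproj_chart \<alpha> e) = {x \<in> pts (wproj_space V W) 0. wproj_fst V 0 x \<in> cdom (proj_chart V \<alpha> e)}"
proof -
  have "C \<in> cdom (wproj_chart \<alpha> e) \<longleftrightarrow> wproj_fst V 0 C \<in> cdom (proj_chart V \<alpha> e)" if C: "C \<in> pts (wproj_space V W) 0" for C
    by (rule wproj_E[OF C]) (simp add: wproj_chart_dom[OF ae] proj_chart_dom[OF V ae] wproj_fst_class)
  moreover have Qp: "premfd (wproj_space V W)" using supermanifold_wproj by (simp add: supermanifold_iff)
  have "cdom (wproj_chart \<alpha> e) \<subseteq> pts (wproj_space V W) 0"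
    by (rule chart_dom[OF premfdD(1)[OF Qp] M_chart[OF Qp wproj_chart_charts[OF ae]]])
  ultimately show ?thesis by blast
qed

lemma fiber_bundle_wproj: "fiber_bundle (wproj_space V W) (proj_space V) (domain_mfd W (nonzero W)) (wproj_fst V)"
proof (rule fiber_bundle_charts[OF supermanifold_wproj supermanifold_proj[OF V] W openin_nonzero])
  show "wproj_fst V n C \<in> pts (proj_space V) n" if C: "C \<in> pts (wproj_space V W) n" for n C
    by (rule wproj_E[OF C]) (simp add: wproj_fst_class pts_proj[OF V])
  show "wproj_fst V n (act (wproj_space V W) m n \<rho> C) = act (proj_space V) m n \<rho> (wproj_fst V m C)"
    if \<rho>: "Grass_hom m n \<rho>" and C: "C \<in> pts (wproj_space V W) m" for m n \<rho> C
    by (rule wproj_E[OF C])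
      (simp add: wproj_fst_class act_wproj[OF \<rho>] act_proj[OF V \<rho>] gpush_dpts[OF \<rho> V] gpush_dpts[OF \<rho> W])
  fix b assume "b \<in> pts (proj_space V) 0"
  then obtain x where x: "x \<in> dpts V (nonzero V) 0" "b = proj_class V 0 x" by (rule proj_E[OF V])
  then have "x {} \<in> nonzero V" by (simp add: dpts_def)
  from unit_functionals_common[OF V this this] obtain \<alpha> e where ae: "(\<alpha>, e) \<in> unit_functionals V" "\<alpha> (x {}) \<noteq> 0" by blast
  note dom = wproj_chart_cdom[OF ae(1)]
  have "(\<lambda>I. fst (cmap (wproj_chart \<alpha> e) n C I)) = cmap (proj_chart V \<alpha> e) n (wproj_fst V n C)"
    if C: "C \<in> rpts (wproj_space V W) (cdom (wproj_chart \<alpha> e)) n" for n C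
    by (rule wproj_chart_rpts_E[OF ae(1) C]) (simp add: wproj_chart_map[OF ae(1)] wproj_fst_class)
  then show "\<exists>cb\<in>charts (proj_space V). \<exists>ce\<in>charts (wproj_space V W). b \<in> cdom cb \<and>
      cdom ce = {x \<in> pts (wproj_space V W) 0. wproj_fst V 0 x \<in> cdom cb} \<and> cmodel ce = ssum (cmodel cb) W \<and>
      cimg ce = cimg cb \<times> nonzero W \<and>
      (\<forall>n. \<forall>x\<in>rpts (wproj_space V W) (cdom ce) n. (\<lambda>I. fst (cmap ce n x I)) = cmap cb n (wproj_fst V n x))"
    using dom wproj_chart_model[OF ae(1)] wproj_chart_img[OF ae(1)] x(2) proj_chart_dom[OF V ae(1) x(1)] ae(2)
    by (intro bexI[OF _ proj_chart_charts[OF V ae(1)]] bexI[OF _ wproj_chart_charts[OF ae(1)]]) simp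
qed

text \<open>Exchanging the components turns the action of a unit into that of its inverse, and
  inversion permutes the units, so orbits are mapped onto orbits.\<close>

lemma swap_wproj_class:
  assumes "x \<in> dpts V (nonzero V) n" "y \<in> dpts W (nonzero W) n"
  shows "swap_class n (wproj_class V W n x y) = wproj_class W V n y x"
proof -
  have "(\<lambda>I. prod.swap (wproj_action V W n a (gpair x y) I)) = wproj_action W V n (ginv n a) (gpair y x)"
    if "a \<in> Grass_units n" for a
    by (simp add: wproj_action_gpair swap_gpair ginv_ginv[OF that])
  then have "swap_class n (wproj_class V W n x y) = (\<lambda>a. wproj_action W V n (ginv n a) (gpair y x)) ` Grass_units n"
    by (simp add: swap_class_def wproj_class_def orbit_def image_image)
  also have "\<dots> = (\<lambda>a. wproj_action W V n a (gpair y x)) ` ginv n ` Grass_units n" by (simp add: image_image)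
  also have "ginv n ` Grass_units n = (Grass_units n :: 'k gr set)"
  proof
    show "ginv n ` Grass_units n \<subseteq> (Grass_units n :: 'k gr set)" using ginv_units by blast
    show "Grass_units n \<subseteq> ginv n ` (Grass_units n :: 'k gr set)"
    proof
      fix a :: "'k gr" assume "a \<in> Grass_units n"
      then show "a \<in> ginv n ` Grass_units n" using ginv_ginv ginv_units by (intro image_eqI[of _ _ "ginv n a"]) auto
    qed
  qed
  finally show ?thesis by (simp add: wproj_class_def orbit_def)
qed

end

lemma linear_swap:
  assumes "vector_superspace V" "vector_superspace W"
  shows "Vector_Spaces.linear (scl (ssum V W)) (scl (ssum W V)) prod.swap"
  using vector_superspaceD(1)[OF vector_superspace_ssum[OF assms]] vector_superspaceD(1)[OF vector_superspace_ssum[OF assms(2,1)]]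
  by (auto simp: linear_iff_module_hom module_hom_def module_hom_axioms_def vector_space_module simp del: ssum_simps)
    (simp_all add: ssum_def case_prod_beta)

lemma smooth_map_swap:
  assumes V: "vector_superspace V" and W: "vector_superspace W"
  shows "smooth_map (wproj_space V W) (pts (wproj_space V W) 0) (wproj_space W V) swap_class"
  unfolding wproj_space_def
proof (rule smooth_map_quotient[OF slice_quotient_wproj[OF V W] slice_quotient_wproj[OF W V]])
  show "supersmooth (ssum V W) (nonzero V \<times> nonzero W) (ssum W V) (nonzero W \<times> nonzero V) (\<lambda>n x I. prod.swap (x I))"
    by (rule supersmooth_linear[OF vector_superspace_ssum[OF V W] vector_superspace_ssum[OF W V] linear_swap[OF V W]])
      (use openin_Times[OF openin_nonzero openin_nonzero] in auto)
  show "swap_class n (orbit (wproj_action V W) n z) = orbit (wproj_action W V) n (\<lambda>I. prod.swap (z I))"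
    if "z \<in> dpts (ssum V W) (nonzero V \<times> nonzero W) n" for n z
    using that swap_wproj_class[OF V W] by (elim dpts_ssum_E) (simp add: wproj_class_def swap_gpair)
qed

section \<open>Tensors\<close>

text \<open>The sign rule for tensors turns \<theta>_I \<theta>_J into \<theta>_J \<theta>_I. A pure
  tensor thus evaluates to the Grassmann product of \<beta>(y) and \<alpha>(x), in this order, and
  questions about tensors become questions about products of scalars.\<close>

lemma gtensor_eq:
  fixes V :: "('k::real_normed_field, 'v::euclidean_space) sspace" and W :: "('k, 'w::euclidean_space) sspace"
  shows "gtensor V W x y = (\<lambda>K \<alpha> \<beta>. if Vector_Spaces.linear (scl V) (*) \<alpha> \<and> Vector_Spaces.linear (scl W) (*) \<beta>
     then gmult (\<lambda>I. \<beta> (y I)) (\<lambda>I. \<alpha> (x I)) K else 0)"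
proof (intro ext)
  fix K and \<alpha> :: "'v \<Rightarrow> 'k" and \<beta> :: "'w \<Rightarrow> 'k"
  have "(\<Sum>I\<in>Pow K. (- 1) ^ (card I * card (K - I)) * gsgn I (K - I) * \<alpha> (x I) * \<beta> (y (K - I))) =
      gmult (\<lambda>I. \<beta> (y I)) (\<lambda>I. \<alpha> (x I)) K"
  proof (cases "finite K")
    case True
    show ?thesis unfolding gsmult_def
    proof (rule sum.reindex_bij_witness[where i = "\<lambda>I. K - I" and j = "\<lambda>I. K - I"])
      fix I assume "I \<in> Pow K"
      then have f: "finite I" "finite (K - I)" "K - (K - I) = I" using True by (auto intro: finite_subset)
      have g: "gsgn (K - I) I = (- 1) ^ (card I * card (K - I)) * (gsgn I (K - I) :: 'k)"
        by (rule gsgn_swap[OF f(1,2) Diff_disjoint, symmetric])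
      show "gsgn (K - I) (K - (K - I)) * \<beta> (y (K - I)) * \<alpha> (x (K - (K - I))) =
          (- 1) ^ (card I * card (K - I)) * gsgn I (K - I) * \<alpha> (x I) * \<beta> (y (K - I))"
        unfolding f(3) g by (simp only: mult_ac)
    qed auto
  qed simp
  then show "gtensor V W x y K \<alpha> \<beta> = (if Vector_Spaces.linear (scl V) (*) \<alpha> \<and> Vector_Spaces.linear (scl W) (*) \<beta>
     then gmult (\<lambda>I. \<beta> (y I)) (\<lambda>I. \<alpha> (x I)) K else 0)"
    by (simp add: gtensor_def)
qed

text \<open>Even scalars are central, so they pass from one factor of the Grassmann product to the
  other. This holds for all even scalars, units or not; the non-units occur as multiples in the
  tautological fiber.\<close>

lemma gtensor_gsmult:
  assumes "a \<in> Grass_even n"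
  shows "gtensor V W (gsmult (scl V) a x) y = gtensor V W x (gsmult (scl W) a y)"
proof (intro ext)
  fix K \<alpha> \<beta>
  show "gtensor V W (gsmult (scl V) a x) y K \<alpha> \<beta> = gtensor V W x (gsmult (scl W) a y) K \<alpha> \<beta>"
  proof (cases "Vector_Spaces.linear (scl V) (*) \<alpha> \<and> Vector_Spaces.linear (scl W) (*) \<beta>")
    case True
    have "gmult (\<lambda>I. \<beta> (y I)) (gmult a (\<lambda>I. \<alpha> (x I))) = gmult (gmult a (\<lambda>I. \<beta> (y I))) (\<lambda>I. \<alpha> (x I))"
      unfolding gmult_assoc by (rule gsmult_commute[OF vector_space_mult assms, symmetric])
    then show ?thesis using True
      by (simp add: gtensor_eq gsmult_linear[of "scl V" "(*)" \<alpha>] gsmult_linear[of "scl W" "(*)" \<beta>])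
  next
    case False
    then show ?thesis by (auto simp: gtensor_eq)
  qed
qed

lemma linear_functional_0: "Vector_Spaces.linear sc (*) \<alpha> \<Longrightarrow> \<alpha> 0 = (0 :: 'k::field)"
  by (simp add: linear_iff_module_hom module_hom.zero)

lemma tensor_push_gtensor:
  fixes V :: "('k::{real_normed_field, euclidean_space}, 'v::euclidean_space) sspace"
    and W :: "('k, 'w::euclidean_space) sspace"
  assumes \<rho>: "Grass_hom m n \<rho>" and x: "x \<in> gsupported m" and y: "y \<in> gsupported m"
  shows "tensor_push m \<rho> (gtensor V W x y) = gtensor V W (gpush (scl V) m \<rho> x) (gpush (scl W) m \<rho> y)"
proof (intro ext)
  fix J \<alpha> \<beta>
  show "tensor_push m \<rho> (gtensor V W x y) J \<alpha> \<beta> =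
      gtensor V W (gpush (scl V) m \<rho> x) (gpush (scl W) m \<rho> y) J \<alpha> \<beta>"
  proof (cases "Vector_Spaces.linear (scl V) (*) \<alpha> \<and> Vector_Spaces.linear (scl W) (*) \<beta>")
    case True
    let ?a = "\<lambda>I. \<alpha> (x I)" and ?b = "\<lambda>I. \<beta> (y I)"
    have ab: "?a \<in> gsupported m" "?b \<in> gsupported m"
      using x y True linear_functional_0[of "scl V" \<alpha>] linear_functional_0[of "scl W" \<beta>] by (simp_all add: gsupported_def)
    have "\<rho> ?a = (\<lambda>J. \<alpha> (gpush (scl V) m \<rho> x J))" "\<rho> ?b = (\<lambda>J. \<beta> (gpush (scl W) m \<rho> y J))"
      using Grass_hom_gpush[OF \<rho> ab(1)] Grass_hom_gpush[OF \<rho> ab(2)] True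
        gpush_linear[of "scl V" "(*)" \<alpha> m \<rho> x] gpush_linear[of "scl W" "(*)" \<beta> m \<rho> y] by simp_all
    moreover have "tensor_push m \<rho> (gtensor V W x y) J \<alpha> \<beta> = gpush (*) m \<rho> (gmult ?b ?a) J"
      using True by (simp add: tensor_push_def gtensor_eq)
    moreover have "gpush (*) m \<rho> (gmult ?b ?a) = gmult (\<rho> ?b) (\<rho> ?a)"
      using Grass_hom_gpush[OF \<rho> gsmult_gsupported[OF vector_space_mult ab(2,1)]] Grass_hom_mult[OF \<rho> ab(2,1)] by simp
    ultimately show ?thesis using True by (simp add: gtensor_eq)
  next
    case False
    then have "(\<lambda>I. gtensor V W x y I \<alpha> \<beta>) = (\<lambda>I. 0)" by (auto simp: gtensor_eq)
    then show ?thesis using False by (auto simp: tensor_push_def gpush_def gtensor_eq)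
  qed
qed

lemma exists_linear_functional:
  assumes W: "vector_superspace W" and w: "w \<noteq> 0"
  shows "\<exists>\<beta>. Vector_Spaces.linear (scl W) (*) \<beta> \<and> \<beta> w = 1"
proof -
  interpret vector_space_pair "scl W" "(*)"
    using vector_superspaceD(1)[OF W] vector_space_mult unfolding vector_space_pair_def by blast
  have "vs1.independent {w}" using vs1.independent_insertI[of w "{}"] w vs1.independent_empty by simp
  from linear_independent_extend[OF this, of "\<lambda>_. 1"] show ?thesis by simp
qed

text \<open>An even functional that does not vanish on the body of \<open>v\<close> makes \<open>v\<close> invertible for the tensor product.\<close>

lemma gtensor_inj:
  assumes V: "vector_superspace V" and W: "vector_superspace W" and v: "v \<in> dpts V (nonzero V) n"
    and w: "w \<in> spts W n" "w' \<in> spts W n" and eq: "gtensor V W v w = gtensor V W v w'"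
  shows "w = w'"
proof (rule ccontr)
  assume "w \<noteq> w'"
  then obtain I where "w I - w' I \<noteq> 0" by (auto simp: fun_eq_iff)
  \<comment> \<open>\<beta> is an arbitrary linear form and not an even one, since the coefficients
    at which w and w' differ may be odd vectors.\<close>
  then obtain \<beta> where \<beta>: "Vector_Spaces.linear (scl W) (*) \<beta>" "\<beta> (w I - w' I) = 1"
    using exists_linear_functional[OF W] by blast
  have "v {} \<in> nonzero V" using v by (simp add: dpts_def)
  then obtain \<alpha> where \<alpha>: "even_functional V \<alpha>" "\<alpha> (v {}) = 1"
    using exists_even_functional[OF V, of "v {}" "v {}"] by blast
  have u: "(\<lambda>I. \<alpha> (v I)) \<in> Grass_units n"
    using \<alpha> by (intro even_functional_units[OF _ dpts_spts[OF v]]) simp_all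
  let ?u = "\<lambda>I. \<alpha> (v I)" and ?b = "\<lambda>I. \<beta> (w I)" and ?b' = "\<lambda>I. \<beta> (w' I)"
  have "gmult ?b ?u K = gmult ?b' ?u K" for K
    using fun_cong[OF fun_cong[OF fun_cong[OF eq, of K], of \<alpha>], of \<beta>] even_functional_linear[OF \<alpha>(1)] \<beta>(1)
    by (simp add: gtensor_eq)
  then have "gmult (gmult ?b ?u) (ginv n ?u) = gmult (gmult ?b' ?u) (ginv n ?u)" by presburger
  moreover have "?b \<in> gsupported n" "?b' \<in> gsupported n"
    using spts_gsupported[OF w(1)] spts_gsupported[OF w(2)] linear_functional_0[OF \<beta>(1)] by (simp_all add: gsupported_def)
  ultimately have "?b = ?b'" by (simp add: gmult_assoc gmult_ginv[OF u])
  then have "\<beta> (w I) = \<beta> (w' I)" by (rule fun_cong)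
  moreover have "\<beta> (w I - w' I) = \<beta> (w I) - \<beta> (w' I)"
    using \<beta>(1) by (simp add: linear_iff_module_hom module_hom.diff)
  ultimately show False using \<beta>(2) by simp
qed

text \<open>The body of a pure tensor is the ordinary tensor product of the bodies, and that of v is
  non-zero. Two functionals with value 1 on the bodies of v and w detect it.\<close>

lemma gtensor_body_nonzero:
  assumes V: "vector_superspace V" and W: "vector_superspace W" and v: "v \<in> dpts V (nonzero V) n"
  shows "gtensor V W v w {} \<noteq> (\<lambda>\<alpha> \<beta>. 0) \<longleftrightarrow> w {} \<noteq> 0"
proof
  show "w {} \<noteq> 0" if "gtensor V W v w {} \<noteq> (\<lambda>\<alpha> \<beta>. 0)"
  proof
    assume "w {} = 0"
    then have "gtensor V W v w {} = (\<lambda>\<alpha> \<beta>. 0)" using linear_functional_0[of "scl W"] by (intro ext) (auto simp: gtensor_eq)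
    then show False using that by simp
  qed
  assume "w {} \<noteq> 0"
  then obtain \<beta> where \<beta>: "Vector_Spaces.linear (scl W) (*) \<beta>" "\<beta> (w {}) = 1"
    using exists_linear_functional[OF W] by blast
  have "v {} \<in> nonzero V" using v by (simp add: dpts_def)
  then obtain \<alpha> where \<alpha>: "even_functional V \<alpha>" "\<alpha> (v {}) = 1"
    using exists_even_functional[OF V, of "v {}" "v {}"] by blast
  have "gtensor V W v w {} \<alpha> \<beta> = 1"
    using \<alpha> \<beta> even_functional_linear[OF \<alpha>(1)] by (simp add: gtensor_eq)
  then show "gtensor V W v w {} \<noteq> (\<lambda>\<alpha> \<beta>. 0)" by auto
qed

section \<open>The complement of the zero section\<close>

context
  fixes V :: "('k::{real_normed_field, euclidean_space}, 'v::euclidean_space) sspace"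
    and W :: "('k, 'w::euclidean_space) sspace"
  assumes V: "vector_superspace V" and W: "vector_superspace W"
begin

interpretation P: slice_quotient V "nonzero V" "proj_action V" "unit_functionals V"
  by (rule slice_quotient_proj[OF V])

abbreviation (input) "PV \<equiv> proj_space V"
abbreviation (input) "TT \<equiv> taut_tensor_nonzero V W"

lemma premfd_PV: "premfd PV"
  using supermanifold_proj[OF V] by (simp add: supermanifold_iff)

lemma proj_class_gsmult: "a \<in> Grass_units n \<Longrightarrow> v \<in> dpts V (nonzero V) n \<Longrightarrow> proj_class V n (gsmult (scl V) a v) = proj_class V n v"
  unfolding proj_class_def using P.cl_act by (simp add: proj_action_def)

lemma proj_class_eq_E:
  assumes "proj_class V n v = proj_class V n v'" "v' \<in> dpts V (nonzero V) n"
  obtains a where "a \<in> Grass_units n" "v' = gsmult (scl V) a v"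
proof -
  have "v' \<in> P.cl n v" using P.cl_self[OF assms(2)] assms(1) by (simp add: proj_class_def)
  then show thesis using that by (elim P.cl_E) (simp add: proj_action_def)
qed

text \<open>The point v \<otimes> w in the fiber over [v], with a generator of the line as its first
  factor. By \<open>pts_taut\<close> every point has this form.\<close>

definition tpt :: "nat \<Rightarrow> 'v gr \<Rightarrow> 'w gr \<Rightarrow> 'v gr set \<times> ('k, 'v, 'w) tensor gr" where
  "tpt n v w = (proj_class V n v, gtensor V W v w)"

lemma tpt_gsmult:
  assumes "a \<in> Grass_units n" "v \<in> dpts V (nonzero V) n"
  shows "tpt n (gsmult (scl V) a v) w = tpt n v (gsmult (scl W) a w)"
  by (simp add: tpt_def proj_class_gsmult[OF assms] gtensor_gsmult[OF Grass_units_even[OF assms(1)]])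

lemma taut_fiber_E:
  assumes "x \<in> taut_fiber V n (proj_class V n v)"
  obtains a where "a \<in> Grass_even n" "x = gsmult (scl V) a v"
proof -
  obtain a u where au: "a \<in> Grass_even n" "u \<in> P.cl n v" "x = gsmult (scl V) a u"
    using assms by (auto simp: taut_fiber_def proj_class_def)
  obtain b where b: "b \<in> Grass_units n" "u = gsmult (scl V) b v"
    using au(2) by (elim P.cl_E) (simp add: proj_action_def)
  show thesis
    by (rule that[of "gmult a b"])
      (simp_all add: au b gmult_even Grass_units_even gsmult_assoc[OF vector_superspaceD(1)[OF V]])
qed

lemma taut_fiberI:
  assumes "a \<in> Grass_even n" "v \<in> dpts V (nonzero V) n"
  shows "gsmult (scl V) a v \<in> taut_fiber V n (proj_class V n v)"
  using assms P.cl_self[OF assms(2)] unfolding taut_fiber_def proj_class_def by blast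

text \<open>An element of the tautological fiber is an even multiple a v of a generator, and a moves
  to the second factor. The first factor can thus always be kept a generator, while all degeneration
  is left to w.\<close>

lemma pts_taut: "pts (taut_tensor V W) n = {tpt n v w | v w. v \<in> dpts V (nonzero V) n \<and> w \<in> spts W n}"
proof
  show "pts (taut_tensor V W) n \<subseteq> {tpt n v w | v w. v \<in> dpts V (nonzero V) n \<and> w \<in> spts W n}"
  proof
    fix p assume "p \<in> pts (taut_tensor V W) n"
    then obtain L x w where p: "p = (L, gtensor V W x w)" "L \<in> pts PV n" "x \<in> taut_fiber V n L" "w \<in> spts W n"
      by (auto simp: taut_tensor_def taut_tensor_functor_def)
    obtain v where v: "v \<in> dpts V (nonzero V) n" "L = proj_class V n v" using proj_E[OF V p(2)] .
    obtain a where a: "a \<in> Grass_even n" "x = gsmult (scl V) a v" using taut_fiber_E[OF p(3)[unfolded v(2)]] .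
    have "p = tpt n v (gsmult (scl W) a w)" by (simp add: p(1) v(2) a(2) tpt_def gtensor_gsmult[OF a(1)])
    then show "p \<in> {tpt n v w | v w. v \<in> dpts V (nonzero V) n \<and> w \<in> spts W n}"
      using v(1) gsmult_spts[OF W a(1) p(4)] by blast
  qed
  have "tpt n v w \<in> pts (taut_tensor V W) n" if v: "v \<in> dpts V (nonzero V) n" and w: "w \<in> spts W n" for v w
  proof -
    have "v \<in> taut_fiber V n (proj_class V n v)"
      using taut_fiberI[OF gconst_even[of 1] v] gsmult_one[OF vector_superspaceD(1)[OF V] spts_gsupported[OF dpts_spts[OF v]]] by simp
    then show ?thesis using pts_proj[OF V v] w unfolding taut_tensor_def taut_tensor_functor_def tpt_def by auto
  qed
  then show "{tpt n v w | v w. v \<in> dpts V (nonzero V) n \<and> w \<in> spts W n} \<subseteq> pts (taut_tensor V W) n" by blast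
qed

lemma act_taut:
  assumes "Grass_hom m n \<rho>" "v \<in> dpts V (nonzero V) m" "w \<in> spts W m"
  shows "act (taut_tensor V W) m n \<rho> (tpt m v w) = tpt n (gpush (scl V) m \<rho> v) (gpush (scl W) m \<rho> w)"
  using act_proj[OF V assms(1,2)]
    tensor_push_gtensor[OF assms(1) spts_gsupported[OF dpts_spts[OF assms(2)]] spts_gsupported[OF assms(3)], of V W]
  by (simp add: taut_tensor_def taut_tensor_functor_def tpt_def)

lemma dpts_nonzero_iff: "w \<in> dpts W (nonzero W) n \<longleftrightarrow> w \<in> spts W n \<and> w {} \<noteq> 0"
  using spts_empty[of w W n] by (auto simp: dpts_def nonzero_def)

abbreviation (input) "S0 \<equiv> {(L, z) \<in> pts (taut_tensor V W) 0. z {} \<noteq> (\<lambda>\<alpha> \<beta>. 0)}"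

lemma act_TT: "act TT = act (taut_tensor V W)"
  by (simp add: taut_tensor_nonzero_def open_sub_def)

text \<open>The zero section is removed by a condition on the body of the tensor, which
  \<open>gtensor_body_nonzero\<close> turns into one on the body of w.\<close>

lemma pts_TT: "pts TT n = {tpt n v w | v w. v \<in> dpts V (nonzero V) n \<and> w \<in> dpts W (nonzero W) n}"
proof -
  have "tpt n v w \<in> rpts (taut_tensor V W) S0 n \<longleftrightarrow> w {} \<noteq> 0"
    if v: "v \<in> dpts V (nonzero V) n" and w: "w \<in> spts W n" for v w
  proof -
    note gv = gpush_dpts[OF gaug_hom V v, of 0] and gw = gpush_spts[OF gaug_hom W w, of 0]
    have "act (taut_tensor V W) n 0 gaug (tpt n v w) = tpt 0 (gpush (scl V) n gaug v) (gpush (scl W) n gaug w)"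
      by (rule act_taut[OF gaug_hom v w])
    moreover have "tpt 0 (gpush (scl V) n gaug v) (gpush (scl W) n gaug w) \<in> pts (taut_tensor V W) 0"
      unfolding pts_taut using gv gw by blast
    moreover have "tpt n v w \<in> pts (taut_tensor V W) n" unfolding pts_taut using v w by blast
    moreover have "gpush (scl W) n gaug w {} = w {}" by (simp add: gpush_gaug vector_superspaceD W)
    ultimately show ?thesis using gtensor_body_nonzero[OF V W gv, of "gpush (scl W) n gaug w"]
      by (simp add: rpts_def tpt_def)
  qed
  note R = this
  have TT: "pts TT n = rpts (taut_tensor V W) S0 n"
    by (simp add: taut_tensor_nonzero_def open_sub_def)
  show ?thesis unfolding TT
  proof (intro equalityI subsetI)
    fix p assume p: "p \<in> rpts (taut_tensor V W) S0 n"
    then obtain v w where vw: "v \<in> dpts V (nonzero V) n" "w \<in> spts W n" "p = tpt n v w"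
      using rpts_pts[OF p] unfolding pts_taut by blast
    then show "p \<in> {tpt n v w | v w. v \<in> dpts V (nonzero V) n \<and> w \<in> dpts W (nonzero W) n}"
      using R[OF vw(1,2)] p unfolding dpts_nonzero_iff by blast
  next
    fix p assume "p \<in> {tpt n v w | v w. v \<in> dpts V (nonzero V) n \<and> w \<in> dpts W (nonzero W) n}"
    then obtain v w where vw: "v \<in> dpts V (nonzero V) n" "w \<in> spts W n" "w {} \<noteq> 0" "p = tpt n v w"
      unfolding dpts_nonzero_iff by blast
    then show "p \<in> rpts (taut_tensor V W) S0 n" using R[OF vw(1,2)] by simp
  qed
qed

lemma TT_E:
  assumes "p \<in> pts TT n"
  obtains v w where "v \<in> dpts V (nonzero V) n" "w \<in> dpts W (nonzero W) n" "p = tpt n v w"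
  using assms unfolding pts_TT by blast

lemma TT_I: "v \<in> dpts V (nonzero V) n \<Longrightarrow> w \<in> dpts W (nonzero W) n \<Longrightarrow> tpt n v w \<in> pts TT n"
  unfolding pts_TT by blast

lemma act_tpt:
  "Grass_hom m n \<rho> \<Longrightarrow> v \<in> dpts V (nonzero V) m \<Longrightarrow> w \<in> dpts W (nonzero W) m \<Longrightarrow>
    act TT m n \<rho> (tpt m v w) = tpt n (gpush (scl V) m \<rho> v) (gpush (scl W) m \<rho> w)"
  unfolding act_TT by (intro act_taut dpts_spts)

lemma functor_TT: "is_gfunctor TT"
  unfolding is_gfunctor_def
proof (intro conjI allI impI ballI)
  note Vs = vector_superspaceD(1)[OF V] and Ws = vector_superspaceD(1)[OF W]
  show "act TT m n \<rho> ` pts TT m \<subseteq> pts TT n" if "Grass_hom m n \<rho>" for m n \<rho>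
    using act_tpt[OF that] TT_I[OF gpush_dpts[OF that V] gpush_dpts[OF that W]] unfolding pts_TT[of m] by auto
  show "act TT n n \<rho> p = p" if \<rho>: "Grass_hom n n \<rho> \<and> (\<forall>a\<in>Grass n. \<rho> a = a)" and p: "p \<in> pts TT n" for n \<rho> p
  proof -
    obtain v w where vw: "v \<in> dpts V (nonzero V) n" "w \<in> dpts W (nonzero W) n" "p = tpt n v w" using TT_E[OF p] .
    have "gpush (scl V) n \<rho> v = v" "gpush (scl W) n \<rho> w = w"
      using \<rho> gpush_id[OF _ Vs spts_gsupported[OF dpts_spts[OF vw(1)]]] gpush_id[OF _ Ws spts_gsupported[OF dpts_spts[OF vw(2)]]]
      by blast+
    then show ?thesis using act_tpt[OF conjunct1[OF \<rho>] vw(1,2)] vw(3) by simp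
  qed
  show "act TT l n \<tau> p = act TT m n \<sigma> (act TT l m \<rho> p)"
    if h: "Grass_hom l m \<rho> \<and> Grass_hom m n \<sigma> \<and> Grass_hom l n \<tau> \<and> (\<forall>a\<in>Grass l. \<tau> a = \<sigma> (\<rho> a))"
      and p: "p \<in> pts TT l" for l m n \<rho> \<sigma> \<tau> p
  proof -
    have h': "Grass_hom l m \<rho>" "Grass_hom m n \<sigma>" "Grass_hom l n \<tau>" "\<And>a. a \<in> Grass l \<Longrightarrow> \<tau> a = \<sigma> (\<rho> a)" using h by auto
    obtain v w where vw: "v \<in> dpts V (nonzero V) l" "w \<in> dpts W (nonzero W) l" "p = tpt l v w" using TT_E[OF p] .
    show ?thesis
      unfolding vw(3) act_tpt[OF h'(1) vw(1,2)] act_tpt[OF h'(3) vw(1,2)]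
        act_tpt[OF h'(2) gpush_dpts[OF h'(1) V vw(1)] gpush_dpts[OF h'(1) W vw(2)]]
      by (simp only: gpush_comp[OF h' Vs] gpush_comp[OF h' Ws])
  qed
qed

lemma fst_TT: "p \<in> pts TT n \<Longrightarrow> fst p \<in> pts PV n"
  by (elim TT_E) (simp add: tpt_def pts_proj[OF V])

lemma fst_act_TT: "Grass_hom m n \<rho> \<Longrightarrow> p \<in> pts TT m \<Longrightarrow> fst (act TT m n \<rho> p) = act PV m n \<rho> (fst p)"
  by (elim TT_E) (simp only: act_tpt, simp add: tpt_def act_proj[OF V])

section \<open>Charts of (E_V \<otimes> W)_0 given by frames of E_V\<close>

definition tdom :: "'v gr set set \<Rightarrow> ('v gr set \<times> ('k, 'v, 'w) tensor gr) set" where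
  "tdom S = {p \<in> pts TT 0. fst p \<in> S}"

lemma rpts_tdom: "p \<in> rpts TT (tdom S) n \<longleftrightarrow> p \<in> pts TT n \<and> fst p \<in> rpts PV S n"
  using fst_act_TT[OF gaug_hom, of p n 0] fst_TT[of p n] gfunctorD(1)[OF functor_TT gaug_hom, of p n 0]
  by (auto simp: rpts_def tdom_def)

definition tchart :: "('k, 'v gr set, 'v) chart \<Rightarrow> (nat \<Rightarrow> 'v gr set \<times> ('k, 'v, 'w) tensor gr \<Rightarrow> ('v \<times> 'w) gr) \<Rightarrow>
    ('k, 'v gr set \<times> ('k, 'v, 'w) tensor gr, 'v \<times> 'w) chart" where
  "tchart c \<kappa> = \<lparr>cdom = tdom (cdom c), cmodel = ssum (cmodel c) W, cimg = cimg c \<times> nonzero W, cmap = \<kappa>\<rparr>"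

lemma tchart_simps [simp]:
  "cdom (tchart c \<kappa>) = tdom (cdom c)" "cmodel (tchart c \<kappa>) = ssum (cmodel c) W"
  "cimg (tchart c \<kappa>) = cimg c \<times> nonzero W" "cmap (tchart c \<kappa>) = \<kappa>"
  by (simp_all add: tchart_def)

text \<open>The condition on \<open>\<kappa>\<close> in \<open>taut_tensor\<close>. It determines
  \<open>\<kappa>\<close> at the points over the chart domain and leaves it open elsewhere, so many
  functions qualify and all of them have to be treated.\<close>

definition framed_map :: "('k, 'v gr set, 'v) chart \<Rightarrow> (nat \<Rightarrow> 'v gr set \<Rightarrow> 'v gr) \<Rightarrow>
    (nat \<Rightarrow> 'v gr set \<times> ('k, 'v, 'w) tensor gr \<Rightarrow> ('v \<times> 'w) gr) \<Rightarrow> bool" where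
  "framed_map c s \<kappa> \<longleftrightarrow> (\<forall>n. \<forall>L\<in>rpts PV (cdom c) n. \<forall>w\<in>spts W n.
      \<kappa> n (L, gtensor V W (s n L) w) = gpair (cmap c n L) w)"

lemma framed_mapD:
  "framed_map c s \<kappa> \<Longrightarrow> L \<in> rpts PV (cdom c) n \<Longrightarrow> w \<in> spts W n \<Longrightarrow> \<kappa> n (L, gtensor V W (s n L) w) = gpair (cmap c n L) w"
  by (simp add: framed_map_def)

context
  fixes c s
  assumes c: "c \<in> charts PV" and s: "taut_frame V c s"
begin

lemma frame_smooth: "supersmooth (cmodel c) (cimg c) V (nonzero V) (\<lambda>n y. s n (cinv PV c n y))"
  using s by (simp add: taut_frame_def)

lemma frame_dpts: "L \<in> rpts PV (cdom c) n \<Longrightarrow> s n L \<in> dpts V (nonzero V) n"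
  using supersmoothD(3)[OF frame_smooth chart_in[OF premfdD(1)[OF premfd_PV] M_chart[OF premfd_PV c]]]
  by (simp add: cinv_cmap[OF premfdD(1)[OF premfd_PV] M_chart[OF premfd_PV c]])

text \<open>The frame at L is an even multiple a v of a generator, and its body is non-zero. Then
  the constant term of a is non-zero, so a is a unit and the frame generates the same line.\<close>

lemma frame_class:
  assumes L: "L \<in> rpts PV (cdom c) n"
  shows "proj_class V n (s n L) = L"
proof -
  obtain v where v: "v \<in> dpts V (nonzero V) n" "L = proj_class V n v" using proj_E[OF V rpts_pts[OF L]] .
  have "s n L \<in> taut_fiber V n L" using s L by (simp add: taut_frame_def)
  then obtain a where a: "a \<in> Grass_even n" "s n L = gsmult (scl V) a v" unfolding v(2) by (rule taut_fiber_E)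
  have "scl V (a {}) (v {}) \<noteq> 0"
    using frame_dpts[OF L] by (simp add: a(2) dpts_def nonzero_def gsmult_empty[OF vector_superspaceD(1)[OF V]])
  then have "a \<in> Grass_units n"
    using a(1) module.scale_zero_left[OF vector_superspace_module[OF V]] by (auto simp: Grass_units_iff)
  then show ?thesis using proj_class_gsmult v a(2) by simp
qed

text \<open>Compatibility of a frame with homomorphisms is contained in the supersmoothness of its
  coordinate expression.\<close>

lemma frame_nat:
  assumes \<rho>: "Grass_hom m n \<rho>" and L: "L \<in> rpts PV (cdom c) m"
  shows "s n (act PV m n \<rho> L) = gpush (scl V) m \<rho> (s m L)"
proof -
  note PF = premfdD(1)[OF premfd_PV] and cc = M_chart[OF premfd_PV c]
  show ?thesis
    using supersmoothD(4)[OF frame_smooth \<rho> chart_in[OF PF cc L]] cinv_nat[OF PF cc \<rho> chart_in[OF PF cc L]]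
    by (simp add: cinv_cmap[OF PF cc L])
qed

lemma frame_tpt: "L \<in> rpts PV (cdom c) n \<Longrightarrow> tpt n (s n L) w = (L, gtensor V W (s n L) w)"
  by (simp add: tpt_def frame_class)

lemma TT_frame_I: "L \<in> rpts PV (cdom c) n \<Longrightarrow> w \<in> dpts W (nonzero W) n \<Longrightarrow> (L, gtensor V W (s n L) w) \<in> pts TT n"
  using TT_I[OF frame_dpts] by (simp add: frame_tpt)

text \<open>Any generator of the line is a unit times the frame, and the unit moves to the second
  factor, where it keeps the body non-zero.\<close>

lemma TT_frame_E:
  assumes p: "p \<in> pts TT n" and L: "fst p \<in> rpts PV (cdom c) n"
  obtains w where "w \<in> dpts W (nonzero W) n" "p = (fst p, gtensor V W (s n (fst p)) w)"
proof -
  obtain v w where vw: "v \<in> dpts V (nonzero V) n" "w \<in> dpts W (nonzero W) n" "p = tpt n v w" using TT_E[OF p] .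
  have "proj_class V n (s n (fst p)) = proj_class V n v" by (simp add: frame_class[OF L]) (simp add: vw(3) tpt_def)
  then obtain a where a: "a \<in> Grass_units n" "v = gsmult (scl V) a (s n (fst p))" using vw(1) by (rule proj_class_eq_E)
  have "p = tpt n (s n (fst p)) (gsmult (scl W) a w)"
    unfolding tpt_gsmult[OF a(1) frame_dpts[OF L], symmetric] a(2)[symmetric] by (rule vw(3))
  then show thesis by (intro that[OF gsmult_nonzero[OF W a(1) vw(2)]]) (simp add: frame_tpt[OF L])
qed

lemma tdom_frame_E:
  assumes "p \<in> rpts TT (tdom (cdom c)) n"
  obtains L w where "L \<in> rpts PV (cdom c) n" "w \<in> dpts W (nonzero W) n" "p = (L, gtensor V W (s n L) w)"
proof -
  have p: "p \<in> pts TT n" "fst p \<in> rpts PV (cdom c) n" using assms by (simp_all add: rpts_tdom)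
  obtain w where "w \<in> dpts W (nonzero W) n" "p = (fst p, gtensor V W (s n (fst p)) w)" using TT_frame_E[OF p] .
  then show thesis by (rule that[OF p(2)])
qed

lemma tdom_frame_I: "L \<in> rpts PV (cdom c) n \<Longrightarrow> w \<in> dpts W (nonzero W) n \<Longrightarrow> (L, gtensor V W (s n L) w) \<in> rpts TT (tdom (cdom c)) n"
  using TT_frame_I by (simp add: rpts_tdom)

context
  fixes \<kappa>
  assumes \<kappa>: "framed_map c s \<kappa>"
begin

text \<open>In frame coordinates the part over \<open>S\<close> is a product, since over every line
  in \<open>S\<close> the vector w runs through all points with non-zero body.\<close>

lemma cbody_tdom:
  assumes S: "S \<subseteq> cdom c"
  shows "(\<lambda>p. \<kappa> 0 p {}) ` tdom S = cbody c S \<times> nonzero W"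
proof -
  note PF = premfdD(1)[OF premfd_PV] and cc = M_chart[OF premfd_PV c]
  have S0: "L \<in> rpts PV (cdom c) 0" if "L \<in> S" for L using that S cdom_rpts[OF PF cc] by blast
  have val: "\<kappa> 0 (L, gtensor V W (s 0 L) w) {} = (cpt c L, w {})" if "L \<in> S" "w \<in> dpts W (nonzero W) 0" for L w
    unfolding framed_mapD[OF \<kappa> S0[OF that(1)] dpts_spts[OF that(2)]] by (simp add: gpair_def)
  show ?thesis
  proof
    show "(\<lambda>p. \<kappa> 0 p {}) ` tdom S \<subseteq> cbody c S \<times> nonzero W"
    proof
      fix y assume "y \<in> (\<lambda>p. \<kappa> 0 p {}) ` tdom S"
      then obtain p where p: "p \<in> pts TT 0" "fst p \<in> S" "y = \<kappa> 0 p {}" by (auto simp: tdom_def)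
      obtain w where w: "w \<in> dpts W (nonzero W) 0" "p = (fst p, gtensor V W (s 0 (fst p)) w)"
        using TT_frame_E[OF p(1) S0[OF p(2)]] .
      have "y = (cpt c (fst p), w {})" unfolding p(3) by (subst w(2)) (rule val[OF p(2) w(1)])
      then show "y \<in> cbody c S \<times> nonzero W" using p(2) w(1) by (simp add: cbody_def dpts_def)
    qed
    show "cbody c S \<times> nonzero W \<subseteq> (\<lambda>p. \<kappa> 0 p {}) ` tdom S"
    proof
      fix y assume "y \<in> cbody c S \<times> nonzero W"
      then obtain L w where Lw: "L \<in> S" "w \<in> nonzero W" "y = (cpt c L, w)" by (auto simp: cbody_def)
      have w: "gconst w \<in> dpts W (nonzero W) 0" using Lw(2) by (intro gconst_dpts[OF W]) (auto simp: nonzero_def)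
      have "(L, gtensor V W (s 0 L) (gconst w)) \<in> tdom S"
        using TT_frame_I[OF S0[OF Lw(1)] w] Lw(1) by (simp add: tdom_def)
      moreover have "y = \<kappa> 0 (L, gtensor V W (s 0 L) (gconst w)) {}" using val[OF Lw(1) w] Lw(3) by simp
      ultimately show "y \<in> (\<lambda>p. \<kappa> 0 p {}) ` tdom S" by blast
    qed
  qed
qed

lemma is_chart_tchart: "is_chart TT (tchart c \<kappa>)"
  unfolding is_chart_def tchart_simps
proof (intro conjI allI impI ballI)
  note PF = premfdD(1)[OF premfd_PV] and cc = M_chart[OF premfd_PV c]
  note Vc = chart_model[OF PF cc]
  show "tdom (cdom c) \<subseteq> pts TT 0" by (auto simp: tdom_def)
  show "vector_superspace (ssum (cmodel c) W)" by (rule vector_superspace_ssum[OF Vc W])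
  show "openin (top_of_set (ev (ssum (cmodel c) W))) (cimg c \<times> nonzero W)"
    using openin_Times[OF chart_open[OF PF cc] openin_nonzero] by simp
  fix n
  show "bij_betw (\<kappa> n) (rpts TT (tdom (cdom c)) n) (dpts (ssum (cmodel c) W) (cimg c \<times> nonzero W) n)"
  proof (rule bij_betwI')
    fix p q assume p: "p \<in> rpts TT (tdom (cdom c)) n" and q: "q \<in> rpts TT (tdom (cdom c)) n"
    obtain L w where Lw: "L \<in> rpts PV (cdom c) n" "w \<in> dpts W (nonzero W) n" "p = (L, gtensor V W (s n L) w)"
      using tdom_frame_E[OF p] .
    obtain L' w' where Lw': "L' \<in> rpts PV (cdom c) n" "w' \<in> dpts W (nonzero W) n" "q = (L', gtensor V W (s n L') w')"
      using tdom_frame_E[OF q] .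
    have \<kappa>p: "\<kappa> n p = gpair (cmap c n L) w" unfolding Lw(3) by (rule framed_mapD[OF \<kappa> Lw(1) dpts_spts[OF Lw(2)]])
    have \<kappa>q: "\<kappa> n q = gpair (cmap c n L') w'" unfolding Lw'(3) by (rule framed_mapD[OF \<kappa> Lw'(1) dpts_spts[OF Lw'(2)]])
    show "\<kappa> n p = \<kappa> n q \<longleftrightarrow> p = q"
    proof
      assume "\<kappa> n p = \<kappa> n q"
      then have "cmap c n L = cmap c n L'" and w: "w = w'" unfolding \<kappa>p \<kappa>q gpair_eq_iff by blast+
      then have "L = L'" by (intro chart_inj[OF PF cc Lw(1) Lw'(1)])
      then show "p = q" unfolding Lw(3) Lw'(3) w by simp
    qed simp
    show "\<kappa> n p \<in> dpts (ssum (cmodel c) W) (cimg c \<times> nonzero W) n"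
      unfolding \<kappa>p gpair_dpts_iff using chart_in[OF PF cc Lw(1)] Lw(2) by blast
  next
    fix y assume "y \<in> dpts (ssum (cmodel c) W) (cimg c \<times> nonzero W) n"
    then obtain y1 w where y: "y = gpair y1 w" "y1 \<in> dpts (cmodel c) (cimg c) n" "w \<in> dpts W (nonzero W) n" by (rule dpts_ssum_E)
    note L = cinv_in[OF PF cc y(2)]
    show "\<exists>p\<in>rpts TT (tdom (cdom c)) n. y = \<kappa> n p"
      by (rule bexI[OF _ tdom_frame_I[OF L y(3)]])
        (simp add: framed_mapD[OF \<kappa> L dpts_spts[OF y(3)]] cmap_cinv_in[OF PF cc y(2)] y(1))
  qed
next
  note PF = premfdD(1)[OF premfd_PV] and cc = M_chart[OF premfd_PV c]
  show "\<kappa> n (act TT m n \<rho> p) = gpush (scl (ssum (cmodel c) W)) m \<rho> (\<kappa> m p)"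
    if \<rho>: "Grass_hom m n \<rho>" and p: "p \<in> rpts TT (tdom (cdom c)) m" for m n \<rho> p
  proof -
    obtain L w where Lw: "L \<in> rpts PV (cdom c) m" "w \<in> dpts W (nonzero W) m" "p = (L, gtensor V W (s m L) w)"
      using tdom_frame_E[OF p] .
    note L' = act_rpts[OF PF \<rho> Lw(1)]
    have "act TT m n \<rho> p = tpt n (gpush (scl V) m \<rho> (s m L)) (gpush (scl W) m \<rho> w)"
      unfolding Lw(3) frame_tpt[OF Lw(1), symmetric] by (rule act_tpt[OF \<rho> frame_dpts[OF Lw(1)] Lw(2)])
    also have "\<dots> = (act PV m n \<rho> L, gtensor V W (s n (act PV m n \<rho> L)) (gpush (scl W) m \<rho> w))"
      unfolding frame_nat[OF \<rho> Lw(1), symmetric] by (rule frame_tpt[OF L'])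
    finally have "\<kappa> n (act TT m n \<rho> p) = gpair (cmap c n (act PV m n \<rho> L)) (gpush (scl W) m \<rho> w)"
      using framed_mapD[OF \<kappa> L' gpush_spts[OF \<rho> W dpts_spts[OF Lw(2)]]] by simp
    then show ?thesis
      unfolding Lw(3) framed_mapD[OF \<kappa> Lw(1) dpts_spts[OF Lw(2)]] gpush_gpair[OF chart_model[OF PF cc] W]
        chart_nat[OF PF cc \<rho> Lw(1)] .
  qed
qed

end

end

text \<open>Restricting a chart of the total space to the complement of the zero section removes
  exactly w = 0 from its image, as \<open>cbody_tdom\<close> computes.\<close>

lemma charts_TT: "charts TT = {tchart c \<kappa> | c s \<kappa>. c \<in> charts PV \<and> taut_frame V c s \<and> framed_map c s \<kappa>}"
proof -
  let ?t = "\<lambda>c \<kappa>. \<lparr>cdom = {(L, z) \<in> pts (taut_tensor_functor V W) 0. L \<in> cdom c},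
                 cmodel = ssum (cmodel c) W, cimg = cimg c \<times> ev W, cmap = \<kappa>\<rparr>"
  let ?r = "\<lambda>t. t\<lparr>cdom := cdom t \<inter> S0, cimg := cbody t (cdom t \<inter> S0)\<rparr>"
  have pts0: "pts (taut_tensor_functor V W) 0 = pts (taut_tensor V W) 0" by (simp add: taut_tensor_def)
  have T0: "S0 = pts TT 0"
  proof -
    have "tpt 0 v w \<in> S0 \<longleftrightarrow> w {} \<noteq> 0" if v: "v \<in> dpts V (nonzero V) 0" and w: "w \<in> spts W 0" for v w
    proof -
      have "tpt 0 v w \<in> pts (taut_tensor V W) 0" unfolding pts_taut using v w by blast
      then show ?thesis using gtensor_body_nonzero[OF V W v, of w] by (simp add: tpt_def)
    qed
    note R = this
    show ?thesis
    proof (intro equalityI subsetI)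
      fix p assume p: "p \<in> S0"
      then have "p \<in> pts (taut_tensor V W) 0" by auto
      then obtain v w where vw: "v \<in> dpts V (nonzero V) 0" "w \<in> spts W 0" "p = tpt 0 v w"
        unfolding pts_taut by blast
      have "w {} \<noteq> 0" using R[OF vw(1,2)] p unfolding vw(3) by (rule iffD1)
      then have "w \<in> dpts W (nonzero W) 0" unfolding dpts_nonzero_iff using vw(2) by blast
      then show "p \<in> pts TT 0" unfolding vw(3) by (rule TT_I[OF vw(1)])
    next
      fix p assume "p \<in> pts TT 0"
      then obtain v w where vw: "v \<in> dpts V (nonzero V) 0" "w \<in> dpts W (nonzero W) 0" "p = tpt 0 v w" by (rule TT_E)
      have "w {} \<noteq> 0" using vw(2) unfolding dpts_nonzero_iff by blast
      then show "p \<in> S0" unfolding vw(3) by (rule iffD2[OF R[OF vw(1) dpts_spts[OF vw(2)]]])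
    qed
  qed
  have eq: "?r (?t c \<kappa>) = tchart c \<kappa>" if "c \<in> charts PV" "taut_frame V c s" "framed_map c s \<kappa>" for c s \<kappa>
  proof -
    have "{(L, z) \<in> pts (taut_tensor_functor V W) 0. L \<in> cdom c} \<inter> S0 = tdom (cdom c)"
      unfolding tdom_def T0[symmetric] pts0 by auto
    moreover have "cbody (?t c \<kappa>) (tdom (cdom c)) = cimg c \<times> nonzero W"
      using cbody_tdom[OF that order_refl] cbody_cdom[OF premfdD(1)[OF premfd_PV] M_chart[OF premfd_PV that(1)]]
      by (simp add: cbody_def)
    ultimately show ?thesis by (simp add: tchart_def)
  qed
  have "charts TT = ?r ` {?t c \<kappa> | c s \<kappa>. c \<in> charts PV \<and> taut_frame V c s \<and> framed_map c s \<kappa>}"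
    unfolding framed_map_def by (simp add: taut_tensor_nonzero_def open_sub_def taut_tensor_def)
  also have "\<dots> = {?r (?t c \<kappa>) | c s \<kappa>. c \<in> charts PV \<and> taut_frame V c s \<and> framed_map c s \<kappa>}" by blast
  also have "\<dots> = {tchart c \<kappa> | c s \<kappa>. c \<in> charts PV \<and> taut_frame V c s \<and> framed_map c s \<kappa>}"
    by (intro Collect_cong ex_cong1 refl rev_conj_cong) (elim conjE, simp only: eq)
  finally show ?thesis .
qed

lemma charts_TT_E:
  assumes "C \<in> charts TT"
  obtains c s \<kappa> where "c \<in> charts PV" "taut_frame V c s" "framed_map c s \<kappa>" "C = tchart c \<kappa>"
proof -
  have "\<exists>c s \<kappa>. C = tchart c \<kappa> \<and> c \<in> charts PV \<and> taut_frame V c s \<and> framed_map c s \<kappa>"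
    using assms unfolding charts_TT by (rule CollectD)
  then show thesis by (elim exE conjE) (rule that)
qed

lemma charts_TT_I: "c \<in> charts PV \<Longrightarrow> taut_frame V c s \<Longrightarrow> framed_map c s \<kappa> \<Longrightarrow> tchart c \<kappa> \<in> charts TT"
  unfolding charts_TT by (intro CollectI exI[of _ c] exI[of _ s] exI[of _ \<kappa>] conjI refl)

text \<open>Over the common domain two frames satisfy s = u t with a unit u, and the fiber
  coordinate changes by w \<mapsto> u w. An even functional \<beta> for which \<beta>(t) is
  invertible gives u = \<beta>(s) / \<beta>(t) near a given point, so u depends supersmoothly on the
  base point.\<close>

lemma TT_transition:
  assumes c: "c \<in> charts PV" and s: "taut_frame V c s" and \<kappa>: "framed_map c s \<kappa>"
    and d: "d \<in> charts PV" and t: "taut_frame V d t" and \<kappa>': "framed_map d t \<kappa>'"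
  shows "supersmooth (ssum (cmodel c) W) (cbody c (cdom c \<inter> cdom d) \<times> nonzero W) (ssum (cmodel d) W)
    (cimg d \<times> nonzero W) (\<lambda>n z. \<kappa>' n (cinv TT (tchart c \<kappa>) n z))"
proof -
  note PF = premfdD(1)[OF premfd_PV] and cc = M_chart[OF premfd_PV c] and dc = M_chart[OF premfd_PV d]
  note Mc = chart_model[OF PF cc] and Md = chart_model[OF PF dc]
  note tc = is_chart_tchart[OF c s \<kappa>] and td = is_chart_tchart[OF d t \<kappa>']
  let ?S = "cdom c \<inter> cdom d" and ?M = "cmodel c"
  let ?Y = "cbody c ?S" and ?i = "\<lambda>n y. cinv PV c n y"
  let ?D = "cbody c ?S \<times> nonzero W"
  have Yo: "openin (top_of_set (ev ?M)) ?Y" by (rule supersmoothD(1)[OF premfdD(4)[OF premfd_PV c d]])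
  have Yc: "?Y \<subseteq> cimg c" unfolding cbody_cdom[OF PF cc, symmetric] by (auto simp: cbody_def)
  have L: "?i n y \<in> rpts PV (cdom c) n" "?i n y \<in> rpts PV (cdom d) n" "?i n y \<in> rpts PV ?S n" if "y \<in> dpts ?M ?Y n" for n y
    using cinv_rpts[OF PF cc Int_lower1 that] rpts_mono[of ?S "cdom c"] rpts_mono[of ?S "cdom d"] by auto
  have sm_s: "supersmooth ?M ?Y V (nonzero V) (\<lambda>n y. s n (?i n y))"
    by (rule supersmooth_restrict[OF Mc V frame_smooth[OF c s] Yo Yc openin_nonzero])
      (use supersmooth_fbody[OF Mc frame_smooth[OF c s]] Yc in blast)
  have sm_t: "supersmooth ?M ?Y V (nonzero V) (\<lambda>n y. t n (?i n y))"
    by (rule supersmooth_cong[OF Mc supersmooth_compose[OF Mc Md premfdD(4)[OF premfd_PV c d] frame_smooth[OF d t]]])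
      (simp add: cinv_cmap[OF PF dc L(2)])
  show ?thesis
  proof (rule supersmooth_local[OF vector_superspace_ssum[OF Mc W]])
    show o2: "openin (top_of_set (ev (ssum (cmodel d) W))) (cimg d \<times> nonzero W)"
      using openin_Times[OF chart_open[OF PF dc] openin_nonzero] by simp
    fix z0 assume z0: "z0 \<in> ?D"
    let ?ft = "fbody (\<lambda>n y. t n (?i n y))"
    have "?ft (fst z0) \<in> nonzero V" by (rule supersmooth_fbody[OF Mc sm_t]) (use z0 in auto)
    \<comment> \<open>\<beta> is adjusted to the point: it is 1 on the body of the frame t there,
      hence non-zero on a neighbourhood.\<close>
    then obtain \<beta> where \<beta>: "even_functional V \<beta>" "\<beta> (?ft (fst z0)) = 1"
      using exists_even_functional[OF V, of "?ft (fst z0)" "?ft (fst z0)"] by blast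
    let ?N = "{v \<in> nonzero V. \<beta> v \<noteq> 0}"
    note No = openin_functional_nonzero[OF V \<beta>(1) openin_nonzero]
    let ?D1 = "{y \<in> ?Y. ?ft y \<in> ?N}"
    have D1o: "openin (top_of_set (ev ?M)) ?D1" by (rule openin_fbody_vimage[OF Mc sm_t No])
    have b: "supersmooth ?M ?D1 sfield (- {0}) (\<lambda>n y I. \<beta> (t n (?i n y) I))"
      by (rule supersmooth_compose[OF Mc V supersmooth_vimage[OF Mc V sm_t No] supersmooth_functional[OF V \<beta>(1) No]]) auto
    have s1: "supersmooth ?M ?D1 V (nonzero V) (\<lambda>n y. s n (?i n y))"
      by (rule supersmooth_restrict[OF Mc V sm_s D1o _ openin_nonzero]) (use supersmooth_fbody[OF Mc sm_s] in auto)
    have a: "supersmooth ?M ?D1 sfield UNIV (\<lambda>n y I. \<beta> (s n (?i n y) I))"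
      by (rule supersmooth_compose[OF Mc V s1 supersmooth_functional[OF V \<beta>(1) openin_nonzero]]) auto
    define r where "r = (\<lambda>n y. gmult (\<lambda>I. \<beta> (s n (?i n y) I)) (ginv n (\<lambda>I. \<beta> (t n (?i n y) I))))"
    have r: "supersmooth ?M ?D1 sfield UNIV r"
      using supersmooth_gsmult[OF Mc vector_superspace_sfield a supersmooth_ginv_comp[OF Mc b]] unfolding r_def by simp
    let ?X = "ssum ?M W" and ?E = "?D1 \<times> nonzero W"
    note X = vector_superspace_ssum[OF Mc W]
    have Eo: "openin (top_of_set (ev ?X)) ?E" using openin_Times[OF D1o openin_nonzero] by simp
    have p1: "supersmooth ?X ?E ?M ?D1 (\<lambda>n z I. fst (z I))"
      by (rule supersmooth_linear[OF X Mc linear_fst[OF Mc W] _ _ Eo D1o]) auto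
    have p2: "supersmooth ?X ?E W (nonzero W) (\<lambda>n z I. snd (z I))"
      by (rule supersmooth_linear[OF X W linear_snd[OF Mc W] _ _ Eo openin_nonzero]) auto
    have q1: "supersmooth ?X ?E (cmodel d) (cimg d) (\<lambda>n z. cmap d n (?i n (\<lambda>I. fst (z I))))"
      by (rule supersmooth_compose[OF X Mc p1 supersmooth_restrict[OF Mc Md premfdD(4)[OF premfd_PV c d] D1o _ chart_open[OF PF dc]]])
        (use supersmooth_fbody[OF Mc premfdD(4)[OF premfd_PV c d]] in auto)
    have q2: "supersmooth ?X ?E W (ev W) (\<lambda>n z. gsmult (scl W) (r n (\<lambda>I. fst (z I))) (\<lambda>I. snd (z I)))"
      by (rule supersmooth_gsmult[OF X W supersmooth_compose[OF X Mc p1 r] p2])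
    let ?G = "\<lambda>n z. gpair (cmap d n (?i n (\<lambda>I. fst (z I)))) (gsmult (scl W) (r n (\<lambda>I. fst (z I))) (\<lambda>I. snd (z I)))"
    \<comment> \<open>Products are known to be supersmooth into all of W; that the values avoid 0 is
      seen in \<open>key\<close>, where the factor is identified as a unit.\<close>
    have G: "supersmooth ?X ?E (ssum (cmodel d) W) (cimg d \<times> ev W) ?G"
      by (rule supersmooth_pair[OF X Md W q1 q2])
    have key: "\<kappa>' n (cinv TT (tchart c \<kappa>) n z) = ?G n z \<and> ?G n z \<in> dpts (ssum (cmodel d) W) (cimg d \<times> nonzero W) n"
      if z: "z \<in> dpts ?X ?E n" for n z
    proof -
      obtain y w where yw: "z = gpair y w" "y \<in> dpts ?M ?D1 n" "w \<in> dpts W (nonzero W) n" using dpts_ssum_E[OF z] .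
      have y: "y \<in> dpts ?M ?Y n" by (rule dpts_mono[OF _ yw(2)]) auto
      let ?L = "?i n y"
      have pd: "(?L, gtensor V W (s n ?L) w) \<in> rpts TT (tdom (cdom c)) n"
        by (rule tdom_frame_I[OF c s L(1)[OF y] yw(3)])
      have "cmap (tchart c \<kappa>) n (?L, gtensor V W (s n ?L) w) = z"
        using framed_mapD[OF \<kappa> L(1)[OF y] dpts_spts[OF yw(3)]] cmap_cinv[OF PF cc Int_lower1 y] by (simp add: yw(1))
      then have inv: "cinv TT (tchart c \<kappa>) n z = (?L, gtensor V W (s n ?L) w)"
        using cinv_cmap[OF functor_TT tc, of "(?L, gtensor V W (s n ?L) w)" n] pd by simp
      have "proj_class V n (t n ?L) = proj_class V n (s n ?L)"
        using frame_class[OF c s L(1)[OF y]] frame_class[OF d t L(2)[OF y]] by simp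
      then obtain u where u: "u \<in> Grass_units n" "s n ?L = gsmult (scl V) u (t n ?L)"
        using frame_dpts[OF c s L(1)[OF y]] by (rule proj_class_eq_E)
      have bu: "(\<lambda>I. \<beta> (t n ?L I)) \<in> Grass_units n" using supersmoothD(3)[OF b yw(2)] by (simp add: Grass_units_eq)
      have "(\<lambda>I. \<beta> (s n ?L I)) = gmult u (\<lambda>I. \<beta> (t n ?L I))"
        unfolding u(2) by (rule even_functional_gsmult[OF \<beta>(1)])
      then have ru: "r n y = u"
        using Grass_even_gsupported[OF Grass_units_even[OF u(1)]] unfolding r_def by (simp add: gmult_assoc gmult_ginv[OF bu])
      have "gtensor V W (s n ?L) w = gtensor V W (t n ?L) (gsmult (scl W) u w)"
        unfolding u(2) by (rule gtensor_gsmult[OF Grass_units_even[OF u(1)]])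
      then have v: "\<kappa>' n (cinv TT (tchart c \<kappa>) n z) = gpair (cmap d n ?L) (gsmult (scl W) u w)"
        using framed_mapD[OF \<kappa>' L(2)[OF y] gsmult_spts[OF W Grass_units_even[OF u(1)] dpts_spts[OF yw(3)]]]
        unfolding inv by simp
      have g: "?G n z = gpair (cmap d n ?L) (gsmult (scl W) u w)" by (simp add: yw(1) ru)
      show ?thesis unfolding v g gpair_dpts_iff
        by (intro conjI refl chart_in[OF PF dc L(2)[OF y]] gsmult_nonzero[OF W u(1) yw(3)])
    qed
    have "supersmooth ?X ?E (ssum (cmodel d) W) (cimg d \<times> nonzero W) ?G"
      by (rule supersmooth_into[OF G refl o2 conjunct2[OF key]])
    moreover have "z0 \<in> ?E" using z0 \<beta>(2) \<open>?ft (fst z0) \<in> nonzero V\<close> by auto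
    ultimately show "\<exists>D1 g. z0 \<in> D1 \<and> D1 \<subseteq> ?D \<and> supersmooth ?X D1 (ssum (cmodel d) W) (cimg d \<times> nonzero W) g \<and>
        (\<forall>n. \<forall>x\<in>dpts ?X D1 n. \<kappa>' n (cinv TT (tchart c \<kappa>) n x) = g n x)"
      by (intro exI[of _ ?E] exI[of _ ?G] conjI allI ballI) (auto intro: conjunct1[OF key])
  qed
qed

subsection \<open>Standard frames\<close>

text \<open>The generator of the line on which \<alpha> is 1; adding e undoes the translation in the
  chart.\<close>

definition std_frame :: "('v \<Rightarrow> 'k) \<Rightarrow> 'v \<Rightarrow> nat \<Rightarrow> 'v gr set \<Rightarrow> 'v gr" where
  "std_frame \<alpha> e n L = (\<lambda>I. gconst e I + cmap (proj_chart V \<alpha> e) n L I)"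

text \<open>The second coordinate is the only w for which the tensor is the frame times w; its
  uniqueness is the cancellation law \<open>gtensor_inj\<close>.\<close>

definition taut_chart :: "('v \<Rightarrow> 'k) \<Rightarrow> 'v \<Rightarrow> ('k, 'v gr set \<times> ('k, 'v, 'w) tensor gr, 'v \<times> 'w) chart" where
  "taut_chart \<alpha> e = tchart (proj_chart V \<alpha> e) (\<lambda>n p. gpair (cmap (proj_chart V \<alpha> e) n (fst p))
     (THE w. w \<in> spts W n \<and> snd p = gtensor V W (std_frame \<alpha> e n (fst p)) w))"

context
  fixes \<alpha> e
  assumes ae: "(\<alpha>, e) \<in> unit_functionals V"
begin

lemma std_frame_class:
  assumes "x \<in> dpts V (nonzero V) n" "\<alpha> (x {}) \<noteq> 0"
  shows "std_frame \<alpha> e n (proj_class V n x) = gsmult (scl V) (ginv n (\<lambda>I. \<alpha> (x I))) x"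
  unfolding std_frame_def proj_chart_map[OF V ae assms] by (auto simp: gconst_def)

lemma unit_functional_units: "x \<in> dpts V (nonzero V) n \<Longrightarrow> \<alpha> (x {}) \<noteq> 0 \<Longrightarrow> (\<lambda>I. \<alpha> (x I)) \<in> Grass_units n"
  by (rule even_functional_units[OF P.A(1)[OF ae] dpts_spts])

text \<open>In the coordinates of the chart the frame is the affine map y \<mapsto> e + y, and on a
  representative x it is x divided by the unit \<alpha>(x), hence an even multiple of x.\<close>

lemma taut_frame_std: "taut_frame V (proj_chart V \<alpha> e) (std_frame \<alpha> e)"
  unfolding taut_frame_def
proof (intro conjI allI ballI)
  let ?c = "proj_chart V \<alpha> e"
  note PF = premfdD(1)[OF premfd_PV] and cc = M_chart[OF premfd_PV proj_chart_charts[OF V ae]]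
  note M = chart_model[OF PF cc] and co = chart_open[OF PF cc]
  show "std_frame \<alpha> e n L \<in> taut_fiber V n L" if "L \<in> rpts PV (cdom ?c) n" for n L
  proof (rule proj_chart_rpts_E[OF V ae that])
    fix x assume x: "x \<in> dpts V (nonzero V) n" "\<alpha> (x {}) \<noteq> 0" "L = proj_class V n x"
    show ?thesis unfolding x(3) std_frame_class[OF x(1,2)]
      by (rule taut_fiberI[OF ginv_even[OF unit_functional_units[OF x(1,2)]] x(1)])
  qed
  have i: "supersmooth (cmodel ?c) (cimg ?c) V (ev V) (\<lambda>n y. y)"
    by (rule supersmooth_inclusion[OF M V _ _ _ co openin_subtopology_self])
      (auto simp: proj_chart_model[OF V ae] proj_chart_img[OF V ae])
  have "supersmooth (cmodel ?c) (cimg ?c) V (ev V) (\<lambda>n y I. gconst e I + y I)"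
    by (rule supersmooth_add[OF M V supersmooth_const[OF M V co openin_subtopology_self P.A(2)[OF ae]] i])
  then have "supersmooth (cmodel ?c) (cimg ?c) V (nonzero V) (\<lambda>n y I. gconst e I + y I)"
    by (rule supersmooth_into[OF _ refl openin_nonzero proj_chart_cinv(1)[OF V ae]])
  then show "supersmooth (cmodel ?c) (cimg ?c) V (nonzero V) (\<lambda>n y. std_frame \<alpha> e n (cinv PV ?c n y))"
    by (rule supersmooth_cong[OF M]) (simp add: std_frame_def cmap_cinv_in[OF PF cc])
qed

lemma framed_taut_chart: "framed_map (proj_chart V \<alpha> e) (std_frame \<alpha> e) (cmap (taut_chart \<alpha> e))"
  unfolding framed_map_def
proof (intro allI ballI)
  fix n L w assume L: "L \<in> rpts PV (cdom (proj_chart V \<alpha> e)) n" and w: "w \<in> spts W n"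
  have "(THE w'. w' \<in> spts W n \<and> gtensor V W (std_frame \<alpha> e n L) w = gtensor V W (std_frame \<alpha> e n L) w') = w"
  proof (rule the_equality)
    fix w' assume w': "w' \<in> spts W n \<and> gtensor V W (std_frame \<alpha> e n L) w = gtensor V W (std_frame \<alpha> e n L) w'"
    show "w' = w"
      by (rule gtensor_inj[OF V W frame_dpts[OF proj_chart_charts[OF V ae] taut_frame_std L] w conjunct1[OF w'] conjunct2[OF w'], symmetric])
  qed (intro conjI w refl)
  then show "cmap (taut_chart \<alpha> e) n (L, gtensor V W (std_frame \<alpha> e n L) w) = gpair (cmap (proj_chart V \<alpha> e) n L) w"
    by (simp add: taut_chart_def)
qed

lemma taut_chart_simps:
  "cdom (taut_chart \<alpha> e) = tdom (cdom (proj_chart V \<alpha> e))" "cmodel (taut_chart \<alpha> e) = ssum (cmodel (proj_chart V \<alpha> e)) W"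
  "cimg (taut_chart \<alpha> e) = cimg (proj_chart V \<alpha> e) \<times> nonzero W"
  by (simp_all add: taut_chart_def)

lemma taut_chart_charts: "taut_chart \<alpha> e \<in> charts TT"
  using charts_TT_I[OF proj_chart_charts[OF V ae] taut_frame_std framed_taut_chart] by (simp add: taut_chart_def)

lemma taut_chart_dom:
  assumes "x \<in> dpts V (nonzero V) 0" "y \<in> dpts W (nonzero W) 0"
  shows "tpt 0 x y \<in> cdom (taut_chart \<alpha> e) \<longleftrightarrow> \<alpha> (x {}) \<noteq> 0"
  unfolding taut_chart_simps using TT_I[OF assms] proj_chart_dom[OF V ae assms(1)] by (simp add: tdom_def) (simp add: tpt_def)

lemma proj_class_rpts:
  assumes x: "x \<in> dpts V (nonzero V) n" "\<alpha> (x {}) \<noteq> 0"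
  shows "proj_class V n x \<in> rpts PV (cdom (proj_chart V \<alpha> e)) n"
proof (rule rptsI[OF pts_proj[OF V x(1)]])
  show "act PV n 0 gaug (proj_class V n x) \<in> cdom (proj_chart V \<alpha> e)"
    unfolding act_proj[OF V gaug_hom x(1)] proj_chart_dom[OF V ae gpush_dpts[OF gaug_hom V x(1)]]
    using x(2) by (simp add: gpush_gaug vector_superspaceD V)
qed

text \<open>x is \<alpha>(x) times the standard frame, and this factor moves to y. The outcome
  coincides with the slice coordinates of [x\<parallel>y].\<close>

lemma taut_chart_map:
  assumes x: "x \<in> dpts V (nonzero V) n" "\<alpha> (x {}) \<noteq> 0" and y: "y \<in> dpts W (nonzero W) n"
  shows "cmap (taut_chart \<alpha> e) n (tpt n x y) =
    gpair (cmap (proj_chart V \<alpha> e) n (proj_class V n x)) (gsmult (scl W) (\<lambda>I. \<alpha> (x I)) y)"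
proof -
  let ?u = "\<lambda>I. \<alpha> (x I)"
  note u = unit_functional_units[OF x]
  note Vs = vector_superspaceD(1)[OF V]
  have "x = gsmult (scl V) ?u (gsmult (scl V) (ginv n ?u) x)"
    by (simp add: gsmult_assoc[OF Vs, symmetric] gmult_ginv[OF u] gsmult_one[OF Vs spts_gsupported[OF dpts_spts[OF x(1)]]])
  then have "gtensor V W x y = gtensor V W (std_frame \<alpha> e n (proj_class V n x)) (gsmult (scl W) ?u y)"
    using gtensor_gsmult[OF Grass_units_even[OF u], of V W "gsmult (scl V) (ginv n ?u) x" y]
    by (simp add: std_frame_class[OF x])
  then show ?thesis
    using framed_mapD[OF framed_taut_chart proj_class_rpts[OF x] gsmult_spts[OF W Grass_units_even[OF u] dpts_spts[OF y]]]
    by (simp add: tpt_def)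
qed

end

end

section \<open>The bundle (E_V \<otimes> W)_0 over P(V)\<close>

context
  fixes V :: "('k::{real_normed_field, euclidean_space}, 'v::euclidean_space) sspace"
    and W :: "('k, 'w::euclidean_space) sspace"
  assumes V: "vector_superspace V" and W: "vector_superspace W"
begin

interpretation P: slice_quotient V "nonzero V" "proj_action V" "unit_functionals V"
  by (rule slice_quotient_proj[OF V])

interpretation Q: slice_quotient "ssum V W" "nonzero V \<times> nonzero W" "wproj_action V W" "wfunctional ` unit_functionals V"
  by (rule slice_quotient_wproj[OF V W])

lemmas [simp] = tchart_simps[OF V W]

lemma premfd_TT: "premfd (taut_tensor_nonzero V W)"
proof (rule premfdI[OF functor_TT[OF V W]])
  show "is_chart (taut_tensor_nonzero V W) C" if "C \<in> charts (taut_tensor_nonzero V W)" for C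
    by (rule charts_TT_E[OF V W that]) (simp only: is_chart_tchart[OF V W])
  show "\<exists>c\<in>charts (taut_tensor_nonzero V W). p \<in> cdom c" if "p \<in> pts (taut_tensor_nonzero V W) 0" for p
  proof -
    obtain x y where xy: "x \<in> dpts V (nonzero V) 0" "y \<in> dpts W (nonzero W) 0" "p = tpt V W 0 x y"
      by (rule TT_E[OF V W \<open>p \<in> pts (taut_tensor_nonzero V W) 0\<close>])
    have x0: "x {} \<in> nonzero V" using xy(1) by (simp add: dpts_def)
    from unit_functionals_common[OF V x0 x0] obtain \<alpha> e where ae: "(\<alpha>, e) \<in> unit_functionals V" "\<alpha> (x {}) \<noteq> 0" by blast
    show ?thesis
      by (rule bexI[OF _ taut_chart_charts[OF V W ae(1)]]) (simp add: xy(3) taut_chart_dom[OF V W ae(1) xy(1,2)] ae(2))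
  qed
  fix C D assume "C \<in> charts (taut_tensor_nonzero V W)" "D \<in> charts (taut_tensor_nonzero V W)"
  obtain c s \<kappa> where C: "c \<in> charts (proj_space V)" "taut_frame V c s" "framed_map V W c s \<kappa>" "C = tchart V W c \<kappa>"
    using charts_TT_E[OF V W \<open>C \<in> charts (taut_tensor_nonzero V W)\<close>] .
  obtain d t \<kappa>' where D: "d \<in> charts (proj_space V)" "taut_frame V d t" "framed_map V W d t \<kappa>'" "D = tchart V W d \<kappa>'"
    using charts_TT_E[OF V W \<open>D \<in> charts (taut_tensor_nonzero V W)\<close>] .
  have "cdom C \<inter> cdom D = tdom V W (cdom c \<inter> cdom d)"
    unfolding C(4) D(4) by (auto simp: tdom_def[OF V W])
  then have "cbody C (cdom C \<inter> cdom D) = cbody c (cdom c \<inter> cdom d) \<times> nonzero W"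
    using cbody_tdom[OF V W C(1-3) Int_lower1, of "cdom d"] by (simp add: cbody_def C(4))
  then show "supersmooth (cmodel C) (cbody C (cdom C \<inter> cdom D)) (cmodel D) (cimg D) (\<lambda>n y. cmap D n (cinv (taut_tensor_nonzero V W) C n y))"
    using TT_transition[OF V W C(1-3) D(1-3)] by (simp add: C(4) D(4))
qed

lemma supermanifold_TT: "supermanifold (taut_tensor_nonzero V W)"
proof -
  obtain A' where A': "A' \<subseteq> unit_functionals V" "countable A'" "\<And>v. v \<in> nonzero V \<Longrightarrow> \<exists>(\<alpha>, e)\<in>A'. \<alpha> v \<noteq> 0"
    using P.countable_slices by blast
  let ?C = "(\<lambda>(\<alpha>, e). taut_chart V W \<alpha> e) ` A'"
  have dom: "p \<in> cdom (taut_chart V W \<alpha> e)"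
    if "(\<alpha>, e) \<in> unit_functionals V" "x \<in> dpts V (nonzero V) 0" "y \<in> dpts W (nonzero W) 0" "p = tpt V W 0 x y" "\<alpha> (x {}) \<noteq> 0"
    for \<alpha> e p x y using that taut_chart_dom[OF V W that(1-3)] by simp
  show ?thesis
  proof (rule supermanifoldI[OF premfd_TT])
    show "countable ?C" using A'(2) by simp
    show "?C \<subseteq> charts (taut_tensor_nonzero V W)" using A'(1) taut_chart_charts[OF V W] by auto
    show "pts (taut_tensor_nonzero V W) 0 \<subseteq> \<Union> (cdom ` ?C)"
    proof
      fix p assume p: "p \<in> pts (taut_tensor_nonzero V W) 0"
      obtain x y where xy: "x \<in> dpts V (nonzero V) 0" "y \<in> dpts W (nonzero W) 0" "p = tpt V W 0 x y" using TT_E[OF V W p] .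
      then have "x {} \<in> nonzero V" by (simp add: dpts_def)
      from A'(3)[OF this] obtain \<alpha> e where ae: "(\<alpha>, e) \<in> A'" "\<alpha> (x {}) \<noteq> 0" by blast
      then have "p \<in> cdom (taut_chart V W \<alpha> e)" using dom[of \<alpha> e, OF _ xy ae(2)] A'(1) by blast
      then show "p \<in> \<Union> (cdom ` ?C)" using ae(1) by force
    qed
    fix p p' assume p: "p \<in> pts (taut_tensor_nonzero V W) 0" and p': "p' \<in> pts (taut_tensor_nonzero V W) 0"
    obtain x y where xy: "x \<in> dpts V (nonzero V) 0" "y \<in> dpts W (nonzero W) 0" "p = tpt V W 0 x y" using TT_E[OF V W p] .
    obtain x' y' where xy': "x' \<in> dpts V (nonzero V) 0" "y' \<in> dpts W (nonzero W) 0" "p' = tpt V W 0 x' y'" using TT_E[OF V W p'] .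
    have "x {} \<in> nonzero V" "x' {} \<in> nonzero V" using xy(1) xy'(1) by (simp_all add: dpts_def)
    from unit_functionals_common[OF V this] obtain \<alpha> e where ae: "(\<alpha>, e) \<in> unit_functionals V" "\<alpha> (x {}) \<noteq> 0" "\<alpha> (x' {}) \<noteq> 0" by blast
    show "\<exists>c\<in>charts (taut_tensor_nonzero V W). p \<in> cdom c \<and> p' \<in> cdom c"
      by (intro bexI[OF _ taut_chart_charts[OF V W ae(1)]] conjI dom[OF ae(1) xy ae(2)] dom[OF ae(1) xy' ae(3)])
  qed
qed

lemma taut_chart_rpts_E:
  assumes ae: "(\<alpha>, e) \<in> unit_functionals V" and p: "p \<in> rpts (taut_tensor_nonzero V W) (cdom (taut_chart V W \<alpha> e)) n"
  obtains x y where "x \<in> dpts V (nonzero V) n" "\<alpha> (x {}) \<noteq> 0" "y \<in> dpts W (nonzero W) n" "p = tpt V W n x y"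
proof -
  obtain x y where xy: "x \<in> dpts V (nonzero V) n" "y \<in> dpts W (nonzero W) n" "p = tpt V W n x y" using TT_E[OF V W rpts_pts[OF p]] .
  have "tpt V W 0 (gpush (scl V) n gaug x) (gpush (scl W) n gaug y) \<in> cdom (taut_chart V W \<alpha> e)"
    using rpts_body[OF p] unfolding xy(3) act_tpt[OF V W gaug_hom xy(1,2)] .
  then have "\<alpha> (gpush (scl V) n gaug x {}) \<noteq> 0"
    using taut_chart_dom[OF V W ae gpush_dpts[OF gaug_hom V xy(1)] gpush_dpts[OF gaug_hom W xy(2)]] by blast
  then show thesis using that xy by (simp add: gpush_gaug vector_superspaceD V)
qed

lemma fst_tpt: "fst (tpt V W n x y) = proj_class V n x"
  by (simp add: tpt_def[OF V W])

lemma fiber_bundle_taut: "fiber_bundle (taut_tensor_nonzero V W) (proj_space V) (domain_mfd W (nonzero W)) (\<lambda>n. fst)"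
proof (rule fiber_bundle_charts[OF supermanifold_TT supermanifold_proj[OF V] W openin_nonzero])
  show "fst p \<in> pts (proj_space V) n" if "p \<in> pts (taut_tensor_nonzero V W) n" for n p by (rule fst_TT[OF V W that])
  show "fst (act (taut_tensor_nonzero V W) m n \<rho> p) = act (proj_space V) m n \<rho> (fst p)" if "Grass_hom m n \<rho>" "p \<in> pts (taut_tensor_nonzero V W) m" for m n \<rho> p
    by (rule fst_act_TT[OF V W that])
  fix b assume "b \<in> pts (proj_space V) 0"
  then obtain x where x: "x \<in> dpts V (nonzero V) 0" "b = proj_class V 0 x" by (rule proj_E[OF V])
  then have "x {} \<in> nonzero V" by (simp add: dpts_def)
  from unit_functionals_common[OF V this this] obtain \<alpha> e where ae: "(\<alpha>, e) \<in> unit_functionals V" "\<alpha> (x {}) \<noteq> 0" by blast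
  have "(\<lambda>I. fst (cmap (taut_chart V W \<alpha> e) n p I)) = cmap (proj_chart V \<alpha> e) n (fst p)"
    if p: "p \<in> rpts (taut_tensor_nonzero V W) (cdom (taut_chart V W \<alpha> e)) n" for n p
    by (rule taut_chart_rpts_E[OF ae(1) p]) (simp add: taut_chart_map[OF V W ae(1)] fst_tpt)
  then show "\<exists>cb\<in>charts (proj_space V). \<exists>ce\<in>charts (taut_tensor_nonzero V W). b \<in> cdom cb \<and>
      cdom ce = {x \<in> pts (taut_tensor_nonzero V W) 0. fst x \<in> cdom cb} \<and> cmodel ce = ssum (cmodel cb) W \<and> cimg ce = cimg cb \<times> nonzero W \<and>
      (\<forall>n. \<forall>x\<in>rpts (taut_tensor_nonzero V W) (cdom ce) n. (\<lambda>I. fst (cmap ce n x I)) = cmap cb n (fst x))"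
    using x(2) proj_chart_dom[OF V ae(1) x(1)] ae(2)
    by (intro bexI[OF _ proj_chart_charts[OF V ae(1)]] bexI[OF _ taut_chart_charts[OF V W ae(1)]])
      (simp add: taut_chart_simps[OF V W ae(1)] tdom_def[OF V W])
qed

section \<open>The isomorphism\<close>

definition wproj_tensor :: "nat \<Rightarrow> ('v \<times> 'w) gr set \<Rightarrow> 'v gr set \<times> ('k, 'v, 'w) tensor gr" where
  "wproj_tensor n C = (wproj_fst V n C, gtensor V W (\<lambda>I. fst ((SOME z. z \<in> C) I)) (\<lambda>I. snd ((SOME z. z \<in> C) I)))"

text \<open>The chosen representative is (a x, a^(-1) y) for some unit a, which cancels against its
  inverse across the tensor sign.\<close>

lemma wproj_tensor_class:
  assumes x: "x \<in> dpts V (nonzero V) n" and y: "y \<in> dpts W (nonzero W) n"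
  shows "wproj_tensor n (wproj_class V W n x y) = tpt V W n x y"
proof -
  note Ws = vector_superspaceD(1)[OF W]
  let ?C = "wproj_class V W n x y"
  have xy: "gpair x y \<in> dpts (ssum V W) (nonzero V \<times> nonzero W) n" using x y by (simp add: gpair_dpts_iff)
  have "(SOME z. z \<in> ?C) \<in> ?C" unfolding wproj_class_def by (rule someI[of "\<lambda>z. z \<in> _", OF Q.cl_self[OF xy]])
  then obtain a where a: "a \<in> Grass_units n" "(SOME z. z \<in> ?C) = wproj_action V W n a (gpair x y)"
    unfolding wproj_class_def by (rule Q.cl_E)
  have "gtensor V W (gsmult (scl V) a x) (gsmult (scl W) (ginv n a) y) = gtensor V W x y"
    using gsmult_one[OF Ws spts_gsupported[OF dpts_spts[OF y]]]
    by (simp add: gtensor_gsmult[OF Grass_units_even[OF a(1)]] gsmult_assoc[OF Ws, symmetric] gmult_ginv[OF a(1)])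
  then show ?thesis
    unfolding wproj_tensor_def wproj_fst_class[OF V W x y] tpt_def[OF V W] a(2) wproj_action_gpair by simp
qed

text \<open>Equality of the lines gives x' = a x with a unit a. Moving a to the second factor and
  cancelling x leaves y = a y', so that (x', y') is obtained from (x, y) by the action of a.\<close>

lemma tpt_eq:
  assumes x: "x \<in> dpts V (nonzero V) n" and y: "y \<in> dpts W (nonzero W) n"
    and x': "x' \<in> dpts V (nonzero V) n" and y': "y' \<in> dpts W (nonzero W) n"
    and eq: "tpt V W n x y = tpt V W n x' y'"
  shows "wproj_class V W n x y = wproj_class V W n x' y'"
proof -
  note Ws = vector_superspaceD(1)[OF W]
  have cl: "proj_class V n x = proj_class V n x'" and gt: "gtensor V W x y = gtensor V W x' y'"
    using eq by (simp_all add: tpt_def[OF V W])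
  obtain a where a: "a \<in> Grass_units n" "x' = gsmult (scl V) a x" using proj_class_eq_E[OF V W cl x'] .
  have "gtensor V W x y = gtensor V W x (gsmult (scl W) a y')"
    unfolding gt a(2) by (rule gtensor_gsmult[OF Grass_units_even[OF a(1)]])
  then have y: "y = gsmult (scl W) a y'"
    by (rule gtensor_inj[OF V W x dpts_spts[OF y] dpts_spts[OF gsmult_nonzero[OF W a(1) y']]])
  have "y' = gsmult (scl W) (ginv n a) y" using gsmult_one[OF Ws spts_gsupported[OF dpts_spts[OF y']]]
    by (simp add: y gsmult_assoc[OF Ws, symmetric] ginv_gmult[OF a(1)])
  then have "gpair x' y' = wproj_action V W n a (gpair x y)" by (simp add: wproj_action_gpair a(2))
  then show ?thesis using Q.cl_act[OF a(1), of "gpair x y"] x \<open>y \<in> dpts W (nonzero W) n\<close>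
    by (simp add: wproj_class_def gpair_dpts_iff)
qed

lemma bij_wproj_tensor: "bij_betw (wproj_tensor n) (pts (wproj_space V W) n) (pts (taut_tensor_nonzero V W) n)"
proof (rule bij_betwI')
  fix C C' assume C: "C \<in> pts (wproj_space V W) n" and C': "C' \<in> pts (wproj_space V W) n"
  obtain x y where xy: "x \<in> dpts V (nonzero V) n" "y \<in> dpts W (nonzero W) n" "C = wproj_class V W n x y" using wproj_E[OF V W C] .
  obtain x' y' where xy': "x' \<in> dpts V (nonzero V) n" "y' \<in> dpts W (nonzero W) n" "C' = wproj_class V W n x' y'" using wproj_E[OF V W C'] .
  show "wproj_tensor n C = wproj_tensor n C' \<longleftrightarrow> C = C'"
  proof
    assume "wproj_tensor n C = wproj_tensor n C'"
    then show "C = C'" unfolding xy(3) xy'(3) wproj_tensor_class[OF xy(1,2)] wproj_tensor_class[OF xy'(1,2)]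
      by (rule tpt_eq[OF xy(1,2) xy'(1,2)])
  qed simp
  show "wproj_tensor n C \<in> pts (taut_tensor_nonzero V W) n" unfolding xy(3) wproj_tensor_class[OF xy(1,2)] by (rule TT_I[OF V W xy(1,2)])
next
  fix p assume p: "p \<in> pts (taut_tensor_nonzero V W) n"
  obtain x y where xy: "x \<in> dpts V (nonzero V) n" "y \<in> dpts W (nonzero W) n" "p = tpt V W n x y" using TT_E[OF V W p] .
  then show "\<exists>C\<in>pts (wproj_space V W) n. p = wproj_tensor n C"
    by (intro bexI[OF _ pts_wproj[OF V W xy(1,2)]]) (simp add: wproj_tensor_class)
qed

lemma bundle_isomorphic_wproj_taut: "bundle_isomorphic (wproj_space V W) (wproj_fst V) (taut_tensor_nonzero V W) (\<lambda>n. fst)"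
proof (rule bundle_isomorphic_charts[OF _ premfd_TT bij_wproj_tensor])
  show "premfd (wproj_space V W)" using supermanifold_wproj[OF V W] by (simp add: supermanifold_iff)
  show "wproj_tensor n (act (wproj_space V W) m n \<rho> C) = act (taut_tensor_nonzero V W) m n \<rho> (wproj_tensor m C)"
    if \<rho>: "Grass_hom m n \<rho>" and C: "C \<in> pts (wproj_space V W) m" for m n \<rho> C
  proof (rule wproj_E[OF V W C])
    fix x y assume xy: "x \<in> dpts V (nonzero V) m" "y \<in> dpts W (nonzero W) m" "C = wproj_class V W m x y"
    show ?thesis unfolding xy(3) act_wproj[OF V W \<rho> xy(1,2)] wproj_tensor_class[OF xy(1,2)] act_tpt[OF V W \<rho> xy(1,2)]
      by (rule wproj_tensor_class[OF gpush_dpts[OF \<rho> V xy(1)] gpush_dpts[OF \<rho> W xy(2)]])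
  qed
  show "fst (wproj_tensor n C) = wproj_fst V n C" for n C by (simp add: wproj_tensor_def)
  fix C assume C: "C \<in> pts (wproj_space V W) 0"
  obtain x y where xy: "x \<in> dpts V (nonzero V) 0" "y \<in> dpts W (nonzero W) 0" "C = wproj_class V W 0 x y" using wproj_E[OF V W C] .
  then have "x {} \<in> nonzero V" by (simp add: dpts_def)
  from unit_functionals_common[OF V this this] obtain \<alpha> e where ae: "(\<alpha>, e) \<in> unit_functionals V" "\<alpha> (x {}) \<noteq> 0" by blast
  let ?c = "wproj_chart V W \<alpha> e" and ?d = "taut_chart V W \<alpha> e"
  have 1: "C \<in> cdom ?c" unfolding xy(3) using wproj_chart_dom[OF V W ae(1) xy(1,2)] ae(2) by simp
  have 2: "cdom ?d = wproj_tensor 0 ` cdom ?c"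
  proof (intro equalityI subsetI)
    fix p assume "p \<in> cdom ?d"
    then have p: "p \<in> pts (taut_tensor_nonzero V W) 0" "fst p \<in> cdom (proj_chart V \<alpha> e)"
      by (simp_all add: taut_chart_simps[OF V W ae(1)] tdom_def[OF V W])
    then obtain C' where C': "C' \<in> pts (wproj_space V W) 0" "p = wproj_tensor 0 C'"
      using bij_betw_imp_surj_on[OF bij_wproj_tensor[of 0]] by blast
    then have "C' \<in> cdom ?c" unfolding wproj_chart_cdom[OF V W ae(1)] using p(2) by (simp add: wproj_tensor_def)
    then show "p \<in> wproj_tensor 0 ` cdom ?c" using C'(2) by (rule rev_image_eqI)
  next
    fix p assume "p \<in> wproj_tensor 0 ` cdom ?c"
    then obtain C' where "C' \<in> pts (wproj_space V W) 0" "wproj_fst V 0 C' \<in> cdom (proj_chart V \<alpha> e)" "p = wproj_tensor 0 C'"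
      unfolding wproj_chart_cdom[OF V W ae(1)] by blast
    then show "p \<in> cdom ?d" using bij_betwE[OF bij_wproj_tensor[of 0]]
      by (simp add: taut_chart_simps[OF V W ae(1)] tdom_def[OF V W]) (simp add: wproj_tensor_def)
  qed
  have 3: "cmap ?d n (wproj_tensor n C') = cmap ?c n C'" if C': "C' \<in> rpts (wproj_space V W) (cdom ?c) n" for n C'
  proof (rule wproj_chart_rpts_E[OF V W ae(1) C'])
    fix x y assume xy: "x \<in> dpts V (nonzero V) n" "\<alpha> (x {}) \<noteq> 0" "y \<in> dpts W (nonzero W) n" "C' = wproj_class V W n x y"
    show ?thesis unfolding xy(4) wproj_tensor_class[OF xy(1,3)] wproj_chart_map[OF V W ae(1) xy(1-3)]
      by (rule taut_chart_map[OF V W ae(1) xy(1-3)])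
  qed
  show "\<exists>c\<in>charts (wproj_space V W). \<exists>d\<in>charts (taut_tensor_nonzero V W). C \<in> cdom c \<and> cdom d = wproj_tensor 0 ` cdom c \<and>
      cmodel d = cmodel c \<and> cimg d = cimg c \<and>
      (\<forall>n. \<forall>x\<in>rpts (wproj_space V W) (cdom c) n. cmap d n (wproj_tensor n x) = cmap c n x)"
    by (intro bexI[OF _ wproj_chart_charts[OF V W ae(1)]] bexI[OF _ taut_chart_charts[OF V W ae(1)]] conjI allI ballI 1 2 3)
      (simp_all add: taut_chart_simps[OF V W ae(1)] wproj_chart_model[OF V W ae(1)] wproj_chart_img[OF V W ae(1)])
qed

end

theorem theorem1:
  fixes V :: "('k::{real_normed_field, euclidean_space}, 'v::euclidean_space) sspace"
    and W :: "('k, 'w::euclidean_space) sspace"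
  assumes "vector_superspace V" and "vector_superspace W"
  shows "\<exists>(\<pi>\<^sub>V :: nat \<Rightarrow> ('v \<times> 'w) gr set \<Rightarrow> 'v gr set)
          (\<pi>\<^sub>W :: nat \<Rightarrow> ('v \<times> 'w) gr set \<Rightarrow> 'w gr set).
     (\<forall>n. \<forall>v\<in>dpts V (nonzero V) n. \<forall>w\<in>dpts W (nonzero W) n.
        \<pi>\<^sub>V n (wproj_class V W n v w) = proj_class V n v \<and>
        \<pi>\<^sub>W n (wproj_class V W n v w) = proj_class W n w) \<and>
     fiber_bundle (wproj_space V W) (proj_space V) (domain_mfd W (nonzero W)) \<pi>\<^sub>V \<and>
     fiber_bundle (wproj_space V W) (proj_space W) (domain_mfd V (nonzero V)) \<pi>\<^sub>W \<and>
     fiber_bundle (taut_tensor_nonzero V W) (proj_space V) (domain_mfd W (nonzero W)) (\<lambda>n. fst) \<and>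
     fiber_bundle (taut_tensor_nonzero W V) (proj_space W) (domain_mfd V (nonzero V)) (\<lambda>n. fst) \<and>
     bundle_isomorphic (wproj_space V W) \<pi>\<^sub>V (taut_tensor_nonzero V W) (\<lambda>n. fst) \<and>
     bundle_isomorphic (wproj_space V W) \<pi>\<^sub>W (taut_tensor_nonzero W V) (\<lambda>n. fst)"
proof -
  \<comment> \<open>The projection to P(W) is the first projection of the space with V and W
    exchanged, preceded by the exchange.\<close>
  let ?\<pi> = "\<lambda>n C. wproj_fst W n (swap_class n C) :: 'w gr set"
  note V = assms(1) and W = assms(2)
  note E = supermanifold_wproj[OF V W] and E' = supermanifold_wproj[OF W V]
  have sw: "swap_class n (swap_class n C) = C" for n and C :: "('a \<times> 'b) gr set" by simp
  \<comment> \<open>The exchange with the roles of V and W interchanged is its own inverse map, so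
    one smoothness lemma serves both directions.\<close>
  note tr = smooth_map_swap[OF V W] smooth_map_swap[OF W V] sw sw
  have "wproj_fst V n (wproj_class V W n v w) = proj_class V n v \<and> ?\<pi> n (wproj_class V W n v w) = proj_class W n w"
    if "v \<in> dpts V (nonzero V) n" "w \<in> dpts W (nonzero W) n" for n v w
    using that by (simp add: wproj_fst_class[OF V W] wproj_fst_class[OF W V] swap_wproj_class[OF V W])
  then show ?thesis
    by (intro exI[of _ "wproj_fst V"] exI[of _ ?\<pi>] conjI allI ballI fiber_bundle_wproj[OF V W] fiber_bundle_taut[OF V W]
        fiber_bundle_taut[OF W V] bundle_isomorphic_wproj_taut[OF V W]
        fiber_bundle_transport[OF E E' tr fiber_bundle_wproj[OF W V]]
        bundle_isomorphic_transport[OF E E' tr supermanifold_TT[OF W V] bundle_isomorphic_wproj_taut[OF W V]]) simp_all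
qed

end
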